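(* Let $\Phi$, $(A,B)$, $B^1,B^2,B^3$, $\delta_0$, $(A_n,B_n)_{n\in\mathbb N}$ and the Markov chain $\{X_n^x\}$, $X_0^x=x$, $X_n^x=\Phi(A_nX_{n-1}^x,B_n(X_{n-1}^x))$, be as described in the context, and let $\alpha>0$. Assume that (1) $B^1$ is $\alpha$-regularly varying with nonzero tail measure $\Lambda_b$, and the corresponding slowly varying function $L_b$ is bounded away from zero and infinity on any compact set; (2) the Markov chain $\{X_n^x\}$ is $\gamma$-geometric for some $\gamma>\alpha$; (3) there exists $\beta>\alpha$ such that $\mathbb E\|A\|^\beta<\infty$; (4) there exists $\varepsilon_0>0$ such that $\mathbb E\big[(B^3)^{\frac{\alpha}{\delta_0}+\varepsilon_0}\big]<\infty$ if $0<\delta_0<1$, and $\mathbb E\big[(B^3)^{\alpha+\varepsilon_0}\big]<\infty$ if $\delta_0=0$; (5) $\mathbb P[\Phi(0,B^1)\neq 0]>0$. Let $\mu$ be the law of $A$ and $[\operatorname{supp}\mu]\subseteq\mathrm{End}(\mathbb R^d)$ the semigroup generated by the support of $\mu$. Assume further that $\Phi(x,0)=x$ for every $x\in\overline{[\operatorname{supp}\mu]\cdot\Phi[\{0\}\times\operatorname{supp}\Lambda_b]}$, and that $\lim_{n\to\infty}\big(\mathbb E\|A_1\cdots A_n\|^\alpha\big)^{1/n}<1$. Let $\Lambda^1$ be the tail measure of a random variable $X$ distributed according to the unique stationary measure of $\{X_n^x\}$, i.e. $\langle f,\Lambda^1\rangle=\lim_{t\to\infty}t^\alpha L_b(t)\mathbb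 E[f(t^{-1}X)]$ for $f\in C_c(\mathbb R^d\setminus\{0\})$. Let $\Gamma_1$ be the tail measure of $\Phi(0,B^1)$ (with respect to $L_b$), and for $n\ge2$ let $\Gamma_n$ be the Radon measure on $\mathbb R^d\setminus\{0\}$ given by $\langle f,\Gamma_n\rangle=\mathbb E\big[\langle f\circ A_2\circ\cdots\circ A_n,\Gamma_1\rangle\big]$. Then for every $f\in C_c(\mathbb R^d\setminus\{0\})$ $$\langle f,\Lambda^1\rangle=\sum_{k=1}^\infty\langle f,\Gamma_k\rangle=\langle f,\Gamma_1\rangle+\mathbb E\Big[\sum_{k=2}^\infty\langle f\circ A_2\circ\cdots\circ A_k,\Gamma_1\rangle\Big].$$ Furthermore, the measures $\Gamma_n$ are $\alpha$-homogeneous and their spherical measures satisfy $$\mathbb E\Big[\int_{\mathbb S^{d-1}}f(A*\omega)\,|A\omega|^\alpha\,\sigma_{\Gamma_n}(d\omega)\Big]=\int_{\mathbb S^{d-1}}f(\omega)\,\sigma_{\Gamma_{n+1}}(d\omega)$$ for every $n\in\mathbb N$ and $f\in C(\mathbb S^{d-1})$, where $A*\omega=\frac{A\omega}{|A\omega|}$. In particular, the spherical measure of $\Lambda^1$ is given by $$\sigma_{\Lambda^1}(d\omega)=\sum_{n=1}^\infty\sigma_{\Gamma_n}(d\omega).$$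
   Context: $\mathbb R^d$ is endowed with an arbitrary norm $|\cdot|$, $\mathbb S^{d-1}$ is its unit sphere, and $\|\cdot\|$ is the operator norm on $\mathrm{End}(\mathbb R^d)$. $\Phi:\mathbb R^d\times\mathbb R^d\to\mathbb R^d$ is a fixed continuous map with $\Phi(tx,ty)=t\Phi(x,y)$ for all $t>0$. $(A,B)$ is a random pair, with $A\in\mathrm{End}(\mathbb R^d)$ and $B$ a random continuous mapping of $\mathbb R^d$ of the form $B(x)=B^1+B^2(x)$, where $B^1$ is a random vector in $\mathbb R^d$, and $B^2$ is a random mapping of $\mathbb R^d$ such that $|B^2(x)|\le B^3|x|^{\delta_0}$ for every $x\in\mathbb R^d$, where $\delta_0\in[0,1)$ is a fixed number and $B^3\ge 0$ is a random variable. $(A_n,B_n)_{n\in\mathbb N}$ are independent copies of $(A,B)$ (together with the decomposition of $B$). Put $\Phi_n(x)=\Phi(A_nx,B_n(x))$; the random maps $\Phi_n$ are assumed to be Lipschitz mappings of $\mathbb R^d$. The chain $X_n^x=\Phi_n(X_{n-1}^x)$ is $\gamma$-geometric ($\gamma>0$) if there are constants $0<C<\infty$ and $0<\rho<1$ such that $\mathbb E\big[|X_n^x-X_n^y|^\gamma\big]\le C\rho^n|x-y|^\gamma$ for all $n\in\mathbb N$ and $x,y\in\mathbb R^d$. A random vector $W\in\mathbb R^d$ is $\alpha$-regularly varying ($\alpha>0$) if there is a slowly varying function $L$ such that the limit $\lim_{t\to\infty}t^\alpha L(t)\,\mathbb E[f(t^{-1}W)]=\int_{\mathbb R^d\setminus\{0\}}f(x)\,\Lambda(dx)=:\langle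 f,\Lambda\rangle$ exists for every $f\in C_c(\mathbb R^d\setminus\{0\})$; the Radon measure $\Lambda$ on $\mathbb R^d\setminus\{0\}$ so defined is called the tail measure of $W$. Slowly varying functions are positive measurable functions, and "compact set" in hypothesis (1) refers to compact subsets of $[0,\infty)$. A Radon measure $\Lambda$ on $\mathbb R^d\setminus\{0\}$ is $\alpha$-homogeneous if $\int f(rx)\Lambda(dx)=r^\alpha\langle f,\Lambda\rangle$ for all $r>0$; equivalently $\langle f,\Lambda\rangle=\int_0^\infty\int_{\mathbb S^{d-1}}f(r\omega)\,\sigma_\Lambda(d\omega)\frac{dr}{r^{1+\alpha}}$ for some measure $\sigma_\Lambda$ on $\mathbb S^{d-1}$, called the spherical measure of $\Lambda$. Every tail measure is $\alpha$-homogeneous. Under hypotheses (1)–(5), the chain has a unique stationary measure, the tail measure $\Lambda^1$ exists, and $\Phi(0,B^1)$ is $\alpha$-regularly varying with slowly varying function $L_b$. Functions $f\in C_c(\mathbb R^d\setminus\{0\})$ are extended by $f(0)=0$, and $f(A*\omega)|A\omega|^\alpha$ is read as $0$ when $A\omega=0$. *)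

theory Defs
  imports "HOL-Probability.Probability"
begin

section \<open>Norms on $\mathbb{R}^d$\<close>

text \<open>
  The type \<open>real^'n\<close> carries the Euclidean norm; the arbitrary norm of the paper is a
  function \<open>N\<close>.  Endomorphisms are square matrices.
\<close>

definition is_norm :: "(real^'n \<Rightarrow> real) \<Rightarrow> bool" where
  "is_norm N \<longleftrightarrow>
     (\<forall>x. N x \<ge> 0) \<and> (\<forall>x. N x = 0 \<longleftrightarrow> x = 0) \<and>
     (\<forall>c x. N (c *\<^sub>R x) = \<bar>c\<bar> * N x) \<and> (\<forall>x y. N (x + y) \<le> N x + N y)"

definition unit_sphere :: "(real^'n \<Rightarrow> real) \<Rightarrow> (real^'n) set" where
  "unit_sphere N = {x. N x = 1}"

definition op_norm :: "(real^'n \<Rightarrow> real) \<Rightarrow> real^'n^'n \<Rightarrow> real" where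
  "op_norm N M = (SUP x\<in>unit_sphere N. N (M *v x))"

definition lipschitz_wrt :: "(real^'n \<Rightarrow> real) \<Rightarrow> (real^'n \<Rightarrow> real^'n) \<Rightarrow> bool" where
  "lipschitz_wrt N g \<longleftrightarrow> (\<exists>K. \<forall>x y. N (g x - g y) \<le> K * N (x - y))"


section \<open>The random maps and the Markov chain\<close>

text \<open>
  A random input is a quadruple \<open>(A, B\<^sup>1, B\<^sup>2, B\<^sup>3)\<close>.  The random mapping \<open>B\<^sup>2\<close> is measured by the
  evaluations at points; on continuous maps these generate the Borel sets of the topology of
  locally uniform convergence.
\<close>

definition input_space ::
    "((real^'n^'n) \<times> (real^'n) \<times> (real^'n \<Rightarrow> real^'n) \<times> real) measure" where
  "input_space = borel \<Otimes>\<^sub>M (borel \<Otimes>\<^sub>M (Pi\<^sub>M UNIV (\<lambda>_. borel) \<Otimes>\<^sub>M borel))"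

text \<open>
  In the growth bound \<open>|x|\<close> to the power \<open>\<delta>\<^sub>0\<close> means \<open>1\<close> when \<open>\<delta>\<^sub>0 = 0\<close>, also at \<open>x = 0\<close>, whereas
  \<open>0 powr 0 = 0\<close>.
\<close>

definition random_input ::
    "(real^'n \<Rightarrow> real) \<Rightarrow> real \<Rightarrow> 'w measure \<Rightarrow> ('w \<Rightarrow> real^'n^'n) \<Rightarrow> ('w \<Rightarrow> real^'n) \<Rightarrow>
     ('w \<Rightarrow> real^'n \<Rightarrow> real^'n) \<Rightarrow> ('w \<Rightarrow> real) \<Rightarrow> bool" where
  "random_input N \<delta>\<^sub>0 M A B1 B2 B3 \<longleftrightarrow>
     (\<lambda>\<omega>. (A \<omega>, B1 \<omega>, B2 \<omega>, B3 \<omega>)) \<in> measurable M input_space \<and>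
     (\<forall>\<omega>\<in>space M.
        continuous_on UNIV (\<lambda>x. B1 \<omega> + B2 \<omega> x) \<and>
        B3 \<omega> \<ge> 0 \<and>
        (\<forall>x. N (B2 \<omega> x) \<le> B3 \<omega> * (if \<delta>\<^sub>0 = 0 then 1 else N x powr \<delta>\<^sub>0)))"

definition random_map ::
    "(real^'n \<Rightarrow> real^'n \<Rightarrow> real^'n) \<Rightarrow> ('w \<Rightarrow> real^'n^'n) \<Rightarrow> ('w \<Rightarrow> real^'n) \<Rightarrow>
     ('w \<Rightarrow> real^'n \<Rightarrow> real^'n) \<Rightarrow> 'w \<Rightarrow> real^'n \<Rightarrow> real^'n" where
  "random_map \<Phi> A B1 B2 \<omega> x = \<Phi> (A \<omega> *v x) (B1 \<omega> + B2 \<omega> x)"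

primrec chain :: "(nat \<Rightarrow> 'w \<Rightarrow> 'a \<Rightarrow> 'a) \<Rightarrow> 'a \<Rightarrow> nat \<Rightarrow> 'w \<Rightarrow> 'a" where
  "chain F x 0 \<omega> = x"
| "chain F x (Suc n) \<omega> = F (Suc n) \<omega> (chain F x n \<omega>)"

definition geometric_chain ::
    "(real^'n \<Rightarrow> real) \<Rightarrow> 'w measure \<Rightarrow> (nat \<Rightarrow> 'w \<Rightarrow> real^'n \<Rightarrow> real^'n) \<Rightarrow> real \<Rightarrow> bool" where
  "geometric_chain N M F \<gamma> \<longleftrightarrow>
     \<gamma> > 0 \<and>
     (\<exists>C \<rho>. 0 < C \<and> 0 < \<rho> \<and> \<rho> < 1 \<and>
        (\<forall>n x y. (\<integral>\<^sup>+\<omega>. ennreal (N (chain F x n \<omega> - chain F y n \<omega>) powr \<gamma>) \<partial>M)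
                   \<le> ennreal (C * \<rho> ^ n * N (x - y) powr \<gamma>)))"

definition stationary_measure ::
    "'w measure \<Rightarrow> ('w \<Rightarrow> real^'n \<Rightarrow> real^'n) \<Rightarrow> (real^'n) measure \<Rightarrow> bool" where
  "stationary_measure M F \<nu> \<longleftrightarrow>
     prob_space \<nu> \<and> sets \<nu> = sets borel \<and>
     (\<forall>S\<in>sets borel.
        emeasure \<nu> S = (\<integral>\<^sup>+x. emeasure (distr M borel (\<lambda>\<omega>. F \<omega> x)) S \<partial>\<nu>))"

text \<open>\<open>mat_prod As m n \<omega>\<close> is $A_m A_{m+1} \cdots A_n$, and the identity if \<open>n < m\<close>.\<close>

definition mat_prod ::
    "(nat \<Rightarrow> 'w \<Rightarrow> real^'n^'n) \<Rightarrow> nat \<Rightarrow> nat \<Rightarrow> 'w \<Rightarrow> real^'n^'n" where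
  "mat_prod As m n \<omega> = foldr (\<lambda>i P. As i \<omega> ** P) [m..<Suc n] (mat 1)"


section \<open>Radon measures on the punctured space and regular variation\<close>

text \<open>
  A function in $C_c(\mathbb{R}^d\setminus\{0\})$ is identified with its extension by zero to
  $\mathbb{R}^d$.
\<close>

definition Cc_punctured :: "(real^'n \<Rightarrow> real) set" where
  "Cc_punctured =
     {f. continuous_on UNIV f \<and> (\<exists>K. compact K \<and> 0 \<notin> K \<and> (\<forall>x. x \<notin> K \<longrightarrow> f x = 0))}"

text \<open>
  On the punctured space, which is locally compact and second countable, a Borel measure that is
  finite on compact sets is automatically regular.
\<close>

definition radon_punctured :: "(real^'n) measure \<Rightarrow> bool" where
  "radon_punctured \<Lambda> \<longleftrightarrow>
     sets \<Lambda> = sets (restrict_space borel (- {0})) \<and>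
     (\<forall>K. compact K \<and> 0 \<notin> K \<longrightarrow> emeasure \<Lambda> K < \<infinity>)"

definition slowly_varying :: "(real \<Rightarrow> real) \<Rightarrow> bool" where
  "slowly_varying L \<longleftrightarrow>
     L \<in> borel_measurable (restrict_space borel {0..}) \<and>
     (\<forall>t\<ge>0. L t > 0) \<and>
     (\<forall>s>0. ((\<lambda>t. L (s * t) / L t) \<longlongrightarrow> 1) at_top)"

text \<open>
  \<open>tail_measure \<alpha> L \<nu> \<Lambda>\<close>: random vectors with law \<open>\<nu>\<close> are \<open>\<alpha>\<close>-regularly varying with slowly
  varying function \<open>L\<close> and tail measure \<open>\<Lambda>\<close>.
\<close>

definition tail_measure ::
    "real \<Rightarrow> (real \<Rightarrow> real) \<Rightarrow> (real^'n) measure \<Rightarrow> (real^'n) measure \<Rightarrow> bool" where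
  "tail_measure \<alpha> L \<nu> \<Lambda> \<longleftrightarrow>
     slowly_varying L \<and> radon_punctured \<Lambda> \<and>
     (\<forall>f\<in>Cc_punctured.
        ((\<lambda>t. t powr \<alpha> * L t * (\<integral>w. f (w /\<^sub>R t) \<partial>\<nu>)) \<longlongrightarrow> (\<integral>x. f x \<partial>\<Lambda>)) at_top)"

definition homogeneous_measure :: "real \<Rightarrow> (real^'n) measure \<Rightarrow> bool" where
  "homogeneous_measure \<alpha> \<Lambda> \<longleftrightarrow>
     (\<forall>r>0. \<forall>f\<in>Cc_punctured. (\<integral>x. f (r *\<^sub>R x) \<partial>\<Lambda>) = r powr \<alpha> * (\<integral>x. f x \<partial>\<Lambda>))"

text \<open>
  The spherical measure of a Radon measure is finite, because an annulus around the origin has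
  finite measure.
\<close>

definition spherical_measure ::
    "(real^'n \<Rightarrow> real) \<Rightarrow> real \<Rightarrow> (real^'n) measure \<Rightarrow> (real^'n) measure \<Rightarrow> bool" where
  "spherical_measure N \<alpha> \<Lambda> \<sigma> \<longleftrightarrow>
     sets \<sigma> = sets (restrict_space borel (unit_sphere N)) \<and> finite_measure \<sigma> \<and>
     (\<forall>f\<in>Cc_punctured.
        (\<integral>x. f x \<partial>\<Lambda>) =
        (LINT r:{0<..}|lborel. (\<integral>w. f (r *\<^sub>R w) \<partial>\<sigma>) / r powr (1 + \<alpha>)))"

definition msupport :: "'a::topological_space measure \<Rightarrow> 'a set" where
  "msupport \<mu> =
     {x \<in> space \<mu>. \<forall>U. open U \<longrightarrow> x \<in> U \<longrightarrow> emeasure \<mu> (U \<inter> space \<mu>) > 0}"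

inductive_set generated_semigroup :: "(real^'n^'n) set \<Rightarrow> (real^'n^'n) set"
  for S :: "(real^'n^'n) set" where
  base: "a \<in> S \<Longrightarrow> a \<in> generated_semigroup S"
| mult: "a \<in> generated_semigroup S \<Longrightarrow> b \<in> generated_semigroup S \<Longrightarrow>
         a ** b \<in> generated_semigroup S"

text \<open>
  The sequence $\Gamma_1, \Gamma_2, \dots$ (the value at index \<open>0\<close> is irrelevant): \<open>\<Gamma> 1\<close> is the tail measure
  of the law \<open>\<kappa>\<close>, and
  $\langle f, \Gamma_n\rangle = \mathbb{E}\langle f \circ A_2 \circ \cdots \circ A_n, \Gamma_1\rangle$ for $n \ge 2$.  The functions
  $f \circ A_2 \circ \cdots \circ A_n$ need not have compact support, so integrability is part of the meaning.
\<close>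

definition Gamma_sequence ::
    "'w measure \<Rightarrow> (nat \<Rightarrow> 'w \<Rightarrow> real^'n^'n) \<Rightarrow> real \<Rightarrow> (real \<Rightarrow> real) \<Rightarrow> (real^'n) measure \<Rightarrow>
     (nat \<Rightarrow> (real^'n) measure) \<Rightarrow> bool" where
  "Gamma_sequence M As \<alpha> L \<kappa> \<Gamma> \<longleftrightarrow>
     tail_measure \<alpha> L \<kappa> (\<Gamma> 1) \<and>
     (\<forall>n\<ge>2. radon_punctured (\<Gamma> n) \<and>
        (\<forall>f\<in>Cc_punctured.
           (\<forall>\<omega>\<in>space M. integrable (\<Gamma> 1) (\<lambda>x. f (mat_prod As 2 n \<omega> *v x))) \<and>
           integrable M (\<lambda>\<omega>. \<integral>x. f (mat_prod As 2 n \<omega> *v x) \<partial>\<Gamma> 1) \<and>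
           (\<integral>x. f x \<partial>\<Gamma> n) = (\<integral>\<omega>. (\<integral>x. f (mat_prod As 2 n \<omega> *v x) \<partial>\<Gamma> 1) \<partial>M)))"

end

theory Submission
  imports Defs
begin

text \<open>
  A large value of \<open>\<Phi> (A X) (B X)\<close> is caused either by a large \<open>X\<close>, in which case \<open>B X\<close> is negligible, or
  by a large \<open>B\<^sup>1\<close>, in which case \<open>X\<close> is negligible; both at once are too unlikely.  Hence one step of the
  chain replaces a tail measure \<open>\<Lambda>\<close> by \<open>\<Gamma>\<^sub>1\<close> plus the law-of-\<open>A\<close> average of the image of \<open>\<Lambda>\<close> under
  \<open>x \<mapsto> \<Phi> (A x) 0\<close>, and on the relevant cone this map is \<open>A\<close> itself.  Starting at \<open>0\<close>, the tail measure of
  \<open>X\<^sub>n\<close> is therefore \<open>\<Gamma>\<^sub>1 + \<cdots> + \<Gamma>\<^sub>n\<close>.  A coupling of the chain started at \<open>0\<close> with the stationary one, together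
  with geometric contraction in a moment \<open>\<gamma> > \<alpha>\<close>, bounds the tail difference uniformly in the scale, so that
  \<open>n \<rightarrow> \<infinity>\<close> can be interchanged with the tail limit.  The spherical statements follow by writing homogeneous
  measures in polar coordinates.
\<close>

section \<open>Test functions and Radon measures on the punctured space\<close>

text \<open>Tail limits are given only for compactly supported test functions, but one step turns
  \<open>f\<close> into \<open>f (\<Phi> (a *v x) 0)\<close>, whose support may be unbounded when
  the matrix is singular. The recursion therefore runs in the larger class \<open>Cb_away\<close>,
  and one must know that no mass escapes to infinity, uniformly in the scale. Potter bounds give
  this. They are extracted from the data: as the tail measure of B1 is nonzero, the normalisation
  t^\<alpha> L(t) is comparable to the monotone function 1 / P(|B1| > t), which fills the gaps
  between dyadic scales. The same bounds supply the envelopes for dominated convergence; moments of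
  order above \<alpha> leave room for exponents \<alpha> + \<eta>. Since \<open>A\<close> and
  \<open>B1\<close> may be dependent, the independent state is always integrated first, with the
  input frozen. B2 is measurable only through its values at fixed points, so compositions at random
  points go through a countable grid and continuity. The tails of the chain stay abstract
  functionals until the support condition on \<Phi> turns them into sums of measures.\<close>

abbreviation punct :: "'a::{topological_space,zero} measure" where
  "punct \<equiv> restrict_space borel (- {0})"

text \<open>The compact support required in \<open>Cc_punctured\<close> is dropped because composing
  with a singular matrix or with \<open>\<Phi> 0\<close> can destroy it; boundedness and vanishing
  near 0 survive.\<close>

definition Cb_away :: "('a::real_normed_vector \<Rightarrow> real) set" where
  "Cb_away = {f. continuous_on UNIV f \<and> (\<exists>C. \<forall>x. \<bar>f x\<bar> \<le> C) \<and>
                 (\<exists>r>0. \<forall>x. norm x < r \<longrightarrow> f x = 0)}"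

lemma Cb_awayE:
  assumes "f \<in> Cb_away"
  obtains C r where "continuous_on UNIV f" "C > 0" "\<And>x. \<bar>f x\<bar> \<le> C" "r > 0" "\<And>x. norm x < r \<Longrightarrow> f x = 0"
proof -
  from assms obtain C r where "continuous_on UNIV f" "\<And>x. \<bar>f x\<bar> \<le> C" "r > 0" "\<And>x. norm x < r \<Longrightarrow> f x = 0"
    unfolding Cb_away_def by auto
  moreover have "max C 1 > 0" "\<And>x. \<bar>f x\<bar> \<le> max C 1" using calculation(2) by (auto simp: le_max_iff_disj)
  ultimately show ?thesis using that by blast
qed

lemma Cb_awayI:
  assumes "continuous_on UNIV f" "\<And>x. \<bar>f x\<bar> \<le> C" "r > 0" "\<And>x. norm x < r \<Longrightarrow> f x = 0"
  shows "f \<in> Cb_away"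
  using assms unfolding Cb_away_def by auto

lemma borel_Cb_away [measurable_dest]: "f \<in> Cb_away \<Longrightarrow> f \<in> borel_measurable borel"
  by (auto simp: Cb_away_def intro: borel_measurable_continuous_onI)

lemma Cc_puncturedI:
  fixes f :: "real^'n \<Rightarrow> real"
  assumes "continuous_on UNIV f" "0 < r" "\<And>x. f x \<noteq> 0 \<Longrightarrow> r \<le> norm x \<and> norm x \<le> R"
  shows "f \<in> Cc_punctured"
proof -
  let ?K = "cball 0 R \<inter> - ball (0::real^'n) r"
  have "compact ?K" by (intro compact_Int_closed) auto
  moreover have "0 \<notin> ?K" using assms by auto
  moreover have "\<forall>x. x \<notin> ?K \<longrightarrow> f x = 0" using assms(3) by fastforce
  ultimately show ?thesis unfolding Cc_punctured_def using assms(1) by blast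
qed

lemma compact_annulus:
  assumes "compact K" "(0::'a::euclidean_space) \<notin> K"
  obtains r R where "0 < r" "r < R" "\<And>x. x \<in> K \<Longrightarrow> r \<le> norm x \<and> norm x \<le> R"
proof -
  obtain R where R: "\<And>x. x \<in> K \<Longrightarrow> norm x \<le> R"
    using compact_imp_bounded[OF assms(1)] unfolding bounded_iff by auto
  have "open (- K)" using compact_imp_closed[OF assms(1)] by (simp add: open_Compl)
  then obtain r where r: "r > 0" "ball 0 r \<subseteq> - K" using assms(2) open_contains_ball by (metis ComplI)
  have "\<And>x. x \<in> K \<Longrightarrow> r \<le> norm x" using r(2) by (force simp: subset_iff not_less)
  then show ?thesis using that[of r "max R (r+1)"] r(1) R by (force simp: le_max_iff_disj)
qed

lemma Cc_puncturedE:
  assumes "f \<in> Cc_punctured"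
  obtains r R where "continuous_on UNIV f" "0 < r" "r < R" "\<And>x. f x \<noteq> 0 \<Longrightarrow> r \<le> norm x \<and> norm x \<le> R"
proof -
  from assms obtain K where K: "continuous_on UNIV f" "compact K" "0 \<notin> K" "\<And>x. x \<notin> K \<Longrightarrow> f x = 0"
    unfolding Cc_punctured_def by auto
  obtain r R where "0 < r" "r < R" "\<And>x. x \<in> K \<Longrightarrow> r \<le> norm x \<and> norm x \<le> R"
    using compact_annulus[OF K(2,3)] by blast
  with K show ?thesis by (intro that[of r R]) auto
qed

lemma Cc_punctured_bounded:
  assumes "f \<in> Cc_punctured"
  obtains C where "C > 0" "\<And>x. \<bar>f x\<bar> \<le> C"
proof -
  from assms obtain K where K: "continuous_on UNIV f" "compact K" "\<And>x. x \<notin> K \<Longrightarrow> f x = 0"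
    unfolding Cc_punctured_def by auto
  have "compact (f ` K)" using K by (intro compact_continuous_image) (auto intro: continuous_on_subset)
  then obtain C where "\<And>x. x \<in> K \<Longrightarrow> \<bar>f x\<bar> \<le> C"
    using compact_imp_bounded[of "f ` K"] unfolding bounded_iff by fastforce
  then have "\<bar>f x\<bar> \<le> max C 1" for x using K(3)[of x] by (cases "x \<in> K") (auto simp: le_max_iff_disj)
  then show ?thesis using that[of "max C 1"] by simp
qed

lemma Cc_subset_Cb_away: "Cc_punctured \<subseteq> Cb_away"
proof
  fix f :: "real^'n \<Rightarrow> real" assume f: "f \<in> Cc_punctured"
  obtain C where C: "C > 0" "\<And>x. \<bar>f x\<bar> \<le> C" by (rule Cc_punctured_bounded[OF f]) blast
  obtain r R where "continuous_on UNIV f" "0 < r" "r < R" "\<And>x. f x \<noteq> 0 \<Longrightarrow> r \<le> norm x \<and> norm x \<le> R"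
    by (rule Cc_puncturedE[OF f]) blast
  with C show "f \<in> Cb_away" by (intro Cb_awayI[of f C r]) force+
qed

text \<open>Two points at distance at most 1 either both lie in the ball of radius
  \<open>R + 1\<close>, where compactness applies, or both lie where the function vanishes.\<close>

lemma Cc_uniformly_continuous:
  fixes f :: "real^'n \<Rightarrow> real"
  assumes "f \<in> Cc_punctured" "\<delta> > 0"
  obtains \<epsilon> where "\<epsilon> > 0" "\<And>x y. norm (x - y) \<le> \<epsilon> \<Longrightarrow> \<bar>f x - f y\<bar> \<le> \<delta>"
proof -
  obtain r R where f: "continuous_on UNIV f" "0 < r" "r < R" "\<And>x. f x \<noteq> 0 \<Longrightarrow> r \<le> norm x \<and> norm x \<le> R"
    by (rule Cc_puncturedE[OF assms(1)]) blast
  have "uniformly_continuous_on (cball 0 (R+1)) f"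
    using f(1) by (intro compact_uniformly_continuous) (auto intro: continuous_on_subset)
  then obtain d where d: "d > 0" "\<And>x y. x \<in> cball 0 (R+1) \<Longrightarrow> y \<in> cball 0 (R+1) \<Longrightarrow> dist y x < d \<Longrightarrow> dist (f y) (f x) < \<delta>"
    unfolding uniformly_continuous_on_def using assms(2) by metis
  show ?thesis
  proof (rule that[of "min (d/2) 1"])
    show "min (d/2) 1 > 0" using d by simp
    fix x y :: "real^'n" assume xy: "norm (x - y) \<le> min (d/2) 1"
    have n: "norm x \<le> norm y + 1" "norm y \<le> norm x + 1"
      using xy norm_triangle_ineq2[of x y] norm_triangle_ineq2[of y x] by (auto simp: norm_minus_commute)
    show "\<bar>f x - f y\<bar> \<le> \<delta>"
    proof (cases "norm x \<le> R \<or> norm y \<le> R")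
      case True
      then have "x \<in> cball 0 (R+1)" "y \<in> cball 0 (R+1)" using n by auto
      moreover have "dist x y < d" using xy d(1) by (simp add: dist_norm)
      ultimately show ?thesis using d(2)[of y x] by (simp add: dist_real_def)
    next
      case False
      then have "f x = 0" "f y = 0" using f(4) by force+
      then show ?thesis using assms(2) by simp
    qed
  qed
qed

lemma Cc_abs: "f \<in> Cc_punctured \<Longrightarrow> (\<lambda>x. \<bar>f x\<bar>) \<in> Cc_punctured"
  unfolding Cc_punctured_def by (auto intro!: continuous_intros)

lemma Cb_away_abs: "f \<in> Cb_away \<Longrightarrow> (\<lambda>x. \<bar>f x\<bar>) \<in> Cb_away"
  unfolding Cb_away_def by (auto intro!: continuous_intros)

text \<open>Continuity at 0 and \<open>h 0 = 0\<close> send a small ball into the ball on which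
  \<open>f\<close> vanishes; no properness of \<open>h\<close> at infinity is asked for.\<close>

lemma Cb_away_compose:
  assumes "f \<in> Cb_away" "continuous_on UNIV h" "h 0 = 0"
  shows "(\<lambda>x. f (h x)) \<in> Cb_away"
proof -
  obtain C r where f: "continuous_on UNIV f" "\<And>x. \<bar>f x\<bar> \<le> C" "r > 0" "\<And>x. norm x < r \<Longrightarrow> f x = 0"
    using Cb_awayE[OF assms(1)] by metis
  have "continuous (at 0) h" using assms(2) by (simp add: continuous_on_eq_continuous_at)
  then obtain d where d: "d > 0" "\<And>x. dist x 0 < d \<Longrightarrow> dist (h x) (h 0) < r"
    unfolding continuous_at_eps_delta using f(3) by metis
  have "continuous_on UNIV (\<lambda>x. f (h x))" using continuous_on_compose2[OF f(1) assms(2)] by auto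
  then show ?thesis using f d assms(3) by (intro Cb_awayI[of _ C d]) auto
qed

definition ramp :: "real \<Rightarrow> real \<Rightarrow> 'a::real_normed_vector \<Rightarrow> real" where
  "ramp a b x = min 1 (max 0 ((norm x - a) / (b - a)))"

lemma ramp_props:
  assumes "a < b"
  shows "continuous_on UNIV (ramp a b)" "0 \<le> ramp a b x" "ramp a b x \<le> 1"
    "norm x \<le> a \<Longrightarrow> ramp a b x = 0" "norm x \<ge> b \<Longrightarrow> ramp a b x = 1"
proof -
  show "continuous_on UNIV (ramp a b)" unfolding ramp_def by (intro continuous_intros) (use assms in auto)
qed (use assms in \<open>auto simp: ramp_def divide_simps\<close>)

lemma ramp_Cb_away: "0 < a \<Longrightarrow> a < b \<Longrightarrow> ramp a b \<in> Cb_away"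
  by (rule Cb_awayI[of _ 1 a]) (auto simp: ramp_props)

lemma ramp_Cc: "0 < a \<Longrightarrow> a < b \<Longrightarrow> b < c \<Longrightarrow> c < d \<Longrightarrow> (\<lambda>x. ramp a b x * (1 - ramp c d x)) \<in> Cc_punctured"
proof -
  assume *: "0 < a" "a < b" "b < c" "c < d"
  show ?thesis
  proof (rule Cc_puncturedI[where r=a and R=d])
    show "continuous_on UNIV (\<lambda>x::real^'n. ramp a b x * (1 - ramp c d x))"
      using * by (intro continuous_intros ramp_props)
    show "a \<le> norm x \<and> norm x \<le> d" if "ramp a b x * (1 - ramp c d x) \<noteq> 0" for x :: "real^'n"
      using that * ramp_props(4)[of a b x] ramp_props(5)[of c d x] by force
  qed (use * in auto)
qed

section \<open>Radon measures on the punctured space and their determination by test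
  functions\<close>

lemma sets_radon: "radon_punctured \<Lambda> \<Longrightarrow> sets \<Lambda> = sets punct"
  by (simp add: radon_punctured_def)

lemma space_radon: "radon_punctured \<Lambda> \<Longrightarrow> space \<Lambda> = - {0}"
  using sets_eq_imp_space_eq[OF sets_radon] by (auto simp: space_restrict_space)

lemma measurable_radon: "radon_punctured \<Lambda> \<Longrightarrow> f \<in> measurable borel M' \<Longrightarrow> f \<in> measurable \<Lambda> M'"
  by (simp add: measurable_cong_sets[OF sets_radon refl] measurable_restrict_space1)

lemma sets_radonI: "radon_punctured \<Lambda> \<Longrightarrow> S \<in> sets borel \<Longrightarrow> 0 \<notin> S \<Longrightarrow> S \<in> sets \<Lambda>"
  by (auto simp: sets_radon sets_restrict_space_iff)

lemma finite_annulus: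
  assumes "radon_punctured \<Lambda>" "0 < r"
  shows "emeasure \<Lambda> {x. r \<le> norm x \<and> norm x \<le> R} < \<infinity>"
proof -
  have "compact (cball (0::real^'a) R \<inter> - ball 0 r)" by (intro compact_Int_closed) auto
  moreover have "cball (0::real^'a) R \<inter> - ball 0 r = {x. r \<le> norm x \<and> norm x \<le> R}" by auto
  ultimately show ?thesis using assms unfolding radon_punctured_def by auto
qed

lemma annulus_sets: "radon_punctured \<Lambda> \<Longrightarrow> 0 < r \<Longrightarrow> {x. r \<le> norm x \<and> norm x \<le> R} \<in> sets \<Lambda>"
  by (rule sets_radonI) (auto)

lemma annulus_index:
  assumes "(x::'a::real_normed_vector) \<noteq> 0"
  obtains m where "1 / (real m + 1) \<le> norm x" "norm x \<le> real m + 1"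
proof -
  obtain m where m: "real m > max (norm x) (1 / norm x)" using reals_Archimedean2 by blast
  then have "1 < real m * norm x" using assms by (simp add: field_simps)
  also have "\<dots> \<le> (real m + 1) * norm x" by (intro mult_right_mono) auto
  finally have "1 / (real m + 1) \<le> norm x" by (simp add: field_simps)
  then show ?thesis using that m by auto
qed

text \<open>The annuli 1/(m+1) \<le> |x| \<le> m+1 exhaust the punctured space. Sigma-finiteness is
  what Fubini with tail measures relies on.\<close>

lemma sigma_finite_radon:
  assumes "radon_punctured \<Lambda>" shows "sigma_finite_measure \<Lambda>"
proof
  let ?A = "\<lambda>m::nat. {x::real^'a. 1 / (real m + 1) \<le> norm x \<and> norm x \<le> real m + 1}"
  show "\<exists>A. countable A \<and> A \<subseteq> sets \<Lambda> \<and> \<Union> A = space \<Lambda> \<and> (\<forall>a\<in>A. emeasure \<Lambda> a \<noteq> \<infinity>)"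
  proof (intro exI[of _ "range ?A"] conjI ballI)
    show "range ?A \<subseteq> sets \<Lambda>" using annulus_sets[OF assms] by auto
    show "\<Union> (range ?A) = space \<Lambda>" unfolding space_radon[OF assms]
    proof (intro equalityI subsetI)
      fix x :: "real^'a" assume "x \<in> - {0}"
      then obtain m where "1 / (real m + 1) \<le> norm x" "norm x \<le> real m + 1" using annulus_index by auto
      then show "x \<in> \<Union> (range ?A)" by (intro UN_I[of m]) auto
    qed auto
    fix a assume "a \<in> range ?A"
    then obtain m where "a = ?A m" by auto
    then show "emeasure \<Lambda> a \<noteq> \<infinity>" using finite_annulus[OF assms, of "1 / (real m + 1)" "real m + 1"] by force
  qed auto
qed

lemma integrable_Cc:
  assumes "radon_punctured \<Lambda>" "f \<in> Cc_punctured" shows "integrable \<Lambda> f"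
proof -
  obtain C where C: "C > 0" "\<And>x. \<bar>f x\<bar> \<le> C" by (rule Cc_punctured_bounded[OF assms(2)]) blast
  obtain r R where f: "continuous_on UNIV f" "0 < r" "r < R" "\<And>x. f x \<noteq> 0 \<Longrightarrow> r \<le> norm x \<and> norm x \<le> R"
    by (rule Cc_puncturedE[OF assms(2)]) blast
  let ?S = "{x::real^'a. r \<le> norm x \<and> norm x \<le> R}"
  have "integrable \<Lambda> (\<lambda>x. C * indicator ?S x)"
    using finite_annulus[OF assms(1) f(2)] annulus_sets[OF assms(1) f(2)] by (intro integrable_mult_right integrable_real_indicator)
  then show ?thesis
  proof (rule Bochner_Integration.integrable_bound)
    show "f \<in> borel_measurable \<Lambda>" by (rule measurable_radon[OF assms(1) borel_measurable_continuous_onI[OF f(1)]])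
    show "AE x in \<Lambda>. norm (f x) \<le> norm (C * indicator ?S x)"
    proof (rule AE_I2)
      fix x show "norm (f x) \<le> norm (C * indicator ?S x)"
        using f(4)[of x] C by (cases "f x = 0") (auto simp: indicator_def)
    qed
  qed
qed

text \<open>Approximates the indicator of a compact set from above, with a dominating function that
  is itself a test function, so that integrals of test functions recover the measure of
  \<open>K\<close>.\<close>

lemma compact_bump:
  assumes K: "compact K" "0 \<notin> (K::(real^'n) set)" "K \<noteq> {}"
  obtains g where "\<And>m. g m \<in> Cc_punctured" "\<And>m x. 0 \<le> g m x" "\<And>m x. x \<in> K \<Longrightarrow> g m x = 1"
    "\<And>m x. g m x \<le> g 0 x" "\<And>x. (\<lambda>m::nat. g m x) \<longlonglongrightarrow> indicator K x"
proof -
  obtain r R where r: "0 < r" "r < R" "\<And>x. x \<in> K \<Longrightarrow> r \<le> norm x \<and> norm x \<le> R" by (rule compact_annulus[OF K(1,2)]) blast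
  \<comment> \<open>The slope 2/r makes every \<open>g m\<close> vanish at distance r/2 from
    \<open>K\<close>, so all supports stay in r/2 \<le> |x| \<le> R + r/2, away from the
    origin.\<close>
  define g where "g m x = max 0 (1 - (2/r) * (real m + 1) * infdist x K)" for m x
  have far: "r/2 \<le> norm x \<and> norm x \<le> R + r/2" if "g m x \<noteq> 0" for m x
  proof -
    have "(2/r) * (real m + 1) * infdist x K < 1" using that unfolding g_def by linarith
    moreover have "(2/r) * infdist x K \<le> (2/r) * (real m + 1) * infdist x K"
      using r infdist_nonneg[of x K] mult_left_mono[of 1 "real m + 1" "2/r"] by (intro mult_right_mono) auto
    ultimately have "(2/r) * infdist x K < 1" by linarith
    then have "infdist x K < r/2" using r by (simp add: field_simps)
    then obtain k where k: "k \<in> K" "dist x k < r/2" using K(1,3)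
      by (metis compact_imp_closed infdist_attains_inf)
    then show ?thesis using r(3)[OF k(1)] norm_triangle_ineq2[of x k] norm_triangle_ineq2[of k x]
      by (auto simp: dist_norm norm_minus_commute)
  qed
  show ?thesis
  proof (rule that[of g])
    show "g m \<in> Cc_punctured" for m
      by (rule Cc_puncturedI[of _ "r/2" "R+r/2"]) (use far r in \<open>auto simp: g_def[abs_def] intro!: continuous_intros\<close>)
    show "0 \<le> g m x" for m x by (simp add: g_def)
    show "g m x = 1" if "x \<in> K" for m x using that by (simp add: g_def)
    show "g m x \<le> g 0 x" for m x unfolding g_def
      using r infdist_nonneg[of x K] mult_left_mono[of 1 "real m + 1" "2/r"]
      by (intro max.mono order_refl diff_left_mono mult_right_mono) auto
    show "(\<lambda>m::nat. g m x) \<longlonglongrightarrow> indicator K x" for x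
    proof (cases "x \<in> K")
      case True then show ?thesis by (simp add: g_def)
    next
      case False
      then have p: "infdist x K > 0" using K
        by (metis compact_imp_closed in_closed_iff_infdist_zero infdist_nonneg less_eq_real_def)
      then obtain m0 where m0: "real m0 > 1 / ((2/r) * infdist x K)" using reals_Archimedean2 by blast
      have "g m x = 0" if "m \<ge> m0" for m
      proof -
        have "1 < (2/r) * infdist x K * real m0" using m0 p r by (simp add: field_simps)
        also have "... \<le> (2/r) * infdist x K * (real m + 1)" using p r that by (intro mult_left_mono) auto
        finally show ?thesis by (simp add: g_def algebra_simps)
      qed
      then have "eventually (\<lambda>m. g m x = indicator K x) sequentially"
        unfolding eventually_sequentially using False by auto
      then show ?thesis by (rule tendsto_eventually)
    qed
  qed
qed

text \<open>Intersecting a closed set with the annuli cuts it into countably many compact pieces.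
  Compact sets are the generator of choice because they are stable under intersection and test
  functions reach them.\<close>

lemma sigma_sets_punct:
  "sets (punct :: (real^'n) measure) = sigma_sets (- {0}) {K. compact K \<and> 0 \<notin> K}" (is "_ = sigma_sets _ ?E")
proof
  show "sigma_sets (- {0}) ?E \<subseteq> sets punct"
  proof -
    have "sigma_sets (space (punct :: (real^'n) measure)) ?E \<subseteq> sets punct"
      by (rule sets.sigma_sets_subset) (auto simp: sets_restrict_space_iff compact_imp_closed)
    then show ?thesis by (simp add: space_restrict_space)
  qed
  interpret S: sigma_algebra "- {0}" "sigma_sets (- {0::real^'n}) ?E" by (rule sigma_algebra_sigma_sets) auto
  have "sets (punct :: (real^'n) measure) = sigma_sets (- {0}) ((\<inter>) (- {0}) ` {S. closed S})"
  proof -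
    have "sets (punct :: (real^'n) measure) = sets (restrict_space (sigma UNIV {S. closed S}) (- {0}))"
      by (intro sets_restrict_space_cong) (simp add: borel_eq_closed)
    also have "\<dots> = sigma_sets (- {0}) ((\<inter>) (- {0}) ` {S. closed S})"
    proof -
      have "sigma_sets (- {0}) ((\<inter>) (- {0}) ` {S. closed S}) = ((\<inter>) (- {0}) ` sigma_sets UNIV {S. closed (S::(real^'n) set)})"
        by (intro sigma_sets_Int[symmetric])
           (auto simp: Compl_eq_Diff_UNIV intro: sigma_sets.Compl[OF sigma_sets.Basic])
      then show ?thesis by (simp add: sets_restrict_space Int_commute)
    qed
    finally show ?thesis .
  qed
  also have "\<dots> \<subseteq> sigma_sets (- {0}) ?E"
  proof (rule S.sigma_sets_subset, safe)
    fix C :: "(real^'n) set" assume C: "closed C"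
    let ?A = "\<lambda>m::nat. C \<inter> (cball 0 (real m + 1) \<inter> - ball 0 (1 / (real m + 1)))"
    have "C \<inter> - {0} = (\<Union>m. ?A m)"
    proof (intro equalityI subsetI)
      fix x assume x: "x \<in> C \<inter> - {0}"
      then have "x \<noteq> 0" by simp
      then obtain m where "1 / (real m + 1) \<le> norm x" "norm x \<le> real m + 1" using annulus_index by blast
      then show "x \<in> (\<Union>m. ?A m)" using x by (intro UN_I[of m]) auto
    qed auto
    moreover have "compact (?A m)" for m
      by (intro closed_Int_compact C compact_Int_closed) auto
    then have "?A m \<in> sigma_sets (- {0}) ?E" for m by (intro sigma_sets.Basic) auto
    then have "(\<Union>m. ?A m) \<in> sigma_sets (- {0}) ?E" by (intro sigma_sets.Union)
    ultimately show "- {0} \<inter> C \<in> sigma_sets (- {0}) ?E" by (simp add: Int_commute)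
  qed
  finally show "sets (punct :: (real^'n) measure) \<subseteq> sigma_sets (- {0}) ?E" .
qed

text \<open>Uniqueness in the Riesz representation: bump functions give the measure of each compact
  set by dominated convergence, and these sets form an intersection-stable generator exhausting the
  space by sets of finite measure.\<close>

lemma radon_punctured_eqI:
  assumes r: "radon_punctured \<Lambda>" "radon_punctured \<Lambda>'"
    and eq: "\<And>f. f \<in> Cc_punctured \<Longrightarrow> (\<And>x. 0 \<le> f x) \<Longrightarrow> (\<integral>x. f x \<partial>\<Lambda>) = (\<integral>x. f x \<partial>\<Lambda>')"
  shows "\<Lambda> = \<Lambda>'"
proof (rule measure_eqI_generator_eq[where E="{K. compact K \<and> 0 \<notin> K}" and \<Omega>="- {0}"
      and A="\<lambda>m::nat. cball 0 (real m + 1) \<inter> - ball 0 (1 / (real m + 1))"])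
  show "Int_stable {K. compact K \<and> (0::real^'a) \<notin> K}" by (auto simp: Int_stable_def)
  show "sets \<Lambda> = sigma_sets (- {0}) {K. compact K \<and> 0 \<notin> K}" "sets \<Lambda>' = sigma_sets (- {0}) {K. compact K \<and> 0 \<notin> K}"
    using r by (simp_all add: sets_radon sigma_sets_punct)
  fix K :: "(real^'a) set" assume "K \<in> {K. compact K \<and> 0 \<notin> K}"
  then have K: "compact K" "0 \<notin> K" by auto
  show "emeasure \<Lambda> K = emeasure \<Lambda>' K"
  proof (cases "K = {}")
    case False
    obtain g where g: "\<And>m. g m \<in> Cc_punctured" "\<And>m x. 0 \<le> g m x" "\<And>m x. x \<in> K \<Longrightarrow> g m x = 1"
      "\<And>m x. g m x \<le> g 0 x" "\<And>x. (\<lambda>m::nat. g m x) \<longlonglongrightarrow> indicator K x"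
      by (rule compact_bump[OF K False]) blast
    have fin: "emeasure M K \<noteq> \<infinity>" and lim: "(\<lambda>m. \<integral>x. g m x \<partial>M) \<longlonglongrightarrow> measure M K" if M: "radon_punctured M" for M
    proof -
      have Ks: "K \<in> sets M" using sets_radonI[OF M borel_closed[OF compact_imp_closed[OF K(1)]] K(2)] .
      show "emeasure M K \<noteq> \<infinity>" using M K unfolding radon_punctured_def by auto
      have "(\<lambda>m. \<integral>x. g m x \<partial>M) \<longlonglongrightarrow> (\<integral>x. indicator K x \<partial>M)"
      proof (rule integral_dominated_convergence[where w="g 0"])
        show "integrable M (g 0)" using integrable_Cc[OF M g(1)] .
        show "\<And>i. g i \<in> borel_measurable M" by (rule borel_measurable_integrable[OF integrable_Cc[OF M g(1)]])
        show "\<And>i. AE x in M. norm (g i x) \<le> g 0 x" using g(2,4) by (intro AE_I2) simp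
        show "AE x in M. (\<lambda>m. g m x) \<longlonglongrightarrow> indicator K x" by (intro AE_I2 g(5))
      qed (use Ks in simp)
      then show "(\<lambda>m. \<integral>x. g m x \<partial>M) \<longlonglongrightarrow> measure M K" using Ks by simp
    qed
    have "measure \<Lambda> K = measure \<Lambda>' K"
      using LIMSEQ_unique[OF lim[OF r(1)]] lim[OF r(2)] by (simp add: eq[OF g(1) g(2)])
    then show ?thesis
      using emeasure_eq_ennreal_measure[of \<Lambda> K] emeasure_eq_ennreal_measure[of \<Lambda>' K] fin[OF r(1)] fin[OF r(2)] by simp
  qed simp
next
  show "range (\<lambda>m. cball (0::real^'a) (real m + 1) \<inter> - ball 0 (1 / (real m + 1))) \<subseteq> {K. compact K \<and> 0 \<notin> K}"
    by (auto intro!: compact_Int_closed)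
  show "(\<Union>m. cball 0 (real m + 1) \<inter> - ball 0 (1 / (real m + 1))) = - {0::real^'a}"
  proof (intro equalityI subsetI)
    fix x :: "real^'a" assume "x \<in> - {0}"
    then have "x \<noteq> 0" by simp
    then obtain m where "1 / (real m + 1) \<le> norm x" "norm x \<le> real m + 1" using annulus_index by blast
    then show "x \<in> (\<Union>m. cball 0 (real m + 1) \<inter> - ball 0 (1 / (real m + 1)))" by (intro UN_I[of m]) auto
  qed auto
  show "emeasure \<Lambda> (cball 0 (real m + 1) \<inter> - ball 0 (1 / (real m + 1))) \<noteq> \<infinity>" for m
  proof -
    have "cball (0::real^'a) (real m + 1) \<inter> - ball 0 (1 / (real m + 1)) = {x. 1 / (real m + 1) \<le> norm x \<and> norm x \<le> real m + 1}" by auto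
    then show ?thesis using finite_annulus[OF r(1), of "1 / (real m + 1)" "real m + 1"] by simp
  qed
qed auto

text \<open>A point outside the support has a basic open neighbourhood of measure zero; second
  countability leaves only countably many of these to discard.\<close>

lemma AE_msupport:
  fixes \<mu> :: "'a::second_countable_topology measure"
  assumes "sets \<mu> = sets (restrict_space borel S)" "S \<in> sets borel"
  shows "AE x in \<mu>. x \<in> msupport \<mu>"
proof -
  obtain B :: "'a set set" where B: "countable B" "topological_basis B" using ex_countable_basis by blast
  have sp: "space \<mu> = S" using sets_eq_imp_space_eq[OF assms(1)] by (simp add: space_restrict_space)
  define Z where "Z = {U \<in> B. emeasure \<mu> (U \<inter> space \<mu>) = 0}"
  have "AE x in \<mu>. \<forall>U\<in>Z. x \<notin> U"
  proof (subst AE_ball_countable)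
    show "countable Z" using B unfolding Z_def by auto
    show "\<forall>U\<in>Z. AE x in \<mu>. x \<notin> U"
    proof
      fix U assume U: "U \<in> Z"
      then have "open U" using B unfolding Z_def by (auto simp: topological_basis_open)
      then have "U \<inter> space \<mu> \<in> sets \<mu>" using assms by (auto simp: sp sets_restrict_space_iff)
      then have "U \<inter> space \<mu> \<in> null_sets \<mu>" using U unfolding Z_def by auto
      then show "AE x in \<mu>. x \<notin> U" by (rule AE_I') auto
    qed
  qed
  with AE_space show ?thesis
  proof eventually_elim
    case (elim x)
    show ?case unfolding msupport_def
    proof (safe)
      fix U assume U: "open U" "x \<in> U"
      then obtain V where V: "V \<in> B" "x \<in> V" "V \<subseteq> U" using topological_basisE[OF B(2)] by metis
      then have "V \<notin> Z" using elim by auto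
      then have "emeasure \<mu> (V \<inter> space \<mu>) > 0" using V unfolding Z_def by (simp add: zero_less_iff_neq_zero)
      also have "emeasure \<mu> (V \<inter> space \<mu>) \<le> emeasure \<mu> (U \<inter> space \<mu>)"
        using U V assms by (intro emeasure_mono) (auto simp: sp sets_restrict_space_iff)
      finally show "emeasure \<mu> (U \<inter> space \<mu>) > 0" .
    qed (use elim in auto)
  qed
qed

text \<open>The minimum of \<open>N\<close> over the Euclidean sphere, attained by compactness,
  gives one constant, the values on coordinate vectors the other. Tail estimates are then made in
  the Euclidean norm.\<close>

lemma is_norm_equiv:
  fixes N :: "real^'n \<Rightarrow> real"
  assumes "is_norm N"
  obtains c where "c > 0" "\<And>x. N x \<le> c * norm x" "\<And>x. norm x \<le> c * N x" "continuous_on UNIV N"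
proof -
  have N: "\<And>x. N x \<ge> 0" "\<And>x. N x = 0 \<longleftrightarrow> x = 0" "\<And>c x. N (c *\<^sub>R x) = \<bar>c\<bar> * N x" "\<And>x y. N (x + y) \<le> N x + N y"
    using assms unfolding is_norm_def by auto
  define C where "C = (\<Sum>i\<in>UNIV. N (axis i (1::real))) + 1"
  have C: "C > 0" unfolding C_def using N(1) by (smt (verit) sum_nonneg)
  have Nsum: "N (\<Sum>i\<in>I. h i) \<le> (\<Sum>i\<in>I. N (h i))" if "finite I" for I and h :: "'n \<Rightarrow> real^'n"
    using that by (induction I) (auto simp: N(2)[THEN iffD2] intro: order_trans[OF N(4)])
  have up: "N x \<le> C * norm x" for x
  proof -
    have "N x = N (\<Sum>i\<in>UNIV. x $ i *\<^sub>R axis i 1)" using basis_expansion[of x] by (simp add: scalar_mult_eq_scaleR)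
    also have "\<dots> \<le> (\<Sum>i\<in>UNIV. \<bar>x $ i\<bar> * N (axis i 1))" using Nsum[of UNIV "\<lambda>i. x $ i *\<^sub>R axis i 1"] by (simp add: N(3))
    also have "\<dots> \<le> (\<Sum>i\<in>UNIV. norm x * N (axis i 1))" by (intro sum_mono mult_right_mono component_le_norm_cart N(1))
    also have "\<dots> \<le> C * norm x" unfolding C_def by (simp add: sum_distrib_left[symmetric] algebra_simps)
    finally show ?thesis .
  qed
  have lip: "\<bar>N x - N y\<bar> \<le> C * norm (x - y)" for x y
    using N(4)[of "x - y" y] N(4)[of "y - x" x] up[of "x - y"] up[of "y - x"] by (simp add: norm_minus_commute)
  have cont: "continuous_on UNIV N"
    using C lip by (intro lipschitz_on_continuous_on[of C] lipschitz_onI) (auto simp: dist_norm)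
  have "\<exists>x\<in>sphere 0 1. \<forall>y\<in>sphere 0 1. N x \<le> N y"
  proof (rule continuous_attains_inf)
    have "axis undefined 1 \<in> sphere (0::real^'n) 1" by simp
    then show "sphere (0::real^'n) 1 \<noteq> {}" by blast
  qed (use cont in \<open>auto intro: continuous_on_subset\<close>)
  then obtain x0 where x0: "x0 \<in> sphere 0 1" "\<And>y. norm y = 1 \<Longrightarrow> N x0 \<le> N y" by auto
  have p: "N x0 > 0" using x0(1) N(1)[of x0] N(2)[of x0] by (metis less_eq_real_def mem_sphere_0 norm_zero zero_neq_one)
  have low: "norm x \<le> 1 / N x0 * N x" for x
  proof (cases "x = 0")
    case False
    have "N x0 \<le> N ((1 / norm x) *\<^sub>R x)" using False by (intro x0(2)) simp
    also have "\<dots> = N x / norm x" by (simp add: N(3))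
    finally show ?thesis using False p by (simp add: field_simps)
  qed (simp add: N)
  show ?thesis
  proof (rule that[of "max C (1 / N x0)"])
    show "max C (1 / N x0) > 0" using C by simp
    show "N x \<le> max C (1 / N x0) * norm x" for x by (rule order_trans[OF up]) (intro mult_right_mono, auto)
    show "norm x \<le> max C (1 / N x0) * N x" for x by (rule order_trans[OF low]) (intro mult_right_mono, auto simp: N)
  qed (rule cont)
qed

section \<open>Regular variation and Potter bounds\<close>

text \<open>Regular variation of index \<alpha>, applied to V(t) = t^\<alpha> L(t). Merging the
  power with the slowly varying factor keeps the later estimates free of \<open>L\<close>.\<close>

definition regvar :: "(real \<Rightarrow> real) \<Rightarrow> real \<Rightarrow> bool" where
  "regvar V \<alpha> \<longleftrightarrow> (\<forall>t>0. V t > 0) \<and> (\<forall>s>0. ((\<lambda>t. V (s * t) / V t) \<longlongrightarrow> s powr \<alpha>) at_top)"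

text \<open>Potter bounds with an arbitrarily small loss \<eta> in the exponent. They are packaged
  as a property of \<open>V\<close> because they will be derived from the tail of the jump, not from
  a general theory of slow variation.\<close>

definition potter :: "(real \<Rightarrow> real) \<Rightarrow> real \<Rightarrow> bool" where
  "potter V \<alpha> \<longleftrightarrow> regvar V \<alpha> \<and>
     (\<forall>\<eta>. 0 < \<eta> \<longrightarrow> \<eta> < \<alpha> \<longrightarrow> (\<exists>K t\<^sub>0. K > 0 \<and> t\<^sub>0 > 0 \<and> (\<forall>t\<ge>t\<^sub>0. \<forall>s\<ge>1.
        V (s * t) \<le> K * s powr (\<alpha> + \<eta>) * V t \<and> s powr (\<alpha> - \<eta>) * V t \<le> K * V (s * t))))"

text \<open>The limit is recorded as a functional and not as a measure: along the chain, limits are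
  found before they are known to be integrals. \<open>T\<close> is constrained only on
  \<open>Cb_away\<close>.\<close>

definition tail_functional ::
    "(real \<Rightarrow> real) \<Rightarrow> ('a::real_normed_vector) measure \<Rightarrow> (('a \<Rightarrow> real) \<Rightarrow> real) \<Rightarrow> bool" where
  "tail_functional V \<kappa> T \<longleftrightarrow>
     (\<forall>f\<in>Cb_away. ((\<lambda>t. V t * (\<integral>x. f (x /\<^sub>R t) \<partial>\<kappa>)) \<longlongrightarrow> T f) at_top)"

definition tail_bounded :: "(real \<Rightarrow> real) \<Rightarrow> ('a::real_normed_vector) measure \<Rightarrow> bool" where
  "tail_bounded V \<kappa> \<longleftrightarrow> (\<exists>K t\<^sub>0. \<forall>t\<ge>t\<^sub>0. V t * measure \<kappa> {x. norm x > t} \<le> K)"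

lemma regvar_slowly_varying:
  assumes "slowly_varying L" shows "regvar (\<lambda>t. t powr \<alpha> * L t) \<alpha>"
  unfolding regvar_def
proof (intro conjI allI impI)
  show "t powr \<alpha> * L t > 0" if "t > 0" for t using assms that unfolding slowly_varying_def by auto
  fix s :: real assume s: "s > 0"
  have "((\<lambda>t. s powr \<alpha> * (L (s * t) / L t)) \<longlongrightarrow> s powr \<alpha> * 1) at_top"
    using assms s unfolding slowly_varying_def by (intro tendsto_intros) auto
  moreover have "eventually (\<lambda>t. s powr \<alpha> * (L (s * t) / L t) = (s * t) powr \<alpha> * L (s * t) / (t powr \<alpha> * L t)) at_top"
    using eventually_gt_at_top[of 0] by eventually_elim (use s in \<open>simp add: powr_mult\<close>)
  ultimately show "((\<lambda>t. (s * t) powr \<alpha> * L (s * t) / (t powr \<alpha> * L t)) \<longlongrightarrow> s powr \<alpha>) at_top"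
    by (simp cong: filterlim_cong add: filterlim_cong)
qed

text \<open>Iterates the single ratio V(2t)/V(t), which eventually lies between 2^(\<alpha>-\<eta>)
  and 2^(\<alpha>+\<eta>). Only the factor 2 occurs, so no uniformity over scale factors is
  required.\<close>

lemma regvar_dyadic:
  assumes V: "regvar V \<alpha>" and \<eta>: "0 < \<eta>"
  obtains t\<^sub>0 where "t\<^sub>0 > 0" "\<And>t k. t \<ge> t\<^sub>0 \<Longrightarrow> (2 powr (\<alpha> - \<eta>)) ^ k * V t \<le> V (2 ^ k * t)"
    "\<And>t k. t \<ge> t\<^sub>0 \<Longrightarrow> V (2 ^ k * t) \<le> (2 powr (\<alpha> + \<eta>)) ^ k * V t"
proof -
  have lim: "((\<lambda>t. V (2 * t) / V t) \<longlongrightarrow> 2 powr \<alpha>) at_top" using V unfolding regvar_def by auto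
  have "eventually (\<lambda>t. 2 powr (\<alpha> - \<eta>) < V (2 * t) / V t) at_top" "eventually (\<lambda>t. V (2 * t) / V t < 2 powr (\<alpha> + \<eta>)) at_top"
    using order_tendstoD[OF lim] \<eta> by (auto intro: powr_less_mono)
  then have "eventually (\<lambda>t. 2 powr (\<alpha> - \<eta>) < V (2 * t) / V t \<and> V (2 * t) / V t < 2 powr (\<alpha> + \<eta>) \<and> t > 0) at_top"
    using eventually_gt_at_top[of 0] by eventually_elim auto
  then obtain t0 where t0: "\<And>t. t \<ge> t0 \<Longrightarrow> 2 powr (\<alpha> - \<eta>) < V (2 * t) / V t \<and> V (2 * t) / V t < 2 powr (\<alpha> + \<eta>) \<and> t > 0"
    unfolding eventually_at_top_linorder by auto
  have p: "t0 > 0" using t0[of t0] by simp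
  have step: "2 powr (\<alpha> - \<eta>) * V t \<le> V (2 * t)" "V (2 * t) \<le> 2 powr (\<alpha> + \<eta>) * V t" if "t \<ge> t0" for t
  proof -
    have "V t > 0" using t0[OF that] V unfolding regvar_def by auto
    then show "2 powr (\<alpha> - \<eta>) * V t \<le> V (2 * t)" "V (2 * t) \<le> 2 powr (\<alpha> + \<eta>) * V t"
      using t0[OF that] by (auto simp: field_simps)
  qed
  have ge: "2 ^ k * t \<ge> t0" if "t \<ge> t0" for k :: nat and t
    using mult_mono[of 1 "2 ^ k" t0 t] that p by auto
  show ?thesis
  proof (rule that[OF p])
    fix t :: real and k :: nat assume t: "t \<ge> t0"
    show "(2 powr (\<alpha> - \<eta>)) ^ k * V t \<le> V (2 ^ k * t)"
    proof (induction k)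
      case (Suc k)
      have "(2 powr (\<alpha> - \<eta>)) ^ Suc k * V t \<le> 2 powr (\<alpha> - \<eta>) * V (2 ^ k * t)"
        using mult_left_mono[OF Suc.IH, of "2 powr (\<alpha> - \<eta>)"] by (simp add: mult.assoc)
      also have "\<dots> \<le> V (2 * (2 ^ k * t))" by (rule step(1)[OF ge[OF t]])
      finally show ?case by (simp add: mult.assoc)
    qed simp
    show "V (2 ^ k * t) \<le> (2 powr (\<alpha> + \<eta>)) ^ k * V t"
    proof (induction k)
      case (Suc k)
      have "V (2 * (2 ^ k * t)) \<le> 2 powr (\<alpha> + \<eta>) * V (2 ^ k * t)" by (rule step(2)[OF ge[OF t]])
      also have "\<dots> \<le> 2 powr (\<alpha> + \<eta>) * ((2 powr (\<alpha> + \<eta>)) ^ k * V t)" by (rule mult_left_mono[OF Suc.IH]) simp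
      finally show ?case by (simp add: mult.assoc)
    qed simp
  qed
qed

lemma integral_ge_measure:
  assumes "finite_measure \<kappa>" "sets \<kappa> = sets borel" "f \<in> borel_measurable borel" "\<And>x. 0 \<le> f x" "\<And>x. f x \<le> C"
    "S \<in> sets borel" "\<And>x. x \<in> S \<Longrightarrow> 1 \<le> f x"
  shows "measure \<kappa> S \<le> (\<integral>x. f x \<partial>\<kappa>)"
proof -
  interpret finite_measure \<kappa> by fact
  have [measurable]: "S \<in> sets \<kappa>" "f \<in> borel_measurable \<kappa>" using assms by (simp_all cong: measurable_cong_sets)
  have "C \<ge> 0" using assms(4,5) order_trans by blast
  have "measure \<kappa> S = (\<integral>x. indicator S x \<partial>\<kappa>)" by simp
  also have "\<dots> \<le> (\<integral>x. f x \<partial>\<kappa>)"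
    using assms(4,5,7) by (intro integral_mono integrable_const_bound[of f C] integrable_real_indicator)
      (auto simp: indicator_def emeasure_finite less_top[symmetric])
  finally show ?thesis .
qed

lemma integral_le_measure:
  assumes "finite_measure \<kappa>" "sets \<kappa> = sets borel" "f \<in> borel_measurable borel"
    "S \<in> sets borel" "\<And>x. \<bar>f x\<bar> \<le> C" "\<And>x. x \<notin> S \<Longrightarrow> f x = 0"
  shows "\<bar>\<integral>x. f x \<partial>\<kappa>\<bar> \<le> C * measure \<kappa> S"
proof -
  interpret finite_measure \<kappa> by fact
  have [measurable]: "S \<in> sets \<kappa>" "f \<in> borel_measurable \<kappa>" using assms by (simp_all cong: measurable_cong_sets)
  have "\<bar>\<integral>x. f x \<partial>\<kappa>\<bar> \<le> (\<integral>x. \<bar>f x\<bar> \<partial>\<kappa>)" by (rule integral_abs_bound)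
  also have "\<dots> \<le> (\<integral>x. C * indicator S x \<partial>\<kappa>)"
    using assms(5,6) by (intro integral_mono integrable_const_bound[of _ C] integrable_mult_right integrable_real_indicator)
      (auto simp: indicator_def emeasure_finite less_top[symmetric])
  also have "\<dots> = C * measure \<kappa> S" by simp
  finally show ?thesis .
qed

lemma measurable_scale: "f \<in> borel_measurable borel \<Longrightarrow> (\<lambda>x::real^'n. f (x /\<^sub>R t)) \<in> borel_measurable borel"
  by (rule measurable_compose[where N=borel and g=f]) measurable

text \<open>A compactly supported test sees one annulus at a time. Dyadic shells cover |x| > t, each
  has probability at most a constant over V(2^k t), and these bounds sum geometrically because V
  grows at least like 2^(k \<alpha>/2) along the shells.\<close>

lemma tail_boundedI:
  fixes \<Lambda> :: "(real^'n) measure"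
  assumes \<alpha>: "\<alpha> > 0" and t: "tail_measure \<alpha> L \<kappa> \<Lambda>" and fin: "prob_space \<kappa>" "sets \<kappa> = sets borel"
  shows "tail_bounded (\<lambda>t. t powr \<alpha> * L t) \<kappa>"
proof -
  interpret prob_space \<kappa> by fact
  define V where "V = (\<lambda>t. t powr \<alpha> * L t)"
  have rv: "regvar V \<alpha>" using t unfolding V_def tail_measure_def by (intro regvar_slowly_varying) auto
  have Vp: "V t > 0" if "t > 0" for t using rv that unfolding regvar_def by auto
  define f :: "real^'n \<Rightarrow> real" where "f = (\<lambda>x. ramp (1/2) 1 x * (1 - ramp 2 3 x))"
  have f: "f \<in> Cc_punctured" unfolding f_def by (rule ramp_Cc) auto
  have f01: "0 \<le> f x" "f x \<le> 1" for x unfolding f_def using ramp_props(2,3)[of "1/2" 1 x] ramp_props(2,3)[of 2 3 x]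
    by (auto intro!: mult_le_one)
  have f1: "f x = 1" if "1 \<le> norm x" "norm x \<le> 2" for x unfolding f_def using ramp_props(5)[of "1/2" 1 x] ramp_props(4)[of 2 3 x] that by auto
  have fm: "f \<in> borel_measurable borel" using f Cc_subset_Cb_away borel_Cb_away by blast
  have "((\<lambda>t. V t * (\<integral>x. f (x /\<^sub>R t) \<partial>\<kappa>)) \<longlongrightarrow> (\<integral>x. f x \<partial>\<Lambda>)) at_top"
    using t f unfolding tail_measure_def V_def by auto
  then have "eventually (\<lambda>t. V t * (\<integral>x. f (x /\<^sub>R t) \<partial>\<kappa>) < (\<integral>x. f x \<partial>\<Lambda>) + 1) at_top"
    by (rule order_tendstoD) simp
  then obtain t1 where t1: "\<And>t. t \<ge> t1 \<Longrightarrow> V t * (\<integral>x. f (x /\<^sub>R t) \<partial>\<kappa>) \<le> (\<integral>x. f x \<partial>\<Lambda>) + 1"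
    unfolding eventually_at_top_linorder by (meson less_imp_le)
  define c where "c = (\<integral>x. f x \<partial>\<Lambda>) + 1"
  have c: "c \<ge> 0" unfolding c_def using f01 by (smt (verit) integral_nonneg_AE AE_I2)
  obtain t0 where t0: "t0 > 0" "\<And>t k. t \<ge> t0 \<Longrightarrow> (2 powr (\<alpha> - \<alpha>/2)) ^ k * V t \<le> V (2 ^ k * t)"
    using regvar_dyadic[OF rv, of "\<alpha>/2"] \<alpha> by (metis half_gt_zero)
  \<comment> \<open>Growth ratio of \<open>V\<close> per dyadic step with the loss \<eta> =
    \<alpha>/2; it exceeds 1 because \<alpha> > 0.\<close>
  define q where "q = (2::real) powr (\<alpha>/2)"
  have q: "q > 1" unfolding q_def using \<alpha> by simp
  have shell: "measure \<kappa> {x. 2^k * t \<le> norm x \<and> norm x \<le> 2 * (2^k * t)} \<le> c / V t * (1/q)^k"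
    if t: "t \<ge> max t0 t1" for t k
  proof -
    have tp: "t > 0" using t t0 by simp
    define u where "u = 2^k * t"
    have u: "u > 0" "u \<ge> t" unfolding u_def using tp by auto
    have "measure \<kappa> {x. u \<le> norm x \<and> norm x \<le> 2 * u} \<le> (\<integral>x. f (x /\<^sub>R u) \<partial>\<kappa>)"
      using fin fm f01 u f1 by (intro integral_ge_measure[of _ _ 1]) (auto simp: field_simps finite_measure_axioms)
    also have "\<dots> \<le> c / V u"
      using t1[of u] u t Vp[of u] unfolding c_def by (simp add: field_simps)
    also have "\<dots> \<le> c / (q^k * V t)"
      using t0(2)[of t k] t Vp[OF tp] Vp[of u] u c q unfolding q_def u_def by (intro divide_left_mono) auto
    also have "\<dots> = c / V t * (1/q)^k" by (simp add: power_one_over field_simps)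
    finally show ?thesis unfolding u_def .
  qed
  show ?thesis unfolding tail_bounded_def V_def[symmetric]
  proof (intro exI allI impI)
    fix t assume t: "t \<ge> max t0 t1"
    then have tp: "t > 0" using t0 by simp
    let ?A = "\<lambda>k::nat. {x::real^'n. 2^k * t \<le> norm x \<and> norm x \<le> 2 * (2^k * t)}"
    have sub: "{x. norm x > t} \<subseteq> (\<Union>k. ?A k)"
    proof
      fix x :: "real^'n" assume "x \<in> {x. norm x > t}"
      then have x: "norm x / t > 1" using tp by simp
      obtain n where n: "norm x / t < 2 ^ n" using real_arch_pow[of 2 "norm x / t"] by auto
      \<comment> \<open>The first power of two exceeding |x|/t is not 2^0, so its predecessor
        indexes a shell containing \<open>x\<close>.\<close>
      define k where "k = (LEAST n. norm x / t < 2 ^ n)"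
      have k: "norm x / t < 2 ^ k" unfolding k_def using n by (rule LeastI)
      then have "k \<noteq> 0" using x by (metis less_asym power_0)
      then obtain j where j: "k = Suc j" using not0_implies_Suc by auto
      have "\<not> norm x / t < 2 ^ j" using not_less_Least[of j "\<lambda>n. norm x / t < 2 ^ n"] j unfolding k_def by auto
      then have "x \<in> ?A j" using k j tp by (auto simp: field_simps)
      then show "x \<in> (\<Union>k. ?A k)" by blast
    qed
    have sm: "summable (\<lambda>k. c / V t * (1/q)^k)" using q by (intro summable_mult summable_geometric) auto
    have Am: "?A k \<in> sets \<kappa>" for k unfolding fin(2) by measurable
    have smA: "summable (\<lambda>k. measure \<kappa> (?A k))"
      by (rule summable_comparison_test[OF _ sm]) (use shell[OF t] in auto)
    have "measure \<kappa> {x. norm x > t} \<le> measure \<kappa> (\<Union>k. ?A k)"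
      using sub Am by (intro finite_measure_mono) auto
    also have "\<dots> \<le> (\<Sum>k. measure \<kappa> (?A k))"
      using Am smA by (intro finite_measure_subadditive_countably) auto
    also have "\<dots> \<le> (\<Sum>k. c / V t * (1/q)^k)" by (rule suminf_le[OF shell[OF t] smA sm])
    also have "\<dots> = c / V t * (1 / (1 - 1/q))" using q by (subst suminf_mult) (auto intro: summable_geometric simp: suminf_geometric)
    finally have "V t * measure \<kappa> {x. norm x > t} \<le> V t * (c / V t * (1 / (1 - 1/q)))"
      using Vp[OF tp] by (intro mult_left_mono) auto
    then show "V t * measure \<kappa> {x. norm x > t} \<le> c * (1 / (1 - 1/q))" using Vp[OF tp] by simp
  qed
qed

text \<open>A nonzero tail measure gives some nonnegative test function a positive integral. That
  function lives in |x| \<ge> r, so its scaled expectation is a lower bound for a tail probability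
  at level r' t; regular variation moves the level to t.\<close>

lemma tail_lower:
  fixes \<Lambda> :: "(real^'n) measure"
  assumes t: "tail_measure \<alpha> L \<kappa> \<Lambda>" and fin: "prob_space \<kappa>" "sets \<kappa> = sets borel"
    and nz: "emeasure \<Lambda> (space \<Lambda>) \<noteq> 0"
  shows "\<exists>c>0. \<exists>t\<^sub>0. \<forall>t\<ge>t\<^sub>0. c \<le> t powr \<alpha> * L t * measure \<kappa> {x. norm x > t}"
proof -
  interpret prob_space \<kappa> by fact
  define V where "V = (\<lambda>t. t powr \<alpha> * L t)"
  have rv: "regvar V \<alpha>" using t unfolding V_def tail_measure_def by (intro regvar_slowly_varying) auto
  have Vp: "V t > 0" if "t > 0" for t using rv that unfolding regvar_def by auto
  have rad: "radon_punctured \<Lambda>" using t unfolding tail_measure_def by auto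
  \<comment> \<open>Otherwise all nonnegative test functions would have integral zero and
    \<open>\<Lambda>\<close> would be the null measure by uniqueness.\<close>
  have "\<exists>f\<in>Cc_punctured. (\<forall>x. 0 \<le> f x) \<and> (\<integral>x. f x \<partial>\<Lambda>) > 0"
  proof (rule ccontr)
    assume "\<not> ?thesis"
    then have z: "(\<integral>x. f x \<partial>\<Lambda>) = 0" if "f \<in> Cc_punctured" "\<And>x. 0 \<le> f x" for f
      using that Bochner_Integration.integral_nonneg[of \<Lambda> f] by (meson antisym not_less)
    have "\<Lambda> = null_measure \<Lambda>"
      by (rule radon_punctured_eqI) (use rad z in \<open>auto simp: radon_punctured_def\<close>)
    then show False using nz emeasure_null_measure by metis
  qed
  then obtain f where f: "f \<in> Cc_punctured" "\<And>x. 0 \<le> f x" and pos: "(\<integral>x. f x \<partial>\<Lambda>) > 0" by auto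
  obtain C where C: "C > 0" "\<And>x. \<bar>f x\<bar> \<le> C" by (rule Cc_punctured_bounded[OF f(1)]) blast
  obtain r R where r: "continuous_on UNIV f" "0 < r" "r < R" "\<And>x. f x \<noteq> 0 \<Longrightarrow> r \<le> norm x \<and> norm x \<le> R"
    by (rule Cc_puncturedE[OF f(1)]) blast
  define d where "d = (\<integral>x. f x \<partial>\<Lambda>) / (2 * C)"
  have d: "d > 0" unfolding d_def using pos C by simp
  \<comment> \<open>Halving \<open>r\<close> turns the support condition |x| \<ge> r t into the
    strict inequality of the tail event.\<close>
  define r' where "r' = r / 2"
  have r': "r' > 0" "r' < r" unfolding r'_def using r by auto
  have fm: "f \<in> borel_measurable borel" using f Cc_subset_Cb_away borel_Cb_away by blast
  have "((\<lambda>t. V t * (\<integral>x. f (x /\<^sub>R t) \<partial>\<kappa>)) \<longlongrightarrow> (\<integral>x. f x \<partial>\<Lambda>)) at_top"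
    using t f unfolding tail_measure_def V_def by auto
  then have "eventually (\<lambda>t. V t * (\<integral>x. f (x /\<^sub>R t) \<partial>\<kappa>) > (\<integral>x. f x \<partial>\<Lambda>) / 2) at_top"
    by (rule order_tendstoD) (use pos in simp)
  then have "eventually (\<lambda>t. V t * measure \<kappa> {x. norm x > r' * t} \<ge> d) at_top"
    using eventually_gt_at_top[of 0]
  proof eventually_elim
    case (elim t)
    have "\<bar>\<integral>x. f (x /\<^sub>R t) \<partial>\<kappa>\<bar> \<le> C * measure \<kappa> {x. norm x > r' * t}"
    proof (rule integral_le_measure)
      show "f (x /\<^sub>R t) = 0" if "x \<notin> {x. norm x > r' * t}" for x
      proof (rule ccontr)
        assume "f (x /\<^sub>R t) \<noteq> 0"
        then have "r \<le> norm (x /\<^sub>R t)" using r(4) by blast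
        then have "r * t \<le> norm x" using elim by (simp add: field_simps)
        moreover have "r' * t < r * t" using r' elim by simp
        ultimately show False using that by simp
      qed
    qed (use C fm fin in \<open>auto simp: finite_measure_axioms\<close>)
    then have "V t * (\<integral>x. f (x /\<^sub>R t) \<partial>\<kappa>) \<le> V t * (C * measure \<kappa> {x. norm x > r' * t})"
      using Vp[of t] elim by (intro mult_left_mono) auto
    then show ?case using elim C unfolding d_def by (simp add: field_simps)
  qed
  then obtain t1 where t1: "\<And>t. t \<ge> t1 \<Longrightarrow> V t * measure \<kappa> {x. norm x > r' * t} \<ge> d"
    unfolding eventually_at_top_linorder by auto
  have "((\<lambda>t. V ((1/r') * t) / V t) \<longlongrightarrow> (1/r') powr \<alpha>) at_top" using rv r' unfolding regvar_def by (meson divide_pos_pos zero_less_one)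
  then have "eventually (\<lambda>t. V ((1/r') * t) / V t < (1/r') powr \<alpha> + 1) at_top" by (rule order_tendstoD) simp
  then obtain t2 where t2: "\<And>t. t \<ge> t2 \<Longrightarrow> V ((1/r') * t) / V t < (1/r') powr \<alpha> + 1"
    unfolding eventually_at_top_linorder by auto
  define c where "c = d / ((1/r') powr \<alpha> + 1)"
  have b: "(1/r') powr \<alpha> + 1 > 0" by (simp add: add_nonneg_pos)
  have "\<forall>t\<ge>max 1 (max t2 (r' * t1)). c \<le> V t * measure \<kappa> {x. norm x > t}"
  proof (intro allI impI)
    fix t assume t: "t \<ge> max 1 (max t2 (r' * t1))"
    have "V ((1/r') * t) * measure \<kappa> {x. norm x > r' * ((1/r') * t)} \<ge> d"
      using t r' by (intro t1) (simp add: field_simps)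
    then have 1: "V ((1/r') * t) * measure \<kappa> {x. norm x > t} \<ge> d" using r' by simp
    have "V t > 0" using t by (intro Vp) auto
    then have "V ((1/r') * t) \<le> ((1/r') powr \<alpha> + 1) * V t" using t2[of t] t by (simp add: field_simps)
    then have "d \<le> ((1/r') powr \<alpha> + 1) * V t * measure \<kappa> {x. norm x > t}"
      using 1 mult_right_mono[of "V ((1/r') * t)" "((1/r') powr \<alpha> + 1) * V t" "measure \<kappa> {x. norm x > t}"] by simp
    then show "c \<le> V t * measure \<kappa> {x. norm x > t}" unfolding c_def using b by (simp add: field_simps)
  qed
  moreover have "c > 0" unfolding c_def using d b by simp
  ultimately show ?thesis unfolding V_def by blast
qed

text \<open>Regular variation at the factor 2 controls \<open>V\<close> only along dyadic points. A
  monotone \<open>g\<close> with V g bounded above and away from 0 supplies control in between; in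
  the application \<open>g\<close> is a tail probability.\<close>

lemma potterI:
  assumes rv: "regvar V \<alpha>" and g: "antimono g"
    and low: "\<exists>c>0. \<exists>t\<^sub>0. \<forall>t\<ge>t\<^sub>0. c \<le> V t * g t" and up: "\<exists>K t\<^sub>0. \<forall>t\<ge>t\<^sub>0. V t * g t \<le> K"
  shows "potter V \<alpha>"
  unfolding potter_def
proof (intro conjI rv allI impI)
  fix \<eta> :: real assume \<eta>: "0 < \<eta>" "\<eta> < \<alpha>"
  obtain c t1 where c: "c > 0" "\<And>t. t \<ge> t1 \<Longrightarrow> c \<le> V t * g t" using low by auto
  obtain K t2 where K: "\<And>t. t \<ge> t2 \<Longrightarrow> V t * g t \<le> K" using up by auto
  obtain t3 where t3: "t3 > 0" "\<And>t k. t \<ge> t3 \<Longrightarrow> (2 powr (\<alpha> - \<eta>)) ^ k * V t \<le> V (2 ^ k * t)"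
    "\<And>t k. t \<ge> t3 \<Longrightarrow> V (2 ^ k * t) \<le> (2 powr (\<alpha> + \<eta>)) ^ k * V t"
    using regvar_dyadic[OF rv \<eta>(1)] by metis
  define T where "T = max t1 (max t2 t3)"
  have T: "T > 0" unfolding T_def using t3 by simp
  have Vp: "V t > 0" if "t > 0" for t using rv that unfolding regvar_def by auto
  have gp: "g t > 0" if "t \<ge> T" for t
    using c that Vp[of t] T by (smt (verit) T_def max.cobounded1 mult_nonneg_nonpos not_less)
  have Kp: "K > 0" using c(1) c(2)[of T] K[of T] unfolding T_def by (smt (verit) max.cobounded1 max.cobounded2)
  \<comment> \<open>\<open>V\<close> is comparable to the monotone function \<open>1 / g\<close>, hence almost monotone.\<close>
  have mono: "V t \<le> K / c * V u" if "T \<le> t" "t \<le> u" for t u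
  proof -
    have "V t * c \<le> V t * (V u * g u)" using c(2)[of u] that less_imp_le[OF Vp[of t]] T unfolding T_def by (intro mult_left_mono) auto
    also have "\<dots> \<le> V u * (V t * g t)" using antimonoD[OF g that(2)] Vp[of t] Vp[of u] that T by (simp add: mult.assoc mult.left_commute)
    also have "\<dots> \<le> V u * K" using K[of t] that less_imp_le[OF Vp[of u]] T unfolding T_def by (intro mult_left_mono) auto
    finally show ?thesis using c(1) by (simp add: field_simps)
  qed
  \<comment> \<open>K/c is the price of almost monotonicity, 2^(\<alpha>+\<eta>) that of rounding
    \<open>s\<close> to a power of two.\<close>
  define P where "P = K / c * 2 powr (\<alpha> + \<eta>)"
  have Pp: "P > 0" unfolding P_def using Kp c by simp
  have "\<forall>t\<ge>T. \<forall>s\<ge>1.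
        V (s * t) \<le> P * s powr (\<alpha> + \<eta>) * V t \<and> s powr (\<alpha> - \<eta>) * V t \<le> P * V (s * t)"
  proof (intro conjI allI impI)
    fix t s :: real assume t: "t \<ge> T" and s: "s \<ge> 1"
    have tp: "t > 0" using t T by simp
    obtain n where n: "s < 2 ^ n" using real_arch_pow[of 2 s] by auto
    define m where "m = (LEAST n. s < 2 ^ n)"
    have m: "s < 2 ^ m" unfolding m_def using n by (rule LeastI)
    then have "m \<noteq> 0" using s by (metis not_less power_0)
    then obtain k where k: "m = Suc k" using not0_implies_Suc by auto
    have k1: "2 ^ k \<le> s" using not_less_Least[of k "\<lambda>n. s < 2 ^ n"] k unfolding m_def by (auto simp: not_less)
    have k2: "s < 2 * 2 ^ k" using m k by simp
    have pw: "(2 powr a) ^ k = (2 ^ k) powr a" for a :: real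
      by (simp add: powr_powr powr_realpow[symmetric] mult.commute)
    have t3': "t \<ge> t3" using t unfolding T_def by simp
    have ge: "T \<le> s * t" "T \<le> 2 ^ k * t"
      using order_trans[OF t, of "s * t"] order_trans[OF t, of "2 ^ k * t"] tp s by simp_all
    have "V (s * t) \<le> K / c * V (2 ^ Suc k * t)" using ge k2 tp by (intro mono) auto
    also have "\<dots> \<le> K / c * ((2 powr (\<alpha> + \<eta>)) ^ Suc k * V t)"
      using Kp c t3(3)[OF t3', of "Suc k"] by (intro mult_left_mono) auto
    also have "\<dots> = P * (2 ^ k) powr (\<alpha> + \<eta>) * V t" unfolding P_def by (simp add: pw)
    also have "\<dots> \<le> P * s powr (\<alpha> + \<eta>) * V t"
      using Pp Vp[OF tp] k1 \<eta> by (intro mult_right_mono mult_left_mono powr_mono2) auto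
    finally show "V (s * t) \<le> P * s powr (\<alpha> + \<eta>) * V t" .
    have "s powr (\<alpha> - \<eta>) * V t \<le> (2 * 2 ^ k) powr (\<alpha> - \<eta>) * V t"
      using Vp[OF tp] k2 \<eta> s by (intro mult_right_mono powr_mono2) auto
    also have "\<dots> = 2 powr (\<alpha> - \<eta>) * ((2 powr (\<alpha> - \<eta>)) ^ k * V t)" by (simp add: powr_mult pw)
    also have "\<dots> \<le> 2 powr (\<alpha> - \<eta>) * V (2 ^ k * t)" using t3(2)[OF t3', of k] by (intro mult_left_mono) auto
    also have "\<dots> \<le> 2 powr (\<alpha> - \<eta>) * (K / c * V (s * t))" using mono[OF ge(2), of "s * t"] k1 tp by (intro mult_left_mono) auto
    also have "\<dots> \<le> 2 powr (\<alpha> + \<eta>) * (K / c * V (s * t))"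
      using Kp c Vp[of "s * t"] s tp \<eta> by (intro mult_right_mono powr_mono) auto
    finally show "s powr (\<alpha> - \<eta>) * V t \<le> P * V (s * t)" unfolding P_def by (simp add: mult_ac)
  qed
  with Pp T show "\<exists>K t\<^sub>0. K > 0 \<and> t\<^sub>0 > 0 \<and> (\<forall>t\<ge>t\<^sub>0. \<forall>s\<ge>1.
        V (s * t) \<le> K * s powr (\<alpha> + \<eta>) * V t \<and> s powr (\<alpha> - \<eta>) * V t \<le> K * V (s * t))" by blast
qed

lemma potter_tail_measure:
  fixes \<Lambda> :: "(real^'n) measure"
  assumes "\<alpha> > 0" "tail_measure \<alpha> L \<kappa> \<Lambda>" "prob_space \<kappa>" "sets \<kappa> = sets borel" "emeasure \<Lambda> (space \<Lambda>) \<noteq> 0"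
  shows "potter (\<lambda>t. t powr \<alpha> * L t) \<alpha>"
proof (rule potterI[where g="\<lambda>t. measure \<kappa> {x. norm x > t}"])
  interpret prob_space \<kappa> by fact
  show "regvar (\<lambda>t. t powr \<alpha> * L t) \<alpha>" using assms(2) by (intro regvar_slowly_varying) (simp add: tail_measure_def)
  show "antimono (\<lambda>t. measure \<kappa> {x. norm x > t})"
    by (intro antimonoI finite_measure_mono) (auto simp: assms(4))
  show "\<exists>c>0. \<exists>t\<^sub>0. \<forall>t\<ge>t\<^sub>0. c \<le> t powr \<alpha> * L t * measure \<kappa> {x. norm x > t}" by (rule tail_lower[OF assms(2-5)])
  show "\<exists>K t\<^sub>0. \<forall>t\<ge>t\<^sub>0. t powr \<alpha> * L t * measure \<kappa> {x. norm x > t} \<le> K"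
    using tail_boundedI[OF assms(1-4)] unfolding tail_bounded_def .
qed

lemma powr_one_divide: "s > 0 \<Longrightarrow> (1 / s) powr a = s powr - (a::real)"
  using powr_divide[of 1 s a] powr_minus_divide[of s a] by simp

text \<open>The two exponents serve small and large \<open>s\<close>; taking their sum makes the
  bound valid for all s > 0 and spares case distinctions when \<open>s\<close> later depends on the
  norm of \<open>A\<close>.\<close>

lemma potter_tail_bound:
  assumes V: "potter V \<alpha>" and \<kappa>: "prob_space \<kappa>" "sets \<kappa> = sets borel" "tail_bounded V \<kappa>"
    and \<eta>: "0 < \<eta>" "\<eta> < \<alpha>"
  obtains K t\<^sub>0 where "K > 0" "t\<^sub>0 > 0"
    "\<And>t s. t \<ge> t\<^sub>0 \<Longrightarrow> s > 0 \<Longrightarrow> V t * measure \<kappa> {x. norm x > s * t} \<le> K * (s powr - (\<alpha> + \<eta>) + s powr - (\<alpha> - \<eta>))"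
proof -
  interpret prob_space \<kappa> by fact
  obtain P t1 where P: "P > 0" "t1 > 0" "\<And>t s. t \<ge> t1 \<Longrightarrow> s \<ge> 1 \<Longrightarrow> V (s * t) \<le> P * s powr (\<alpha> + \<eta>) * V t"
    "\<And>t s. t \<ge> t1 \<Longrightarrow> s \<ge> 1 \<Longrightarrow> s powr (\<alpha> - \<eta>) * V t \<le> P * V (s * t)"
  proof -
    from V \<eta> obtain P t1 where "P > 0 \<and> t1 > 0 \<and> (\<forall>t\<ge>t1. \<forall>s\<ge>1.
        V (s * t) \<le> P * s powr (\<alpha> + \<eta>) * V t \<and> s powr (\<alpha> - \<eta>) * V t \<le> P * V (s * t))"
      unfolding potter_def by blast
    then show ?thesis by (intro that[of P t1]) auto
  qed
  obtain C t2 where C: "\<And>t. t \<ge> t2 \<Longrightarrow> V t * measure \<kappa> {x. norm x > t} \<le> C"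
    using \<kappa>(3) unfolding tail_bounded_def by auto
  have Vp: "V t > 0" if "t > 0" for t using V that unfolding potter_def regvar_def by auto
  define T where "T = max t1 t2"
  have T: "T > 0" unfolding T_def using P by simp
  \<comment> \<open>The summand V T serves the range s t < T: there the probability is bounded only
    by 1, and V(t) itself is of order (1/s)^(\<alpha>+\<eta>) V(T).\<close>
  define K where "K = P * (max C 0 + V T)"
  have K: "K > 0" unfolding K_def using P Vp[OF T] by (intro mult_pos_pos) auto
  show ?thesis
  proof (rule that[OF K T])
    fix t s :: real assume t: "t \<ge> T" and s: "s > 0"
    have tp: "t > 0" using t T by simp
    define p where "p = measure \<kappa> {x. norm x > s * t}"
    have p: "0 \<le> p" "p \<le> 1" unfolding p_def by auto
    have CK: "P * C \<le> K" unfolding K_def using P Vp[OF T] by (intro mult_left_mono) auto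
    \<comment> \<open>Potter bounds compare two arguments above the threshold, the larger written as
      a multiple of the smaller. Below the threshold, s t is replaced by T.\<close>
    consider "s * t \<ge> T" "s \<ge> 1" | "s * t \<ge> T" "s < 1" | "s * t < T" by linarith
    then have "V t * p \<le> K * s powr - (\<alpha> + \<eta>) \<or> V t * p \<le> K * s powr - (\<alpha> - \<eta>)"
    proof cases
      case 1
      have "s powr (\<alpha> - \<eta>) * V t \<le> P * V (s * t)" using P(4)[of t s] t 1 unfolding T_def by auto
      then have "V t \<le> P * V (s * t) * s powr - (\<alpha> - \<eta>)"
        using s by (simp add: powr_minus powr_diff field_simps)
      then have "V t * p \<le> P * V (s * t) * s powr - (\<alpha> - \<eta>) * p" by (rule mult_right_mono[OF _ p(1)])
      also have "\<dots> = P * (V (s * t) * p) * s powr - (\<alpha> - \<eta>)" by simp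
      also have "\<dots> \<le> P * C * s powr - (\<alpha> - \<eta>)"
        using C[of "s * t"] 1 P unfolding T_def p_def by (intro mult_right_mono mult_left_mono) auto
      also have "\<dots> \<le> K * s powr - (\<alpha> - \<eta>)" by (rule mult_right_mono[OF CK]) simp
      finally show ?thesis by simp
    next
      case 2
      have "V ((1/s) * (s * t)) \<le> P * (1/s) powr (\<alpha> + \<eta>) * V (s * t)" using 2 s unfolding T_def by (intro P(3)) auto
      moreover have "(1/s) powr (\<alpha> + \<eta>) = s powr - (\<alpha> + \<eta>)" by (rule powr_one_divide[OF s])
      moreover have "(1/s) * (s * t) = t" using s by simp
      ultimately have "V t \<le> P * s powr - (\<alpha> + \<eta>) * V (s * t)" by metis
      then have "V t * p \<le> P * s powr - (\<alpha> + \<eta>) * V (s * t) * p" by (rule mult_right_mono[OF _ p(1)])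
      also have "\<dots> = P * (V (s * t) * p) * s powr - (\<alpha> + \<eta>)" by simp
      also have "\<dots> \<le> P * C * s powr - (\<alpha> + \<eta>)"
        using C[of "s * t"] 2 P unfolding T_def p_def by (intro mult_right_mono mult_left_mono) auto
      also have "\<dots> \<le> K * s powr - (\<alpha> + \<eta>)" by (rule mult_right_mono[OF CK]) simp
      finally show ?thesis by simp
    next
      case 3
      have "V ((t/T) * T) \<le> P * (t/T) powr (\<alpha> + \<eta>) * V T" using t T unfolding T_def by (intro P(3)) auto
      then have "V t \<le> P * (t/T) powr (\<alpha> + \<eta>) * V T" using T by simp
      also have "\<dots> \<le> P * (1/s) powr (\<alpha> + \<eta>) * V T"
        using 3 s T tp P Vp[OF T] \<eta> by (intro mult_right_mono mult_left_mono powr_mono2) (auto simp: field_simps)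
      also have "\<dots> = (P * V T) * s powr - (\<alpha> + \<eta>)"
      proof -
        show ?thesis unfolding powr_one_divide[OF s] by simp
      qed
      also have "\<dots> \<le> K * s powr - (\<alpha> + \<eta>)" unfolding K_def using P by (intro mult_right_mono mult_left_mono) auto
      finally have "V t \<le> K * s powr - (\<alpha> + \<eta>)" .
      moreover have "V t * p \<le> V t * 1" using p Vp[OF tp] by (intro mult_left_mono) auto
      ultimately show ?thesis by simp
    qed
    moreover have "K * s powr - (\<alpha> + \<eta>) \<ge> 0" "K * s powr - (\<alpha> - \<eta>) \<ge> 0" using K by auto
    ultimately show "V t * measure \<kappa> {x. norm x > s * t} \<le> K * (s powr - (\<alpha> + \<eta>) + s powr - (\<alpha> - \<eta>))"
      unfolding p_def[symmetric] distrib_left by linarith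
  qed
qed

text \<open>Exchange of limits in which the error bound \<open>e n\<close> has to hold only
  eventually, from a threshold that may depend on \<open>n\<close>.\<close>

lemma tendsto_swap:
  fixes F :: "'a \<Rightarrow> real" and G :: "nat \<Rightarrow> 'a \<Rightarrow> real"
  assumes "\<And>n. (G n \<longlongrightarrow> a n) net" "a \<longlonglongrightarrow> l" "e \<longlonglongrightarrow> 0"
    "\<And>n. eventually (\<lambda>t. \<bar>F t - G n t\<bar> \<le> e n) net"
  shows "(F \<longlongrightarrow> l) net"
proof (rule tendstoI)
  fix d :: real assume d: "d > 0"
  have "eventually (\<lambda>n. dist (a n) l < d/3) sequentially" "eventually (\<lambda>n. dist (e n) 0 < d/3) sequentially"
    using tendstoD[OF assms(2), of "d/3"] tendstoD[OF assms(3), of "d/3"] d by auto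
  then have "eventually (\<lambda>n. dist (a n) l < d/3 \<and> dist (e n) 0 < d/3) sequentially" by eventually_elim auto
  then obtain n where n: "dist (a n) l < d/3" "dist (e n) 0 < d/3" using eventually_happens'[OF sequentially_bot] by blast
  have "eventually (\<lambda>t. dist (G n t) (a n) < d/3) net" using tendstoD[OF assms(1)[of n], of "d/3"] d by auto
  then show "eventually (\<lambda>t. dist (F t) l < d) net" using assms(4)[of n]
  proof eventually_elim
    case (elim t)
    show ?case using elim n unfolding dist_real_def by linarith
  qed
qed

lemma powr_neg_tendsto_0: "a > 0 \<Longrightarrow> c > 0 \<Longrightarrow> (\<lambda>n. (c * (real n + 1)) powr - a) \<longlonglongrightarrow> 0"
  by (intro tendsto_neg_powr filterlim_tendsto_pos_mult_at_top[OF tendsto_const]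
        filterlim_at_top_mono[OF filterlim_real_sequentially]) auto

section \<open>From compactly supported to bounded test functions\<close>

context
  fixes \<Lambda> \<kappa> :: "(real^'n) measure" and V \<alpha> L
  assumes \<alpha>: "\<alpha> > 0" and t: "tail_measure \<alpha> L \<kappa> \<Lambda>" and fin: "prob_space \<kappa>" "sets \<kappa> = sets borel"
    and V_def: "V = (\<lambda>t. t powr \<alpha> * L t)" and V: "potter V \<alpha>"
begin

text \<open>The Radon property speaks only of compact sets. The Potter bound caps the integrals of
  all outer cutoffs by one constant, which passes to the increasing union of annuli.\<close>

lemma tail_measure_finite_outside: "r > 0 \<Longrightarrow> emeasure \<Lambda> {x. r \<le> norm x} < \<infinity>"
proof -
  assume r: "r > 0"
  interpret prob_space \<kappa> by fact
  have rad: "radon_punctured \<Lambda>" using t unfolding tail_measure_def by auto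
  have Vp: "V t > 0" if "t > 0" for t using V that unfolding potter_def regvar_def by auto
  have tb: "tail_bounded V \<kappa>" unfolding V_def by (rule tail_boundedI[OF \<alpha> t fin])
  have \<alpha>2: "0 < \<alpha>/2" "\<alpha>/2 < \<alpha>" using \<alpha> by auto
  obtain K t0 where K: "K > 0" "t0 > 0"
    "\<And>t s. t \<ge> t0 \<Longrightarrow> s > 0 \<Longrightarrow> V t * measure \<kappa> {x. norm x > s * t} \<le> K * (s powr - (\<alpha> + \<alpha>/2) + s powr - (\<alpha> - \<alpha>/2))"
    by (rule potter_tail_bound[OF V fin tb \<alpha>2]) blast
  \<comment> \<open>Independent of the outer radius. The level r/3 lies below r/2, up to which the
    cutoff vanishes, so its support is inside the strict tail event.\<close>
  define B where "B = K * ((r/3) powr - (\<alpha> + \<alpha>/2) + (r/3) powr - (\<alpha> - \<alpha>/2))"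
  let ?A = "\<lambda>n::nat. {x::real^'n. r \<le> norm x \<and> norm x \<le> real n + r}"
  have bd: "emeasure \<Lambda> (?A n) \<le> ennreal B" for n
  proof -
    define f :: "real^'n \<Rightarrow> real" where "f = (\<lambda>x. ramp (r/2) r x * (1 - ramp (real n + r + 1) (real n + r + 2) x))"
    have f: "f \<in> Cc_punctured" unfolding f_def using r by (intro ramp_Cc) auto
    have f01: "0 \<le> f x" "f x \<le> 1" for x unfolding f_def using r ramp_props(2,3)[of "r/2" r x] ramp_props(2,3)[of "real n + r + 1" "real n + r + 2" x]
      by (auto intro!: mult_le_one)
    have f1: "f x = 1" if "r \<le> norm x" "norm x \<le> real n + r" for x
      unfolding f_def using r ramp_props(5)[of "r/2" r x] ramp_props(4)[of "real n + r + 1" "real n + r + 2" x] that by auto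
    have f0: "f x = 0" if "norm x \<le> r/2" for x unfolding f_def using ramp_props(4)[of "r/2" r x] that r by auto
    have fm: "f \<in> borel_measurable borel" using f Cc_subset_Cb_away borel_Cb_away by blast
    have As: "?A n \<in> sets \<Lambda>" using annulus_sets[OF rad r] .
    have Af: "emeasure \<Lambda> (?A n) < \<infinity>" using finite_annulus[OF rad r] .
    have lim: "((\<lambda>t. V t * (\<integral>x. f (x /\<^sub>R t) \<partial>\<kappa>)) \<longlongrightarrow> (\<integral>x. f x \<partial>\<Lambda>)) at_top"
      using t f unfolding tail_measure_def V_def by auto
    have "eventually (\<lambda>t. V t * (\<integral>x. f (x /\<^sub>R t) \<partial>\<kappa>) \<le> B) at_top"
      using eventually_ge_at_top[of t0]
    proof eventually_elim
      case (elim t)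
      then have tp: "t > 0" using K by simp
      have "\<bar>\<integral>x. f (x /\<^sub>R t) \<partial>\<kappa>\<bar> \<le> 1 * measure \<kappa> {x. norm x > r/3 * t}"
      proof (rule integral_le_measure)
        show "f (x /\<^sub>R t) = 0" if "x \<notin> {x. norm x > r/3 * t}" for x
        proof (rule f0)
          have "norm x \<le> r/3 * t" using that by simp
          also have "\<dots> \<le> r/2 * t" using tp r by (intro mult_right_mono) auto
          finally have "norm x \<le> r/2 * t" .
          then show "norm (x /\<^sub>R t) \<le> r / 2" using tp by (simp add: field_simps)
        qed
      qed (use fm fin f01 in \<open>auto simp: finite_measure_axioms abs_of_nonneg\<close>)
      then have "V t * (\<integral>x. f (x /\<^sub>R t) \<partial>\<kappa>) \<le> V t * measure \<kappa> {x. norm x > r/3 * t}"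
        using Vp[OF tp] by (intro mult_left_mono) auto
      also have "\<dots> \<le> B" unfolding B_def using elim r by (intro K(3)) auto
      finally show ?case .
    qed
    then have le: "(\<integral>x. f x \<partial>\<Lambda>) \<le> B" by (intro tendsto_upperbound[OF lim]) auto
    have "measure \<Lambda> (?A n) = (\<integral>x. indicator (?A n) x \<partial>\<Lambda>)" using As by simp
    also have "\<dots> \<le> (\<integral>x. f x \<partial>\<Lambda>)"
      using As Af f01 f1 by (intro integral_mono integrable_Cc[OF rad f] integrable_real_indicator) (auto simp: indicator_def)
    finally have "measure \<Lambda> (?A n) \<le> B" using le by simp
    moreover have "emeasure \<Lambda> (?A n) = ennreal (measure \<Lambda> (?A n))"
      using Af by (intro emeasure_eq_ennreal_measure) auto
    ultimately show ?thesis by (simp only: ennreal_leI)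
  qed
  have "(\<Union>n. ?A n) = {x. r \<le> norm x}"
  proof (intro equalityI subsetI)
    fix x :: "real^'n" assume x: "x \<in> {x. r \<le> norm x}"
    obtain n where "norm x < real n" using reals_Archimedean2 by blast
    then show "x \<in> (\<Union>n. ?A n)" using x r by (intro UN_I[of n]) auto
  qed auto
  moreover have "(SUP n. emeasure \<Lambda> (?A n)) = emeasure \<Lambda> (\<Union>n. ?A n)"
    using annulus_sets[OF rad r] by (intro SUP_emeasure_incseq) (auto simp: incseq_def)
  moreover have "(SUP n. emeasure \<Lambda> (?A n)) \<le> ennreal B" by (rule SUP_least) (rule bd)
  ultimately have "emeasure \<Lambda> {x. r \<le> norm x} \<le> ennreal B" by simp
  also have "ennreal B < \<infinity>" by simp
  finally show ?thesis .
qed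

lemma tail_measure_integrable:
  assumes f: "f \<in> Cb_away" shows "integrable \<Lambda> f"
proof -
  have rad: "radon_punctured \<Lambda>" using t unfolding tail_measure_def by auto
  obtain C r where C: "continuous_on UNIV f" "C > 0" "\<And>x. \<bar>f x\<bar> \<le> C" "r > 0" "\<And>x. norm x < r \<Longrightarrow> f x = 0"
    by (rule Cb_awayE[OF f]) blast
  have s: "{x. r \<le> norm x} \<in> sets \<Lambda>" using C(4) by (intro sets_radonI[OF rad]) auto
  have "integrable \<Lambda> (\<lambda>x. C * indicator {x. r \<le> norm x} x)"
    by (intro integrable_mult_right integrable_real_indicator s tail_measure_finite_outside C)
  then show ?thesis
  proof (rule Bochner_Integration.integrable_bound)
    show "f \<in> borel_measurable \<Lambda>" by (rule measurable_radon[OF rad borel_Cb_away[OF f]])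
    show "AE x in \<Lambda>. norm (f x) \<le> norm (C * indicator {x. r \<le> norm x} x)"
    proof (rule AE_I2)
      fix x show "norm (f x) \<le> norm (C * indicator {x. r \<le> norm x} x)"
        using C(3)[of x] C(2) C(5)[of x] by (cases "r \<le> norm x") (auto simp: indicator_def)
    qed
  qed
qed

text \<open>Cutting off between radii n+1 and n+2 gives an admissible test function. The discarded
  part is bounded, uniformly in large t, by a Potter bound that tends to 0 with n, so the two limits
  may be exchanged.\<close>

lemma tail_functional_tail_measure: "tail_functional V \<kappa> (\<lambda>f. \<integral>x. f x \<partial>\<Lambda>)"
  unfolding tail_functional_def
proof
  fix f :: "real^'n \<Rightarrow> real" assume f: "f \<in> Cb_away"
  interpret prob_space \<kappa> by (rule fin)
  have rad: "radon_punctured \<Lambda>" using t unfolding tail_measure_def by auto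
  have Vp: "V t > 0" if "t > 0" for t using V that unfolding potter_def regvar_def by auto
  have tb: "tail_bounded V \<kappa>" unfolding V_def by (rule tail_boundedI[OF \<alpha> t fin])
  have \<alpha>2: "0 < \<alpha>/2" "\<alpha>/2 < \<alpha>" using \<alpha> by auto
  obtain K t0 where K: "K > 0" "t0 > 0"
    "\<And>t s. t \<ge> t0 \<Longrightarrow> s > 0 \<Longrightarrow> V t * measure \<kappa> {x. norm x > s * t} \<le> K * (s powr - (\<alpha> + \<alpha>/2) + s powr - (\<alpha> - \<alpha>/2))"
    by (rule potter_tail_bound[OF V fin tb \<alpha>2]) blast
  obtain C r where C: "continuous_on UNIV f" "C > 0" "\<And>x. \<bar>f x\<bar> \<le> C" "r > 0" "\<And>x. norm x < r \<Longrightarrow> f x = 0"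
    by (rule Cb_awayE[OF f]) blast
  define \<psi> :: "nat \<Rightarrow> real^'n \<Rightarrow> real" where "\<psi> n x = 1 - ramp (real n + 1) (real n + 2) x" for n x
  have \<psi>: "continuous_on UNIV (\<psi> n)" "0 \<le> \<psi> n x" "\<psi> n x \<le> 1" "norm x \<le> real n + 1 \<Longrightarrow> \<psi> n x = 1" "norm x \<ge> real n + 2 \<Longrightarrow> \<psi> n x = 0" for n x
    unfolding \<psi>_def using ramp_props[of "real n + 1" "real n + 2"] by (auto intro!: continuous_intros)
  have Cc: "(\<lambda>x. f x * \<psi> n x) \<in> Cc_punctured" for n
  proof (rule Cc_puncturedI[OF _ C(4)])
    show "continuous_on UNIV (\<lambda>x. f x * \<psi> n x)" by (intro continuous_intros C(1) \<psi>(1))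
    show "r \<le> norm x \<and> norm x \<le> real n + 2" if "f x * \<psi> n x \<noteq> 0" for x
      using that C(5)[of x] \<psi>(5)[of n x] by (metis linorder_not_le mult_eq_0_iff order.strict_iff_order)
  qed
  \<comment> \<open>The discarded function vanishes for |x| \<le> (n+1) t; half of this level is
    taken to fit a strict tail event.\<close>
  define e where "e n = C * (K * ((1/2 * (real n + 1)) powr - (\<alpha> + \<alpha>/2) + (1/2 * (real n + 1)) powr - (\<alpha> - \<alpha>/2)))" for n :: nat
  show "((\<lambda>t. V t * (\<integral>x. f (x /\<^sub>R t) \<partial>\<kappa>)) \<longlongrightarrow> (\<integral>x. f x \<partial>\<Lambda>)) at_top"
  proof (rule tendsto_swap)
    show "((\<lambda>t. V t * (\<integral>x. (\<lambda>x. f x * \<psi> n x) (x /\<^sub>R t) \<partial>\<kappa>)) \<longlongrightarrow> (\<integral>x. f x * \<psi> n x \<partial>\<Lambda>)) at_top" for n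
      using t Cc unfolding tail_measure_def V_def by fast
    show "(\<lambda>n. \<integral>x. f x * \<psi> n x \<partial>\<Lambda>) \<longlonglongrightarrow> (\<integral>x. f x \<partial>\<Lambda>)"
    proof (rule integral_dominated_convergence[where w="\<lambda>x. \<bar>f x\<bar>"])
      show "f \<in> borel_measurable \<Lambda>" by (rule measurable_radon[OF rad borel_Cb_away[OF f]])
      show "(\<lambda>x. f x * \<psi> n x) \<in> borel_measurable \<Lambda>" for n
        by (rule borel_measurable_integrable[OF integrable_Cc[OF rad Cc]])
      show "integrable \<Lambda> (\<lambda>x. \<bar>f x\<bar>)" by (intro integrable_abs tail_measure_integrable f)
      show "AE x in \<Lambda>. norm (f x * \<psi> n x) \<le> \<bar>f x\<bar>" for n
        using \<psi>(2,3) by (intro AE_I2) (simp add: abs_mult mult_left_le)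
      show "AE x in \<Lambda>. (\<lambda>n. f x * \<psi> n x) \<longlonglongrightarrow> f x"
      proof (rule AE_I2)
        fix x :: "real^'n"
        obtain m where m: "norm x < real m" using reals_Archimedean2 by blast
        have "eventually (\<lambda>n. f x * \<psi> n x = f x) sequentially"
          using eventually_ge_at_top[of m] by eventually_elim (use m in \<open>simp add: \<psi>(4)\<close>)
        then show "(\<lambda>n. f x * \<psi> n x) \<longlonglongrightarrow> f x" by (rule tendsto_eventually)
      qed
    qed
    have "e \<longlonglongrightarrow> C * (K * (0 + 0))" unfolding e_def[abs_def]
      using \<alpha> by (intro tendsto_intros powr_neg_tendsto_0) auto
    then show "e \<longlonglongrightarrow> 0" by simp
    fix n :: nat
    show "eventually (\<lambda>t. \<bar>V t * (\<integral>x. f (x /\<^sub>R t) \<partial>\<kappa>) - V t * (\<integral>x. (\<lambda>x. f x * \<psi> n x) (x /\<^sub>R t) \<partial>\<kappa>)\<bar> \<le> e n) at_top"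
      using eventually_ge_at_top[of t0]
    proof eventually_elim
      case (elim t)
      then have tp: "t > 0" using K by simp
      define h where "h = (\<lambda>x. f x * (1 - \<psi> n x))"
      have fm: "f \<in> borel_measurable borel" "(\<psi> n) \<in> borel_measurable borel"
        using borel_Cb_away[OF f] borel_measurable_continuous_onI[OF \<psi>(1)] by auto
      have [measurable]: "(\<lambda>x. f (x /\<^sub>R t)) \<in> borel_measurable \<kappa>" "(\<lambda>x. \<psi> n (x /\<^sub>R t)) \<in> borel_measurable \<kappa>"
        using fm by (auto simp: fin cong: measurable_cong_sets)
      have "(\<integral>x. f (x /\<^sub>R t) \<partial>\<kappa>) - (\<integral>x. f (x /\<^sub>R t) * \<psi> n (x /\<^sub>R t) \<partial>\<kappa>)
          = (\<integral>x. f (x /\<^sub>R t) - f (x /\<^sub>R t) * \<psi> n (x /\<^sub>R t) \<partial>\<kappa>)"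
        using C(2,3) \<psi>(2,3) by (intro Bochner_Integration.integral_diff[symmetric] integrable_const_bound[of _ C])
          (auto simp: abs_mult intro!: AE_I2 order_trans[OF mult_left_le])
      also have "\<dots> = (\<integral>x. h (x /\<^sub>R t) \<partial>\<kappa>)" unfolding h_def by (simp add: algebra_simps)
      finally have eq: "(\<integral>x. f (x /\<^sub>R t) \<partial>\<kappa>) - (\<integral>x. f (x /\<^sub>R t) * \<psi> n (x /\<^sub>R t) \<partial>\<kappa>) = (\<integral>x. h (x /\<^sub>R t) \<partial>\<kappa>)" .
      have "\<bar>\<integral>x. h (x /\<^sub>R t) \<partial>\<kappa>\<bar> \<le> C * measure \<kappa> {x. norm x > 1/2 * (real n + 1) * t}"
      proof (rule integral_le_measure)
        show "(\<lambda>x. h (x /\<^sub>R t)) \<in> borel_measurable borel" unfolding h_def using fm by measurable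
        show "\<bar>h (x /\<^sub>R t)\<bar> \<le> C" for x unfolding h_def abs_mult
          using C(3)[of "x /\<^sub>R t"] \<psi>(2,3)[of n "x /\<^sub>R t"] by (intro order_trans[OF mult_left_le]) auto
        show "h (x /\<^sub>R t) = 0" if "x \<notin> {x. norm x > 1/2 * (real n + 1) * t}" for x
        proof -
          have "norm x \<le> 1/2 * (real n + 1) * t" using that by simp
          also have "\<dots> \<le> (real n + 1) * t" using tp by simp
          finally have "\<psi> n (x /\<^sub>R t) = 1" using tp by (intro \<psi>(4)) (simp add: field_simps)
          then show ?thesis unfolding h_def by simp
        qed
      qed (use fin in \<open>auto simp: finite_measure_axioms\<close>)
      then have "\<bar>V t * (\<integral>x. h (x /\<^sub>R t) \<partial>\<kappa>)\<bar> \<le> C * (V t * measure \<kappa> {x. norm x > 1/2 * (real n + 1) * t})"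
        using mult_left_mono[of "\<bar>\<integral>x. h (x /\<^sub>R t) \<partial>\<kappa>\<bar>" "C * measure \<kappa> {x. norm x > 1/2 * (real n + 1) * t}" "V t"] Vp[OF tp]
        by (simp add: abs_mult mult_ac)
      also have "\<dots> \<le> e n" unfolding e_def using C(2) elim by (intro mult_left_mono K(3)) auto
      finally show ?case by (simp add: eq right_diff_distrib[symmetric])
    qed
  qed
qed

end

section \<open>Measurability of random continuous maps\<close>

text \<open>Rounds each coordinate down to a multiple of 1/(k+1). The countable range reduces
  evaluation at a random point to evaluations at fixed points, which are what the product
  sigma-algebra controls.\<close>

definition grid :: "nat \<Rightarrow> real^'n \<Rightarrow> real^'n" where
  "grid k x = (\<chi> i. of_int \<lfloor>real (Suc k) * x $ i\<rfloor> / real (Suc k))"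

lemma countable_range_grid: "countable (range (grid k :: real^'n \<Rightarrow> _))"
proof -
  have "range (grid k :: real^'n \<Rightarrow> _) \<subseteq> range (\<lambda>z :: 'n \<Rightarrow> int. \<chi> i. of_int (z i) / real (Suc k))"
    unfolding grid_def by (auto simp: image_iff)
  then show ?thesis by (rule countable_subset) auto
qed

lemma grid_tendsto: "(\<lambda>k. grid k x) \<longlonglongrightarrow> x"
proof (rule vec_tendstoI)
  fix i
  have "(\<lambda>k. of_int \<lfloor>real (Suc k) * x $ i\<rfloor> / real (Suc k)) \<longlonglongrightarrow> x $ i"
  proof (rule tendsto_sandwich[of "\<lambda>k. x $ i - 1 / real (Suc k)" _ _ "\<lambda>k. x $ i"])
    have "(\<lambda>k. x $ i - 1 / real (Suc k)) \<longlonglongrightarrow> x $ i - 0" by (intro tendsto_intros LIMSEQ_Suc[OF lim_1_over_n])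
    then show "(\<lambda>k. x $ i - 1 / real (Suc k)) \<longlonglongrightarrow> x $ i" by simp
    show "eventually (\<lambda>k. x $ i - 1 / real (Suc k) \<le> of_int \<lfloor>real (Suc k) * x $ i\<rfloor> / real (Suc k)) sequentially"
    proof (intro always_eventually allI)
      fix k
      have "real (Suc k) * x $ i - 1 \<le> of_int \<lfloor>real (Suc k) * x $ i\<rfloor>" by linarith
      then have "(real (Suc k) * x $ i - 1) / real (Suc k) \<le> of_int \<lfloor>real (Suc k) * x $ i\<rfloor> / real (Suc k)"
        by (rule divide_right_mono) simp
      then show "x $ i - 1 / real (Suc k) \<le> of_int \<lfloor>real (Suc k) * x $ i\<rfloor> / real (Suc k)"
        by (simp add: diff_divide_distrib)
    qed
    show "eventually (\<lambda>k. of_int \<lfloor>real (Suc k) * x $ i\<rfloor> / real (Suc k) \<le> x $ i) sequentially"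
    proof (intro always_eventually allI)
      fix k
      have "of_int \<lfloor>real (Suc k) * x $ i\<rfloor> / real (Suc k) \<le> (real (Suc k) * x $ i) / real (Suc k)"
        by (intro divide_right_mono) auto
      then show "of_int \<lfloor>real (Suc k) * x $ i\<rfloor> / real (Suc k) \<le> x $ i" by simp
    qed
  qed simp
  then show "(\<lambda>k. grid k x $ i) \<longlonglongrightarrow> x $ i" by (simp add: grid_def)
qed

lemma measurable_grid: "(grid k :: real^'n \<Rightarrow> _) \<in> measurable borel (count_space (range (grid k)))"
proof -
  have g: "(grid k :: real^'n \<Rightarrow> _) \<in> borel_measurable borel"
  proof (rule borel_measurable_euclidean_space[THEN iffD2], rule ballI)
    fix b :: "real^'n" assume "b \<in> Basis"
    then obtain i where b: "b = axis i 1" by (auto simp: Basis_vec_def)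
    have "(\<lambda>x::real^'n. x $ i) \<in> borel_measurable borel" by (intro borel_measurable_continuous_onI continuous_intros)
    then have "(\<lambda>x::real^'n. of_int \<lfloor>real (Suc k) * x $ i\<rfloor> / real (Suc k) :: real) \<in> borel_measurable borel" by measurable
    then show "(\<lambda>x. grid k x \<bullet> b) \<in> borel_measurable borel" by (simp add: b inner_axis grid_def)
  qed
  show ?thesis
  proof (subst measurable_count_space_eq_countable[OF countable_range_grid], intro conjI ballI)
    fix a show "grid k -` {a} \<inter> space borel \<in> sets (borel :: (real^'n) measure)"
      using measurable_sets[OF g, of "{a}"] by auto
  qed auto
qed

text \<open>Caratheodory functions are jointly measurable: at grid points the evaluation is a
  countable case distinction, and continuity lets the mesh tend to 0.\<close>

lemma measurable_caratheodory:
  fixes f :: "'a \<Rightarrow> real^'n \<Rightarrow> 'b::metric_space"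
  assumes "\<And>x. (\<lambda>\<omega>. f \<omega> x) \<in> borel_measurable M" "\<And>\<omega>. \<omega> \<in> space M \<Longrightarrow> continuous_on UNIV (f \<omega>)"
  shows "(\<lambda>p. f (snd p) (fst p)) \<in> borel_measurable (borel \<Otimes>\<^sub>M M)"
proof (rule borel_measurable_LIMSEQ_metric)
  show "(\<lambda>p. f (snd p) (grid k (fst p))) \<in> borel_measurable (borel \<Otimes>\<^sub>M M)" for k
  proof (rule measurable_compose_countable'[OF _ _ countable_range_grid])
    show "(\<lambda>p. f (snd p) z) \<in> borel_measurable (borel \<Otimes>\<^sub>M M)" for z
      by (rule measurable_compose[OF measurable_snd assms(1)])
    show "(\<lambda>p. grid k (fst p)) \<in> measurable (borel \<Otimes>\<^sub>M M) (count_space (range (grid k)))"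
      by (rule measurable_compose[OF measurable_fst measurable_grid])
  qed
  show "(\<lambda>k. f (snd p) (grid k (fst p))) \<longlonglongrightarrow> f (snd p) (fst p)" if "p \<in> space (borel \<Otimes>\<^sub>M M)" for p
  proof -
    have "isCont (f (snd p)) (fst p)"
      using assms(2)[of "snd p"] that by (auto simp: space_pair_measure continuous_on_eq_continuous_at)
    then show ?thesis using grid_tendsto by (rule isCont_tendsto_compose)
  qed
qed

lemma borel_measurable_matrix_vector_mult [measurable (raw)]:
  fixes A :: "'a \<Rightarrow> real^'n^'m"
  assumes "A \<in> borel_measurable M" "x \<in> borel_measurable M"
  shows "(\<lambda>w. A w *v x w) \<in> borel_measurable M"
proof -
  have "continuous_on UNIV (\<lambda>p. fst p *v snd p :: real^'m)" for p :: "(real^'n^'m) \<times> (real^'n)"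
    unfolding matrix_vector_mult_def by (intro continuous_intros)
  then have "(\<lambda>p. fst p *v snd p) \<in> borel_measurable (borel :: ((real^'n^'m) \<times> (real^'n)) measure)"
    by (intro borel_measurable_continuous_onI) auto
  from measurable_compose[OF _ this, of "\<lambda>w. (A w, x w)" M] assms show ?thesis by (simp add: borel_prod[symmetric])
qed

lemma borel_measurable_matrix_matrix_mult [measurable (raw)]:
  fixes A :: "'a \<Rightarrow> real^'n^'m" and B :: "'a \<Rightarrow> real^'k^'n"
  assumes "A \<in> borel_measurable M" "B \<in> borel_measurable M"
  shows "(\<lambda>w. A w ** B w) \<in> borel_measurable M"
proof -
  have "continuous_on UNIV (\<lambda>p. fst p ** snd p :: real^'k^'m)" for p :: "(real^'n^'m) \<times> (real^'k^'n)"
    unfolding matrix_matrix_mult_def by (intro continuous_intros)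
  then have "(\<lambda>p. fst p ** snd p) \<in> borel_measurable (borel :: ((real^'n^'m) \<times> (real^'k^'n)) measure)"
    by (intro borel_measurable_continuous_onI) auto
  from measurable_compose[OF _ this, of "\<lambda>w. (A w, B w)" M] assms show ?thesis by (simp add: borel_prod[symmetric])
qed

text \<open>The random map as a function of the input quadruple alone, so that equality in law and
  independence of the inputs can be transported to the maps.\<close>

definition input_map ::
    "(real^'n \<Rightarrow> real^'n \<Rightarrow> real^'n) \<Rightarrow> ((real^'n^'n) \<times> (real^'n) \<times> (real^'n \<Rightarrow> real^'n) \<times> real) \<Rightarrow> real^'n \<Rightarrow> real^'n" where
  "input_map \<Phi> i x = \<Phi> (fst i *v x) (fst (snd i) + fst (snd (snd i)) x)"

lemma random_map_eq_input_map: "random_map \<Phi> A B1 B2 \<omega> x = input_map \<Phi> (A \<omega>, B1 \<omega>, B2 \<omega>, B3 \<omega>) x"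
  by (simp add: random_map_def input_map_def)

lemma measurable_input_map:
  assumes "continuous_on UNIV (\<lambda>(x, y). \<Phi> x y)"
  shows "(\<lambda>i. input_map \<Phi> i x) \<in> borel_measurable (input_space :: ((real^'n^'n) \<times> (real^'n) \<times> (real^'n \<Rightarrow> real^'n) \<times> real) measure)"
proof -
  let ?S = "input_space :: ((real^'n^'n) \<times> (real^'n) \<times> (real^'n \<Rightarrow> real^'n) \<times> real) measure"
  have P: "(\<lambda>p. \<Phi> (fst p) (snd p)) \<in> borel_measurable borel"
    using borel_measurable_continuous_onI[OF assms] by (simp add: case_prod_unfold)
  have 1: "(\<lambda>i. fst i) \<in> measurable ?S borel" "(\<lambda>i. fst (snd i)) \<in> measurable ?S borel" unfolding input_space_def by measurable
  have 2: "(\<lambda>i. fst (snd (snd i)) x) \<in> measurable ?S borel"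
  proof -
    have "(\<lambda>i. fst (snd (snd i))) \<in> measurable ?S (Pi\<^sub>M UNIV (\<lambda>_. borel))" unfolding input_space_def by measurable
    then show ?thesis by (rule measurable_compose) (rule measurable_component_singleton, simp)
  qed
  have "(\<lambda>i. (fst i *v x, fst (snd i) + fst (snd (snd i)) x)) \<in> measurable ?S borel"
    using 1 2 unfolding borel_prod[symmetric] by measurable
  from measurable_compose[OF this P] show ?thesis by (simp add: input_map_def)
qed

lemma random_inputD:
  fixes A :: "'w \<Rightarrow> real^'n^'n"
  assumes "random_input N \<delta> M A B1 B2 B3"
  shows "A \<in> borel_measurable M" "B1 \<in> borel_measurable M" "(\<lambda>\<omega>. B2 \<omega> x) \<in> borel_measurable M" "B3 \<in> borel_measurable M"
    "(\<lambda>\<omega>. (A \<omega>, B1 \<omega>, B2 \<omega>, B3 \<omega>)) \<in> measurable M input_space"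
    "\<omega> \<in> space M \<Longrightarrow> continuous_on UNIV (\<lambda>x. B1 \<omega> + B2 \<omega> x)"
    "\<omega> \<in> space M \<Longrightarrow> B3 \<omega> \<ge> 0"
    "\<omega> \<in> space M \<Longrightarrow> N (B2 \<omega> x) \<le> B3 \<omega> * (if \<delta> = 0 then 1 else N x powr \<delta>)"
proof -
  let ?S = "input_space :: ((real^'n^'n) \<times> (real^'n) \<times> (real^'n \<Rightarrow> real^'n) \<times> real) measure"
  show m: "(\<lambda>\<omega>. (A \<omega>, B1 \<omega>, B2 \<omega>, B3 \<omega>)) \<in> measurable M ?S" using assms unfolding random_input_def by simp
  have 1: "fst \<in> measurable ?S borel" "(\<lambda>i. fst (snd i)) \<in> measurable ?S borel" "(\<lambda>i. snd (snd (snd i))) \<in> measurable ?S borel"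
    unfolding input_space_def by measurable
  have "(\<lambda>i. fst (snd (snd i))) \<in> measurable ?S (Pi\<^sub>M UNIV (\<lambda>_. borel))" unfolding input_space_def by measurable
  then have 2: "(\<lambda>i. fst (snd (snd i)) x) \<in> measurable ?S borel" by (rule measurable_compose) (rule measurable_component_singleton, simp)
  show "A \<in> borel_measurable M" using measurable_compose[OF m 1(1)] by simp
  show "B1 \<in> borel_measurable M" using measurable_compose[OF m 1(2)] by simp
  show "(\<lambda>\<omega>. B2 \<omega> x) \<in> borel_measurable M" using measurable_compose[OF m 2] by simp
  show "B3 \<in> borel_measurable M" using measurable_compose[OF m 1(3)] by simp
qed (use assms in \<open>auto simp: random_input_def\<close>)

lemma continuous_random_map:
  assumes "continuous_on UNIV (\<lambda>(x, y). \<Phi> x y)" "random_input N \<delta> M A B1 B2 B3" "\<omega> \<in> space M"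
  shows "continuous_on UNIV (random_map \<Phi> A B1 B2 \<omega>)"
proof -
  have "continuous_on UNIV (\<lambda>x. (A \<omega> *v x, B1 \<omega> + B2 \<omega> x))"
    by (intro continuous_on_Pair random_inputD(6)[OF assms(2,3)] linear_continuous_on matrix_vector_mul_bounded_linear)
  from continuous_on_compose2[OF assms(1) this] show ?thesis by (simp add: random_map_def[abs_def])
qed

lemma measurable_random_map:
  assumes "continuous_on UNIV (\<lambda>(x, y). \<Phi> x y)" "random_input N \<delta> M A B1 B2 B3"
  shows "(\<lambda>\<omega>. random_map \<Phi> A B1 B2 \<omega> x) \<in> borel_measurable M"
  unfolding random_map_eq_input_map[of \<Phi> A B1 B2 _ x B3]
  by (rule measurable_compose[OF random_inputD(5)[OF assms(2)] measurable_input_map[OF assms(1)]])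

section \<open>The stationary Markov chain\<close>

locale random_chain = prob_space M for M :: "'w measure" +
  fixes N :: "real^'n \<Rightarrow> real" and \<Phi> :: "real^'n \<Rightarrow> real^'n \<Rightarrow> real^'n" and \<delta> :: real
    and A :: "'w \<Rightarrow> real^'n^'n" and B1 :: "'w \<Rightarrow> real^'n" and B2 :: "'w \<Rightarrow> real^'n \<Rightarrow> real^'n" and B3 :: "'w \<Rightarrow> real"
    and As :: "nat \<Rightarrow> 'w \<Rightarrow> real^'n^'n" and B1s :: "nat \<Rightarrow> 'w \<Rightarrow> real^'n"
    and B2s :: "nat \<Rightarrow> 'w \<Rightarrow> real^'n \<Rightarrow> real^'n" and B3s :: "nat \<Rightarrow> 'w \<Rightarrow> real"
  assumes Phi_cont: "continuous_on UNIV (\<lambda>(x, y). \<Phi> x y)"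
    and input: "random_input N \<delta> M A B1 B2 B3"
    and copies: "\<forall>n\<ge>1. random_input N \<delta> M (As n) (B1s n) (B2s n) (B3s n)"
    and same_law: "\<forall>n\<ge>1. distr M input_space (\<lambda>\<omega>. (As n \<omega>, B1s n \<omega>, B2s n \<omega>, B3s n \<omega>))
                        = distr M input_space (\<lambda>\<omega>. (A \<omega>, B1 \<omega>, B2 \<omega>, B3 \<omega>))"
    and indep: "indep_vars (\<lambda>_. input_space) (\<lambda>n \<omega>. (As n \<omega>, B1s n \<omega>, B2s n \<omega>, B3s n \<omega>)) {1..}"
begin

abbreviation F :: "'w \<Rightarrow> real^'n \<Rightarrow> real^'n" where "F \<equiv> random_map \<Phi> A B1 B2"
abbreviation inp where "inp n \<omega> \<equiv> (As n \<omega>, B1s n \<omega>, B2s n \<omega>, B3s n \<omega>)"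
abbreviation X :: "real^'n \<Rightarrow> nat \<Rightarrow> 'w \<Rightarrow> real^'n" where
  "X \<equiv> chain (\<lambda>n. random_map \<Phi> (As n) (B1s n) (B2s n))"

text \<open>The Markov operator of the chain, written with the generic input and not with a
  particular copy.\<close>

definition transition_op :: "(real^'n \<Rightarrow> real) \<Rightarrow> real^'n \<Rightarrow> real" where
  "transition_op g x = (\<integral>\<omega>. g (F \<omega> x) \<partial>M)"

text \<open>The chain as a measurable function of the input path. Evaluating the third input
  component at a random point is not a measurable operation on the product space, so a limit over
  grid points replaces it; for continuous maps the limit is the true value.\<close>

primrec approx :: "real^'n \<Rightarrow> nat \<Rightarrow> (nat \<Rightarrow> (real^'n^'n) \<times> (real^'n) \<times> (real^'n \<Rightarrow> real^'n) \<times> real) \<Rightarrow> real^'n" where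
  "approx x 0 i = x"
| "approx x (Suc n) i = lim (\<lambda>k. input_map \<Phi> (i (Suc n)) (grid k (approx x n i)))"

lemma measurable_approx: "{1..n} \<subseteq> J \<Longrightarrow> approx x n \<in> borel_measurable (Pi\<^sub>M J (\<lambda>_. input_space))"
proof (induction n)
  case (Suc n)
  have "{1..n} \<subseteq> J" using Suc.prems by auto
  note IH = Suc.IH[OF this]
  have J: "Suc n \<in> J" using Suc.prems by auto
  have "(\<lambda>i. lim (\<lambda>k. input_map \<Phi> (i (Suc n)) (grid k (approx x n i)))) \<in> borel_measurable (Pi\<^sub>M J (\<lambda>_. input_space))"
  proof (rule borel_measurable_lim_metric)
    fix k
    show "(\<lambda>i. input_map \<Phi> (i (Suc n)) (grid k (approx x n i))) \<in> borel_measurable (Pi\<^sub>M J (\<lambda>_. input_space))"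
    proof (rule measurable_compose_countable'[where f="\<lambda>z i. input_map \<Phi> (i (Suc n)) z" and g="\<lambda>i. grid k (approx x n i)", OF _ _ countable_range_grid])
      show "(\<lambda>i. input_map \<Phi> (i (Suc n)) z) \<in> borel_measurable (Pi\<^sub>M J (\<lambda>_. input_space))" for z
        by (rule measurable_compose[OF measurable_component_singleton[OF J] measurable_input_map[OF Phi_cont]])
      show "(\<lambda>i. grid k (approx x n i)) \<in> measurable (Pi\<^sub>M J (\<lambda>_. input_space)) (count_space (range (grid k)))"
        by (rule measurable_compose[OF IH measurable_grid])
    qed
  qed
  then show ?case by simp
next
  case 0
  have "approx x 0 = (\<lambda>_. x)" by (simp add: fun_eq_iff)
  then show ?case by simp
qed

lemma continuous_F: "\<omega> \<in> space M \<Longrightarrow> continuous_on UNIV (F \<omega>)"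
  by (rule continuous_random_map[OF Phi_cont input])

lemma measurable_F: "(\<lambda>\<omega>. F \<omega> x) \<in> borel_measurable M"
  by (rule measurable_random_map[OF Phi_cont input])

lemma measurable_F_pair: "(\<lambda>p. F (snd p) (fst p)) \<in> borel_measurable (borel \<Otimes>\<^sub>M M)"
  by (rule measurable_caratheodory[OF measurable_F continuous_F])

lemma continuous_Fn: "n \<ge> 1 \<Longrightarrow> \<omega> \<in> space M \<Longrightarrow> continuous_on UNIV (random_map \<Phi> (As n) (B1s n) (B2s n) \<omega>)"
  using copies by (auto intro: continuous_random_map[OF Phi_cont])

lemma continuous_X: "\<omega> \<in> space M \<Longrightarrow> continuous_on UNIV (\<lambda>x. X x n \<omega>)"
proof (induction n)
  case (Suc n)
  then show ?case using continuous_on_compose2[OF continuous_Fn[of "Suc n" \<omega>] Suc.IH] by auto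
qed auto

text \<open>Continuity of the realised maps turns the grid limits into actual iterates. Hence X_n
  depends on the inputs 1, ..., n alone, as independence from the next input requires.\<close>

lemma X_eq_approx:
  assumes \<omega>: "\<omega> \<in> space M" shows "{1..n} \<subseteq> J \<Longrightarrow> X x n \<omega> = approx x n (restrict (\<lambda>i. inp i \<omega>) J)"
proof (induction n)
  case (Suc n)
  let ?i = "restrict (\<lambda>i. inp i \<omega>) J"
  have "{1..n} \<subseteq> J" using Suc.prems by auto
  note IH = Suc.IH[OF this]
  have "Suc n \<in> J" using Suc.prems by auto
  then have i: "?i (Suc n) = inp (Suc n) \<omega>" by simp
  have "isCont (random_map \<Phi> (As (Suc n)) (B1s (Suc n)) (B2s (Suc n)) \<omega>) (X x n \<omega>)"
    using continuous_Fn[of "Suc n" \<omega>] \<omega> by (auto simp: continuous_on_eq_continuous_at)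
  from isCont_tendsto_compose[OF this grid_tendsto]
  have "(\<lambda>k. input_map \<Phi> (?i (Suc n)) (grid k (approx x n ?i))) \<longlonglongrightarrow> X x (Suc n) \<omega>"
    unfolding i IH[symmetric] random_map_eq_input_map[of \<Phi> "As (Suc n)" "B1s (Suc n)" "B2s (Suc n)" _ _ "B3s (Suc n)"] chain.simps .
  from limI[OF this, symmetric] show ?case unfolding approx.simps .
qed simp

lemma measurable_X: "X x n \<in> borel_measurable M"
proof -
  have "(\<lambda>\<omega>. restrict (\<lambda>i. inp i \<omega>) {1..n}) \<in> measurable M (Pi\<^sub>M {1..n} (\<lambda>_. input_space))"
  proof (rule measurable_restrict)
    fix i assume "i \<in> {1..n}"
    then have "random_input N \<delta> M (As i) (B1s i) (B2s i) (B3s i)" using copies by auto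
    from random_inputD(5)[OF this] show "inp i \<in> measurable M input_space" .
  qed
  from measurable_compose[OF this measurable_approx[of n "{1..n}" x]]
  have "(\<lambda>\<omega>. approx x n (restrict (\<lambda>i. inp i \<omega>) {1..n})) \<in> borel_measurable M" by simp
  then show ?thesis by (subst measurable_cong[OF X_eq_approx[of _ n "{1..n}"]]) auto
qed

abbreviation past where "past n \<omega> \<equiv> restrict (\<lambda>i. inp i \<omega>) {1..n}"
abbreviation present where "present n \<omega> \<equiv> restrict (\<lambda>i. inp i \<omega>) {Suc n}"

lemma indep_past_present:
  "indep_var (Pi\<^sub>M {1..n} (\<lambda>_. input_space)) (past n) (Pi\<^sub>M {Suc n} (\<lambda>_. input_space)) (present n)"
  by (rule indep_var_restrict[OF indep]) auto

text \<open>The law of the whole quadruple is shared, hence also the law of its image under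
  \<open>input_map\<close> at a fixed point.\<close>

lemma transition_op_copy:
  assumes "n \<ge> 1" "g \<in> borel_measurable borel"
  shows "(\<integral>\<omega>. g (random_map \<Phi> (As n) (B1s n) (B2s n) \<omega> x) \<partial>M) = transition_op g x"
proof -
  have m: "(\<lambda>i. g (input_map \<Phi> i x)) \<in> borel_measurable input_space"
    by (rule measurable_compose[OF measurable_input_map[OF Phi_cont] assms(2)])
  have i: "random_input N \<delta> M (As n) (B1s n) (B2s n) (B3s n)" using copies assms by auto
  have "(\<integral>\<omega>. g (input_map \<Phi> (inp n \<omega>) x) \<partial>M) = (\<integral>i. g (input_map \<Phi> i x) \<partial>distr M input_space (inp n))"
    by (rule integral_distr[symmetric, OF random_inputD(5)[OF i] m])
  also have "\<dots> = (\<integral>i. g (input_map \<Phi> i x) \<partial>distr M input_space (\<lambda>\<omega>. (A \<omega>, B1 \<omega>, B2 \<omega>, B3 \<omega>)))"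
    using same_law assms by simp
  also have "\<dots> = (\<integral>\<omega>. g (input_map \<Phi> (A \<omega>, B1 \<omega>, B2 \<omega>, B3 \<omega>) x) \<partial>M)"
    by (rule integral_distr[OF random_inputD(5)[OF input] m])
  finally show ?thesis
    unfolding transition_op_def random_map_eq_input_map[of \<Phi> A B1 B2 _ _ B3] random_map_eq_input_map[of \<Phi> "As n" "B1s n" "B2s n" _ _ "B3s n"] .
qed

context
  fixes g :: "real^'n \<Rightarrow> real" and C :: real
  assumes g: "continuous_on UNIV g" and bd: "\<And>x. \<bar>g x\<bar> \<le> C"
begin

lemma measurable_g: "g \<in> borel_measurable borel"
  by (rule borel_measurable_continuous_onI[OF g])

lemma transition_op_bounded: "\<bar>transition_op g x\<bar> \<le> C"
proof -
  have "\<bar>transition_op g x\<bar> \<le> (\<integral>\<omega>. \<bar>g (F \<omega> x)\<bar> \<partial>M)" unfolding transition_op_def by (rule integral_abs_bound)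
  also have "\<dots> \<le> (\<integral>\<omega>. C \<partial>M)"
    using bd measurable_compose[OF measurable_F measurable_g] by (intro integral_mono integrable_const_bound[of _ C] integrable_const) auto
  finally show ?thesis by (simp add: prob_space)
qed

lemma continuous_integral_bounded:
  assumes m: "\<And>x. (\<lambda>\<omega>. H \<omega> x) \<in> borel_measurable M" and c: "\<And>\<omega>. \<omega> \<in> space M \<Longrightarrow> continuous_on UNIV (H \<omega>)"
  shows "continuous_on UNIV (\<lambda>x::real^'n. \<integral>\<omega>. g (H \<omega> x) \<partial>M)"
proof (rule continuous_on_sequentiallyI)
  fix u :: "nat \<Rightarrow> real^'n" and a assume u: "u \<longlonglongrightarrow> a"
  show "(\<lambda>n. \<integral>\<omega>. g (H \<omega> (u n)) \<partial>M) \<longlonglongrightarrow> (\<integral>\<omega>. g (H \<omega> a) \<partial>M)"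
  proof (rule integral_dominated_convergence[where w="\<lambda>_. C"])
    show "AE \<omega> in M. (\<lambda>n. g (H \<omega> (u n))) \<longlonglongrightarrow> g (H \<omega> a)"
    proof (rule AE_I2)
      fix \<omega> assume "\<omega> \<in> space M"
      then have "continuous_on UNIV (\<lambda>x. g (H \<omega> x))" using continuous_on_compose2[OF g c] by auto
      then show "(\<lambda>n. g (H \<omega> (u n))) \<longlonglongrightarrow> g (H \<omega> a)"
        by (intro isCont_tendsto_compose[OF _ u]) (simp add: continuous_on_eq_continuous_at)
    qed
  qed (use bd m measurable_compose[OF m measurable_g] in auto)
qed

lemma continuous_transition_op: "continuous_on UNIV (transition_op g)"
  unfolding transition_op_def[abs_def] by (rule continuous_integral_bounded[OF measurable_F continuous_F])

lemma continuous_expectation_X: "continuous_on UNIV (\<lambda>x. \<integral>\<omega>. g (X x n \<omega>) \<partial>M)"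
  by (rule continuous_integral_bounded[OF measurable_X continuous_X])

text \<open>The Markov property. Past and present inputs are independent, so Fubini on the product
  of their laws integrates out the present one. This is done at the rounded state, and both sides
  are then passed to the limit by bounded convergence.\<close>

lemma chain_step: "(\<integral>\<omega>. g (X x (Suc n) \<omega>) \<partial>M) = (\<integral>\<omega>. transition_op g (X x n \<omega>) \<partial>M)"
proof (rule LIMSEQ_unique)
  let ?S1 = "Pi\<^sub>M {1..n} (\<lambda>_. input_space :: ((real^'n^'n) \<times> (real^'n) \<times> (real^'n \<Rightarrow> real^'n) \<times> real) measure)"
  let ?S2 = "Pi\<^sub>M {Suc n} (\<lambda>_. input_space :: ((real^'n^'n) \<times> (real^'n) \<times> (real^'n \<Rightarrow> real^'n) \<times> real) measure)"
  let ?X = "distr M ?S1 (past n)" and ?I = "distr M ?S2 (present n)"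
  have i: "random_input N \<delta> M (As (Suc n)) (B1s (Suc n)) (B2s (Suc n)) (B3s (Suc n))" using copies by auto
  have rm: "past n \<in> measurable M ?S1" "present n \<in> measurable M ?S2"
    and joint: "?X \<Otimes>\<^sub>M ?I = distr M (?S1 \<Otimes>\<^sub>M ?S2) (\<lambda>\<omega>. (past n \<omega>, present n \<omega>))"
    using indep_past_present[of n] unfolding indep_var_distribution_eq by auto
  interpret I: prob_space ?I by (rule prob_space_distr[OF rm(2)])
  interpret X: prob_space ?X by (rule prob_space_distr[OF rm(1)])
  interpret XI: pair_prob_space ?X ?I ..
  have am: "approx x n \<in> borel_measurable ?S1" by (rule measurable_approx) simp
  have cm: "(\<lambda>y. y (Suc n)) \<in> measurable ?S2 input_space" by (rule measurable_component_singleton) simp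
  have ax: "approx x n (past n \<omega>) = X x n \<omega>" if "\<omega> \<in> space M" for \<omega>
    by (rule X_eq_approx[OF that order_refl, symmetric])
  have i': "present n \<omega> (Suc n) = inp (Suc n) \<omega>" for \<omega> by simp
  \<comment> \<open>Rounding the state makes this jointly measurable on all input paths, including
    those whose maps are not continuous.\<close>
  define h where "h k p = g (input_map \<Phi> (snd p (Suc n)) (grid k (approx x n (fst p))))" for k p
  have hm: "h k \<in> borel_measurable (?S1 \<Otimes>\<^sub>M ?S2)" for k unfolding h_def[abs_def]
  proof (rule measurable_compose_countable'[where f="\<lambda>z p. g (input_map \<Phi> (snd p (Suc n)) z)"
        and g="\<lambda>p. grid k (approx x n (fst p))", OF _ _ countable_range_grid])
    show "(\<lambda>p. g (input_map \<Phi> (snd p (Suc n)) z)) \<in> borel_measurable (?S1 \<Otimes>\<^sub>M ?S2)" for z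
      by (rule measurable_compose[OF measurable_snd
            measurable_compose[OF cm measurable_compose[OF measurable_input_map[OF Phi_cont] measurable_g]]])
    show "(\<lambda>p. grid k (approx x n (fst p))) \<in> measurable (?S1 \<Otimes>\<^sub>M ?S2) (count_space (range (grid k)))"
      by (rule measurable_compose[OF measurable_fst measurable_compose[OF am measurable_grid]])
  qed
  have eq: "(\<integral>\<omega>. g (random_map \<Phi> (As (Suc n)) (B1s (Suc n)) (B2s (Suc n)) \<omega> (grid k (X x n \<omega>))) \<partial>M)
      = (\<integral>\<omega>. transition_op g (grid k (X x n \<omega>)) \<partial>M)" for k
  proof -
    have "(\<integral>\<omega>. g (random_map \<Phi> (As (Suc n)) (B1s (Suc n)) (B2s (Suc n)) \<omega> (grid k (X x n \<omega>))) \<partial>M)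
       = (\<integral>\<omega>. h k (past n \<omega>, present n \<omega>) \<partial>M)"
      by (rule Bochner_Integration.integral_cong[OF refl])
        (simp only: h_def ax fst_conv snd_conv i' random_map_eq_input_map[of \<Phi> "As (Suc n)" "B1s (Suc n)" "B2s (Suc n)" _ _ "B3s (Suc n)"])
    also have "\<dots> = (\<integral>p. h k p \<partial>distr M (?S1 \<Otimes>\<^sub>M ?S2) (\<lambda>\<omega>. (past n \<omega>, present n \<omega>)))"
      by (rule integral_distr[symmetric, OF measurable_Pair[OF rm] hm])
    also have "\<dots> = (\<integral>p. h k p \<partial>(?X \<Otimes>\<^sub>M ?I))" unfolding joint ..
    also have "\<dots> = (\<integral>y. (\<integral>i. h k (y, i) \<partial>?I) \<partial>?X)"
    proof (rule XI.integral_fst'[symmetric])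
      have "h k \<in> borel_measurable (?X \<Otimes>\<^sub>M ?I)" using hm by (simp cong: measurable_cong_sets)
      then show "integrable (?X \<Otimes>\<^sub>M ?I) (h k)"
        using bd by (intro XI.integrable_const_bound[of _ C]) (auto simp: h_def)
    qed
    also have "\<dots> = (\<integral>y. transition_op g (grid k (approx x n y)) \<partial>?X)"
    proof (rule Bochner_Integration.integral_cong[OF refl])
      fix y
      have "(\<integral>i. h k (y, i) \<partial>?I) = (\<integral>\<omega>. h k (y, present n \<omega>) \<partial>M)"
      proof (rule integral_distr[OF rm(2)])
        show "(\<lambda>i. h k (y, i)) \<in> borel_measurable ?S2" unfolding h_def fst_conv snd_conv
          by (rule measurable_compose[OF cm measurable_compose[OF measurable_input_map[OF Phi_cont] measurable_g]])
      qed
      also have "\<dots> = transition_op g (grid k (approx x n y))" unfolding transition_op_copy[of "Suc n", OF _ measurable_g, symmetric, simplified]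
        by (simp only: h_def fst_conv snd_conv i' random_map_eq_input_map[of \<Phi> "As (Suc n)" "B1s (Suc n)" "B2s (Suc n)" _ _ "B3s (Suc n)"])
      finally show "(\<integral>i. h k (y, i) \<partial>?I) = transition_op g (grid k (approx x n y))" .
    qed
    also have "\<dots> = (\<integral>\<omega>. transition_op g (grid k (approx x n (past n \<omega>))) \<partial>M)"
    proof (rule integral_distr[OF rm(1)])
      show "(\<lambda>y. transition_op g (grid k (approx x n y))) \<in> borel_measurable ?S1"
        by (rule measurable_compose_countable'[OF _ measurable_compose[OF am measurable_grid] countable_range_grid]) auto
    qed
    also have "\<dots> = (\<integral>\<omega>. transition_op g (grid k (X x n \<omega>)) \<partial>M)"
      by (rule Bochner_Integration.integral_cong[OF refl]) (simp only: ax)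
    finally show ?thesis .
  qed
  have meq: "(\<lambda>\<omega>. g (random_map \<Phi> (As (Suc n)) (B1s (Suc n)) (B2s (Suc n)) \<omega> (grid k (X x n \<omega>)))) \<in> borel_measurable M" for k
  proof (rule measurable_compose_countable'[where f="\<lambda>z \<omega>. g (random_map \<Phi> (As (Suc n)) (B1s (Suc n)) (B2s (Suc n)) \<omega> z)"
        and g="\<lambda>\<omega>. grid k (X x n \<omega>)", OF _ _ countable_range_grid])
    show "(\<lambda>\<omega>. g (random_map \<Phi> (As (Suc n)) (B1s (Suc n)) (B2s (Suc n)) \<omega> z)) \<in> borel_measurable M" for z
      by (rule measurable_compose[OF measurable_random_map[OF Phi_cont i] measurable_g])
    show "(\<lambda>\<omega>. grid k (X x n \<omega>)) \<in> measurable M (count_space (range (grid k)))"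
      by (rule measurable_compose[OF measurable_X measurable_grid])
  qed
  show "(\<lambda>k. \<integral>\<omega>. transition_op g (grid k (X x n \<omega>)) \<partial>M) \<longlonglongrightarrow> (\<integral>\<omega>. transition_op g (X x n \<omega>) \<partial>M)"
  proof (rule integral_dominated_convergence[where w="\<lambda>_. C"])
    show "(\<lambda>\<omega>. transition_op g (X x n \<omega>)) \<in> borel_measurable M"
      by (rule measurable_compose[OF measurable_X borel_measurable_continuous_onI[OF continuous_transition_op]])
    show "(\<lambda>\<omega>. transition_op g (grid k (X x n \<omega>))) \<in> borel_measurable M" for k
      by (rule measurable_compose[OF measurable_X])
         (rule measurable_compose_countable'[OF _ measurable_grid countable_range_grid], auto)
    show "AE \<omega> in M. (\<lambda>k. transition_op g (grid k (X x n \<omega>))) \<longlonglongrightarrow> transition_op g (X x n \<omega>)"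
      using continuous_transition_op by (intro AE_I2 isCont_tendsto_compose[OF _ grid_tendsto]) (simp add: continuous_on_eq_continuous_at)
  qed (use transition_op_bounded in auto)
  show "(\<lambda>k. \<integral>\<omega>. transition_op g (grid k (X x n \<omega>)) \<partial>M) \<longlonglongrightarrow> (\<integral>\<omega>. g (X x (Suc n) \<omega>) \<partial>M)"
    unfolding eq[symmetric]
  proof (rule integral_dominated_convergence[where w="\<lambda>_. C"])
    show "(\<lambda>\<omega>. g (X x (Suc n) \<omega>)) \<in> borel_measurable M" by (rule measurable_compose[OF measurable_X measurable_g])
    show "AE \<omega> in M. (\<lambda>k. g (random_map \<Phi> (As (Suc n)) (B1s (Suc n)) (B2s (Suc n)) \<omega> (grid k (X x n \<omega>)))) \<longlonglongrightarrow> g (X x (Suc n) \<omega>)"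
    proof (rule AE_I2)
      fix \<omega> assume "\<omega> \<in> space M"
      then have "continuous_on UNIV (\<lambda>z. g (random_map \<Phi> (As (Suc n)) (B1s (Suc n)) (B2s (Suc n)) \<omega> z))"
        using continuous_on_compose2[OF g continuous_Fn[of "Suc n" \<omega>]] by auto
      then show "(\<lambda>k. g (random_map \<Phi> (As (Suc n)) (B1s (Suc n)) (B2s (Suc n)) \<omega> (grid k (X x n \<omega>)))) \<longlonglongrightarrow> g (X x (Suc n) \<omega>)"
        unfolding chain.simps by (intro isCont_tendsto_compose[OF _ grid_tendsto]) (simp add: continuous_on_eq_continuous_at)
    qed
  qed (use meq bd in auto)
qed

end

text \<open>Puts stationarity into the form needed for Fubini: \<open>\<nu>\<close> is the law of
  F(x) for x drawn from \<open>\<nu>\<close> independently of the input. The defining integral is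
  the slice formula for the product measure.\<close>

lemma stationary_law:
  assumes "stationary_measure M F \<nu>"
  shows "\<nu> = distr (\<nu> \<Otimes>\<^sub>M M) borel (\<lambda>p. F (snd p) (fst p))"
proof (rule measure_eqI)
  have s: "sets \<nu> = sets borel" and p: "prob_space \<nu>" using assms unfolding stationary_measure_def by auto
  show "sets \<nu> = sets (distr (\<nu> \<Otimes>\<^sub>M M) borel (\<lambda>p. F (snd p) (fst p)))" using s by simp
  have m: "(\<lambda>p. F (snd p) (fst p)) \<in> borel_measurable (\<nu> \<Otimes>\<^sub>M M)"
    using measurable_F_pair by (simp add: measurable_cong_sets[OF sets_pair_measure_cong[OF s refl] refl])
  fix S assume "S \<in> sets \<nu>"
  then have S: "S \<in> sets borel" using s by simp
  have "emeasure \<nu> S = (\<integral>\<^sup>+x. emeasure (distr M borel (\<lambda>\<omega>. F \<omega> x)) S \<partial>\<nu>)"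
    using assms S unfolding stationary_measure_def by auto
  also have "\<dots> = (\<integral>\<^sup>+x. emeasure M (Pair x -` ((\<lambda>p. F (snd p) (fst p)) -` S \<inter> space (\<nu> \<Otimes>\<^sub>M M))) \<partial>\<nu>)"
  proof (rule nn_integral_cong)
    fix x assume "x \<in> space \<nu>"
    then have "(Pair x -` ((\<lambda>p. F (snd p) (fst p)) -` S \<inter> space (\<nu> \<Otimes>\<^sub>M M))) = (\<lambda>\<omega>. F \<omega> x) -` S \<inter> space M"
      by (auto simp: space_pair_measure)
    then show "emeasure (distr M borel (\<lambda>\<omega>. F \<omega> x)) S = emeasure M (Pair x -` ((\<lambda>p. F (snd p) (fst p)) -` S \<inter> space (\<nu> \<Otimes>\<^sub>M M)))"
      by (simp add: emeasure_distr[OF measurable_F S])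
  qed
  also have "\<dots> = emeasure (\<nu> \<Otimes>\<^sub>M M) ((\<lambda>p. F (snd p) (fst p)) -` S \<inter> space (\<nu> \<Otimes>\<^sub>M M))"
    by (rule emeasure_pair_measure_alt[symmetric]) (rule measurable_sets[OF m S])
  also have "\<dots> = emeasure (distr (\<nu> \<Otimes>\<^sub>M M) borel (\<lambda>p. F (snd p) (fst p))) S"
    by (rule emeasure_distr[OF m S, symmetric])
  finally show "emeasure \<nu> S = emeasure (distr (\<nu> \<Otimes>\<^sub>M M) borel (\<lambda>p. F (snd p) (fst p))) S" .
qed

lemma stationary_transition_op:
  fixes g :: "real^'n \<Rightarrow> real"
  assumes st: "stationary_measure M F \<nu>" and g: "continuous_on UNIV g" "\<And>x. \<bar>g x\<bar> \<le> C"
  shows "(\<integral>x. transition_op g x \<partial>\<nu>) = (\<integral>x. g x \<partial>\<nu>)"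
proof -
  have s: "sets \<nu> = sets borel" and p: "prob_space \<nu>" using st unfolding stationary_measure_def by auto
  interpret nu: prob_space \<nu> by (rule p)
  interpret P: pair_prob_space \<nu> M ..
  have m: "(\<lambda>p. F (snd p) (fst p)) \<in> borel_measurable (\<nu> \<Otimes>\<^sub>M M)"
    using measurable_F_pair by (simp add: measurable_cong_sets[OF sets_pair_measure_cong[OF s refl] refl])
  have gm: "g \<in> borel_measurable borel" by (rule borel_measurable_continuous_onI[OF g(1)])
  have "(\<integral>x. g x \<partial>\<nu>) = (\<integral>x. g x \<partial>distr (\<nu> \<Otimes>\<^sub>M M) borel (\<lambda>p. F (snd p) (fst p)))"
    using stationary_law[OF st] by simp
  also have "\<dots> = (\<integral>p. g (F (snd p) (fst p)) \<partial>(\<nu> \<Otimes>\<^sub>M M))" by (rule integral_distr[OF m gm])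
  also have "\<dots> = (\<integral>x. (\<integral>\<omega>. g (F (snd (x, \<omega>)) (fst (x, \<omega>))) \<partial>M) \<partial>\<nu>)"
    using measurable_compose[OF m gm] g(2)
    by (intro P.integral_fst'[symmetric] P.integrable_const_bound[of _ C]) auto
  finally show ?thesis by (simp add: transition_op_def)
qed

text \<open>The induction generalises over \<open>g\<close>, because a chain step replaces it by
  \<open>transition_op g\<close>, which is again bounded and continuous.\<close>

lemma stationary_chain:
  fixes g :: "real^'n \<Rightarrow> real"
  assumes st: "stationary_measure M F \<nu>" and g: "continuous_on UNIV g" "\<And>x. \<bar>g x\<bar> \<le> C"
  shows "(\<integral>x. (\<integral>\<omega>. g (X x n \<omega>) \<partial>M) \<partial>\<nu>) = (\<integral>x. g x \<partial>\<nu>)"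
  using g
proof (induction n arbitrary: g)
  case (Suc n)
  have "(\<integral>x. (\<integral>\<omega>. g (X x (Suc n) \<omega>) \<partial>M) \<partial>\<nu>) = (\<integral>x. (\<integral>\<omega>. transition_op g (X x n \<omega>) \<partial>M) \<partial>\<nu>)"
    by (simp only: chain_step[OF Suc.prems])
  also have "\<dots> = (\<integral>x. transition_op g x \<partial>\<nu>)"
    by (rule Suc.IH[OF continuous_transition_op[OF Suc.prems] transition_op_bounded[OF Suc.prems]])
  also have "\<dots> = (\<integral>x. g x \<partial>\<nu>)" by (rule stationary_transition_op[OF st Suc.prems])
  finally show ?case .
qed (simp add: prob_space)

end

section \<open>One big jump\<close>

text \<open>The ramp from 1/2 to 1 lies in \<open>Cb_away\<close> and dominates the indicator of |x|
  > 1, so its limit bounds the tail probabilities.\<close>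

lemma tail_functional_bounded:
  fixes \<kappa> :: "(real^'n) measure"
  assumes T: "tail_functional V \<kappa> T" and \<kappa>: "prob_space \<kappa>" "sets \<kappa> = sets borel" and V: "\<And>t. t > 0 \<Longrightarrow> V t > 0"
  shows "tail_bounded V \<kappa>"
proof -
  interpret prob_space \<kappa> by fact
  let ?f = "ramp (1/2) 1 :: real^'n \<Rightarrow> real"
  have f: "?f \<in> Cb_away" by (rule ramp_Cb_away) auto
  have "((\<lambda>t. V t * (\<integral>x. ?f (x /\<^sub>R t) \<partial>\<kappa>)) \<longlongrightarrow> T ?f) at_top" using T f unfolding tail_functional_def by blast
  then have "eventually (\<lambda>t. V t * (\<integral>x. ?f (x /\<^sub>R t) \<partial>\<kappa>) < T ?f + 1) at_top" by (rule order_tendstoD) simp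
  then have "eventually (\<lambda>t. V t * measure \<kappa> {x. norm x > t} \<le> T ?f + 1) at_top"
    using eventually_gt_at_top[of 0]
  proof eventually_elim
    case (elim t)
    have "measure \<kappa> {x. norm x > t} \<le> (\<integral>x. ?f (x /\<^sub>R t) \<partial>\<kappa>)"
    proof (rule integral_ge_measure)
      show "?f (x /\<^sub>R t) \<le> 1" "0 \<le> ?f (x /\<^sub>R t)" for x by (rule ramp_props; simp)+
      show "1 \<le> ?f (x /\<^sub>R t)" if "x \<in> {x. norm x > t}" for x
        using that elim ramp_props(5)[of "1/2" 1 "x /\<^sub>R t"] by (simp add: field_simps)
      show "(\<lambda>x. ?f (x /\<^sub>R t)) \<in> borel_measurable borel" by (rule measurable_scale[OF borel_Cb_away[OF f]])
    qed (auto simp: \<kappa> finite_measure_axioms)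
    then have "V t * measure \<kappa> {x. norm x > t} \<le> V t * (\<integral>x. ?f (x /\<^sub>R t) \<partial>\<kappa>)" using V[of t] elim by (intro mult_left_mono) auto
    then show ?case using elim by simp
  qed
  then show ?thesis unfolding tail_bounded_def eventually_at_top_linorder by blast
qed

text \<open>\<open>V\<close> grows at most like t^(\<alpha>+\<eta>) with \<alpha> + \<eta> < q. Any
  tail of polynomial order q > \<alpha> is thus invisible at the scale of \<open>V\<close>.\<close>

lemma potter_growth:
  assumes V: "potter V \<alpha>" and \<alpha>: "\<alpha> > 0" and q: "q > \<alpha>"
  shows "((\<lambda>t. V t * t powr - q) \<longlongrightarrow> 0) at_top"
proof -
  define \<eta> where "\<eta> = min (q - \<alpha>) \<alpha> / 2"
  have \<eta>: "0 < \<eta>" "\<eta> < \<alpha>" "\<alpha> + \<eta> < q" unfolding \<eta>_def using \<alpha> q by (auto simp: min_def field_simps)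
  obtain K t0 where K: "K > 0" "t0 > 0" "\<And>t s. t \<ge> t0 \<Longrightarrow> s \<ge> 1 \<Longrightarrow> V (s * t) \<le> K * s powr (\<alpha> + \<eta>) * V t"
  proof -
    from V \<eta> obtain P t1 where "P > 0 \<and> t1 > 0 \<and> (\<forall>t\<ge>t1. \<forall>s\<ge>1.
        V (s * t) \<le> P * s powr (\<alpha> + \<eta>) * V t \<and> s powr (\<alpha> - \<eta>) * V t \<le> P * V (s * t))"
      unfolding potter_def by blast
    then show ?thesis by (intro that[of P t1]) auto
  qed
  have Vp: "V t > 0" if "t > 0" for t using V that unfolding potter_def regvar_def by auto
  have lim: "((\<lambda>t. (K * V t0 * (1/t0) powr (\<alpha> + \<eta>)) * t powr (\<alpha> + \<eta> - q)) \<longlongrightarrow> (K * V t0 * (1/t0) powr (\<alpha> + \<eta>)) * 0) at_top"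
    using \<eta> by (intro tendsto_intros tendsto_neg_powr filterlim_ident) auto
  show ?thesis
  proof (rule tendsto_sandwich[OF _ _ tendsto_const])
    show "((\<lambda>t. (K * V t0 * (1/t0) powr (\<alpha> + \<eta>)) * t powr (\<alpha> + \<eta> - q)) \<longlongrightarrow> 0) at_top" using lim by simp
    show "eventually (\<lambda>t. 0 \<le> V t * t powr - q) at_top"
      using eventually_gt_at_top[of 0] by eventually_elim (use Vp in \<open>simp add: less_imp_le\<close>)
    show "eventually (\<lambda>t. V t * t powr - q \<le> (K * V t0 * (1/t0) powr (\<alpha> + \<eta>)) * t powr (\<alpha> + \<eta> - q)) at_top"
      using eventually_ge_at_top[of t0]
    proof eventually_elim
      case (elim t)
      have tp: "t > 0" using elim K by simp
      have "V ((1/t0 * t) * t0) \<le> K * (1/t0 * t) powr (\<alpha> + \<eta>) * V t0" using elim K(2) by (intro K(3)) (auto simp: field_simps)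
      moreover have "(1/t0 * t) * t0 = t" using K by simp
      ultimately have "V t \<le> K * ((1/t0) powr (\<alpha> + \<eta>) * t powr (\<alpha> + \<eta>)) * V t0" using K tp by (simp only: powr_mult)
      then have "V t * t powr - q \<le> K * ((1/t0) powr (\<alpha> + \<eta>) * t powr (\<alpha> + \<eta>)) * V t0 * t powr - q" by (rule mult_right_mono) simp
      also have "\<dots> = (K * V t0 * (1/t0) powr (\<alpha> + \<eta>)) * (t powr (\<alpha> + \<eta>) * t powr - q)" by simp
      also have "t powr (\<alpha> + \<eta>) * t powr - q = t powr (\<alpha> + \<eta> - q)" by (simp only: powr_add[symmetric] diff_conv_add_uminus)
      finally show ?case .
    qed
  qed
qed

text \<open>\<open>V\<close> grows at least like t^a, so the tail decays at least like t^-a. Below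
  the Potter threshold the trivial bound 1 is absorbed into the constant.\<close>

lemma potter_tail_polynomial:
  assumes V: "potter V \<alpha>" and \<kappa>: "prob_space \<kappa>" "tail_bounded V \<kappa>" and a: "0 < a" "a < \<alpha>"
  obtains K where "K > 0" "\<And>y. y > 0 \<Longrightarrow> measure \<kappa> {x. norm x > y} \<le> K * y powr - a"
proof -
  interpret prob_space \<kappa> by fact
  have \<eta>: "0 < \<alpha> - a" "\<alpha> - a < \<alpha>" using a by auto
  obtain P t1 where P: "P > 0" "t1 > 0" "\<And>t s. t \<ge> t1 \<Longrightarrow> s \<ge> 1 \<Longrightarrow> s powr a * V t \<le> P * V (s * t)"
  proof -
    from V \<eta> obtain P t1 where "P > 0 \<and> t1 > 0 \<and> (\<forall>t\<ge>t1. \<forall>s\<ge>1.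
        V (s * t) \<le> P * s powr (\<alpha> + (\<alpha> - a)) * V t \<and> s powr (\<alpha> - (\<alpha> - a)) * V t \<le> P * V (s * t))"
      unfolding potter_def by blast
    then show ?thesis by (intro that[of P t1]) auto
  qed
  obtain C t2 where C: "\<And>t. t \<ge> t2 \<Longrightarrow> V t * measure \<kappa> {x. norm x > t} \<le> C"
    using \<kappa>(2) unfolding tail_bounded_def by blast
  have Vp: "V t > 0" if "t > 0" for t using V that unfolding potter_def regvar_def by auto
  define T where "T = max t1 t2"
  have T: "T > 0" "T \<ge> t1" "T \<ge> t2" unfolding T_def using P by auto
  define K0 where "K0 = max 1 (P * max C 0 / V T)"
  define K where "K = K0 * T powr a"
  have K0: "K0 \<ge> 1" unfolding K0_def by simp
  show ?thesis
  proof (rule that[of K])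
    show "K > 0" unfolding K_def using K0 T by simp
    fix y :: real assume y: "y > 0"
    define p where "p = measure \<kappa> {x. norm x > y}"
    have p: "0 \<le> p" "p \<le> 1" unfolding p_def by auto
    have "p \<le> K0 * (y / T) powr - a"
    proof (cases "y \<ge> T")
      case True
      have "(y/T) powr a * V T \<le> P * V (y/T * T)" using True T by (intro P(3)) (auto simp: field_simps)
      then have 1: "(y/T) powr a * V T \<le> P * V y" using T by simp
      have "V y * p \<le> max C 0" using C[of y] True T unfolding p_def by simp
      then have "P * V y * p \<le> P * max C 0" using P by (simp add: mult.assoc)
      then have "(y/T) powr a * V T * p \<le> P * max C 0" using mult_right_mono[OF 1 p(1)] by linarith
      then have "p \<le> P * max C 0 / V T * (y/T) powr - a"
        using y T Vp[of T] by (simp add: powr_minus_divide field_simps)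
      also have "\<dots> \<le> K0 * (y/T) powr - a" unfolding K0_def by (intro mult_right_mono) auto
      finally show ?thesis .
    next
      case False
      have "1 \<le> (y/T) powr - a" using False y T a powr_le1[of a "y/T"]
        by (simp add: powr_minus_divide)
      then have "1 \<le> K0 * (y/T) powr - a" using K0 mult_mono[of 1 K0 1 "(y/T) powr - a"] by simp
      then show ?thesis using p by simp
    qed
    also have "\<dots> = K * y powr - a" unfolding K_def using y T by (simp add: powr_divide powr_minus_divide)
    finally show "measure \<kappa> {x. norm x > y} \<le> K * y powr - a" unfolding p_def .
  qed
qed

lemma norm_matrix_vector_mult_le: "norm (A *v x) \<le> norm A * norm (x :: real^'n)" for A :: "real^'n^'m"
proof -
  have "norm (A *v x) = L2_set (\<lambda>i. norm (A $ i \<bullet> x)) UNIV" by (simp add: norm_vec_def matrix_vector_mul_component)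
  also have "\<dots> \<le> L2_set (\<lambda>i. norm (A $ i) * norm x) UNIV" by (intro L2_set_mono) (auto intro: Cauchy_Schwarz_ineq2)
  also have "\<dots> = norm A * norm x" unfolding norm_vec_def[of A] by (rule L2_set_left_distrib[symmetric]) simp
  finally show ?thesis .
qed

text \<open>The state is integrated first, with \<omega> frozen, since \<open>A\<close>,
  \<open>B1\<close> and \<open>B2\<close> are functions of the same \<omega> and may depend on each
  other.\<close>

lemma measure_pair_fubini:
  assumes "prob_space K" "prob_space M" "E \<in> sets (K \<Otimes>\<^sub>M M)"
  shows "measure (K \<Otimes>\<^sub>M M) E = (\<integral>\<omega>. measure K {x\<in>space K. (x, \<omega>) \<in> E} \<partial>M)"
    "(\<lambda>\<omega>. measure K {x\<in>space K. (x, \<omega>) \<in> E}) \<in> borel_measurable M"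
proof -
  interpret K: prob_space K by fact
  interpret M: prob_space M by fact
  interpret P: pair_prob_space K M ..
  have i: "integrable (K \<Otimes>\<^sub>M M) (indicator E :: _ \<Rightarrow> real)"
    using assms(3) by (intro integrable_real_indicator) (auto simp: P.emeasure_finite less_top[symmetric])
  have eq: "(\<integral>x. indicat_real E (x, \<omega>) \<partial>K) = measure K {x\<in>space K. (x, \<omega>) \<in> E}" if "\<omega> \<in> space M" for \<omega>
  proof -
    have s: "{x\<in>space K. (x, \<omega>) \<in> E} \<in> sets K"
    proof -
      have "(\<lambda>x. (x, \<omega>)) -` E \<inter> space K \<in> sets K" using that by (intro measurable_sets[OF _ assms(3)]) auto
      moreover have "(\<lambda>x. (x, \<omega>)) -` E \<inter> space K = {x\<in>space K. (x, \<omega>) \<in> E}" by auto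
      ultimately show ?thesis by simp
    qed
    have "(\<integral>x. indicat_real E (x, \<omega>) \<partial>K) = (\<integral>x. indicator {x\<in>space K. (x, \<omega>) \<in> E} x \<partial>K)"
      by (rule Bochner_Integration.integral_cong) (auto simp: indicator_def)
    then show ?thesis using s by simp
  qed
  have "measure (K \<Otimes>\<^sub>M M) E = (\<integral>p. indicat_real E p \<partial>(K \<Otimes>\<^sub>M M))" using assms(3) by simp
  also have "\<dots> = (\<integral>\<omega>. (\<integral>x. indicat_real E (x, \<omega>) \<partial>K) \<partial>M)"
    using P.integral_snd[of "\<lambda>x \<omega>. indicat_real E (x, \<omega>)"] i by (simp only: case_prod_eta)
  also have "\<dots> = (\<integral>\<omega>. measure K {x\<in>space K. (x, \<omega>) \<in> E} \<partial>M)" by (rule Bochner_Integration.integral_cong[OF refl eq])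
  finally show "measure (K \<Otimes>\<^sub>M M) E = (\<integral>\<omega>. measure K {x\<in>space K. (x, \<omega>) \<in> E} \<partial>M)" .
  have "(\<lambda>\<omega>. \<integral>x. indicat_real E (x, \<omega>) \<partial>K) \<in> borel_measurable M"
    using P.integrable_snd[of "\<lambda>x \<omega>. indicat_real E (x, \<omega>)"] i
    by (intro borel_measurable_integrable) (simp only: case_prod_eta)
  then show "(\<lambda>\<omega>. measure K {x\<in>space K. (x, \<omega>) \<in> E}) \<in> borel_measurable M"
    by (subst measurable_cong[OF eq[symmetric]])
qed

text \<open>The one-big-jump estimate: with \<open>u\<close> and \<open>v\<close> the two normalised inputs of \<open>\<Phi>\<close>, the composition
  \<open>f (\<Phi> u v)\<close> splits additively unless both inputs are large, one of them is huge, or \<open>v\<close> is far from its main part \<open>b\<close>.\<close>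

lemma one_big_jump:
  fixes \<Phi> :: "real^'n \<Rightarrow> real^'n \<Rightarrow> real^'n"
  assumes f: "f \<in> Cb_away" and c: "continuous_on UNIV (\<lambda>(x, y). \<Phi> x y)" and z: "\<Phi> 0 0 = 0"
  obtains C \<eta> where "C > 0" "\<eta> > 0" "\<And>u v b. \<bar>f (\<Phi> u v) - f (\<Phi> u 0) - f (\<Phi> 0 b)\<bar> \<le> C"
    "\<And>R d. R > 0 \<Longrightarrow> d > 0 \<Longrightarrow> \<exists>\<epsilon>>0. \<forall>u v b. norm (v - b) \<le> \<epsilon> \<longrightarrow> norm u \<le> \<epsilon> \<or> norm b \<le> \<epsilon> \<longrightarrow> norm u \<le> R \<longrightarrow> norm b \<le> R \<longrightarrow>
        \<bar>f (\<Phi> u v) - f (\<Phi> u 0) - f (\<Phi> 0 b)\<bar> \<le> (if norm u > \<eta> \<or> norm b > \<eta> then d else 0)"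
proof -
  obtain C r where C: "continuous_on UNIV f" "C > 0" "\<And>x. \<bar>f x\<bar> \<le> C" "r > 0" "\<And>x. norm x < r \<Longrightarrow> f x = 0"
    by (rule Cb_awayE[OF f]) blast
  define G where "G p = f (\<Phi> (fst p) (snd p))" for p
  have Gc: "continuous_on UNIV G" unfolding G_def
    using continuous_on_compose2[OF C(1) c] by (simp add: case_prod_unfold)
  have "continuous (at (0,0)) (\<lambda>(x, y). \<Phi> x y)" using c by (simp add: continuous_on_eq_continuous_at)
  then obtain e where e: "e > 0" "\<And>p. dist p (0,0) < e \<Longrightarrow> dist (\<Phi> (fst p) (snd p)) 0 < r"
  proof -
    from \<open>continuous (at (0,0)) (\<lambda>(x, y). \<Phi> x y)\<close> C(4) obtain e where
      e: "e > 0" "\<And>p. dist p (0,0) < e \<Longrightarrow> dist ((\<lambda>(x, y). \<Phi> x y) p) ((\<lambda>(x, y). \<Phi> x y) (0,0)) < r"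
      unfolding continuous_at_eps_delta by blast
    show ?thesis by (rule that[OF e(1)]) (use e(2) z in \<open>simp add: case_prod_unfold\<close>)
  qed
  \<comment> \<open>If both arguments have norm at most 2 \<eta>, the pair is within e/2 of the
    origin and \<open>f\<close> vanishes at its image. The factor 2 leaves room for the difference
    between \<open>v\<close> and \<open>b\<close>.\<close>
  define \<eta> where "\<eta> = e / 8"
  have \<eta>: "\<eta> > 0" unfolding \<eta>_def using e by simp
  have small: "f (\<Phi> u v) = 0" if "norm u \<le> 2 * \<eta>" "norm v \<le> 2 * \<eta>" for u v
  proof -
    have "norm (u, v) \<le> norm u + norm v" by (rule norm_Pair_le)
    also have "\<dots> < e" using that e unfolding \<eta>_def by simp
    finally have "dist (\<Phi> u v) 0 < r" using e(2)[of "(u, v)"] by (simp add: dist_norm zero_prod_def[symmetric])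
    then show ?thesis using C(5) by simp
  qed
  show ?thesis
  proof (rule that[of "3 * C" \<eta>])
    show "\<bar>f (\<Phi> u v) - f (\<Phi> u 0) - f (\<Phi> 0 b)\<bar> \<le> 3 * C" for u v b
      using C(3)[of "\<Phi> u v"] C(3)[of "\<Phi> u 0"] C(3)[of "\<Phi> 0 b"] by linarith
    fix R d :: real assume R: "R > 0" and d: "d > 0"
    have "uniformly_continuous_on (cball 0 (2*R+2*\<eta>)) G"
      by (intro compact_uniformly_continuous) (auto intro: continuous_on_subset[OF Gc])
    then obtain e' where e': "e' > 0" "\<And>p q. p \<in> cball 0 (2*R+2*\<eta>) \<Longrightarrow> q \<in> cball 0 (2*R+2*\<eta>) \<Longrightarrow> dist q p < e' \<Longrightarrow> dist (G q) (G p) < d"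
      unfolding uniformly_continuous_on_def using d by meson
    \<comment> \<open>At most \<eta>, so that passing from \<open>b\<close> to \<open>v\<close>
      stays inside the vanishing region, and small against the modulus e' of uniform continuity of
      \<open>G\<close>.\<close>
    define \<epsilon> where "\<epsilon> = min \<eta> (e' / 8)"
    have \<epsilon>: "\<epsilon> > 0" "\<epsilon> \<le> \<eta>" "8 * \<epsilon> \<le> e'" unfolding \<epsilon>_def using \<eta> e' by auto
    have n2: "norm (a, b) \<le> norm a + norm b" for a b :: "real^'n"
      by (rule norm_Pair_le)
    have close: "\<bar>f (\<Phi> u v) - f (\<Phi> u' v')\<bar> \<le> d"
      if "norm u + norm v \<le> 2*R+2*\<eta>" "norm u' + norm v' \<le> 2*R+2*\<eta>" "norm (u - u') + norm (v - v') \<le> 4 * \<epsilon>" for u v u' v'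
    proof -
      have "dist (u, v) (u', v') < e'" using n2[of "u - u'" "v - v'"] that \<epsilon> by (simp add: dist_norm)
      moreover have "(u, v) \<in> cball 0 (2*R+2*\<eta>)" "(u', v') \<in> cball 0 (2*R+2*\<eta>)"
        using n2[of u v] n2[of u' v'] that by auto
      ultimately have "dist (G (u, v)) (G (u', v')) < d" using e'(2) by blast
      then show ?thesis by (simp add: G_def dist_real_def)
    qed
    have "\<bar>f (\<Phi> u v) - f (\<Phi> u 0) - f (\<Phi> 0 b)\<bar> \<le> (if norm u > \<eta> \<or> norm b > \<eta> then d else 0)"
      if h: "norm (v - b) \<le> \<epsilon>" "norm u \<le> \<epsilon> \<or> norm b \<le> \<epsilon>" "norm u \<le> R" "norm b \<le> R" for u v b
    proof -
      have v: "norm v \<le> norm b + \<epsilon>" using h(1) norm_triangle_sub[of v b] by simp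
      show ?thesis
      proof (cases "norm u \<le> \<eta> \<and> norm b \<le> \<eta>")
        case True
        then show ?thesis using small[of u v] small[of u 0] small[of 0 b] v \<epsilon> \<eta> by simp
      next
        case False
        \<comment> \<open>The small argument may be replaced by 0 in the mixed term and its own pure
          term vanishes, so only the pure term of the other argument is left to compare.\<close>
        consider "norm u \<le> \<epsilon>" | "norm b \<le> \<epsilon>" using h(2) by blast
        then have "\<bar>f (\<Phi> u v) - f (\<Phi> u 0) - f (\<Phi> 0 b)\<bar> \<le> d"
        proof cases
          case 1
          then have "f (\<Phi> u 0) = 0" using \<epsilon> \<eta> by (intro small) auto
          moreover have "\<bar>f (\<Phi> u v) - f (\<Phi> 0 b)\<bar> \<le> d" using 1 h v \<epsilon> R \<eta> by (intro close) auto
          ultimately show ?thesis by simp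
        next
          case 2
          then have "f (\<Phi> 0 b) = 0" using \<epsilon> \<eta> by (intro small) auto
          moreover have "\<bar>f (\<Phi> u v) - f (\<Phi> u 0)\<bar> \<le> d" using 2 h v \<epsilon> R \<eta> by (intro close) auto
          ultimately show ?thesis by simp
        qed
        then show ?thesis using False by auto
      qed
    qed
    then show "\<exists>\<epsilon>>0. \<forall>u v b. norm (v - b) \<le> \<epsilon> \<longrightarrow> norm u \<le> \<epsilon> \<or> norm b \<le> \<epsilon> \<longrightarrow> norm u \<le> R \<longrightarrow> norm b \<le> R \<longrightarrow>
        \<bar>f (\<Phi> u v) - f (\<Phi> u 0) - f (\<Phi> 0 b)\<bar> \<le> (if norm u > \<eta> \<or> norm b > \<eta> then d else 0)" using \<epsilon>(1) by blast
  qed (use C \<eta> in auto)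
qed

lemma integrable_powr_le:
  fixes f :: "'a \<Rightarrow> real"
  assumes "finite_measure M" "f \<in> borel_measurable M" "integrable M (\<lambda>\<omega>. f \<omega> powr p)" "0 < q" "q \<le> p"
    "\<And>\<omega>. \<omega> \<in> space M \<Longrightarrow> 0 \<le> f \<omega>"
  shows "integrable M (\<lambda>\<omega>. f \<omega> powr q)"
proof -
  interpret finite_measure M by fact
  have "integrable M (\<lambda>\<omega>. 1 + f \<omega> powr p)" using assms by auto
  then show ?thesis
  proof (rule Bochner_Integration.integrable_bound)
    show "(\<lambda>\<omega>. f \<omega> powr q) \<in> borel_measurable M" using assms(2) by measurable
    show "AE \<omega> in M. norm (f \<omega> powr q) \<le> norm (1 + f \<omega> powr p)"
    proof (rule AE_I2)
      fix \<omega> assume w: "\<omega> \<in> space M"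
      have "f \<omega> powr q \<le> 1 + f \<omega> powr p"
      proof (cases "f \<omega> \<le> 1")
        case True
        then have "f \<omega> powr q \<le> 1" using assms(4) assms(6)[OF w] by (intro powr_le1) auto
        then show ?thesis using powr_ge_zero[of "f \<omega>" p] by linarith
      next
        case False
        then have "f \<omega> powr q \<le> f \<omega> powr p" using assms(5) by (intro powr_mono) auto
        then show ?thesis by simp
      qed
      then show "norm (f \<omega> powr q) \<le> norm (1 + f \<omega> powr p)" using powr_ge_zero[of "f \<omega>" p] by simp
    qed
  qed
qed

lemma markov_powr:
  fixes f :: "'a \<Rightarrow> real"
  assumes "finite_measure M" "f \<in> borel_measurable M" "integrable M (\<lambda>\<omega>. f \<omega> powr p)" "0 < p"
    "\<And>\<omega>. \<omega> \<in> space M \<Longrightarrow> 0 \<le> f \<omega>" "y > 0"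
  shows "measure M {\<omega>\<in>space M. f \<omega> > y} \<le> y powr - p * (\<integral>\<omega>. f \<omega> powr p \<partial>M)"
proof -
  interpret finite_measure M by fact
  define S where "S = {\<omega>\<in>space M. f \<omega> > y}"
  have s: "S \<in> sets M" unfolding S_def using assms(2) by measurable
  have "measure M S = (\<integral>\<omega>. indicator S \<omega> \<partial>M)" using s by simp
  also have "\<dots> \<le> (\<integral>\<omega>. y powr - p * f \<omega> powr p \<partial>M)"
  proof (rule integral_mono)
    show "integrable M (indicat_real S)"
      using s by (intro integrable_real_indicator) (auto simp: emeasure_finite less_top[symmetric])
    show "integrable M (\<lambda>\<omega>. y powr - p * f \<omega> powr p)" using assms(3) by simp
    fix \<omega> assume w: "\<omega> \<in> space M"
    show "indicator S \<omega> \<le> y powr - p * f \<omega> powr p"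
    proof (cases "f \<omega> > y")
      case True
      then have "y powr p \<le> f \<omega> powr p" using assms(4,6) by (intro powr_mono2) auto
      then have "1 \<le> y powr - p * f \<omega> powr p" using assms(6) by (simp add: powr_minus_divide field_simps)
      then show ?thesis by (simp add: indicator_def)
    qed (simp add: S_def)
  qed
  finally show ?thesis unfolding S_def by simp
qed

text \<open>\<open>V\<close> is the common normalisation of all tails. The moment of
  \<open>A\<close> is taken in the Euclidean matrix norm, to be derived from the operator norm.
  \<open>Tb\<close> is left abstract; its integral representation enters only in
  \<open>tail_chain\<close>.\<close>

locale heavy_chain = random_chain M N \<Phi> \<delta> A B1 B2 B3 As B1s B2s B3s
  for M :: "'w measure" and N :: "real^'n \<Rightarrow> real" and \<Phi> :: "real^'n \<Rightarrow> real^'n \<Rightarrow> real^'n" and \<delta> :: real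
    and A :: "'w \<Rightarrow> real^'n^'n" and B1 :: "'w \<Rightarrow> real^'n" and B2 :: "'w \<Rightarrow> real^'n \<Rightarrow> real^'n" and B3 :: "'w \<Rightarrow> real"
    and As :: "nat \<Rightarrow> 'w \<Rightarrow> real^'n^'n" and B1s :: "nat \<Rightarrow> 'w \<Rightarrow> real^'n"
    and B2s :: "nat \<Rightarrow> 'w \<Rightarrow> real^'n \<Rightarrow> real^'n" and B3s :: "nat \<Rightarrow> 'w \<Rightarrow> real" +
  fixes V :: "real \<Rightarrow> real" and \<alpha> :: real and Tb :: "(real^'n \<Rightarrow> real) \<Rightarrow> real"
  assumes norm: "is_norm N"
    and Phi_hom: "\<forall>t>0. \<forall>x y. \<Phi> (t *\<^sub>R x) (t *\<^sub>R y) = t *\<^sub>R \<Phi> x y"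
    and delta: "0 \<le> \<delta>" "\<delta> < 1"
    and alpha: "\<alpha> > 0"
    and V: "potter V \<alpha>"
    and B1_tail: "tail_functional V (distr M borel B1) Tb"
    and A_moment: "\<exists>\<beta>>\<alpha>. integrable M (\<lambda>\<omega>. norm (A \<omega>) powr \<beta>)"
    and B3_moment: "\<exists>\<epsilon>\<^sub>0>0. (0 < \<delta> \<longrightarrow> integrable M (\<lambda>\<omega>. B3 \<omega> powr (\<alpha> / \<delta> + \<epsilon>\<^sub>0))) \<and>
          (\<delta> = 0 \<longrightarrow> integrable M (\<lambda>\<omega>. B3 \<omega> powr (\<alpha> + \<epsilon>\<^sub>0)))"
begin

lemma measurable_inputs [measurable]:
  "A \<in> borel_measurable M" "B1 \<in> borel_measurable M" "B3 \<in> borel_measurable M"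
  using random_inputD[OF input] by auto

lemma V_pos: "t > 0 \<Longrightarrow> V t > 0"
  using V unfolding potter_def regvar_def by auto

lemma Phi_0_0: "\<Phi> 0 0 = 0"
proof -
  have "\<Phi> (2 *\<^sub>R 0) (2 *\<^sub>R 0) = 2 *\<^sub>R \<Phi> 0 0" using Phi_hom by (metis zero_less_numeral)
  then have "\<Phi> 0 0 = 2 *\<^sub>R \<Phi> 0 0" by simp
  then show ?thesis by (simp add: scaleR_2)
qed

lemma Phi_scale: "t > 0 \<Longrightarrow> \<Phi> x y /\<^sub>R t = \<Phi> (x /\<^sub>R t) (y /\<^sub>R t)"
  using Phi_hom by simp

lemma continuous_Phi: "continuous_on UNIV (\<lambda>x. \<Phi> x y)" "continuous_on UNIV (\<Phi> x)"
proof -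
  have "continuous_on UNIV (\<lambda>x. (x, y))" "continuous_on UNIV (\<lambda>y. (x, y))" by (intro continuous_intros)+
  from this[THEN continuous_on_compose2[OF Phi_cont]]
  show "continuous_on UNIV (\<lambda>x. \<Phi> x y)" "continuous_on UNIV (\<Phi> x)" by auto
qed

lemma Cb_away_Phi:
  assumes "f \<in> Cb_away"
  shows "(\<lambda>y. f (\<Phi> 0 y)) \<in> Cb_away" "(\<lambda>x. f (\<Phi> (a *v x) 0)) \<in> Cb_away"
proof -
  show "(\<lambda>y. f (\<Phi> 0 y)) \<in> Cb_away" by (rule Cb_away_compose[OF assms continuous_Phi(2) Phi_0_0])
  have "continuous_on UNIV (\<lambda>x. \<Phi> (a *v x) 0)"
    by (rule continuous_on_compose2[OF continuous_Phi(1)]) (auto intro: linear_continuous_on matrix_vector_mul_bounded_linear)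
  then show "(\<lambda>x. f (\<Phi> (a *v x) 0)) \<in> Cb_away"
    by (rule Cb_away_compose[OF assms]) (simp add: Phi_0_0)
qed

lemma B1_prob: "prob_space (distr M borel B1)"
  by (rule prob_space_distr) simp

lemma B1_bounded: "tail_bounded V (distr M borel B1)"
  by (rule tail_functional_bounded[OF B1_tail B1_prob]) (auto intro: V_pos)

context
  fixes \<kappa> :: "(real^'n) measure" and T
  assumes kappa: "prob_space \<kappa>" "sets \<kappa> = sets borel" and kappa_tail: "tail_functional V \<kappa> T"
begin

interpretation K: prob_space \<kappa> by (rule kappa)
interpretation P: pair_prob_space \<kappa> M ..

lemma space_kappa: "space \<kappa> = UNIV"
  using sets_eq_imp_space_eq[OF kappa(2)] by simp

lemma kappa_measurable_cong [measurable_cong]: "sets \<kappa> = sets borel" by (rule kappa)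

lemma kappa_bounded: "tail_bounded V \<kappa>"
  by (rule tail_functional_bounded[OF kappa_tail kappa]) (auto intro: V_pos)

text \<open>The Potter bound at the scale s/c, where c will be the norm of \<open>A\<close>. It
  produces powers of c with exponents \<alpha> \<plusminus> \<eta>, both at most \<beta>, and hence
  an integrable envelope for dominated convergence in \<omega>.\<close>

lemma kappa_dominated:
  obtains a b K t\<^sub>0 where "0 < b" "0 < a" "K > 0" "t\<^sub>0 > 0"
    "integrable M (\<lambda>\<omega>. norm (A \<omega>) powr a)" "integrable M (\<lambda>\<omega>. norm (A \<omega>) powr b)"
    "\<And>t s c. t \<ge> t\<^sub>0 \<Longrightarrow> s > 0 \<Longrightarrow> c \<ge> 0 \<Longrightarrow>
       V t * measure \<kappa> {x. norm x * c > s * t} \<le> K * (s powr - a * c powr a + s powr - b * c powr b)"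
proof -
  obtain \<beta> where \<beta>: "\<beta> > \<alpha>" "integrable M (\<lambda>\<omega>. norm (A \<omega>) powr \<beta>)" using A_moment by blast
  \<comment> \<open>Keeps \<alpha> + \<eta> within the available moment \<beta> and \<alpha> -
    \<eta> positive.\<close>
  define \<eta> where "\<eta> = min (\<beta> - \<alpha>) \<alpha> / 2"
  have \<eta>: "0 < \<eta>" "\<eta> < \<alpha>" "\<alpha> + \<eta> \<le> \<beta>" unfolding \<eta>_def using alpha \<beta> by (auto simp: min_def field_simps)
  obtain K t0 where K: "K > 0" "t0 > 0"
    "\<And>t s. t \<ge> t0 \<Longrightarrow> s > 0 \<Longrightarrow> V t * measure \<kappa> {x. norm x > s * t} \<le> K * (s powr - (\<alpha> + \<eta>) + s powr - (\<alpha> - \<eta>))"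
    by (rule potter_tail_bound[OF V kappa kappa_bounded \<eta>(1,2)]) blast
  show ?thesis
  proof (rule that[of "\<alpha> - \<eta>" "\<alpha> + \<eta>" K t0])
    have m: "(\<lambda>\<omega>. norm (A \<omega>)) \<in> borel_measurable M" by measurable
    show "integrable M (\<lambda>\<omega>. norm (A \<omega>) powr (\<alpha> + \<eta>))"
      by (rule integrable_powr_le[OF finite_measure_axioms m \<beta>(2)]) (use \<eta> alpha in auto)
    show "integrable M (\<lambda>\<omega>. norm (A \<omega>) powr (\<alpha> - \<eta>))"
      by (rule integrable_powr_le[OF finite_measure_axioms m \<beta>(2)]) (use \<eta> alpha in auto)
    fix t s c :: real assume t: "t \<ge> t0" and s: "s > 0" and c: "c \<ge> 0"
    have tp: "t > 0" using t K by simp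
    show "V t * measure \<kappa> {x. norm x * c > s * t} \<le> K * (s powr - (\<alpha> + \<eta>) * c powr (\<alpha> + \<eta>) + s powr - (\<alpha> - \<eta>) * c powr (\<alpha> - \<eta>))"
    proof (cases "c = 0")
      case True
      then have "{x::real^'n. norm x * c > s * t} = {}" using s tp by (auto simp: not_less)
      then show ?thesis using K by simp
    next
      case False
      then have c: "c > 0" using c by simp
      have "{x::real^'n. norm x * c > s * t} = {x. norm x > (s / c) * t}" using c by (auto simp: field_simps)
      then have "V t * measure \<kappa> {x. norm x * c > s * t} \<le> K * ((s / c) powr - (\<alpha> + \<eta>) + (s / c) powr - (\<alpha> - \<eta>))"
        using K(3)[OF t, of "s / c"] s c by simp
      also have "(s / c) powr - (\<alpha> + \<eta>) = s powr - (\<alpha> + \<eta>) * c powr (\<alpha> + \<eta>)" using s c by (simp only: powr_divide powr_minus_divide) (simp add: field_simps)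
      also have "(s / c) powr - (\<alpha> - \<eta>) = s powr - (\<alpha> - \<eta>) * c powr (\<alpha> - \<eta>)" using s c by (simp only: powr_divide powr_minus_divide) (simp add: field_simps)
      finally show ?thesis .
    qed
  qed (use \<eta> alpha K in auto)
qed

lemma measure_AX_fubini:
  "measure (\<kappa> \<Otimes>\<^sub>M M) {p\<in>space (\<kappa> \<Otimes>\<^sub>M M). norm (fst p) * norm (A (snd p)) > y}
     = (\<integral>\<omega>. measure \<kappa> {x. norm x * norm (A \<omega>) > y} \<partial>M)"
  "(\<lambda>\<omega>. measure \<kappa> {x. norm x * norm (A \<omega>) > y}) \<in> borel_measurable M"
proof -
  let ?E = "{p\<in>space (\<kappa> \<Otimes>\<^sub>M M). norm (fst p) * norm (A (snd p)) > y}"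
  have E: "?E \<in> sets (\<kappa> \<Otimes>\<^sub>M M)" by measurable
  have eq: "{x\<in>space \<kappa>. (x, \<omega>) \<in> ?E} = {x. norm x * norm (A \<omega>) > y}" if "\<omega> \<in> space M" for \<omega>
    using that by (auto simp: space_pair_measure space_kappa)
  show "measure (\<kappa> \<Otimes>\<^sub>M M) ?E = (\<integral>\<omega>. measure \<kappa> {x. norm x * norm (A \<omega>) > y} \<partial>M)"
    unfolding measure_pair_fubini(1)[OF kappa(1) prob_space_axioms E]
    by (rule Bochner_Integration.integral_cong[OF refl]) (simp only: eq)
  show "(\<lambda>\<omega>. measure \<kappa> {x. norm x * norm (A \<omega>) > y}) \<in> borel_measurable M"
    using measure_pair_fubini(2)[OF kappa(1) prob_space_axioms E] by (rule measurable_cong[THEN iffD1, rotated]) (simp only: eq)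
qed

lemma AX_tail:
  obtains a b K t\<^sub>0 where "0 < b" "0 < a" "K > 0" "t\<^sub>0 > 0"
    "\<And>t s. t \<ge> t\<^sub>0 \<Longrightarrow> s > 0 \<Longrightarrow>
       V t * measure (\<kappa> \<Otimes>\<^sub>M M) {p\<in>space (\<kappa> \<Otimes>\<^sub>M M). norm (fst p) * norm (A (snd p)) > s * t} \<le> K * (s powr - a + s powr - b)"
proof -
  obtain a b K t0 where K: "0 < b" "0 < a" "K > 0" "t0 > 0"
    "integrable M (\<lambda>\<omega>. norm (A \<omega>) powr a)" "integrable M (\<lambda>\<omega>. norm (A \<omega>) powr b)"
    "\<And>t s c. t \<ge> t0 \<Longrightarrow> s > 0 \<Longrightarrow> c \<ge> 0 \<Longrightarrow>
       V t * measure \<kappa> {x. norm x * c > s * t} \<le> K * (s powr - a * c powr a + s powr - b * c powr b)"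
    by (rule kappa_dominated) blast
  define Ea where "Ea = (\<integral>\<omega>. norm (A \<omega>) powr a \<partial>M)"
  define Eb where "Eb = (\<integral>\<omega>. norm (A \<omega>) powr b \<partial>M)"
  have E: "Ea \<ge> 0" "Eb \<ge> 0" unfolding Ea_def Eb_def by (auto intro: Bochner_Integration.integral_nonneg)
  show ?thesis
  proof (rule that[of b a "K * (Ea + Eb + 1)" t0])
    fix t s :: real assume t: "t \<ge> t0" and s: "s > 0"
    have tp: "t > 0" using t K by simp
    have "V t * measure (\<kappa> \<Otimes>\<^sub>M M) {p\<in>space (\<kappa> \<Otimes>\<^sub>M M). norm (fst p) * norm (A (snd p)) > s * t}
       = (\<integral>\<omega>. V t * measure \<kappa> {x. norm x * norm (A \<omega>) > s * t} \<partial>M)" unfolding measure_AX_fubini(1) by simp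
    also have "\<dots> \<le> (\<integral>\<omega>. K * (s powr - a * norm (A \<omega>) powr a + s powr - b * norm (A \<omega>) powr b) \<partial>M)"
    proof (rule integral_mono)
      show "integrable M (\<lambda>\<omega>. V t * measure \<kappa> {x. norm x * norm (A \<omega>) > s * t})"
        by (intro integrable_mult_right integrable_const_bound[of _ 1] measure_AX_fubini(2)) auto
      show "integrable M (\<lambda>\<omega>. K * (s powr - a * norm (A \<omega>) powr a + s powr - b * norm (A \<omega>) powr b))"
        using K by auto
    qed (use K(7)[OF t s] in auto)
    also have "\<dots> = K * (s powr - a * Ea + s powr - b * Eb)" unfolding Ea_def Eb_def using K by simp
    also have "\<dots> \<le> K * (s powr - a * (Ea + Eb + 1) + s powr - b * (Ea + Eb + 1))"
      using E K by (intro mult_left_mono add_mono) auto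
    finally show "V t * measure (\<kappa> \<Otimes>\<^sub>M M) {p\<in>space (\<kappa> \<Otimes>\<^sub>M M). norm (fst p) * norm (A (snd p)) > s * t} \<le> K * (Ea + Eb + 1) * (s powr - a + s powr - b)"
      by (simp add: algebra_simps)
  qed (use K E in \<open>auto intro!: mult_pos_pos\<close>)
qed

text \<open>\<open>A\<close> and \<open>B1\<close> may be dependent, so the probability does not
  factor. Integrating the state first leaves V(t) P(|x| |A| > s t), which has an integrable
  envelope, times the indicator of |B1| > s t, which for fixed \<omega> is eventually 0.\<close>

lemma both_large:
  assumes s: "s > 0"
  shows "((\<lambda>t. V t * measure (\<kappa> \<Otimes>\<^sub>M M) {p\<in>space (\<kappa> \<Otimes>\<^sub>M M). norm (fst p) * norm (A (snd p)) > s * t \<and> norm (B1 (snd p)) > s * t}) \<longlongrightarrow> 0) at_top"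
proof -
  obtain a b K t0 where K: "0 < b" "0 < a" "K > 0" "t0 > 0"
    "integrable M (\<lambda>\<omega>. norm (A \<omega>) powr a)" "integrable M (\<lambda>\<omega>. norm (A \<omega>) powr b)"
    "\<And>t s c. t \<ge> t0 \<Longrightarrow> s > 0 \<Longrightarrow> c \<ge> 0 \<Longrightarrow>
       V t * measure \<kappa> {x. norm x * c > s * t} \<le> K * (s powr - a * c powr a + s powr - b * c powr b)"
    by (rule kappa_dominated) blast
  let ?E = "\<lambda>t. {p\<in>space (\<kappa> \<Otimes>\<^sub>M M). norm (fst p) * norm (A (snd p)) > s * t \<and> norm (B1 (snd p)) > s * t}"
  have E: "?E t \<in> sets (\<kappa> \<Otimes>\<^sub>M M)" for t by measurable
  let ?m = "\<lambda>t \<omega>. V t * (measure \<kappa> {x. norm x * norm (A \<omega>) > s * t} * indicator {\<omega>. norm (B1 \<omega>) > s * t} \<omega>)"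
  have mm: "?m t \<in> borel_measurable M" for t
  proof -
    have "(\<lambda>\<omega>. indicat_real {\<omega>. norm (B1 \<omega>) > s * t} \<omega>) \<in> borel_measurable M"
    proof -
      have "(\<lambda>\<omega>. indicat_real {\<omega>. norm (B1 \<omega>) > s * t} \<omega>) = (\<lambda>\<omega>. indicat_real {y. norm y > s * t} (B1 \<omega>))" by (auto simp: indicator_def)
      moreover have "(\<lambda>\<omega>. indicat_real {y. norm y > s * t} (B1 \<omega>)) \<in> borel_measurable M" by measurable
      ultimately show ?thesis by simp
    qed
    then show ?thesis using measure_AX_fubini(2)[of "s * t"] by (intro borel_measurable_times) auto
  qed
  have eq: "V t * measure (\<kappa> \<Otimes>\<^sub>M M) (?E t) = (\<integral>\<omega>. ?m t \<omega> \<partial>M)" for t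
  proof -
    have "measure \<kappa> {x\<in>space \<kappa>. (x, \<omega>) \<in> ?E t} = measure \<kappa> {x. norm x * norm (A \<omega>) > s * t} * indicator {\<omega>. norm (B1 \<omega>) > s * t} \<omega>"
      if "\<omega> \<in> space M" for \<omega>
      using that by (cases "norm (B1 \<omega>) > s * t") (auto simp: space_pair_measure space_kappa)
    then have "measure (\<kappa> \<Otimes>\<^sub>M M) (?E t) = (\<integral>\<omega>. measure \<kappa> {x. norm x * norm (A \<omega>) > s * t} * indicator {\<omega>. norm (B1 \<omega>) > s * t} \<omega> \<partial>M)"
      unfolding measure_pair_fubini(1)[OF kappa(1) prob_space_axioms E] by (rule Bochner_Integration.integral_cong[OF refl])
    then show ?thesis by simp
  qed
  have "((\<lambda>t. \<integral>\<omega>. ?m t \<omega> \<partial>M) \<longlongrightarrow> (\<integral>\<omega>. 0 \<partial>M)) at_top"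
  proof (rule integral_dominated_convergence_at_top[where w="\<lambda>\<omega>. K * (s powr - a * norm (A \<omega>) powr a + s powr - b * norm (A \<omega>) powr b)"])
    show "integrable M (\<lambda>\<omega>. K * (s powr - a * norm (A \<omega>) powr a + s powr - b * norm (A \<omega>) powr b))" using K by auto
    show "eventually (\<lambda>t. AE \<omega> in M. norm (?m t \<omega>) \<le> K * (s powr - a * norm (A \<omega>) powr a + s powr - b * norm (A \<omega>) powr b)) at_top"
      using eventually_ge_at_top[of t0]
    proof eventually_elim
      case (elim t)
      then have "V t > 0" using K V_pos by simp
      show ?case
      proof (rule AE_I2)
        fix \<omega>
        have "norm (?m t \<omega>) \<le> V t * measure \<kappa> {x. norm x * norm (A \<omega>) > s * t}"
          using \<open>V t > 0\<close> by (auto simp: indicator_def)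
        also have "\<dots> \<le> K * (s powr - a * norm (A \<omega>) powr a + s powr - b * norm (A \<omega>) powr b)" by (rule K(7)[OF elim s]) simp
        finally show "norm (?m t \<omega>) \<le> K * (s powr - a * norm (A \<omega>) powr a + s powr - b * norm (A \<omega>) powr b)" .
      qed
    qed
    show "AE \<omega> in M. ((\<lambda>t. ?m t \<omega>) \<longlongrightarrow> 0) at_top"
    proof (rule AE_I2)
      fix \<omega>
      have "eventually (\<lambda>t. ?m t \<omega> = 0) at_top" using eventually_ge_at_top[of "norm (B1 \<omega>) / s"]
        by eventually_elim (use s in \<open>simp add: field_simps\<close>)
      then show "((\<lambda>t. ?m t \<omega>) \<longlongrightarrow> 0) at_top" by (rule tendsto_eventually)
    qed
    show "?m t \<in> borel_measurable M" for t by (rule mm)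
  qed simp
  then show ?thesis by (simp add: eq)
qed

text \<open>Moves the growth bound from \<open>N\<close> to the Euclidean norm; the case \<delta> =
  0 keeps its separate reading, in which the power is 1 even at the origin.\<close>

lemma B2_bound:
  obtains c where "c > 0" "\<And>\<omega> x. \<omega> \<in> space M \<Longrightarrow> norm (B2 \<omega> x) \<le> c * B3 \<omega> * (if \<delta> = 0 then 1 else norm x powr \<delta>)"
proof -
  obtain c where c: "c > 0" "\<And>x. N x \<le> c * norm x" "\<And>x. norm x \<le> c * N x" by (rule is_norm_equiv[OF norm]) blast
  have Np: "N x \<ge> 0" for x using norm unfolding is_norm_def by auto
  show ?thesis
  proof (rule that[of "c * max 1 (c powr \<delta>)"])
    show "c * max 1 (c powr \<delta>) > 0" using c by (intro mult_pos_pos) auto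
    fix \<omega> x assume w: "\<omega> \<in> space M"
    have p: "N x powr \<delta> \<le> c powr \<delta> * norm x powr \<delta>"
      using powr_mono2[of \<delta> "N x" "c * norm x"] c(2)[of x] Np[of x] delta c(1) by (simp add: powr_mult)
    have "(if \<delta> = 0 then 1 else N x powr \<delta>) \<le> max 1 (c powr \<delta>) * (if \<delta> = 0 then 1 else norm x powr \<delta>)"
    proof (cases "\<delta> = 0")
      case False
      have "c powr \<delta> * norm x powr \<delta> \<le> max 1 (c powr \<delta>) * norm x powr \<delta>" by (intro mult_right_mono) auto
      then show ?thesis using p False by simp
    qed simp
    then have "B3 \<omega> * (if \<delta> = 0 then 1 else N x powr \<delta>) \<le> B3 \<omega> * (max 1 (c powr \<delta>) * (if \<delta> = 0 then 1 else norm x powr \<delta>))"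
      by (rule mult_left_mono) (rule random_inputD(7)[OF input w])
    then have "c * N (B2 \<omega> x) \<le> c * (B3 \<omega> * (max 1 (c powr \<delta>) * (if \<delta> = 0 then 1 else norm x powr \<delta>)))"
      using random_inputD(8)[OF input w, of x] c(1) by (intro mult_left_mono) auto
    then show "norm (B2 \<omega> x) \<le> c * max 1 (c powr \<delta>) * B3 \<omega> * (if \<delta> = 0 then 1 else norm x powr \<delta>)"
      using c(3)[of "B2 \<omega> x"] by (simp add: mult_ac)
  qed
qed

lemma B2_continuous: "\<omega> \<in> space M \<Longrightarrow> continuous_on UNIV (B2 \<omega>)"
proof -
  assume w: "\<omega> \<in> space M"
  have "continuous_on UNIV (\<lambda>x. (B1 \<omega> + B2 \<omega> x) - B1 \<omega>)" by (intro continuous_intros random_inputD(6)[OF input w])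
  then show ?thesis by simp
qed

lemma measurable_B2 [measurable]: "(\<lambda>p. B2 (snd p) (fst p)) \<in> borel_measurable (\<kappa> \<Otimes>\<^sub>M M)"
proof -
  have "(\<lambda>p. B2 (snd p) (fst p)) \<in> borel_measurable (borel \<Otimes>\<^sub>M M)"
    by (rule measurable_caratheodory[OF random_inputD(3)[OF input] B2_continuous])
  then show ?thesis by (simp add: measurable_cong_sets[OF sets_pair_measure_cong[OF kappa(2) refl] refl])
qed

text \<open>For \<delta> > 0 a value |B2(x)| > y forces |x| > (y / (c B3))^(1/\<delta>), so a tail
  exponent a < \<alpha> of the state becomes a/\<delta>, which can be made larger than \<alpha>. For
  \<delta> = 0 the bound on B2 does not involve the state, and Markov's inequality for B3
  suffices.\<close>

lemma B2_polynomial_tail: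
  obtains K q where "q > \<alpha>" "\<And>y. y > 0 \<Longrightarrow> measure (\<kappa> \<Otimes>\<^sub>M M) {p\<in>space (\<kappa> \<Otimes>\<^sub>M M). norm (B2 (snd p) (fst p)) > y} \<le> K * y powr - q"
proof -
  obtain c where c: "c > 0" "\<And>\<omega> x. \<omega> \<in> space M \<Longrightarrow> norm (B2 \<omega> x) \<le> c * B3 \<omega> * (if \<delta> = 0 then 1 else norm x powr \<delta>)"
    by (rule B2_bound) blast
  let ?E = "\<lambda>y. {p\<in>space (\<kappa> \<Otimes>\<^sub>M M). norm (B2 (snd p) (fst p)) > y}"
  have E: "?E y \<in> sets (\<kappa> \<Otimes>\<^sub>M M)" for y by measurable
  have B3p: "B3 \<omega> \<ge> 0" if "\<omega> \<in> space M" for \<omega> by (rule random_inputD(7)[OF input that])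
  obtain \<epsilon> where \<epsilon>: "\<epsilon> > 0" "0 < \<delta> \<Longrightarrow> integrable M (\<lambda>\<omega>. B3 \<omega> powr (\<alpha> / \<delta> + \<epsilon>))" "\<delta> = 0 \<Longrightarrow> integrable M (\<lambda>\<omega>. B3 \<omega> powr (\<alpha> + \<epsilon>))"
    using B3_moment by blast
  have mE: "measure (\<kappa> \<Otimes>\<^sub>M M) (?E y) \<le> (\<integral>\<omega>. h \<omega> \<partial>M)"
    if "integrable M h" "\<And>\<omega>. \<omega> \<in> space M \<Longrightarrow> measure \<kappa> {x. norm (B2 \<omega> x) > y} \<le> h \<omega>" for h y
  proof -
    have 1: "measure \<kappa> {x\<in>space \<kappa>. (x, \<omega>) \<in> ?E y} \<le> h \<omega>" if "\<omega> \<in> space M" for \<omega>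
      using \<open>\<And>\<omega>. \<omega> \<in> space M \<Longrightarrow> measure \<kappa> {x. norm (B2 \<omega> x) > y} \<le> h \<omega>\<close>[OF that] that by (simp add: space_pair_measure space_kappa)
    show ?thesis unfolding measure_pair_fubini(1)[OF kappa(1) prob_space_axioms E]
    proof (rule integral_mono[OF _ that(1) 1])
      show "integrable M (\<lambda>\<omega>. measure \<kappa> {x\<in>space \<kappa>. (x, \<omega>) \<in> ?E y})"
        by (rule integrable_const_bound[of _ 1, OF _ measure_pair_fubini(2)[OF kappa(1) prob_space_axioms E]]) simp
    qed
  qed
  show ?thesis
  proof (cases "\<delta> = 0")
    case True
    define I where "I = (\<integral>\<omega>. B3 \<omega> powr (\<alpha> + \<epsilon>) \<partial>M)"
    show ?thesis
    proof (rule that[of "\<alpha> + \<epsilon>" "c powr (\<alpha> + \<epsilon>) * I"])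
      fix y :: real assume y: "y > 0"
      have yc: "y / c > 0" using y c by simp
      have s: "{\<omega>\<in>space M. B3 \<omega> > y / c} \<in> sets M" by measurable
      have "measure (\<kappa> \<Otimes>\<^sub>M M) (?E y) \<le> (\<integral>\<omega>. indicator {\<omega>\<in>space M. B3 \<omega> > y / c} \<omega> \<partial>M)"
      proof (rule mE)
        show "integrable M (indicat_real {\<omega>\<in>space M. B3 \<omega> > y / c})"
          using s by (intro integrable_real_indicator) (auto simp: emeasure_finite less_top[symmetric])
        fix \<omega> assume w: "\<omega> \<in> space M"
        show "measure \<kappa> {x. norm (B2 \<omega> x) > y} \<le> indicator {\<omega>\<in>space M. B3 \<omega> > y / c} \<omega>"
        proof (cases "B3 \<omega> > y / c")
          case False
          then have "c * B3 \<omega> \<le> y" using c by (simp add: field_simps)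
          then have "{x. norm (B2 \<omega> x) > y} = {}" using c(2)[OF w] True by (auto simp: not_less intro: order_trans)
          then show ?thesis by simp
        qed (use w in \<open>simp add: indicator_def\<close>)
      qed
      also have "\<dots> = measure M {\<omega>\<in>space M. B3 \<omega> > y / c}" using s by simp
      also have "\<dots> \<le> (y / c) powr - (\<alpha> + \<epsilon>) * I" unfolding I_def
        by (rule markov_powr[OF finite_measure_axioms _ \<epsilon>(3)[OF True]]) (use alpha \<epsilon> B3p yc in auto)
      also have "(y / c) powr - (\<alpha> + \<epsilon>) = c powr (\<alpha> + \<epsilon>) * y powr - (\<alpha> + \<epsilon>)"
        using y c by (simp only: powr_divide powr_minus_divide) (simp add: field_simps)
      finally show "measure (\<kappa> \<Otimes>\<^sub>M M) (?E y) \<le> c powr (\<alpha> + \<epsilon>) * I * y powr - (\<alpha> + \<epsilon>)" by (simp add: mult_ac)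
    qed (use \<epsilon> in simp)
  next
    case False
    then have d: "0 < \<delta>" using delta by simp
    \<comment> \<open>The midpoint of \<alpha> \<delta> and \<alpha>: a < \<alpha> is an available
      tail exponent, q = a/\<delta> exceeds \<alpha>, and q is below \<alpha>/\<delta>, so B3 has a
      finite moment of order q.\<close>
    define a where "a = \<alpha> * (1 + \<delta>) / 2"
    have "0 < \<alpha> * (1 + \<delta>)" "\<alpha> * (1 + \<delta>) < \<alpha> * 2" using alpha delta by (auto intro!: mult_pos_pos mult_strict_left_mono)
    then have a: "0 < a" "a < \<alpha>" unfolding a_def by auto
    define q where "q = a / \<delta>"
    have "\<alpha> * \<delta> < a" unfolding a_def using alpha delta d by (auto simp: field_simps)
    then have q: "q > \<alpha>" "q > 0" unfolding q_def using d a by (auto simp: field_simps)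
    have "q \<le> \<alpha> / \<delta> + \<epsilon>" unfolding q_def using a d \<epsilon> divide_right_mono[of a \<alpha> \<delta>] by linarith
    then have iq: "integrable M (\<lambda>\<omega>. B3 \<omega> powr q)"
      using q by (intro integrable_powr_le[OF finite_measure_axioms _ \<epsilon>(2)[OF d]] B3p) auto
    obtain K where K: "K > 0" "\<And>y. y > 0 \<Longrightarrow> measure \<kappa> {x. norm x > y} \<le> K * y powr - a"
      by (rule potter_tail_polynomial[OF V kappa(1) kappa_bounded a]) blast
    define I where "I = (\<integral>\<omega>. B3 \<omega> powr q \<partial>M)"
    show ?thesis
    proof (rule that[of q "K * c powr q * I"])
      fix y :: real assume y: "y > 0"
      have "measure (\<kappa> \<Otimes>\<^sub>M M) (?E y) \<le> (\<integral>\<omega>. K * c powr q * y powr - q * B3 \<omega> powr q \<partial>M)"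
      proof (rule mE)
        show "integrable M (\<lambda>\<omega>. K * c powr q * y powr - q * B3 \<omega> powr q)" using iq by simp
        fix \<omega> assume w: "\<omega> \<in> space M"
        show "measure \<kappa> {x. norm (B2 \<omega> x) > y} \<le> K * c powr q * y powr - q * B3 \<omega> powr q"
        proof (cases "B3 \<omega> = 0")
          case True
          then have "norm (B2 \<omega> x) \<le> 0" for x using c(2)[OF w, of x] by simp
          then have "{x. norm (B2 \<omega> x) > y} = {}" using y by auto
          then show ?thesis using True by simp
        next
          case False
          then have b: "B3 \<omega> > 0" using B3p[OF w] by simp
          define z where "z = y / (c * B3 \<omega>)"
          have z: "z > 0" unfolding z_def using y c b by simp
          have "{x. norm (B2 \<omega> x) > y} \<subseteq> {x. norm x > z powr (1/\<delta>)}"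
          proof
            fix x assume "x \<in> {x. norm (B2 \<omega> x) > y}"
            then have "y < c * B3 \<omega> * norm x powr \<delta>" using c(2)[OF w, of x] d by simp
            then have "z < norm x powr \<delta>" unfolding z_def using c b by (simp add: field_simps)
            then have "z powr (1/\<delta>) < (norm x powr \<delta>) powr (1/\<delta>)" using z d by (intro powr_less_mono2) auto
            then show "x \<in> {x. norm x > z powr (1/\<delta>)}" using d by (simp add: powr_powr)
          qed
          then have "measure \<kappa> {x. norm (B2 \<omega> x) > y} \<le> measure \<kappa> {x. norm x > z powr (1/\<delta>)}"
            by (rule K.finite_measure_mono) (simp add: kappa)
          also have "\<dots> \<le> K * (z powr (1/\<delta>)) powr - a" using z by (intro K) simp
          also have "(z powr (1/\<delta>)) powr - a = z powr - q" unfolding q_def by (simp add: powr_powr)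
          also have "z powr - q = c powr q * B3 \<omega> powr q * y powr - q"
            unfolding z_def using y c b by (simp only: powr_divide powr_minus_divide powr_mult) (simp add: powr_divide powr_mult field_simps)
          finally show ?thesis by (simp add: mult_ac)
        qed
      qed
      then show "measure (\<kappa> \<Otimes>\<^sub>M M) (?E y) \<le> K * c powr q * I * y powr - q" unfolding I_def by (simp add: mult_ac)
    qed (use q in simp)
  qed
qed

lemma B2_negligible:
  assumes e: "e > 0"
  shows "((\<lambda>t. V t * measure (\<kappa> \<Otimes>\<^sub>M M) {p\<in>space (\<kappa> \<Otimes>\<^sub>M M). norm (B2 (snd p) (fst p)) > e * t}) \<longlongrightarrow> 0) at_top"
proof -
  obtain K q where K: "q > \<alpha>" "\<And>y. y > 0 \<Longrightarrow> measure (\<kappa> \<Otimes>\<^sub>M M) {p\<in>space (\<kappa> \<Otimes>\<^sub>M M). norm (B2 (snd p) (fst p)) > y} \<le> K * y powr - q"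
    by (rule B2_polynomial_tail) blast
  have lim: "((\<lambda>t. (K * e powr - q) * (V t * t powr - q)) \<longlongrightarrow> (K * e powr - q) * 0) at_top"
    by (intro tendsto_intros potter_growth[OF V alpha K(1)])
  show ?thesis
  proof (rule tendsto_sandwich[OF _ _ tendsto_const])
    show "((\<lambda>t. (K * e powr - q) * (V t * t powr - q)) \<longlongrightarrow> 0) at_top" using lim by simp
    show "eventually (\<lambda>t. 0 \<le> V t * measure (\<kappa> \<Otimes>\<^sub>M M) {p\<in>space (\<kappa> \<Otimes>\<^sub>M M). norm (B2 (snd p) (fst p)) > e * t}) at_top"
      using eventually_gt_at_top[of 0] by eventually_elim (use V_pos in \<open>simp add: less_imp_le\<close>)
    show "eventually (\<lambda>t. V t * measure (\<kappa> \<Otimes>\<^sub>M M) {p\<in>space (\<kappa> \<Otimes>\<^sub>M M). norm (B2 (snd p) (fst p)) > e * t} \<le> (K * e powr - q) * (V t * t powr - q)) at_top"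
      using eventually_gt_at_top[of 0]
    proof eventually_elim
      case (elim t)
      have "V t * measure (\<kappa> \<Otimes>\<^sub>M M) {p\<in>space (\<kappa> \<Otimes>\<^sub>M M). norm (B2 (snd p) (fst p)) > e * t} \<le> V t * (K * (e * t) powr - q)"
        using V_pos[OF elim] e elim by (intro mult_left_mono K) auto
      also have "\<dots> = (K * e powr - q) * (V t * t powr - q)" using e elim by (simp add: powr_mult)
      finally show ?case .
    qed
  qed
qed

end

section \<open>Limit of the tail under one step of the chain\<close>

context
  fixes \<kappa> :: "(real^'n) measure" and T
  assumes kappa: "prob_space \<kappa>" "sets \<kappa> = sets borel" and kappa_tail: "tail_functional V \<kappa> T"
begin

interpretation K: prob_space \<kappa> by (rule kappa)
interpretation P: pair_prob_space \<kappa> M ..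

lemma kappa_cong [measurable_cong]: "sets \<kappa> = sets borel" by (rule kappa)

lemma measurable_pair_borel:
  "fst \<in> measurable (\<kappa> \<Otimes>\<^sub>M M) borel" "snd \<in> measurable (M \<Otimes>\<^sub>M \<kappa>) borel"
  using measurable_fst[of \<kappa> M] measurable_snd[of M \<kappa>] by (simp_all add: measurable_cong_sets[OF refl kappa(2)])

text \<open>Breiman's lemma in functional form: for a frozen matrix the limit is \<open>T\<close> of
  a composed test function, and the Potter envelope lets the expectation over \<open>A\<close> pass
  through the limit.\<close>

lemma A_limit:
  assumes f: "f \<in> Cb_away"
  shows "integrable M (\<lambda>\<omega>. T (\<lambda>x. f (\<Phi> (A \<omega> *v x) 0)))"
    "((\<lambda>t. V t * (\<integral>\<omega>. (\<integral>x. f (\<Phi> (A \<omega> *v (x /\<^sub>R t)) 0) \<partial>\<kappa>) \<partial>M)) \<longlongrightarrow> (\<integral>\<omega>. T (\<lambda>x. f (\<Phi> (A \<omega> *v x) 0)) \<partial>M)) at_top"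
proof -
  define g where "g = (\<lambda>x. f (\<Phi> x 0))"
  have g: "g \<in> Cb_away" unfolding g_def by (rule Cb_away_compose[OF f continuous_Phi(1) Phi_0_0])
  have [measurable]: "g \<in> borel_measurable borel" by (rule borel_Cb_away[OF g])
  obtain C r where C: "continuous_on UNIV g" "C > 0" "\<And>x. \<bar>g x\<bar> \<le> C" "r > 0" "\<And>x. norm x < r \<Longrightarrow> g x = 0"
    by (rule Cb_awayE[OF g]) blast
  obtain a b K t0 where K: "0 < b" "0 < a" "K > 0" "t0 > 0"
    "integrable M (\<lambda>\<omega>. norm (A \<omega>) powr a)" "integrable M (\<lambda>\<omega>. norm (A \<omega>) powr b)"
    "\<And>t s c. t \<ge> t0 \<Longrightarrow> s > 0 \<Longrightarrow> c \<ge> 0 \<Longrightarrow>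
       V t * measure \<kappa> {x. norm x * c > s * t} \<le> K * (s powr - a * c powr a + s powr - b * c powr b)"
    by (rule kappa_dominated[OF kappa kappa_tail]) blast
  define s where "s t \<omega> = V t * (\<integral>x. g (A \<omega> *v (x /\<^sub>R t)) \<partial>\<kappa>)" for t \<omega>
  define w where "w \<omega> = C * (K * ((r/2) powr - a * norm (A \<omega>) powr a + (r/2) powr - b * norm (A \<omega>) powr b))" for \<omega>
  have w: "integrable M w" unfolding w_def using K by auto
  have sm: "s t \<in> borel_measurable M" for t
  proof -
    note [measurable] = measurable_pair_borel
    have "(\<lambda>p. A (fst p) *v (snd p /\<^sub>R t)) \<in> borel_measurable (M \<Otimes>\<^sub>M \<kappa>)" by measurable
    from measurable_compose[OF this borel_Cb_away[OF g]]
    have "(\<lambda>(\<omega>, x). g (A \<omega> *v (x /\<^sub>R t))) \<in> borel_measurable (M \<Otimes>\<^sub>M \<kappa>)" by (simp add: case_prod_unfold)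
    from K.borel_measurable_lebesgue_integral[OF this] show ?thesis unfolding s_def[abs_def] by measurable
  qed
  have bound: "norm (s t \<omega>) \<le> w \<omega>" if t: "t \<ge> t0" for t \<omega>
  proof -
    have tp: "t > 0" using t K by simp
    have "\<bar>\<integral>x. g (A \<omega> *v (x /\<^sub>R t)) \<partial>\<kappa>\<bar> \<le> C * measure \<kappa> {x. norm x * norm (A \<omega>) > (r/2) * t}"
    proof (rule integral_le_measure)
      show "(\<lambda>x. g (A \<omega> *v (x /\<^sub>R t))) \<in> borel_measurable borel" by measurable
      show "{x. norm x * norm (A \<omega>) > (r/2) * t} \<in> sets borel" by measurable
      show "g (A \<omega> *v (x /\<^sub>R t)) = 0" if "x \<notin> {x. norm x * norm (A \<omega>) > (r/2) * t}" for x
      proof (rule C(5))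
        have "norm (A \<omega> *v (x /\<^sub>R t)) \<le> norm (A \<omega>) * norm (x /\<^sub>R t)" by (rule norm_matrix_vector_mult_le)
        also have "\<dots> = (norm x * norm (A \<omega>)) / t" using tp by (simp add: field_simps)
        also have "\<dots> \<le> r/2" using that tp by (simp add: field_simps not_less)
        finally show "norm (A \<omega> *v (x /\<^sub>R t)) < r" using C(4) by simp
      qed
    qed (use kappa C K.finite_measure_axioms in auto)
    then have "norm (s t \<omega>) \<le> C * (V t * measure \<kappa> {x. norm x * norm (A \<omega>) > (r/2) * t})"
      unfolding s_def using mult_left_mono[of _ _ "V t"] V_pos[OF tp] by (simp add: abs_mult mult_ac)
    also have "\<dots> \<le> w \<omega>" unfolding w_def using C(2,4) by (intro mult_left_mono K(7)[OF t]) auto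
    finally show ?thesis .
  qed
  have lim: "((\<lambda>t. s t \<omega>) \<longlongrightarrow> T (\<lambda>x. g (A \<omega> *v x))) at_top" for \<omega>
    using bspec[OF kappa_tail[unfolded tail_functional_def] Cb_away_Phi(2)[OF f, of "A \<omega>"]] unfolding s_def g_def .
  have limn: "(\<lambda>n. s (real n) \<omega>) \<longlonglongrightarrow> T (\<lambda>x. g (A \<omega> *v x))" for \<omega>
    by (rule filterlim_compose[OF lim filterlim_real_sequentially])
  \<comment> \<open>\<open>T\<close> is an arbitrary functional, so measurability in \<omega> is
    obtained from the limit along integer scales.\<close>
  have Tm: "(\<lambda>\<omega>. T (\<lambda>x. g (A \<omega> *v x))) \<in> borel_measurable M"
    by (rule borel_measurable_LIMSEQ_real[OF limn sm])
  have "\<bar>T (\<lambda>x. g (A \<omega> *v x))\<bar> \<le> w \<omega>" for \<omega>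
  proof (rule tendsto_upperbound)
    show "((\<lambda>t. \<bar>s t \<omega>\<bar>) \<longlongrightarrow> \<bar>T (\<lambda>x. g (A \<omega> *v x))\<bar>) at_top" by (intro tendsto_rabs lim)
    show "eventually (\<lambda>t. \<bar>s t \<omega>\<bar> \<le> w \<omega>) at_top" using eventually_ge_at_top[of t0]
      by eventually_elim (use bound in simp)
  qed simp
  then show "integrable M (\<lambda>\<omega>. T (\<lambda>x. f (\<Phi> (A \<omega> *v x) 0)))"
  proof -
    assume "\<And>\<omega>. \<bar>T (\<lambda>x. g (A \<omega> *v x))\<bar> \<le> w \<omega>"
    then have "AE \<omega> in M. norm (T (\<lambda>x. g (A \<omega> *v x))) \<le> norm (w \<omega>)" by (intro AE_I2) (simp add: order_trans[OF _ abs_ge_self])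
    from Bochner_Integration.integrable_bound[OF w Tm this] show ?thesis unfolding g_def .
  qed
  have "((\<lambda>t. \<integral>\<omega>. s t \<omega> \<partial>M) \<longlongrightarrow> (\<integral>\<omega>. T (\<lambda>x. g (A \<omega> *v x)) \<partial>M)) at_top"
  proof (rule integral_dominated_convergence_at_top[OF Tm sm w])
    show "eventually (\<lambda>t. AE \<omega> in M. norm (s t \<omega>) \<le> w \<omega>) at_top"
      using eventually_ge_at_top[of t0] by eventually_elim (use bound in simp)
  qed (use lim in simp)
  then show "((\<lambda>t. V t * (\<integral>\<omega>. (\<integral>x. f (\<Phi> (A \<omega> *v (x /\<^sub>R t)) 0) \<partial>\<kappa>) \<partial>M)) \<longlongrightarrow> (\<integral>\<omega>. T (\<lambda>x. f (\<Phi> (A \<omega> *v x) 0)) \<partial>M)) at_top"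
    unfolding s_def g_def by simp
qed

lemma B1_marginal:
  "measure (\<kappa> \<Otimes>\<^sub>M M) {p\<in>space (\<kappa> \<Otimes>\<^sub>M M). norm (B1 (snd p)) > y} = measure (distr M borel B1) {x. norm x > y}"
proof -
  let ?E = "{p\<in>space (\<kappa> \<Otimes>\<^sub>M M). norm (B1 (snd p)) > y}"
  have E: "?E \<in> sets (\<kappa> \<Otimes>\<^sub>M M)" by measurable
  define S where "S = {\<omega>\<in>space M. norm (B1 \<omega>) > y}"
  have S: "S \<in> sets M" unfolding S_def by measurable
  have "measure (\<kappa> \<Otimes>\<^sub>M M) ?E = (\<integral>\<omega>. measure \<kappa> {x\<in>space \<kappa>. (x, \<omega>) \<in> ?E} \<partial>M)"
    by (rule measure_pair_fubini(1)[OF kappa(1) prob_space_axioms E])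
  also have "\<dots> = (\<integral>\<omega>. indicator S \<omega> \<partial>M)"
  proof (rule Bochner_Integration.integral_cong[OF refl])
    fix \<omega> assume "\<omega> \<in> space M"
    then have "{x\<in>space \<kappa>. (x, \<omega>) \<in> ?E} = (if \<omega> \<in> S then space \<kappa> else {})"
      by (auto simp: space_pair_measure S_def)
    then show "measure \<kappa> {x\<in>space \<kappa>. (x, \<omega>) \<in> ?E} = indicator S \<omega>" by (simp add: K.prob_space)
  qed
  also have "\<dots> = measure M S" using S by simp
  also have "\<dots> = measure (distr M borel B1) {x. norm x > y}"
  proof -
    have "S = B1 -` {x. norm x > y} \<inter> space M" unfolding S_def by auto
    moreover have "{x::real^'n. norm x > y} \<in> sets borel" by measurable
    ultimately show ?thesis by (subst measure_distr) auto
  qed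
  finally show ?thesis .
qed

text \<open>Splitting \<open>\<Phi> (A x) (B x)\<close> into \<open>\<Phi> (A x) 0\<close> and \<open>\<Phi> 0 B1\<close> costs nothing on the scale of the tail.\<close>

lemma split_error:
  assumes f: "f \<in> Cb_away"
  shows "((\<lambda>t. V t * (\<integral>p. f (\<Phi> (A (snd p) *v (fst p /\<^sub>R t)) ((B1 (snd p) + B2 (snd p) (fst p)) /\<^sub>R t))
       - f (\<Phi> (A (snd p) *v (fst p /\<^sub>R t)) 0) - f (\<Phi> 0 (B1 (snd p) /\<^sub>R t)) \<partial>(\<kappa> \<Otimes>\<^sub>M M))) \<longlongrightarrow> 0) at_top"
    (is "((\<lambda>t. V t * (\<integral>p. ?err t p \<partial>_)) \<longlongrightarrow> 0) at_top")
proof (rule tendstoI)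
  fix e :: real assume e: "e > 0"
  obtain C \<eta> where C: "C > 0" "\<eta> > 0" "\<And>u v b. \<bar>f (\<Phi> u v) - f (\<Phi> u 0) - f (\<Phi> 0 b)\<bar> \<le> C"
    and jump: "\<And>R d. R > 0 \<Longrightarrow> d > 0 \<Longrightarrow> \<exists>\<epsilon>>0. \<forall>u v b. norm (v - b) \<le> \<epsilon> \<longrightarrow> norm u \<le> \<epsilon> \<or> norm b \<le> \<epsilon> \<longrightarrow> norm u \<le> R \<longrightarrow> norm b \<le> R \<longrightarrow>
        \<bar>f (\<Phi> u v) - f (\<Phi> u 0) - f (\<Phi> 0 b)\<bar> \<le> (if norm u > \<eta> \<or> norm b > \<eta> then d else 0)"
    by (rule one_big_jump[OF f Phi_cont Phi_0_0]) blast
  obtain a b K t0 where K: "0 < b" "0 < a" "K > 0" "t0 > 0"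
    "\<And>t s. t \<ge> t0 \<Longrightarrow> s > 0 \<Longrightarrow>
       V t * measure (\<kappa> \<Otimes>\<^sub>M M) {p\<in>space (\<kappa> \<Otimes>\<^sub>M M). norm (fst p) * norm (A (snd p)) > s * t} \<le> K * (s powr - a + s powr - b)"
    by (rule AX_tail[OF kappa kappa_tail]) blast
  define a' where "a' = \<alpha> + \<alpha>/2"
  define b' where "b' = \<alpha> - \<alpha>/2"
  have ab': "a' > 0" "b' > 0" unfolding a'_def b'_def using alpha by auto
  have h2: "0 < \<alpha>/2" "\<alpha>/2 < \<alpha>" using alpha by auto
  have sB: "sets (distr M borel B1) = sets borel" by simp
  obtain K' t0' where K': "K' > 0" "t0' > 0"
    "\<And>t s. t \<ge> t0' \<Longrightarrow> s > 0 \<Longrightarrow> V t * measure (distr M borel B1) {x. norm x > s * t} \<le> K' * (s powr - a' + s powr - b')"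
    unfolding a'_def b'_def by (rule potter_tail_bound[OF V B1_prob sB B1_bounded h2]) blast
  \<comment> \<open>A common Potter bound for the two tails at level s t. It tends to 0 as s grows,
    which selects R, and it is finite at \<eta>, which selects d.\<close>
  define Q where "Q s = K * (s powr - a + s powr - b) + K' * (s powr - a' + s powr - b')" for s
  have Q0: "Q s \<ge> 0" for s unfolding Q_def using K K' by auto
  have "((\<lambda>R. C * Q R) \<longlongrightarrow> C * (K * (0 + 0) + K' * (0 + 0))) at_top" unfolding Q_def
    using K ab' by (intro tendsto_intros tendsto_neg_powr filterlim_ident) auto
  then have "((\<lambda>R. C * Q R) \<longlongrightarrow> 0) at_top" by simp
  from order_tendstoD(2)[OF this, of "e/4"] e have "eventually (\<lambda>R. C * Q R < e/4) at_top" by simp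
  then have "eventually (\<lambda>R. C * Q R < e/4 \<and> R > 0) at_top" using eventually_gt_at_top[of 0] by eventually_elim simp
  then obtain R where R: "C * Q R < e/4" "R > 0" using eventually_happens'[OF trivial_limit_at_top_linorder] by blast
  \<comment> \<open>Error budget: d Q(\<eta>) \<le> e/4 here, C Q(R) < e/4 from the choice of R, and
    two eventual errors below e/8 stay under e together.\<close>
  define d where "d = e / (4 * (Q \<eta> + 1))"
  have d: "d > 0" "d * Q \<eta> \<le> e/4" unfolding d_def using e Q0[of \<eta>] by (auto simp: field_simps)
  from jump[OF R(2) d(1)] obtain \<epsilon> where \<epsilon>_props: "\<epsilon> > 0 \<and> (\<forall>u v b. norm (v - b) \<le> \<epsilon> \<longrightarrow> norm u \<le> \<epsilon> \<or> norm b \<le> \<epsilon> \<longrightarrow> norm u \<le> R \<longrightarrow> norm b \<le> R \<longrightarrow>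
        \<bar>f (\<Phi> u v) - f (\<Phi> u 0) - f (\<Phi> 0 b)\<bar> \<le> (if norm u > \<eta> \<or> norm b > \<eta> then d else 0))" ..
  note \<epsilon> = conjunct1[OF \<epsilon>_props] and close = conjunct2[OF \<epsilon>_props]
  let ?P = "\<kappa> \<Otimes>\<^sub>M M"
  \<comment> \<open>Events on which the one-big-jump estimate fails or is not zero.
    \<open>S1\<close> and \<open>S2\<close> are asymptotically negligible; \<open>S3\<close> and
    \<open>S4\<close> are used at level R with cost C and at level \<eta> with cost d.\<close>
  define S1 where "S1 t = {p\<in>space ?P. norm (B2 (snd p) (fst p)) > \<epsilon> * t}" for t
  define S2 where "S2 t = {p\<in>space ?P. norm (fst p) * norm (A (snd p)) > \<epsilon> * t \<and> norm (B1 (snd p)) > \<epsilon> * t}" for t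
  define S3 where "S3 s t = {p\<in>space ?P. norm (fst p) * norm (A (snd p)) > s * t}" for s t
  define S4 where "S4 s t = {p\<in>space ?P. norm (B1 (snd p)) > s * t}" for s t
  note [measurable] = measurable_B2[OF kappa kappa_tail]
  note [measurable] = measurable_pair_borel
  have S1: "S1 t \<in> sets ?P" for t unfolding S1_def by measurable
  have S2: "S2 t \<in> sets ?P" for t unfolding S2_def by measurable
  have S3: "S3 s t \<in> sets ?P" for s t unfolding S3_def by measurable
  have S4: "S4 s t \<in> sets ?P" for s t unfolding S4_def by measurable
  note S = S1 S2 S3 S4
  have lims: "((\<lambda>t. C * (V t * measure ?P (S1 t))) \<longlongrightarrow> C * 0) at_top" "((\<lambda>t. C * (V t * measure ?P (S2 t))) \<longlongrightarrow> C * 0) at_top"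
    unfolding S1_def S2_def
    by (intro tendsto_intros B2_negligible[OF kappa kappa_tail] both_large[OF kappa kappa_tail] \<epsilon>)+
  have e8: "C * 0 < e/8" using e by simp
  have "eventually (\<lambda>t. C * (V t * measure ?P (S1 t)) < e/8) at_top" "eventually (\<lambda>t. C * (V t * measure ?P (S2 t)) < e/8) at_top"
    by (rule order_tendstoD(2)[OF lims(1) e8], rule order_tendstoD(2)[OF lims(2) e8])
  then show "eventually (\<lambda>t. dist (V t * (\<integral>p. ?err t p \<partial>?P)) 0 < e) at_top"
    using eventually_ge_at_top[of "max t0 t0'"]
  proof eventually_elim
    case (elim t)
    then have tp: "t > 0" using K by simp
    have fc: "continuous_on UNIV f" using f by (auto simp: Cb_away_def)
    let ?b = "\<lambda>p. C * indicat_real (S1 t) p + C * indicat_real (S2 t) p + d * indicat_real (S3 \<eta> t) p + d * indicat_real (S4 \<eta> t) p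
        + C * indicat_real (S3 R t) p + C * indicat_real (S4 R t) p"
    have pw: "\<bar>?err t p\<bar> \<le> ?b p" if p: "p \<in> space ?P" for p
    proof -
      define u where "u = A (snd p) *v (fst p /\<^sub>R t)"
      define v where "v = (B1 (snd p) + B2 (snd p) (fst p)) /\<^sub>R t"
      define b where "b = B1 (snd p) /\<^sub>R t"
      have nu: "norm u \<le> norm (fst p) * norm (A (snd p)) / t"
        using norm_matrix_vector_mult_le[of "A (snd p)" "fst p /\<^sub>R t"] tp unfolding u_def by (simp add: field_simps)
      have vb: "v - b = B2 (snd p) (fst p) /\<^sub>R t" unfolding v_def b_def by (simp add: scaleR_right_diff_distrib[symmetric])
      have nvb: "norm (v - b) = norm (B2 (snd p) (fst p)) / t" unfolding vb using tp by (simp add: field_simps)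
      have nb: "norm b = norm (B1 (snd p)) / t" unfolding b_def using tp by (simp add: field_simps)
      have i1: "p \<in> S1 t" if "norm (v - b) > \<epsilon>" using that p tp unfolding S1_def nvb by (simp add: field_simps)
      have i3: "p \<in> S3 s t" if "norm u > s" for s
      proof -
        have "s < norm (fst p) * norm (A (snd p)) / t" using that nu by simp
        then show ?thesis using p tp unfolding S3_def by (simp add: field_simps)
      qed
      have i4: "p \<in> S4 s t" if "norm b > s" for s using that p tp unfolding S4_def nb by (simp add: field_simps)
      have i2: "p \<in> S2 t" if "norm u > \<epsilon>" "norm b > \<epsilon>" using i3[OF that(1)] i4[OF that(2)] unfolding S2_def S3_def S4_def by simp
      have ge0: "0 \<le> C * indicat_real X p" "0 \<le> d * indicat_real X p" for X using C d by auto
      have eq1: "C * indicat_real X p = C" "d * indicat_real X p = d" if "p \<in> X" for X using that by auto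
      note ge0s = ge0(1)[of "S1 t"] ge0(1)[of "S2 t"] ge0(2)[of "S3 \<eta> t"] ge0(2)[of "S4 \<eta> t"] ge0(1)[of "S3 R t"] ge0(1)[of "S4 R t"]
      have "\<bar>f (\<Phi> u v) - f (\<Phi> u 0) - f (\<Phi> 0 b)\<bar> \<le> ?b p"
      proof (cases "norm (v - b) \<le> \<epsilon> \<and> (norm u \<le> \<epsilon> \<or> norm b \<le> \<epsilon>) \<and> norm u \<le> R \<and> norm b \<le> R")
        case True
        then have 1: "\<bar>f (\<Phi> u v) - f (\<Phi> u 0) - f (\<Phi> 0 b)\<bar> \<le> (if norm u > \<eta> \<or> norm b > \<eta> then d else 0)" by (intro close[rule_format]) auto
        have le: "\<bar>f (\<Phi> u v) - f (\<Phi> u 0) - f (\<Phi> 0 b)\<bar> \<le> d"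
          using d(1) by (intro order_trans[OF 1]) auto
        consider "norm u > \<eta>" | "norm b > \<eta>" | "\<not> (norm u > \<eta> \<or> norm b > \<eta>)" by blast
        then show ?thesis
        proof cases
          case 1
          show ?thesis using le eq1(2)[OF i3[OF 1]] ge0s by linarith
        next
          case 2
          show ?thesis using le eq1(2)[OF i4[OF 2]] ge0s by linarith
        next
          case 3
          then have "\<bar>f (\<Phi> u v) - f (\<Phi> u 0) - f (\<Phi> 0 b)\<bar> \<le> 0" using \<open>_ \<le> (if _ then d else 0)\<close> by simp
          then show ?thesis using ge0s by linarith
        qed
      next
        case False
        then consider "norm (v - b) > \<epsilon>" | "norm u > \<epsilon>" "norm b > \<epsilon>" | "norm u > R" | "norm b > R" by fastforce
        then show ?thesis
        proof cases
          case 1 then show ?thesis using C(3)[of u v b] eq1(1)[OF i1[OF 1]] ge0s by linarith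
        next
          case 2 then show ?thesis using C(3)[of u v b] eq1(1)[OF i2[OF 2]] ge0s by linarith
        next
          case 3 then show ?thesis using C(3)[of u v b] eq1(1)[OF i3[OF 3]] ge0s by linarith
        next
          case 4 then show ?thesis using C(3)[of u v b] eq1(1)[OF i4[OF 4]] ge0s by linarith
        qed
      qed
      then show ?thesis unfolding u_def v_def b_def .
    qed
    have ind: "integrable ?P (indicat_real X)" if "X \<in> sets ?P" for X
      using that by (intro integrable_real_indicator) (auto simp: P.emeasure_finite less_top[symmetric])
    have bi: "integrable ?P ?b"
      by (intro Bochner_Integration.integrable_add integrable_mult_right ind S)
    have "\<bar>\<integral>p. ?err t p \<partial>?P\<bar> \<le> (\<integral>p. ?b p \<partial>?P)"
    proof (rule order_trans[OF integral_abs_bound integral_mono'[OF bi]])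
      show "\<And>p. p \<in> space ?P \<Longrightarrow> \<bar>?err t p\<bar> \<le> ?b p" by (rule pw)
      show "\<And>p. p \<in> space ?P \<Longrightarrow> 0 \<le> ?b p" using C(1) d(1) by (intro add_nonneg_nonneg mult_nonneg_nonneg) auto
    qed
    also have "(\<integral>p. ?b p \<partial>?P) = C * measure ?P (S1 t) + C * measure ?P (S2 t) + d * measure ?P (S3 \<eta> t) + d * measure ?P (S4 \<eta> t)
        + C * measure ?P (S3 R t) + C * measure ?P (S4 R t)"
      by (simp add: Bochner_Integration.integral_add Bochner_Integration.integrable_add integrable_mult_right ind S
          Bochner_Integration.integral_indicator sets.Int_space_eq2)
    finally have "V t * \<bar>\<integral>p. ?err t p \<partial>?P\<bar> \<le> V t * (C * measure ?P (S1 t) + C * measure ?P (S2 t) + d * measure ?P (S3 \<eta> t) + d * measure ?P (S4 \<eta> t)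
        + C * measure ?P (S3 R t) + C * measure ?P (S4 R t))"
      using V_pos[OF tp] by (intro mult_left_mono) auto
    also have "\<dots> = C * (V t * measure ?P (S1 t)) + C * (V t * measure ?P (S2 t))
        + d * (V t * measure ?P (S3 \<eta> t) + V t * measure ?P (S4 \<eta> t)) + C * (V t * measure ?P (S3 R t) + V t * measure ?P (S4 R t))"
      by (simp add: algebra_simps)
    also have "\<dots> \<le> C * (V t * measure ?P (S1 t)) + C * (V t * measure ?P (S2 t)) + d * Q \<eta> + C * Q R"
    proof -
      have "V t * measure ?P (S3 s t) + V t * measure ?P (S4 s t) \<le> Q s" if "s > 0" for s
        unfolding Q_def S3_def S4_def B1_marginal using elim that by (intro add_mono K(5) K'(3)) auto
      then show ?thesis using C d R by (intro add_mono mult_left_mono order_refl) auto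
    qed
    also have "\<dots> < e" using elim d R e by linarith
    finally show ?case using V_pos[OF tp] by (simp add: abs_mult)
  qed
qed

text \<open>Homogeneity of \<Phi> moves the scaling 1/t into both arguments. The expectation then
  splits into the B1 term, the A term and an error, for each of which the limit is known.\<close>

theorem tail_functional_step:
  assumes f: "f \<in> Cb_away"
  shows "((\<lambda>t. V t * (\<integral>x. transition_op (\<lambda>y. f (y /\<^sub>R t)) x \<partial>\<kappa>)) \<longlongrightarrow>
     Tb (\<lambda>y. f (\<Phi> 0 y)) + (\<integral>\<omega>. T (\<lambda>x. f (\<Phi> (A \<omega> *v x) 0)) \<partial>M)) at_top"
proof -
  let ?P = "\<kappa> \<Otimes>\<^sub>M M"
  define e1 where "e1 t p = f (\<Phi> (A (snd p) *v (fst p /\<^sub>R t)) ((B1 (snd p) + B2 (snd p) (fst p)) /\<^sub>R t))" for t p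
  define e2 where "e2 t p = f (\<Phi> (A (snd p) *v (fst p /\<^sub>R t)) 0)" for t p
  define e3 where "e3 t p = f (\<Phi> 0 (B1 (snd p) /\<^sub>R t))" for t and p :: "(real^'n) \<times> 'w"
  obtain C where C: "\<And>x. \<bar>f x\<bar> \<le> C" using f by (auto simp: Cb_away_def)
  have g[measurable]: "(\<lambda>x. f (\<Phi> x 0)) \<in> borel_measurable borel" "(\<lambda>x. f (\<Phi> 0 x)) \<in> borel_measurable borel"
    by (rule borel_Cb_away, rule Cb_away_compose[OF f continuous_Phi(1) Phi_0_0])
       (rule borel_Cb_away, rule Cb_away_Phi(1)[OF f])
  have [measurable]: "(\<lambda>p. f (\<Phi> (fst p) (snd p))) \<in> borel_measurable (borel \<Otimes>\<^sub>M borel)"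
  proof -
    have "(\<lambda>p. \<Phi> (fst p) (snd p)) \<in> borel_measurable borel"
      using borel_measurable_continuous_onI[OF Phi_cont] by (simp add: case_prod_unfold)
    from measurable_compose[OF this borel_Cb_away[OF f]] show ?thesis unfolding borel_prod .
  qed
  note [measurable] = measurable_B2[OF kappa kappa_tail] measurable_pair_borel
  have m: "e1 t \<in> borel_measurable ?P" "e2 t \<in> borel_measurable ?P" "e3 t \<in> borel_measurable ?P" for t
  proof -
    have "(\<lambda>p. (A (snd p) *v (fst p /\<^sub>R t), (B1 (snd p) + B2 (snd p) (fst p)) /\<^sub>R t)) \<in> measurable ?P (borel \<Otimes>\<^sub>M borel)" by measurable
    from measurable_compose[OF this, of "\<lambda>p. f (\<Phi> (fst p) (snd p))"] show "e1 t \<in> borel_measurable ?P" unfolding e1_def by simp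
    show "e2 t \<in> borel_measurable ?P" unfolding e2_def by (rule measurable_compose[OF _ g(1)]) measurable
    show "e3 t \<in> borel_measurable ?P" unfolding e3_def by (rule measurable_compose[OF _ g(2)]) measurable
  qed
  have i: "integrable ?P (e1 t)" "integrable ?P (e2 t)" "integrable ?P (e3 t)" for t
    by (rule P.integrable_const_bound[of _ C, OF _ m(1)] P.integrable_const_bound[of _ C, OF _ m(2)] P.integrable_const_bound[of _ C, OF _ m(3)],
        simp add: e1_def e2_def e3_def C)+
  have j1: "(\<integral>x. transition_op (\<lambda>y. f (y /\<^sub>R t)) x \<partial>\<kappa>) = (\<integral>p. e1 t p \<partial>?P)" if t: "t > 0" for t
  proof -
    have "(\<integral>x. transition_op (\<lambda>y. f (y /\<^sub>R t)) x \<partial>\<kappa>) = (\<integral>x. (\<integral>\<omega>. e1 t (x, \<omega>) \<partial>M) \<partial>\<kappa>)"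
      unfolding transition_op_def e1_def random_map_def Phi_scale[OF t] by (simp add: matrix_vector_mult_scaleR)
    then show ?thesis using P.integral_fst'[OF i(1)] by simp
  qed
  have j2: "(\<integral>p. e2 t p \<partial>?P) = (\<integral>\<omega>. (\<integral>x. f (\<Phi> (A \<omega> *v (x /\<^sub>R t)) 0) \<partial>\<kappa>) \<partial>M)" for t
  proof -
    have "(\<integral>p. e2 t p \<partial>?P) = (\<integral>\<omega>. (\<integral>x. e2 t (x, \<omega>) \<partial>\<kappa>) \<partial>M)"
      using P.integral_snd[of "\<lambda>x \<omega>. e2 t (x, \<omega>)"] i(2)[of t] by (simp only: case_prod_eta)
    then show ?thesis unfolding e2_def fst_conv snd_conv .
  qed
  have j3: "(\<integral>p. e3 t p \<partial>?P) = (\<integral>y. f (\<Phi> 0 (y /\<^sub>R t)) \<partial>distr M borel B1)" for t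
  proof -
    have "(\<integral>p. e3 t p \<partial>?P) = (\<integral>\<omega>. (\<integral>x. e3 t (x, \<omega>) \<partial>\<kappa>) \<partial>M)"
      using P.integral_snd[of "\<lambda>x \<omega>. e3 t (x, \<omega>)"] i(3)[of t] by (simp only: case_prod_eta)
    also have "\<dots> = (\<integral>\<omega>. f (\<Phi> 0 (B1 \<omega> /\<^sub>R t)) \<partial>M)" unfolding e3_def by (simp add: K.prob_space)
    also have "\<dots> = (\<integral>y. f (\<Phi> 0 (y /\<^sub>R t)) \<partial>distr M borel B1)"
      by (rule integral_distr[symmetric, OF measurable_inputs(2) measurable_scale[OF g(2)]])
    finally show ?thesis .
  qed
  have "((\<lambda>t. V t * (\<integral>y. f (\<Phi> 0 (y /\<^sub>R t)) \<partial>distr M borel B1)) \<longlongrightarrow> Tb (\<lambda>y. f (\<Phi> 0 y))) at_top"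
    by (rule bspec[OF B1_tail[unfolded tail_functional_def] Cb_away_Phi(1)[OF f]])
  from tendsto_add[OF tendsto_add[OF this A_limit(2)[OF f]] split_error[OF f]]
  have "((\<lambda>t. V t * (\<integral>p. e3 t p \<partial>?P) + V t * (\<integral>p. e2 t p \<partial>?P) + V t * (\<integral>p. e1 t p - e2 t p - e3 t p \<partial>?P))
      \<longlongrightarrow> Tb (\<lambda>y. f (\<Phi> 0 y)) + (\<integral>\<omega>. T (\<lambda>x. f (\<Phi> (A \<omega> *v x) 0)) \<partial>M) + 0) at_top"
    unfolding j2 j3 unfolding e1_def e2_def e3_def .
  moreover have "eventually (\<lambda>t. V t * (\<integral>p. e3 t p \<partial>?P) + V t * (\<integral>p. e2 t p \<partial>?P) + V t * (\<integral>p. e1 t p - e2 t p - e3 t p \<partial>?P)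
       = V t * (\<integral>x. transition_op (\<lambda>y. f (y /\<^sub>R t)) x \<partial>\<kappa>)) at_top"
    using eventually_gt_at_top[of 0]
  proof eventually_elim
    case (elim t)
    have "(\<integral>p. e1 t p - e2 t p - e3 t p \<partial>?P) = (\<integral>p. e1 t p \<partial>?P) - (\<integral>p. e2 t p \<partial>?P) - (\<integral>p. e3 t p \<partial>?P)"
      using i by simp
    then show ?case unfolding j1[OF elim] by (simp only: distrib_left[symmetric]) simp
  qed
  ultimately show ?thesis using tendsto_cong by fastforce
qed

end

end

section \<open>Convergence to the stationary tail\<close>

text \<open>This is where a moment of order \<gamma> > \<alpha> pays off. The truncated power is
  dominated by a sum over levels 2^-(k+1) s t with weights 2^(-k \<gamma>), while the Potter bound
  lets the tail probabilities grow only like 2^(k (\<alpha>+\<eta>)).\<close>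

lemma truncated_moment_bound:
  fixes \<nu> :: "(real^'n) measure"
  assumes V: "potter V \<alpha>" and \<alpha>: "\<alpha> > 0" and \<nu>: "prob_space \<nu>" "sets \<nu> = sets borel" "tail_bounded V \<nu>" and \<gamma>: "\<gamma> > \<alpha>"
  obtains a b K t\<^sub>0 where "a > 0" "b > 0" "K > 0" "t\<^sub>0 > 0"
    "\<And>t s. t \<ge> t\<^sub>0 \<Longrightarrow> s > 0 \<Longrightarrow> V t * (\<integral>x. min 1 ((norm x / (s * t)) powr \<gamma>) \<partial>\<nu>) \<le> K * (s powr - a + s powr - b)"
proof -
  interpret prob_space \<nu> by (rule \<nu>)
  have [measurable_cong]: "sets \<nu> = sets borel" by (rule \<nu>)
  define \<eta> where "\<eta> = min (\<gamma> - \<alpha>) \<alpha> / 2"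
  have \<eta>: "0 < \<eta>" "\<eta> < \<alpha>" "\<alpha> + \<eta> < \<gamma>" unfolding \<eta>_def using \<alpha> \<gamma> by (auto simp: min_def field_simps)
  define a where "a = \<alpha> + \<eta>"
  define b where "b = \<alpha> - \<eta>"
  have ab: "a > 0" "b > 0" "b \<le> a" "a < \<gamma>" unfolding a_def b_def using \<eta> by auto
  obtain K t0 where K: "K > 0" "t0 > 0"
    "\<And>t s. t \<ge> t0 \<Longrightarrow> s > 0 \<Longrightarrow> V t * measure \<nu> {x. norm x > s * t} \<le> K * (s powr - a + s powr - b)"
    unfolding a_def b_def by (rule potter_tail_bound[OF V \<nu> \<eta>(1,2)]) blast
  \<comment> \<open>The ratio of the resulting geometric series, below 1 because a = \<alpha> +
    \<eta> < \<gamma>.\<close>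
  define q where "q = 2 powr (a - \<gamma>)"
  have q: "0 < q" "q < 1" unfolding q_def using ab powr_less_mono[of "a - \<gamma>" 0 2] by auto
  have Vp: "V t > 0" if "t > 0" for t using V that unfolding potter_def regvar_def by auto
  show ?thesis
  proof (rule that[of a b "K * 2 powr a / (1 - q)" t0])
    show "K * 2 powr a / (1 - q) > 0" using K q by simp
    fix t s :: real assume t: "t \<ge> t0" and s: "s > 0"
    have tp: "t > 0" using t K by simp
    define \<psi> where "\<psi> x = min 1 ((norm x / (s * t)) powr \<gamma>)" for x :: "real^'n"
    have \<psi>01: "0 \<le> \<psi> x" "\<psi> x \<le> 1" for x unfolding \<psi>_def by auto
    have \<psi>m: "\<psi> \<in> borel_measurable \<nu>" unfolding \<psi>_def[abs_def] by measurable
    define S where "S k = {x::real^'n. norm x > (1/2) ^ Suc k * (s * t)}" for k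
    have S: "S k \<in> sets \<nu>" for k unfolding S_def \<nu>(2) by measurable
    define c where "c = K * 2 powr a * (s powr - a + s powr - b) / V t"
    have c: "c \<ge> 0" unfolding c_def using K Vp[OF tp] by simp
    have shell: "(2 powr - \<gamma>) ^ k * measure \<nu> (S k) \<le> c * q ^ k" for k
    proof -
      have "V t * measure \<nu> (S k) \<le> K * (((1/2) ^ Suc k * s) powr - a + ((1/2) ^ Suc k * s) powr - b)"
        using K(3)[OF t, of "(1/2) ^ Suc k * s"] s unfolding S_def by (simp add: mult.assoc)
      also have "\<dots> \<le> K * ((2 powr a) ^ Suc k * s powr - a + (2 powr a) ^ Suc k * s powr - b)"
      proof -
        have e: "((1/2) ^ Suc k * s) powr - z = (2 powr z) ^ Suc k * s powr - z" for z
        proof -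
          have "((1/2) ^ Suc k * s) powr - z = ((1/2) ^ Suc k) powr - z * s powr - z" using s by (simp only: powr_mult)
          also have "((1/2::real) ^ Suc k) powr - z = (2 powr z) ^ Suc k"
          proof -
            have "((1/2::real) ^ Suc k) = 2 powr - real (Suc k)" by (simp only: powr_minus powr_realpow zero_less_numeral power_one_over inverse_eq_divide)
            then have "((1/2::real) ^ Suc k) powr - z = 2 powr (z * real (Suc k))" by (simp only: powr_powr) (simp add: algebra_simps)
            also have "\<dots> = (2 powr z) ^ Suc k" by (subst powr_powr[symmetric]) (rule powr_realpow, simp)
            finally show ?thesis .
          qed
          finally show ?thesis .
        qed
        have "(2 powr b) ^ Suc k \<le> (2 powr a) ^ Suc k" using ab by (intro power_mono powr_mono) auto
        then show ?thesis unfolding e using K by (intro mult_left_mono add_mono mult_right_mono) auto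
      qed
      also have "\<dots> = K * 2 powr a * (s powr - a + s powr - b) * (2 powr a) ^ k" by (simp add: algebra_simps)
      finally have "measure \<nu> (S k) \<le> c * (2 powr a) ^ k" unfolding c_def using Vp[OF tp] by (simp add: field_simps)
      then have "(2 powr - \<gamma>) ^ k * measure \<nu> (S k) \<le> (2 powr - \<gamma>) ^ k * (c * (2 powr a) ^ k)" by (rule mult_left_mono) simp
      also have "\<dots> = c * ((2 powr - \<gamma>) * (2 powr a)) ^ k" by (simp only: power_mult_distrib) simp
      also have "(2 powr - \<gamma>) * (2 powr a) = q" unfolding q_def by (simp add: powr_add[symmetric])
      finally show ?thesis .
    qed
    have pw: "ennreal (\<psi> x) \<le> (\<Sum>k. ennreal ((2 powr - \<gamma>) ^ k) * indicator (S k) x)" for x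
    proof (cases "x = 0")
      case True
      then show ?thesis by (simp add: \<psi>_def)
    next
      case False
      define y where "y = norm x / (s * t)"
      have y: "y > 0" unfolding y_def using False s tp by simp
      obtain n where n: "(1/2) ^ n < y" using real_arch_pow_inv[OF y, of "1/2"] by auto
      \<comment> \<open>Minimality of k gives y \<le> 2^-k when k > 0, so the truncated power is at
        most 2^(-k \<gamma>); for k = 0 the truncation at 1 does it. The single k-th summand already
        dominates.\<close>
      define k where "k = (LEAST k. (1/2) ^ Suc k < y)"
      have "(1/2) ^ Suc n < y" using n by (rule le_less_trans[rotated]) simp
      then have k: "(1/2) ^ Suc k < y" unfolding k_def by (rule LeastI)
      have "\<psi> x \<le> (2 powr - \<gamma>) ^ k"
      proof (cases k)
        case 0 then show ?thesis using \<psi>01 by simp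
      next
        case (Suc j)
        have "\<not> (1/2) ^ Suc j < y" using not_less_Least[of j "\<lambda>k. (1/2) ^ Suc k < y"] Suc unfolding k_def by simp
        then have "y \<le> (1/2) ^ k" using Suc by simp
        then have "y powr \<gamma> \<le> ((1/2) ^ k) powr \<gamma>" using y \<gamma> \<alpha> by (intro powr_mono2) auto
        also have "\<dots> = ((1/2) powr \<gamma>) ^ k" by (simp add: powr_realpow[symmetric] powr_powr mult.commute)
        also have "(1/2) powr \<gamma> = 2 powr - \<gamma>" by (rule powr_one_divide) simp
        finally show ?thesis unfolding \<psi>_def y_def by simp
      qed
      moreover have "x \<in> S k" using k s tp unfolding S_def y_def by (simp add: field_simps)
      ultimately have "ennreal (\<psi> x) \<le> (\<Sum>k\<in>{k}. ennreal ((2 powr - \<gamma>) ^ k) * indicator (S k) x)" by (simp add: ennreal_leI)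
      also have "\<dots> \<le> (\<Sum>k. ennreal ((2 powr - \<gamma>) ^ k) * indicator (S k) x)" by (rule sum_le_suminf) auto
      finally show ?thesis .
    qed
    have "ennreal (\<integral>x. \<psi> x \<partial>\<nu>) = (\<integral>\<^sup>+x. ennreal (\<psi> x) \<partial>\<nu>)"
      using \<psi>01 \<psi>m by (intro nn_integral_eq_integral[symmetric] integrable_const_bound[of _ 1]) auto
    also have "\<dots> \<le> (\<integral>\<^sup>+x. (\<Sum>k. ennreal ((2 powr - \<gamma>) ^ k) * indicator (S k) x) \<partial>\<nu>)" by (intro nn_integral_mono pw)
    also have "\<dots> = (\<Sum>k. \<integral>\<^sup>+x. ennreal ((2 powr - \<gamma>) ^ k) * indicator (S k) x \<partial>\<nu>)"
      using S by (intro nn_integral_suminf) auto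
    also have "\<dots> = (\<Sum>k. ennreal ((2 powr - \<gamma>) ^ k * measure \<nu> (S k)))"
      using S by (intro suminf_cong) (simp add: nn_integral_cmult_indicator emeasure_eq_measure ennreal_mult)
    also have "\<dots> \<le> (\<Sum>k. ennreal (c * q ^ k))" by (intro suminf_le ennreal_leI shell) auto
    also have "\<dots> = ennreal (\<Sum>k. c * q ^ k)"
      using c q by (intro suminf_ennreal2 summable_mult summable_geometric) auto
    also have "(\<Sum>k. c * q ^ k) = c * (1 / (1 - q))" using q by (subst suminf_mult) (auto intro: summable_geometric simp: suminf_geometric)
    finally have "(\<integral>x. \<psi> x \<partial>\<nu>) \<le> c * (1 / (1 - q))" using c q by (subst (asm) ennreal_le_iff) auto
    then have "V t * (\<integral>x. \<psi> x \<partial>\<nu>) \<le> V t * (c * (1 / (1 - q)))" using Vp[OF tp] by (intro mult_left_mono) auto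
    also have "\<dots> = K * 2 powr a / (1 - q) * (s powr - a + s powr - b)" unfolding c_def using Vp[OF tp] by simp
    finally show "V t * (\<integral>x. min 1 ((norm x / (s * t)) powr \<gamma>) \<partial>\<nu>) \<le> K * 2 powr a / (1 - q) * (s powr - a + s powr - b)"
      unfolding \<psi>_def .
  qed (use ab K in auto)
qed

context heavy_chain
begin

text \<open>Begins with 0 because X_0 = 0 and test functions vanish there. In the recursion the
  \<open>Tb\<close> term is the latest jump, and earlier jumps are carried through one more map
  \<open>\<Phi> (A *v x) 0\<close>.\<close>

primrec chain_functional :: "nat \<Rightarrow> (real^'n \<Rightarrow> real) \<Rightarrow> real" where
  "chain_functional 0 f = 0"
| "chain_functional (Suc n) f = Tb (\<lambda>y. f (\<Phi> 0 y)) + (\<integral>\<omega>. chain_functional n (\<lambda>x. f (\<Phi> (A \<omega> *v x) 0)) \<partial>M)"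

text \<open>The one-step limit applies with the law of X_n as the independent state, since
  \<open>chain_step\<close> writes the expectation at time n+1 through the Markov operator.\<close>

lemma tail_functional_chain: "tail_functional V (distr M borel (X 0 n)) (chain_functional n)"
proof (induction n)
  case 0
  show ?case unfolding tail_functional_def
  proof
    fix f :: "real^'n \<Rightarrow> real" assume f: "f \<in> Cb_away"
    have f0: "f 0 = 0" using f by (auto simp: Cb_away_def)
    have "(\<integral>x. f (x /\<^sub>R t) \<partial>distr M borel (X 0 0)) = 0" for t
      by (subst integral_distr[OF measurable_X measurable_scale[OF borel_Cb_away[OF f]]]) (simp add: f0)
    then show "((\<lambda>t. V t * (\<integral>x. f (x /\<^sub>R t) \<partial>distr M borel (X 0 0))) \<longlongrightarrow> chain_functional 0 f) at_top" by simp
  qed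
next
  case (Suc n)
  show ?case unfolding tail_functional_def
  proof
    fix f :: "real^'n \<Rightarrow> real" assume f: "f \<in> Cb_away"
    obtain C where C: "\<And>x. \<bar>f x\<bar> \<le> C" and fc: "continuous_on UNIV f" using f by (auto simp: Cb_away_def)
    have g: "continuous_on UNIV (\<lambda>y. f (y /\<^sub>R t))" for t
      by (rule continuous_on_compose2[OF fc]) (auto intro!: continuous_intros)
    have "(\<integral>x. f (x /\<^sub>R t) \<partial>distr M borel (X 0 (Suc n))) = (\<integral>x. transition_op (\<lambda>y. f (y /\<^sub>R t)) x \<partial>distr M borel (X 0 n))" for t
    proof -
      have "(\<integral>x. f (x /\<^sub>R t) \<partial>distr M borel (X 0 (Suc n))) = (\<integral>\<omega>. f (X 0 (Suc n) \<omega> /\<^sub>R t) \<partial>M)"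
        by (rule integral_distr[OF measurable_X measurable_scale[OF borel_Cb_away[OF f]]])
      also have "\<dots> = (\<integral>\<omega>. transition_op (\<lambda>y. f (y /\<^sub>R t)) (X 0 n \<omega>) \<partial>M)"
        by (rule chain_step[OF g]) (rule C)
      also have "\<dots> = (\<integral>x. transition_op (\<lambda>y. f (y /\<^sub>R t)) x \<partial>distr M borel (X 0 n))"
        by (rule integral_distr[symmetric, OF measurable_X borel_measurable_continuous_onI[OF continuous_transition_op[OF g]]]) (rule C)
      finally show ?thesis .
    qed
    then show "((\<lambda>t. V t * (\<integral>x. f (x /\<^sub>R t) \<partial>distr M borel (X 0 (Suc n)))) \<longlongrightarrow> chain_functional (Suc n) f) at_top"
      using tail_functional_step[OF prob_space_distr[OF measurable_X] _ Suc.IH f] by simp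
  qed
qed

text \<open>Markov's inequality for the \<gamma>-th power of the coupled difference. The minimum
  with 1 matters because x will be drawn from the stationary law, which need not have a moment of
  order \<gamma>. The factor (c c)^\<gamma> compares the two norms once in each direction.\<close>

lemma geometric_tail:
  assumes geo: "geometric_chain N M (\<lambda>n. random_map \<Phi> (As n) (B1s n) (B2s n)) \<gamma>"
  obtains C \<rho> where "C > 0" "0 < \<rho>" "\<rho> < 1"
    "\<And>n x y. y > 0 \<Longrightarrow> measure M {\<omega>\<in>space M. norm (X x n \<omega> - X 0 n \<omega>) > y} \<le> min 1 (C * \<rho> ^ n * (norm x / y) powr \<gamma>)"
proof -
  obtain c where c: "c > 0" "\<And>x. N x \<le> c * norm x" "\<And>x. norm x \<le> c * N x" "continuous_on UNIV N" by (rule is_norm_equiv[OF norm]) blast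
  have Np: "N x \<ge> 0" for x using norm unfolding is_norm_def by auto
  obtain C \<rho> where g: "\<gamma> > 0" "0 < C" "0 < \<rho>" "\<rho> < 1"
    "\<And>n x y. (\<integral>\<^sup>+\<omega>. ennreal (N (X x n \<omega> - X y n \<omega>) powr \<gamma>) \<partial>M) \<le> ennreal (C * \<rho> ^ n * N (x - y) powr \<gamma>)"
    using geo unfolding geometric_chain_def by auto
  have Nm: "N \<in> borel_measurable borel" by (rule borel_measurable_continuous_onI[OF c(4)])
  show ?thesis
  proof (rule that[of "C * (c * c) powr \<gamma>" \<rho>])
    fix n x and y :: real assume y: "y > 0"
    define S where "S = {\<omega>\<in>space M. norm (X x n \<omega> - X 0 n \<omega>) > y}"
    have [measurable]: "X x n \<in> borel_measurable M" "X 0 n \<in> borel_measurable M" by (rule measurable_X)+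
    have S: "S \<in> sets M" unfolding S_def by measurable
    have "ennreal ((y / c) powr \<gamma> * measure M S) = (\<integral>\<^sup>+\<omega>. ennreal ((y / c) powr \<gamma>) * indicator S \<omega> \<partial>M)"
      using S by (simp add: nn_integral_cmult_indicator emeasure_eq_measure ennreal_mult)
    also have "\<dots> \<le> (\<integral>\<^sup>+\<omega>. ennreal (N (X x n \<omega> - X 0 n \<omega>) powr \<gamma>) \<partial>M)"
    proof (rule nn_integral_mono)
      fix \<omega>
      show "ennreal ((y / c) powr \<gamma>) * indicator S \<omega> \<le> ennreal (N (X x n \<omega> - X 0 n \<omega>) powr \<gamma>)"
      proof (cases "\<omega> \<in> S")
        case True
        then have "y < c * N (X x n \<omega> - X 0 n \<omega>)" using c(3)[of "X x n \<omega> - X 0 n \<omega>"] unfolding S_def by simp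
        then have "y / c \<le> N (X x n \<omega> - X 0 n \<omega>)" using c(1) by (simp add: field_simps)
        then have "(y / c) powr \<gamma> \<le> N (X x n \<omega> - X 0 n \<omega>) powr \<gamma>" using y c(1) g(1) by (intro powr_mono2) auto
        then show ?thesis using True by (simp add: ennreal_leI)
      qed simp
    qed
    also have "\<dots> \<le> ennreal (C * \<rho> ^ n * N (x - 0) powr \<gamma>)" by (rule g(5))
    finally have "(y / c) powr \<gamma> * measure M S \<le> C * \<rho> ^ n * N x powr \<gamma>"
      using g by (subst (asm) ennreal_le_iff) auto
    also have "\<dots> \<le> C * \<rho> ^ n * (c * norm x) powr \<gamma>"
      using g c(2)[of x] Np[of x] by (intro mult_left_mono powr_mono2) auto
    finally have "(y / c) powr \<gamma> * measure M S \<le> C * \<rho> ^ n * (c * norm x) powr \<gamma>" .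
    then have "measure M S \<le> C * \<rho> ^ n * ((c * norm x) powr \<gamma> / (y / c) powr \<gamma>)" using y c(1) by (simp add: field_simps)
    also have "(c * norm x) powr \<gamma> / (y / c) powr \<gamma> = (c * c) powr \<gamma> * (norm x / y) powr \<gamma>"
      using y c(1) by (simp add: powr_divide powr_mult field_simps)
    finally show "measure M {\<omega>\<in>space M. norm (X x n \<omega> - X 0 n \<omega>) > y} \<le> min 1 (C * (c * c) powr \<gamma> * \<rho> ^ n * (norm x / y) powr \<gamma>)"
      unfolding S_def[symmetric] by (simp add: mult_ac)
  qed (use g c in auto)
qed

text \<open>By stationarity the n-step expectation of a test function, averaged over the starting
  point, does not depend on n. Hence only the difference of two chains driven by the same inputs,
  from x and from 0, has to be estimated.\<close>

theorem chain_tail_converges: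
  assumes geo: "geometric_chain N M (\<lambda>n. random_map \<Phi> (As n) (B1s n) (B2s n)) \<gamma>" and \<gamma>: "\<gamma> > \<alpha>"
    and st: "stationary_measure M F \<nu>" and \<nu>T: "tail_functional V \<nu> T1" and f: "f \<in> Cc_punctured"
  shows "(\<lambda>n. chain_functional n f) \<longlonglongrightarrow> T1 f"
proof -
  have \<nu>: "prob_space \<nu>" "sets \<nu> = sets borel" using st unfolding stationary_measure_def by auto
  interpret nu: prob_space \<nu> by (rule \<nu>)
  have [measurable_cong]: "sets \<nu> = sets borel" by (rule \<nu>)
  have tb: "tail_bounded V \<nu>" by (rule tail_functional_bounded[OF \<nu>T \<nu> V_pos])
  have fb: "f \<in> Cb_away" using f Cc_subset_Cb_away by auto
  obtain Cf r where Cf: "continuous_on UNIV f" "Cf > 0" "\<And>x. \<bar>f x\<bar> \<le> Cf" "r > 0" "\<And>x. norm x < r \<Longrightarrow> f x = 0"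
    by (rule Cb_awayE[OF fb]) blast
  \<comment> \<open>Equals 1 at \<open>u\<close> whenever f(u) or f(v) can be nonzero for
    \<open>v\<close> close to \<open>u\<close>. Lying in \<open>Cb_away\<close>, it has a finite
    tail limit, which multiplies the continuity error d.\<close>
  define \<phi> :: "real^'n \<Rightarrow> real" where "\<phi> = ramp (r/4) (r/2)"
  have r4: "0 < r/4" "r/4 < r/2" using Cf(4) by auto
  have \<phi>: "\<phi> \<in> Cb_away" "\<And>x. 0 \<le> \<phi> x" "\<And>x. \<phi> x \<le> 1" "\<And>x. norm x \<ge> r/2 \<Longrightarrow> \<phi> x = 1" "continuous_on UNIV \<phi>"
    unfolding \<phi>_def using ramp_Cb_away[OF r4] ramp_props[OF r4(2)] by auto
  obtain a b K t0 where K: "a > 0" "b > 0" "K > 0" "t0 > 0"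
    "\<And>t s. t \<ge> t0 \<Longrightarrow> s > 0 \<Longrightarrow> V t * (\<integral>x. min 1 ((norm x / (s * t)) powr \<gamma>) \<partial>\<nu>) \<le> K * (s powr - a + s powr - b)"
    by (rule truncated_moment_bound[OF V alpha \<nu> tb \<gamma>]) blast
  obtain C \<rho> where g: "C > 0" "0 < \<rho>" "\<rho> < 1"
    "\<And>n x y. y > 0 \<Longrightarrow> measure M {\<omega>\<in>space M. norm (X x n \<omega> - X 0 n \<omega>) > y} \<le> min 1 (C * \<rho> ^ n * (norm x / y) powr \<gamma>)"
    by (rule geometric_tail[OF geo]) blast
  have \<gamma>p: "\<gamma> > 0" using \<gamma> alpha by simp
  show ?thesis
  proof (rule tendstoI)
    fix e :: real assume e: "e > 0"
    have T\<phi>: "T1 \<phi> \<ge> 0"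
    proof (rule tendsto_lowerbound)
      show "((\<lambda>t. V t * (\<integral>x. \<phi> (x /\<^sub>R t) \<partial>\<nu>)) \<longlongrightarrow> T1 \<phi>) at_top"
        by (rule bspec[OF \<nu>T[unfolded tail_functional_def] \<phi>(1)])
      show "eventually (\<lambda>t. 0 \<le> V t * (\<integral>x. \<phi> (x /\<^sub>R t) \<partial>\<nu>)) at_top"
        using eventually_gt_at_top[of 0]
      proof eventually_elim
        case (elim t)
        then show ?case using V_pos[of t] \<phi>(2) by (intro mult_nonneg_nonneg Bochner_Integration.integral_nonneg) auto
      qed
    qed simp
    \<comment> \<open>The summand 1 keeps the quotient defined when T1 \<phi> = 0.\<close>
    define d where "d = e / (2 * (T1 \<phi> + 1))"
    have d1: "d > 0" unfolding d_def using e T\<phi> by simp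
    have "d * T1 \<phi> \<le> d * (T1 \<phi> + 1)" using d1 by simp
    also have "\<dots> = e / 2" unfolding d_def using T\<phi> by (simp add: divide_simps)
    also have "\<dots> < e" using e by simp
    finally have d: "d > 0" "d * T1 \<phi> < e" using d1 by auto
    obtain \<epsilon>0 where \<epsilon>0: "\<epsilon>0 > 0" "\<And>x y. norm (x - y) \<le> \<epsilon>0 \<Longrightarrow> \<bar>f x - f y\<bar> \<le> d"
      by (rule Cc_uniformly_continuous[OF f d(1)]) blast
    define \<epsilon> where "\<epsilon> = min \<epsilon>0 (r/4)"
    have \<epsilon>: "\<epsilon> > 0" "\<epsilon> \<le> \<epsilon>0" "\<epsilon> \<le> r/4" unfolding \<epsilon>_def using \<epsilon>0 Cf by auto
    \<comment> \<open>Either the two points are close, and uniform continuity costs d where \<phi>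
      is 1, or they are more than \<epsilon> apart, which geometric contraction makes
      unlikely.\<close>
    have pw: "\<bar>f u - f v\<bar> \<le> d * \<phi> u + 2 * Cf * (if norm (u - v) > \<epsilon> then 1 else 0)" for u v
    proof (cases "norm (u - v) > \<epsilon>")
      case True
      have "\<bar>f u - f v\<bar> \<le> 2 * Cf" using Cf(3)[of u] Cf(3)[of v] by linarith
      then show ?thesis using True d(1) \<phi>(2)[of u] by (simp add: add_increasing)
    next
      case False
      show ?thesis
      proof (cases "norm u \<ge> r/2")
        case True
        then show ?thesis using False \<epsilon>0(2)[of u v] \<epsilon>(2) \<phi>(4)[OF True] by simp
      next
        case False': False
        have "norm v \<le> norm u + norm (u - v)" using norm_triangle_sub[of v u] by (simp add: norm_minus_commute)
        then have "norm v < r" "norm u < r" using False False' \<epsilon>(3) Cf(4) by auto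
        then have "f u = 0" "f v = 0" using Cf(5) by auto
        then show ?thesis using False d(1) \<phi>(2)[of u] by simp
      qed
    qed
    \<comment> \<open>Absorbs the contraction factor into the scale: C \<rho>^n
      (y/\<epsilon>)^\<gamma> becomes (y/s_n)^\<gamma>, with s_n tending to infinity.\<close>
    define s where "s n = (C * \<rho> ^ n) powr - (1/\<gamma>) * \<epsilon>" for n
    have sp: "s n > 0" for n unfolding s_def using g \<epsilon> by simp
    have s_eq: "C * \<rho> ^ n * (y / \<epsilon>) powr \<gamma> = (y / s n) powr \<gamma>" if "y \<ge> 0" for n y
    proof -
      have "(y / s n) powr \<gamma> = (y / \<epsilon> * (C * \<rho> ^ n) powr (1/\<gamma>)) powr \<gamma>"
        unfolding s_def by (simp add: powr_minus_divide field_simps)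
      also have "\<dots> = (y / \<epsilon>) powr \<gamma> * ((C * \<rho> ^ n) powr (1/\<gamma>)) powr \<gamma>"
        by (rule powr_mult)
      also have "((C * \<rho> ^ n) powr (1/\<gamma>)) powr \<gamma> = C * \<rho> ^ n" using g \<gamma>p by (simp add: powr_powr)
      finally show ?thesis by simp
    qed
    \<comment> \<open>A bound after the limit in t. Only its second term depends on n, and it
      vanishes as s_n grows.\<close>
    define E where "E n = d * T1 \<phi> + 2 * Cf * (K * (s n powr - a + s n powr - b))" for n
    have bound: "\<bar>T1 f - chain_functional n f\<bar> \<le> E n" for n
    proof (rule tendsto_le)
      let ?L = "distr M borel (X 0 n)"
      show "((\<lambda>t. \<bar>V t * (\<integral>x. f (x /\<^sub>R t) \<partial>\<nu>) - V t * (\<integral>x. f (x /\<^sub>R t) \<partial>?L)\<bar>) \<longlongrightarrow> \<bar>T1 f - chain_functional n f\<bar>) at_top"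
        by (intro tendsto_intros bspec[OF \<nu>T[unfolded tail_functional_def] fb]
            bspec[OF tail_functional_chain[unfolded tail_functional_def] fb])
      show "((\<lambda>t. d * (V t * (\<integral>x. \<phi> (x /\<^sub>R t) \<partial>\<nu>)) + 2 * Cf * (K * (s n powr - a + s n powr - b))) \<longlongrightarrow> E n) at_top"
        unfolding E_def by (intro tendsto_intros bspec[OF \<nu>T[unfolded tail_functional_def] \<phi>(1)])
      show "eventually (\<lambda>t. \<bar>V t * (\<integral>x. f (x /\<^sub>R t) \<partial>\<nu>) - V t * (\<integral>x. f (x /\<^sub>R t) \<partial>?L)\<bar>
          \<le> d * (V t * (\<integral>x. \<phi> (x /\<^sub>R t) \<partial>\<nu>)) + 2 * Cf * (K * (s n powr - a + s n powr - b))) at_top"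
        using eventually_ge_at_top[of t0]
      proof eventually_elim
        case (elim t)
        have tp: "t > 0" using elim K by simp
        let ?f = "\<lambda>y. f (y /\<^sub>R t)" and ?p = "\<lambda>y. \<phi> (y /\<^sub>R t)"
        have cs: "continuous_on UNIV (\<lambda>y::real^'n. y /\<^sub>R t)" by (intro continuous_intros)
        have fc: "continuous_on UNIV ?f" by (rule continuous_on_compose2[OF Cf(1) cs]) simp
        have pc: "continuous_on UNIV ?p" by (rule continuous_on_compose2[OF \<phi>(5) cs]) simp
        have fB: "\<And>x. \<bar>?f x\<bar> \<le> Cf" using Cf(3) by simp
        have pB: "\<And>x. \<bar>?p x\<bar> \<le> 1" using \<phi>(2,3) by simp
        have fm: "?f \<in> borel_measurable borel" "?p \<in> borel_measurable borel"
          using borel_measurable_continuous_onI[OF fc] borel_measurable_continuous_onI[OF pc] by auto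
        have iX1: "integrable M (\<lambda>\<omega>. ?f (X x n \<omega>))" for x
          by (rule integrable_const_bound[of _ Cf, OF _ measurable_compose[OF measurable_X fm(1)]]) (use fB in simp)
        have iX2: "integrable M (\<lambda>\<omega>. ?p (X x n \<omega>))" for x
          by (rule integrable_const_bound[of _ 1, OF _ measurable_compose[OF measurable_X fm(2)]]) (use pB in simp)
        note iX = iX1 iX2
        let ?m = "\<lambda>x. min 1 ((norm x / (s n * t)) powr \<gamma>)"
        have one: "\<bar>(\<integral>\<omega>. ?f (X x n \<omega>) \<partial>M) - (\<integral>\<omega>. ?f (X 0 n \<omega>) \<partial>M)\<bar> \<le> d * (\<integral>\<omega>. ?p (X x n \<omega>) \<partial>M) + 2 * Cf * ?m x" for x
        proof -
          define S where "S = {\<omega>\<in>space M. norm (X x n \<omega> - X 0 n \<omega>) > \<epsilon> * t}"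
          have [measurable]: "X x n \<in> borel_measurable M" "X 0 n \<in> borel_measurable M" by (rule measurable_X)+
          have S: "S \<in> sets M" unfolding S_def by measurable
          have iS: "integrable M (indicat_real S)" using S by (intro integrable_real_indicator) (auto simp: emeasure_finite less_top[symmetric])
          have "\<bar>(\<integral>\<omega>. ?f (X x n \<omega>) \<partial>M) - (\<integral>\<omega>. ?f (X 0 n \<omega>) \<partial>M)\<bar> = \<bar>\<integral>\<omega>. ?f (X x n \<omega>) - ?f (X 0 n \<omega>) \<partial>M\<bar>"
            using iX by simp
          also have "\<dots> \<le> (\<integral>\<omega>. d * ?p (X x n \<omega>) + 2 * Cf * indicator S \<omega> \<partial>M)"
          proof (rule order_trans[OF integral_abs_bound integral_mono])
            show "integrable M (\<lambda>\<omega>. \<bar>?f (X x n \<omega>) - ?f (X 0 n \<omega>)\<bar>)"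
              by (intro integrable_abs Bochner_Integration.integrable_diff iX1)
            show "integrable M (\<lambda>\<omega>. d * ?p (X x n \<omega>) + 2 * Cf * indicat_real S \<omega>)"
              by (intro Bochner_Integration.integrable_add integrable_mult_right iX2 iS)
            fix \<omega> assume w: "\<omega> \<in> space M"
            have "norm (X x n \<omega> /\<^sub>R t - X 0 n \<omega> /\<^sub>R t) = norm (X x n \<omega> - X 0 n \<omega>) / t"
              unfolding scaleR_right_diff_distrib[symmetric] using tp by (simp add: divide_inverse mult.commute)
            then have "norm (X x n \<omega> /\<^sub>R t - X 0 n \<omega> /\<^sub>R t) > \<epsilon> \<longleftrightarrow> \<omega> \<in> S"
              using w tp unfolding S_def by (simp add: pos_less_divide_eq)
            then show "\<bar>?f (X x n \<omega>) - ?f (X 0 n \<omega>)\<bar> \<le> d * ?p (X x n \<omega>) + 2 * Cf * indicator S \<omega>"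
              using pw[of "X x n \<omega> /\<^sub>R t" "X 0 n \<omega> /\<^sub>R t"] by (auto simp: indicator_def)
          qed
          also have "\<dots> = d * (\<integral>\<omega>. ?p (X x n \<omega>) \<partial>M) + 2 * Cf * measure M S"
            using S by (subst Bochner_Integration.integral_add) (auto intro!: integrable_mult_right iX2 iS)
          also have "measure M S \<le> ?m x"
          proof -
            have "measure M S \<le> min 1 (C * \<rho> ^ n * (norm x / (\<epsilon> * t)) powr \<gamma>)" unfolding S_def using \<epsilon> tp by (intro g(4)) simp
            also have "C * \<rho> ^ n * (norm x / (\<epsilon> * t)) powr \<gamma> = (norm x / (s n * t)) powr \<gamma>"
              using s_eq[of "norm x / t" n] tp by (simp add: field_simps)
            finally show ?thesis .
          qed
          then have "2 * Cf * measure M S \<le> 2 * Cf * ?m x" using Cf(2) by (intro mult_left_mono) auto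
          finally show ?thesis by simp
        qed
        have mm: "?m \<in> borel_measurable borel" by measurable
        have inu: "integrable \<nu> ?m" using mm \<nu>(2)
          by (intro nu.integrable_const_bound[of _ 1]) (auto cong: measurable_cong_sets)
        have ipn: "integrable \<nu> (\<lambda>x. \<integral>\<omega>. ?p (X x n \<omega>) \<partial>M)"
        proof (rule nu.integrable_const_bound[of _ 1])
          have "(\<lambda>x. \<integral>\<omega>. ?p (X x n \<omega>) \<partial>M) \<in> borel_measurable borel"
            by (rule borel_measurable_continuous_onI[OF continuous_expectation_X[OF pc pB]])
          then show "(\<lambda>x. \<integral>\<omega>. ?p (X x n \<omega>) \<partial>M) \<in> borel_measurable \<nu>" by (simp only: measurable_cong_sets[OF \<nu>(2) refl])
          have "\<bar>\<integral>\<omega>. ?p (X x n \<omega>) \<partial>M\<bar> \<le> 1" for x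
          proof -
            have "\<bar>\<integral>\<omega>. ?p (X x n \<omega>) \<partial>M\<bar> \<le> (\<integral>\<omega>. \<bar>?p (X x n \<omega>)\<bar> \<partial>M)" by (rule integral_abs_bound)
            also have "\<dots> \<le> (\<integral>\<omega>. 1 \<partial>M)" using pB by (intro integral_mono integrable_abs iX2) auto
            finally show ?thesis by (simp add: prob_space)
          qed
          then show "AE x in \<nu>. norm (\<integral>\<omega>. ?p (X x n \<omega>) \<partial>M) \<le> 1" by simp
        qed
        have ifn: "integrable \<nu> (\<lambda>x. \<integral>\<omega>. ?f (X x n \<omega>) \<partial>M)"
        proof (rule nu.integrable_const_bound[of _ Cf])
          have "(\<lambda>x. \<integral>\<omega>. ?f (X x n \<omega>) \<partial>M) \<in> borel_measurable borel"
            by (rule borel_measurable_continuous_onI[OF continuous_expectation_X[OF fc fB]])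
          then show "(\<lambda>x. \<integral>\<omega>. ?f (X x n \<omega>) \<partial>M) \<in> borel_measurable \<nu>" by (simp only: measurable_cong_sets[OF \<nu>(2) refl])
          have "\<bar>\<integral>\<omega>. ?f (X x n \<omega>) \<partial>M\<bar> \<le> Cf" for x
          proof -
            have "\<bar>\<integral>\<omega>. ?f (X x n \<omega>) \<partial>M\<bar> \<le> (\<integral>\<omega>. \<bar>?f (X x n \<omega>)\<bar> \<partial>M)" by (rule integral_abs_bound)
            also have "\<dots> \<le> (\<integral>\<omega>. Cf \<partial>M)" using fB by (intro integral_mono integrable_abs iX1) auto
            finally show ?thesis by (simp add: prob_space)
          qed
          then show "AE x in \<nu>. norm (\<integral>\<omega>. ?f (X x n \<omega>) \<partial>M) \<le> Cf" by simp
        qed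
        define c0 where "c0 = (\<integral>\<omega>. ?f (X 0 n \<omega>) \<partial>M)"
        have c0: "(\<integral>x. ?f x \<partial>?L) = c0" unfolding c0_def by (rule integral_distr[OF measurable_X fm(1)])
        \<comment> \<open>Stationarity inserts the n-step expectation under the integral over \<nu>;
          used again for \<phi>, it keeps the first error term free of n.\<close>
        have "\<bar>(\<integral>x. ?f x \<partial>\<nu>) - (\<integral>x. ?f x \<partial>?L)\<bar> = \<bar>\<integral>x. (\<integral>\<omega>. ?f (X x n \<omega>) \<partial>M) - c0 \<partial>\<nu>\<bar>"
          unfolding c0 stationary_chain[OF st fc fB, of n, symmetric] using ifn by (simp add: nu.prob_space)
        also have "\<dots> \<le> (\<integral>x. d * (\<integral>\<omega>. ?p (X x n \<omega>) \<partial>M) + 2 * Cf * ?m x \<partial>\<nu>)"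
        proof (rule order_trans[OF integral_abs_bound integral_mono])
          show "integrable \<nu> (\<lambda>x. \<bar>(\<integral>\<omega>. ?f (X x n \<omega>) \<partial>M) - c0\<bar>)"
            by (intro integrable_abs Bochner_Integration.integrable_diff ifn) simp
          show "integrable \<nu> (\<lambda>x. d * (\<integral>\<omega>. ?p (X x n \<omega>) \<partial>M) + 2 * Cf * ?m x)"
            by (intro Bochner_Integration.integrable_add integrable_mult_right ipn inu)
        qed (use one in \<open>simp add: c0_def\<close>)
        also have "\<dots> = d * (\<integral>x. (\<integral>\<omega>. ?p (X x n \<omega>) \<partial>M) \<partial>\<nu>) + 2 * Cf * (\<integral>x. ?m x \<partial>\<nu>)"
          by (subst Bochner_Integration.integral_add) (auto intro!: ipn inu)
        also have "(\<integral>x. (\<integral>\<omega>. ?p (X x n \<omega>) \<partial>M) \<partial>\<nu>) = (\<integral>x. ?p x \<partial>\<nu>)" by (rule stationary_chain[OF st pc pB])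
        finally have "V t * \<bar>(\<integral>x. ?f x \<partial>\<nu>) - (\<integral>x. ?f x \<partial>?L)\<bar> \<le> V t * (d * (\<integral>x. ?p x \<partial>\<nu>) + 2 * Cf * (\<integral>x. ?m x \<partial>\<nu>))"
          using V_pos[OF tp] by (intro mult_left_mono) auto
        also have "\<dots> = d * (V t * (\<integral>x. ?p x \<partial>\<nu>)) + 2 * Cf * (V t * (\<integral>x. ?m x \<partial>\<nu>))" by (simp add: distrib_left mult_ac)
        also have "\<dots> \<le> d * (V t * (\<integral>x. ?p x \<partial>\<nu>)) + 2 * Cf * (K * (s n powr - a + s n powr - b))"
          using Cf(2) by (intro add_mono mult_left_mono K(5)[OF elim sp] order_refl) auto
        finally show ?case using V_pos[OF tp] by (simp add: abs_mult right_diff_distrib[symmetric])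
      qed
    qed simp
    have "E \<longlonglongrightarrow> d * T1 \<phi> + 2 * Cf * (K * (0 + 0))"
    proof -
      have rho: "(\<lambda>n. C * \<rho> ^ n) \<longlonglongrightarrow> 0" using g by (intro tendsto_mult_right_zero LIMSEQ_realpow_zero) auto
      have pw0: "(\<lambda>n. s n powr - z) \<longlonglongrightarrow> 0" if z: "z > 0" for z
      proof -
        have eq: "s n powr - z = \<epsilon> powr - z * (C * \<rho> ^ n) powr (z / \<gamma>)" for n
          unfolding s_def using g \<epsilon> by (simp add: powr_mult powr_powr mult_ac)
        have "(\<lambda>n. (C * \<rho> ^ n) powr (z / \<gamma>)) \<longlonglongrightarrow> 0"
          by (rule tendsto_zero_powrI[OF rho tendsto_const]) (use g z \<gamma>p in auto)
        then show ?thesis unfolding eq by (rule tendsto_mult_right_zero)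
      qed
      show ?thesis unfolding E_def[abs_def] by (intro tendsto_intros pw0 K)
    qed
    then have "E \<longlonglongrightarrow> d * T1 \<phi>" by simp
    from order_tendstoD(2)[OF this d(2)] show "eventually (\<lambda>n. dist (chain_functional n f) (T1 f) < e) sequentially"
    proof eventually_elim
      case (elim n)
      then show ?case using bound[of n] by (simp add: dist_real_def abs_minus_commute)
    qed
  qed
qed

end

section \<open>Propagation of the tail of a single jump\<close>

text \<open>Mass arriving at 0 is discarded, since a singular matrix or \<open>\<Phi> 0\<close> may
  collapse a set of infinite measure onto the origin.\<close>

definition punctured_image :: "'b measure \<Rightarrow> ('b \<Rightarrow> real^'n) \<Rightarrow> (real^'n) measure" where
  "punctured_image P h = restrict_space (distr P borel h) (- {0})"

text \<open>Stronger than the Radon property: the mass near infinity is finite as well, which makes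
  every function in \<open>Cb_away\<close> integrable.\<close>

definition finite_away :: "(real^'n) measure \<Rightarrow> bool" where
  "finite_away \<Lambda> \<longleftrightarrow> sets \<Lambda> = sets punct \<and> (\<forall>r>0. emeasure \<Lambda> {x. r \<le> norm x} < \<infinity>)"

lemma finite_away_radon: "finite_away \<Lambda> \<Longrightarrow> radon_punctured \<Lambda>"
  for \<Lambda> :: "(real^'n) measure"
  unfolding finite_away_def radon_punctured_def
proof (elim conjE, intro conjI allI impI, assumption, elim conjE)
  fix K :: "(real^'n) set"
  assume s: "sets \<Lambda> = sets punct" and fin: "\<forall>r>0. emeasure \<Lambda> {x. r \<le> norm x} < \<infinity>" and K: "compact K" "0 \<notin> K"
  obtain r R where r: "0 < r" "r < R" "\<And>x. x \<in> K \<Longrightarrow> r \<le> norm x \<and> norm x \<le> R" by (rule compact_annulus[OF K]) blast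
  have "{x::real^'n. r \<le> norm x} \<in> sets \<Lambda>" unfolding s using r(1) by (auto simp: sets_restrict_space_iff)
  then have "emeasure \<Lambda> K \<le> emeasure \<Lambda> {x. r \<le> norm x}" using r(3) by (intro emeasure_mono) auto
  also have "\<dots> < \<infinity>" using fin r(1) by blast
  finally show "emeasure \<Lambda> K < \<infinity>" .
qed

lemma finite_away_integrable:
  assumes "finite_away \<Lambda>" "f \<in> Cb_away" shows "integrable \<Lambda> f"
proof -
  have rad: "radon_punctured \<Lambda>" by (rule finite_away_radon[OF assms(1)])
  obtain C r where C: "continuous_on UNIV f" "C > 0" "\<And>x. \<bar>f x\<bar> \<le> C" "r > 0" "\<And>x. norm x < r \<Longrightarrow> f x = 0"
    by (rule Cb_awayE[OF assms(2)]) blast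
  have s: "{x. r \<le> norm x} \<in> sets \<Lambda>" using C(4) by (intro sets_radonI[OF rad]) auto
  have fin: "emeasure \<Lambda> {x. r \<le> norm x} < \<infinity>" using assms(1) C(4) unfolding finite_away_def by blast
  have "integrable \<Lambda> (\<lambda>x. C * indicator {x. r \<le> norm x} x)"
    by (intro integrable_mult_right integrable_real_indicator s fin)
  then show ?thesis
  proof (rule Bochner_Integration.integrable_bound)
    show "f \<in> borel_measurable \<Lambda>" by (rule measurable_radon[OF rad borel_Cb_away[OF assms(2)]])
    show "AE x in \<Lambda>. norm (f x) \<le> norm (C * indicator {x. r \<le> norm x} x)"
    proof (rule AE_I2)
      fix x show "norm (f x) \<le> norm (C * indicator {x. r \<le> norm x} x)"
        using C(3)[of x] C(2) C(5)[of x] by (cases "r \<le> norm x") (auto simp: indicator_def)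
    qed
  qed
qed

lemma sets_punctured_image: "sets (punctured_image P h) = sets punct"
  unfolding punctured_image_def by (rule sets_restrict_space_cong) simp

context
  fixes P :: "'b measure" and h :: "'b \<Rightarrow> real^'n"
  assumes h: "h \<in> borel_measurable P"
begin

lemma nn_integral_punctured_image:
  assumes f: "f \<in> borel_measurable borel" and f0: "f 0 = 0"
  shows "(\<integral>\<^sup>+x. f x \<partial>punctured_image P h) = (\<integral>\<^sup>+p. f (h p) \<partial>P)"
proof -
  have "(\<integral>\<^sup>+x. f x \<partial>punctured_image P h) = (\<integral>\<^sup>+x. f x * indicator (- {0}) x \<partial>distr P borel h)"
    unfolding punctured_image_def by (rule nn_integral_restrict_space) simp
  also have "\<dots> = (\<integral>\<^sup>+x. f x \<partial>distr P borel h)"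
    by (rule nn_integral_cong) (simp add: indicator_def f0)
  also have "\<dots> = (\<integral>\<^sup>+p. f (h p) \<partial>P)" using h f by (intro nn_integral_distr) auto
  finally show ?thesis .
qed

lemma integral_punctured_image:
  fixes f :: "real^'n \<Rightarrow> real"
  assumes f: "f \<in> borel_measurable borel" and f0: "f 0 = 0"
  shows "(\<integral>x. f x \<partial>punctured_image P h) = (\<integral>p. f (h p) \<partial>P)"
    "integrable (punctured_image P h) f \<longleftrightarrow> integrable P (\<lambda>p. f (h p))"
proof -
  have eq: "(\<lambda>x. indicator (- {0}) x *\<^sub>R f x) = f" by (auto simp: fun_eq_iff indicator_def f0)
  have "(\<integral>x. f x \<partial>punctured_image P h) = (\<integral>x. indicator (- {0}) x *\<^sub>R f x \<partial>distr P borel h)"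
    unfolding punctured_image_def by (rule integral_restrict_space) simp
  then show "(\<integral>x. f x \<partial>punctured_image P h) = (\<integral>p. f (h p) \<partial>P)"
    unfolding eq using integral_distr[OF h f] by simp
  have "integrable (punctured_image P h) f \<longleftrightarrow> integrable (distr P borel h) (\<lambda>x. indicator (- {0}) x *\<^sub>R f x)"
    unfolding punctured_image_def by (rule integrable_restrict_space) simp
  then show "integrable (punctured_image P h) f \<longleftrightarrow> integrable P (\<lambda>p. f (h p))"
    unfolding eq using integrable_distr_eq[OF h f] by simp
qed

lemma AE_punctured_image:
  assumes "AE p in P. Q (h p)" "{x. Q x} \<in> sets borel"
  shows "AE x in punctured_image P h. Q x"
proof -
  have "AE x in distr P borel h. Q x" using assms by (subst AE_distr_iff[OF h]) auto
  then show ?thesis unfolding punctured_image_def by (subst AE_restrict_space_iff) auto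
qed

end

lemma punctured_measure_eqI:
  assumes "sets \<Lambda> = sets punct" "sets \<Lambda>' = sets punct"
    "\<And>f::real^'n \<Rightarrow> ennreal. f \<in> borel_measurable borel \<Longrightarrow> f 0 = 0 \<Longrightarrow> (\<integral>\<^sup>+x. f x \<partial>\<Lambda>) = (\<integral>\<^sup>+x. f x \<partial>\<Lambda>')"
  shows "\<Lambda> = \<Lambda>'"
proof (rule measure_eqI)
  show "sets \<Lambda> = sets \<Lambda>'" using assms by simp
  fix S assume S: "S \<in> sets \<Lambda>"
  then have "S \<in> sets borel" "0 \<notin> S" using assms(1) by (auto simp: sets_restrict_space_iff)
  then have "(\<integral>\<^sup>+x. indicator S x \<partial>\<Lambda>) = (\<integral>\<^sup>+x. indicator S x \<partial>\<Lambda>')" by (intro assms(3)) auto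
  then show "emeasure \<Lambda> S = emeasure \<Lambda>' S" using S assms by simp
qed

lemma matrix_image_measurable:
  fixes \<Lambda> :: "(real^'n) measure" and \<mu> :: "(real^'n^'n) measure"
  assumes \<mu>: "sets \<mu> = sets borel" and \<Lambda>: "sets \<Lambda> = sets punct"
  shows "(\<lambda>p. fst p *v snd p) \<in> borel_measurable (\<mu> \<Otimes>\<^sub>M \<Lambda>)"
proof -
  have id: "(\<lambda>x. x) \<in> measurable \<Lambda> borel"
    by (simp add: measurable_cong_sets[OF \<Lambda> refl] measurable_restrict_space1)
  have m: "fst \<in> measurable (\<mu> \<Otimes>\<^sub>M \<Lambda>) borel" "snd \<in> measurable (\<mu> \<Otimes>\<^sub>M \<Lambda>) borel"
    using measurable_fst[of \<mu> \<Lambda>] measurable_compose[OF measurable_snd id, of \<mu>] by (simp_all add: measurable_cong_sets[OF refl \<mu>])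
  show ?thesis by (rule borel_measurable_matrix_vector_mult[OF m])
qed

lemma nn_integral_matrix_image:
  fixes \<Lambda> :: "(real^'n) measure" and \<mu> :: "(real^'n^'n) measure"
  assumes \<mu>: "sets \<mu> = sets borel" and \<Lambda>: "sigma_finite_measure \<Lambda>" "sets \<Lambda> = sets punct"
    and f: "f \<in> borel_measurable borel" "f 0 = 0"
  shows "(\<integral>\<^sup>+x. f x \<partial>punctured_image (\<mu> \<Otimes>\<^sub>M \<Lambda>) (\<lambda>p. fst p *v snd p)) = (\<integral>\<^sup>+a. (\<integral>\<^sup>+x. f (a *v x) \<partial>\<Lambda>) \<partial>\<mu>)"
proof -
  note h = matrix_image_measurable[OF \<mu> \<Lambda>(2)]
  show ?thesis
    unfolding nn_integral_punctured_image[OF h f]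
    using sigma_finite_measure.nn_integral_fst[OF \<Lambda>(1) measurable_compose[OF h f(1)]] by simp
qed

text \<open>Substituting t/r for t in the limit changes the normalisation by V(t/r)/V(t), which
  tends to r^-\<alpha>.\<close>

lemma tail_functional_homogeneous:
  assumes T: "tail_functional V \<kappa> T" and V: "regvar V \<alpha>" and f: "f \<in> Cb_away" and r: "r > 0"
  shows "T (\<lambda>x. f (r *\<^sub>R x)) = r powr \<alpha> * T f"
proof -
  have fr: "(\<lambda>x. f (r *\<^sub>R x)) \<in> Cb_away"
    by (rule Cb_away_compose[OF f]) (auto intro!: continuous_intros)
  have "((\<lambda>t. V t * (\<integral>x. f (x /\<^sub>R t) \<partial>\<kappa>)) \<longlongrightarrow> T f) at_top" by (rule bspec[OF T[unfolded tail_functional_def] f])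
  moreover have "filterlim (\<lambda>t. (1/r) * t) at_top at_top"
    using r by (intro filterlim_tendsto_pos_mult_at_top[OF tendsto_const] filterlim_ident) auto
  ultimately have 1: "((\<lambda>t. V ((1/r) * t) * (\<integral>x. f (x /\<^sub>R ((1/r) * t)) \<partial>\<kappa>)) \<longlongrightarrow> T f) at_top"
    by (rule filterlim_compose)
  have "((\<lambda>t. V ((1/r) * t) / V t) \<longlongrightarrow> (1/r) powr \<alpha>) at_top"
    using V r unfolding regvar_def by (meson divide_pos_pos zero_less_one)
  then have "((\<lambda>t. inverse (V ((1/r) * t) / V t)) \<longlongrightarrow> inverse ((1/r) powr \<alpha>)) at_top"
    using r by (intro tendsto_inverse) auto
  from tendsto_mult[OF this 1]
  have 2: "((\<lambda>t. inverse (V ((1/r) * t) / V t) * (V ((1/r) * t) * (\<integral>x. f (x /\<^sub>R ((1/r) * t)) \<partial>\<kappa>))) \<longlongrightarrow> inverse ((1/r) powr \<alpha>) * T f) at_top" .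
  have ev: "eventually (\<lambda>t. inverse (V ((1/r) * t) / V t) * (V ((1/r) * t) * (\<integral>x. f (x /\<^sub>R ((1/r) * t)) \<partial>\<kappa>))
      = V t * (\<integral>x. f (r *\<^sub>R (x /\<^sub>R t)) \<partial>\<kappa>)) at_top"
    using eventually_gt_at_top[of 0]
  proof eventually_elim
    case (elim t)
    have "V ((1/r) * t) > 0" using V r elim unfolding regvar_def by simp
    moreover have sc: "x /\<^sub>R ((1/r) * t) = r *\<^sub>R (x /\<^sub>R t)" for x :: 'a using r elim by (simp add: divide_inverse mult.commute)
    ultimately show ?case unfolding sc by simp
  qed
  have "((\<lambda>t. V t * (\<integral>x. f (r *\<^sub>R (x /\<^sub>R t)) \<partial>\<kappa>)) \<longlongrightarrow> inverse ((1/r) powr \<alpha>) * T f) at_top"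
    by (rule Lim_transform_eventually[OF 2 ev])
  moreover have "((\<lambda>t. V t * (\<integral>x. f (r *\<^sub>R (x /\<^sub>R t)) \<partial>\<kappa>)) \<longlongrightarrow> T (\<lambda>x. f (r *\<^sub>R x))) at_top"
    by (rule bspec[OF T[unfolded tail_functional_def] fr])
  ultimately have "T (\<lambda>x. f (r *\<^sub>R x)) = inverse ((1/r) powr \<alpha>) * T f"
    by (intro tendsto_unique[OF trivial_limit_at_top_linorder])
  also have "inverse ((1/r) powr \<alpha>) = r powr \<alpha>" using r by (simp add: powr_one_divide powr_minus)
  finally show ?thesis .
qed

locale tail_chain = heavy_chain M N \<Phi> \<delta> A B1 B2 B3 As B1s B2s B3s V \<alpha> "\<lambda>f. \<integral>x. f x \<partial>\<Lambda>\<^sub>b"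
  for M :: "'w measure" and N :: "real^'n \<Rightarrow> real" and \<Phi> :: "real^'n \<Rightarrow> real^'n \<Rightarrow> real^'n" and \<delta> :: real
    and A :: "'w \<Rightarrow> real^'n^'n" and B1 :: "'w \<Rightarrow> real^'n" and B2 :: "'w \<Rightarrow> real^'n \<Rightarrow> real^'n" and B3 :: "'w \<Rightarrow> real"
    and As :: "nat \<Rightarrow> 'w \<Rightarrow> real^'n^'n" and B1s :: "nat \<Rightarrow> 'w \<Rightarrow> real^'n"
    and B2s :: "nat \<Rightarrow> 'w \<Rightarrow> real^'n \<Rightarrow> real^'n" and B3s :: "nat \<Rightarrow> 'w \<Rightarrow> real"
    and V :: "real \<Rightarrow> real" and \<alpha> :: real and \<Lambda>\<^sub>b :: "(real^'n) measure" +
  assumes Lb: "finite_away \<Lambda>\<^sub>b"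
    and Phi_id: "\<forall>x \<in> closure {g *v \<Phi> 0 y | g y.
                    g \<in> generated_semigroup (msupport (distr M borel A)) \<and> y \<in> msupport \<Lambda>\<^sub>b}. \<Phi> x 0 = x"
begin

abbreviation \<mu> :: "(real^'n^'n) measure" where "\<mu> \<equiv> distr M borel A"

text \<open>The measures are indexed from \<open>0\<close>: \<open>jump_tail k\<close> is \<open>\<Gamma>\<^bsub>k+1\<^esub>\<close>.\<close>

primrec jump_tail :: "nat \<Rightarrow> (real^'n) measure" where
  "jump_tail 0 = punctured_image \<Lambda>\<^sub>b (\<Phi> 0)"
| "jump_tail (Suc k) = punctured_image (\<mu> \<Otimes>\<^sub>M jump_tail k) (\<lambda>p. fst p *v snd p)"

lemma rad_Lb: "radon_punctured \<Lambda>\<^sub>b" by (rule finite_away_radon[OF Lb])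

lemma Phi0_measurable: "\<Phi> 0 \<in> borel_measurable \<Lambda>\<^sub>b"
  by (rule measurable_radon[OF rad_Lb borel_measurable_continuous_onI[OF continuous_Phi(2)]])

lemma prob_mu: "prob_space \<mu>"
  by (rule prob_space_distr) simp

lemma sets_jump_tail: "sets (jump_tail k) = sets punct"
  by (cases k) (simp_all add: sets_punctured_image)

lemma alpha_moment: "integrable M (\<lambda>\<omega>. norm (A \<omega>) powr \<alpha>)"
proof -
  obtain \<beta> where \<beta>: "\<beta> > \<alpha>" "integrable M (\<lambda>\<omega>. norm (A \<omega>) powr \<beta>)" using A_moment by blast
  have m: "(\<lambda>\<omega>. norm (A \<omega>)) \<in> borel_measurable M" by measurable
  show ?thesis by (rule integrable_powr_le[OF finite_measure_axioms m \<beta>(2)]) (use \<beta> alpha in auto)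
qed

lemma B1_regvar: "regvar V \<alpha>" using V unfolding potter_def by simp

text \<open>Homogeneity makes the bound on the exterior mass a pure power of s. A matrix
  \<open>a\<close> pulls the threshold s back to s/|a|, so each step multiplies the constant by E
  |A|^\<alpha>, which is finite.\<close>

lemma jump_tail_tail: "\<exists>C\<ge>0. \<forall>s>0. emeasure (jump_tail k) {x. s \<le> norm x} \<le> ennreal (C * s powr - \<alpha>)"
proof (induction k)
  case 0
  \<comment> \<open>Dominates the indicator of |\<Phi> 0 y| \<ge> 1. The general threshold follows
    from homogeneity of \<Phi> and of the tail measure of B1.\<close>
  define g where "g = (\<lambda>y. ramp (1/2) 1 (\<Phi> 0 y))"
  have rc: "ramp (1/2) 1 \<in> (Cb_away :: (real^'n \<Rightarrow> real) set)" by (rule ramp_Cb_away) auto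
  have g: "g \<in> Cb_away" unfolding g_def by (rule Cb_away_Phi(1)[OF rc])
  have g0: "0 \<le> g y" for y unfolding g_def by (rule ramp_props) simp
  show ?case
  proof (intro exI[of _ "\<integral>y. g y \<partial>\<Lambda>\<^sub>b"] conjI allI impI)
    show "(\<integral>y. g y \<partial>\<Lambda>\<^sub>b) \<ge> 0" using g0 by (simp add: Bochner_Integration.integral_nonneg)
    fix s :: real assume s: "s > 0"
    have gs: "(\<lambda>y. g (inverse s *\<^sub>R y)) \<in> Cb_away"
      by (rule Cb_away_compose[OF g]) (auto intro!: continuous_intros)
    let ?S = "{x::real^'n. s \<le> norm x}"
    have S: "?S \<in> sets punct" using s by (auto simp: sets_restrict_space_iff)
    have "emeasure (jump_tail 0) ?S = (\<integral>\<^sup>+x. indicator ?S x \<partial>jump_tail 0)" using S by (simp only: sets_jump_tail nn_integral_indicator)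
    also have "\<dots> = (\<integral>\<^sup>+y. indicator ?S (\<Phi> 0 y) \<partial>\<Lambda>\<^sub>b)" unfolding jump_tail.simps
      using s by (intro nn_integral_punctured_image[OF Phi0_measurable]) auto
    also have "\<dots> \<le> (\<integral>\<^sup>+y. ennreal (g (inverse s *\<^sub>R y)) \<partial>\<Lambda>\<^sub>b)"
    proof (rule nn_integral_mono)
      fix y
      show "indicator ?S (\<Phi> 0 y) \<le> ennreal (g (inverse s *\<^sub>R y))"
      proof (cases "s \<le> norm (\<Phi> 0 y)")
        case True
        have "\<Phi> 0 (inverse s *\<^sub>R y) = \<Phi> 0 y /\<^sub>R s" using Phi_scale[OF s, of 0 y] by simp
        then have "norm (\<Phi> 0 (inverse s *\<^sub>R y)) \<ge> 1" using True s by (simp add: field_simps)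
        then have "g (inverse s *\<^sub>R y) = 1" unfolding g_def by (intro ramp_props) auto
        then show ?thesis by (simp add: indicator_def)
      qed simp
    qed
    also have "\<dots> = ennreal (\<integral>y. g (inverse s *\<^sub>R y) \<partial>\<Lambda>\<^sub>b)"
      using g0 by (intro nn_integral_eq_integral finite_away_integrable[OF Lb gs]) auto
    also have "(\<integral>y. g (inverse s *\<^sub>R y) \<partial>\<Lambda>\<^sub>b) = inverse s powr \<alpha> * (\<integral>y. g y \<partial>\<Lambda>\<^sub>b)"
      using s by (intro tail_functional_homogeneous[OF B1_tail B1_regvar g]) simp
    also have "inverse s powr \<alpha> = s powr - \<alpha>" using s powr_one_divide[of s \<alpha>] by (simp add: inverse_eq_divide)
    finally show "emeasure (jump_tail 0) ?S \<le> ennreal ((\<integral>y. g y \<partial>\<Lambda>\<^sub>b) * s powr - \<alpha>)" by (simp only: mult.commute)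
  qed
next
  case (Suc k)
  then obtain C where C: "C \<ge> 0" "\<And>s. s > 0 \<Longrightarrow> emeasure (jump_tail k) {x. s \<le> norm x} \<le> ennreal (C * s powr - \<alpha>)" by blast
  have "finite_away (jump_tail k)" unfolding finite_away_def
  proof (intro conjI sets_jump_tail allI impI)
    fix r :: real assume "r > 0"
    from C(2)[OF this] show "emeasure (jump_tail k) {x. r \<le> norm x} < \<infinity>" by (rule order_le_less_trans) simp
  qed
  note sf = sigma_finite_radon[OF finite_away_radon[OF this]]
  define m where "m = (\<integral>\<omega>. norm (A \<omega>) powr \<alpha> \<partial>M)"
  have m: "m \<ge> 0" unfolding m_def by (simp add: Bochner_Integration.integral_nonneg)
  show ?case
  proof (intro exI[of _ "C * m"] conjI allI impI)
    show "C * m \<ge> 0" using C m by simp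
    fix s :: real assume s: "s > 0"
    let ?S = "{x::real^'n. s \<le> norm x}"
    have S: "?S \<in> sets punct" using s by (auto simp: sets_restrict_space_iff)
    have "emeasure (jump_tail (Suc k)) ?S = (\<integral>\<^sup>+x. indicator ?S x \<partial>jump_tail (Suc k))" using S by (simp only: sets_jump_tail nn_integral_indicator)
    also have "\<dots> = (\<integral>\<^sup>+a. (\<integral>\<^sup>+x. indicator ?S (a *v x) \<partial>jump_tail k) \<partial>\<mu>)" unfolding jump_tail.simps
      using s by (intro nn_integral_matrix_image[OF _ sf sets_jump_tail]) auto
    also have "\<dots> \<le> (\<integral>\<^sup>+a. ennreal (C * s powr - \<alpha> * norm a powr \<alpha>) \<partial>\<mu>)"
    proof (rule nn_integral_mono)
      fix a :: "real^'n^'n"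
      show "(\<integral>\<^sup>+x. indicator ?S (a *v x) \<partial>jump_tail k) \<le> ennreal (C * s powr - \<alpha> * norm a powr \<alpha>)"
      proof (cases "a = 0")
        case True
        then show ?thesis using s by (simp add: indicator_def)
      next
        case False
        let ?R = "{x::real^'n. s / norm a \<le> norm x}"
        have R: "?R \<in> sets (jump_tail k)" unfolding sets_jump_tail using divide_pos_pos[OF s, of "norm a"] False by (auto simp: sets_restrict_space_iff)
        have "(\<integral>\<^sup>+x. indicator ?S (a *v x) \<partial>jump_tail k) \<le> (\<integral>\<^sup>+x. indicator ?R x \<partial>jump_tail k)"
        proof (rule nn_integral_mono)
          fix x
          have "s \<le> norm (a *v x) \<Longrightarrow> s / norm a \<le> norm x"
            using norm_matrix_vector_mult_le[of a x] False by (simp add: field_simps)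
          then show "indicator ?S (a *v x) \<le> (indicator ?R x :: ennreal)" by (auto simp: indicator_def)
        qed
        also have "\<dots> = emeasure (jump_tail k) ?R" using R by simp
        also have "\<dots> \<le> ennreal (C * (s / norm a) powr - \<alpha>)" using s False by (intro C) auto
        also have "(s / norm a) powr - \<alpha> = s powr - \<alpha> * norm a powr \<alpha>"
          by (simp only: powr_divide powr_minus_divide) (simp add: field_simps)
        finally show ?thesis by (simp add: mult.assoc)
      qed
    qed
    also have "\<dots> = (\<integral>\<^sup>+\<omega>. ennreal (C * s powr - \<alpha> * norm (A \<omega>) powr \<alpha>) \<partial>M)" by (rule nn_integral_distr) auto
    also have "\<dots> = ennreal (\<integral>\<omega>. C * s powr - \<alpha> * norm (A \<omega>) powr \<alpha> \<partial>M)"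
      using C alpha_moment by (intro nn_integral_eq_integral) auto
    also have "(\<integral>\<omega>. C * s powr - \<alpha> * norm (A \<omega>) powr \<alpha> \<partial>M) = C * m * s powr - \<alpha>" unfolding m_def by simp
    finally show "emeasure (jump_tail (Suc k)) ?S \<le> ennreal (C * m * s powr - \<alpha>)" .
  qed
qed

lemma jump_tail_finite_away: "finite_away (jump_tail k)"
  unfolding finite_away_def
proof (intro conjI sets_jump_tail allI impI)
  fix r :: real assume r: "r > 0"
  obtain C where "\<And>s. s > 0 \<Longrightarrow> emeasure (jump_tail k) {x. s \<le> norm x} \<le> ennreal (C * s powr - \<alpha>)" using jump_tail_tail[of k] by blast
  from this[OF r] show "emeasure (jump_tail k) {x. r \<le> norm x} < \<infinity>" by (rule order_le_less_trans) simp
qed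

lemma rad_jump_tail: "radon_punctured (jump_tail k)" by (rule finite_away_radon[OF jump_tail_finite_away])

lemma sigma_finite_jump_tail: "sigma_finite_measure (jump_tail k)" by (rule sigma_finite_radon[OF rad_jump_tail])

lemma integrable_jump_tail: "f \<in> Cb_away \<Longrightarrow> integrable (jump_tail k) f"
  by (rule finite_away_integrable[OF jump_tail_finite_away])

lemma Cb_away_matrix: "f \<in> Cb_away \<Longrightarrow> (\<lambda>x. f (a *v x)) \<in> Cb_away" for f :: "real^'n \<Rightarrow> real" and a :: "real^'n^'n"
  by (rule Cb_away_compose) (auto intro: linear_continuous_on matrix_vector_mul_bounded_linear)

lemma matrix_mult_measurable: "(\<lambda>p. fst p *v snd p) \<in> borel_measurable (\<mu> \<Otimes>\<^sub>M jump_tail k)"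
  by (rule matrix_image_measurable[OF _ sets_jump_tail]) simp

lemma integral_jump_tail_0:
  assumes f: "f \<in> Cb_away" shows "(\<integral>x. f x \<partial>jump_tail 0) = (\<integral>y. f (\<Phi> 0 y) \<partial>\<Lambda>\<^sub>b)"
  unfolding jump_tail.simps
  by (rule integral_punctured_image(1)[OF Phi0_measurable borel_Cb_away[OF f]]) (use f in \<open>auto simp: Cb_away_def\<close>)

lemma integral_jump_tail_Suc:
  assumes f: "f \<in> Cb_away"
  shows "(\<integral>x. f x \<partial>jump_tail (Suc k)) = (\<integral>\<omega>. (\<integral>x. f (A \<omega> *v x) \<partial>jump_tail k) \<partial>M)"
    "integrable M (\<lambda>\<omega>. \<integral>x. f (A \<omega> *v x) \<partial>jump_tail k)"
proof -
  interpret mu: prob_space \<mu> by (rule prob_mu)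
  interpret g: sigma_finite_measure "jump_tail k" by (rule sigma_finite_jump_tail)
  interpret P: pair_sigma_finite \<mu> "jump_tail k" ..
  have f0: "f 0 = 0" using f by (auto simp: Cb_away_def)
  note im = integral_punctured_image[OF matrix_mult_measurable borel_Cb_away[OF f] f0, of k]
  have i: "integrable (\<mu> \<Otimes>\<^sub>M jump_tail k) (\<lambda>p. f (fst p *v snd p))"
    using integrable_jump_tail[OF f, of "Suc k"] im(2) by simp
  have i1: "integrable \<mu> (\<lambda>a. \<integral>x. f (a *v x) \<partial>jump_tail k)" using P.integrable_fst'[OF i] by simp
  have "(\<integral>x. f x \<partial>jump_tail (Suc k)) = (\<integral>p. f (fst p *v snd p) \<partial>(\<mu> \<Otimes>\<^sub>M jump_tail k))" using im(1) by simp
  also have "\<dots> = (\<integral>a. (\<integral>x. f (a *v x) \<partial>jump_tail k) \<partial>\<mu>)" using P.integral_fst'[OF i] by simp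
  also have "\<dots> = (\<integral>\<omega>. (\<integral>x. f (A \<omega> *v x) \<partial>jump_tail k) \<partial>M)"
    by (rule integral_distr) (use borel_measurable_integrable[OF i1] in auto)
  finally show "(\<integral>x. f x \<partial>jump_tail (Suc k)) = (\<integral>\<omega>. (\<integral>x. f (A \<omega> *v x) \<partial>jump_tail k) \<partial>M)" .
  show "integrable M (\<lambda>\<omega>. \<integral>x. f (A \<omega> *v x) \<partial>jump_tail k)"
    by (rule integrable_distr[OF _ i1]) simp
qed

text \<open>Homogeneity passes from one level to the next because \<open>\<Phi> 0\<close> and linear
  maps commute with positive dilations.\<close>

lemma jump_tail_homogeneous: "f \<in> Cb_away \<Longrightarrow> r > 0 \<Longrightarrow> (\<integral>x. f (r *\<^sub>R x) \<partial>jump_tail k) = r powr \<alpha> * (\<integral>x. f x \<partial>jump_tail k)"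
proof (induction k arbitrary: f)
  case 0
  have fr: "(\<lambda>x. f (r *\<^sub>R x)) \<in> Cb_away"
    by (rule Cb_away_compose[OF 0(1)]) (auto intro!: continuous_intros)
  have "\<Phi> 0 (r *\<^sub>R y) = r *\<^sub>R \<Phi> 0 y" for y using Phi_hom 0(2) by (metis scaleR_zero_right)
  then show ?case unfolding integral_jump_tail_0[OF fr] integral_jump_tail_0[OF 0(1)]
    using tail_functional_homogeneous[OF B1_tail B1_regvar Cb_away_Phi(1)[OF 0(1)] 0(2)] by simp
next
  case (Suc k)
  have fr: "(\<lambda>x. f (r *\<^sub>R x)) \<in> Cb_away"
    by (rule Cb_away_compose[OF Suc(2)]) (auto intro!: continuous_intros)
  have "(\<integral>x. f (r *\<^sub>R (A \<omega> *v x)) \<partial>jump_tail k) = r powr \<alpha> * (\<integral>x. f (A \<omega> *v x) \<partial>jump_tail k)" for \<omega>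
    using Suc.IH[OF Cb_away_matrix[OF Suc(2)] Suc(3), of "A \<omega>"] by (simp add: matrix_vector_mult_scaleR)
  then show ?case unfolding integral_jump_tail_Suc(1)[OF fr] integral_jump_tail_Suc(1)[OF Suc(2)] by simp
qed

definition supp_cl :: "(real^'n) set" where
  "supp_cl = closure {g *v \<Phi> 0 y | g y. g \<in> generated_semigroup (msupport \<mu>) \<and> y \<in> msupport \<Lambda>\<^sub>b}"

text \<open>\<open>a ** g\<close> stays in the semigroup, and continuity of the linear map extends
  the inclusion to the closure.\<close>

lemma supp_cl_invariant:
  assumes a: "a \<in> msupport \<mu>" and x: "x \<in> supp_cl" shows "a *v x \<in> supp_cl"
proof -
  let ?S = "{g *v \<Phi> 0 y | g y. g \<in> generated_semigroup (msupport \<mu>) \<and> y \<in> msupport \<Lambda>\<^sub>b}"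
  have "(*v) a ` closure ?S \<subseteq> closure ?S"
  proof (rule image_closure_subset)
    show "continuous_on (closure ?S) ((*v) a)" by (intro linear_continuous_on matrix_vector_mul_bounded_linear)
    show "(*v) a ` ?S \<subseteq> closure ?S"
    proof
      fix z assume "z \<in> (*v) a ` ?S"
      then obtain g y where gy: "z = a *v (g *v \<Phi> 0 y)" "g \<in> generated_semigroup (msupport \<mu>)" "y \<in> msupport \<Lambda>\<^sub>b" by auto
      have "z = (a ** g) *v \<Phi> 0 y" using gy by (simp add: matrix_vector_mul_assoc)
      moreover have "a ** g \<in> generated_semigroup (msupport \<mu>)"
        by (rule generated_semigroup.mult[OF generated_semigroup.base[OF a] gy(2)])
      ultimately have "z \<in> ?S" using gy by blast
      then show "z \<in> closure ?S" by (rule subsetD[OF closure_subset])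
    qed
  qed simp
  from subsetD[OF this imageI[OF x[unfolded supp_cl_def]]] show ?thesis unfolding supp_cl_def .
qed

lemma supp_cl_preimage: "{x. a *v x \<in> supp_cl} \<in> sets borel"
proof -
  have "closed ((*v) a -` supp_cl)" unfolding supp_cl_def
    by (intro closed_vimage closed_closure) (simp add: linear_continuous_on matrix_vector_mul_bounded_linear)
  then show ?thesis by (simp add: vimage_def)
qed

text \<open>The matrix in front is essential: the semigroup need not contain the identity, so
  \<open>\<Phi> 0 y\<close> itself may lie outside \<open>supp_cl\<close>. The recursion only ever
  needs the identity for \<Phi> at points already multiplied by a matrix.\<close>

lemma jump_tail_support: "a \<in> msupport \<mu> \<Longrightarrow> AE x in jump_tail k. a *v x \<in> supp_cl"
proof (induction k arbitrary: a)
  case 0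
  have "AE y in \<Lambda>\<^sub>b. y \<in> msupport \<Lambda>\<^sub>b"
    by (rule AE_msupport[of _ "- {0}"]) (use Lb in \<open>auto simp: finite_away_def\<close>)
  then have "AE y in \<Lambda>\<^sub>b. a *v \<Phi> 0 y \<in> supp_cl"
  proof eventually_elim
    case (elim y)
    have "a *v \<Phi> 0 y \<in> {g *v \<Phi> 0 y | g y. g \<in> generated_semigroup (msupport \<mu>) \<and> y \<in> msupport \<Lambda>\<^sub>b}"
      by (rule CollectI, intro exI[of _ a] exI[of _ y] conjI generated_semigroup.base 0 elim refl)
    then show ?case unfolding supp_cl_def by (rule subsetD[OF closure_subset])
  qed
  then show ?case unfolding jump_tail.simps by (rule AE_punctured_image[OF Phi0_measurable _ supp_cl_preimage])
next
  case (Suc k)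
  interpret mu: prob_space \<mu> by (rule prob_mu)
  interpret g: sigma_finite_measure "jump_tail k" by (rule sigma_finite_jump_tail)
  interpret P: pair_sigma_finite \<mu> "jump_tail k" ..
  have 1: "AE b in \<mu>. b \<in> msupport \<mu>" by (rule AE_msupport[of _ UNIV]) auto
  have 2: "{p \<in> space (\<mu> \<Otimes>\<^sub>M jump_tail k). a *v (fst p *v snd p) \<in> supp_cl} \<in> sets (\<mu> \<Otimes>\<^sub>M jump_tail k)"
  proof -
    have "(\<lambda>p. fst p *v snd p) -` {x. a *v x \<in> supp_cl} \<inter> space (\<mu> \<Otimes>\<^sub>M jump_tail k) \<in> sets (\<mu> \<Otimes>\<^sub>M jump_tail k)"
      by (rule measurable_sets[OF matrix_mult_measurable supp_cl_preimage])
    then show ?thesis by (simp add: vimage_def Int_def conj_commute)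
  qed
  have "AE p in \<mu> \<Otimes>\<^sub>M jump_tail k. a *v (fst p *v snd p) \<in> supp_cl"
  proof (rule P.AE_pair_measure[OF 2])
    show "AE b in \<mu>. AE x in jump_tail k. a *v (fst (b, x) *v snd (b, x)) \<in> supp_cl"
      using 1
    proof eventually_elim
      case (elim b)
      from Suc.IH[OF elim] show ?case by eventually_elim (use supp_cl_invariant[OF Suc.prems] in simp)
    qed
  qed
  then show ?case unfolding jump_tail.simps(2) by (rule AE_punctured_image[OF matrix_mult_measurable _ supp_cl_preimage])
qed

text \<open>\<open>A\<close> lies in the support of its law almost surely, and then A x lies in
  \<open>supp_cl\<close> for almost every x, so \<Phi> (A x) 0 may be replaced by A x. The recursion
  thereby shifts every summand by one index and puts the newest jump in front.\<close>

theorem chain_functional_eq_sum: "f \<in> Cb_away \<Longrightarrow> chain_functional n f = (\<Sum>k<n. \<integral>x. f x \<partial>jump_tail k)"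
proof (induction n arbitrary: f)
  case (Suc n)
  have "AE a in \<mu>. a \<in> msupport \<mu>" by (rule AE_msupport[of _ UNIV]) auto
  then have AEm: "AE \<omega> in M. A \<omega> \<in> msupport \<mu>" by (rule AE_distrD[rotated]) simp
  have eq: "(\<integral>\<omega>. chain_functional n (\<lambda>x. f (\<Phi> (A \<omega> *v x) 0)) \<partial>M) = (\<integral>\<omega>. (\<Sum>k<n. \<integral>x. f (A \<omega> *v x) \<partial>jump_tail k) \<partial>M)"
  proof (rule integral_cong_AE)
    show "(\<lambda>\<omega>. chain_functional n (\<lambda>x. f (\<Phi> (A \<omega> *v x) 0))) \<in> borel_measurable M"
      by (rule borel_measurable_integrable[OF A_limit(1)[OF prob_space_distr[OF measurable_X] _ tail_functional_chain Suc.prems]]) simp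
    show "(\<lambda>\<omega>. \<Sum>k<n. \<integral>x. f (A \<omega> *v x) \<partial>jump_tail k) \<in> borel_measurable M"
      by (intro borel_measurable_sum borel_measurable_integrable integral_jump_tail_Suc(2)[OF Suc.prems])
    show "AE \<omega> in M. chain_functional n (\<lambda>x. f (\<Phi> (A \<omega> *v x) 0)) = (\<Sum>k<n. \<integral>x. f (A \<omega> *v x) \<partial>jump_tail k)"
      using AEm
    proof eventually_elim
      case (elim \<omega>)
      have "(\<integral>x. f (\<Phi> (A \<omega> *v x) 0) \<partial>jump_tail k) = (\<integral>x. f (A \<omega> *v x) \<partial>jump_tail k)" for k
      proof (rule integral_cong_AE)
        show "(\<lambda>x. f (\<Phi> (A \<omega> *v x) 0)) \<in> borel_measurable (jump_tail k)"
          by (rule borel_measurable_integrable[OF integrable_jump_tail[OF Cb_away_Phi(2)[OF Suc.prems]]])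
        show "(\<lambda>x. f (A \<omega> *v x)) \<in> borel_measurable (jump_tail k)"
          by (rule borel_measurable_integrable[OF integrable_jump_tail[OF Cb_away_matrix[OF Suc.prems]]])
        show "AE x in jump_tail k. f (\<Phi> (A \<omega> *v x) 0) = f (A \<omega> *v x)"
          using jump_tail_support[OF elim, of k]
        proof eventually_elim
          case (elim x)
          have "\<Phi> (A \<omega> *v x) 0 = A \<omega> *v x" using Phi_id elim unfolding supp_cl_def by blast
          then show ?case by simp
        qed
      qed
      then show ?case unfolding Suc.IH[OF Cb_away_Phi(2)[OF Suc.prems]] by simp
    qed
  qed
  have "chain_functional (Suc n) f = (\<integral>x. f x \<partial>jump_tail 0) + (\<integral>\<omega>. (\<Sum>k<n. \<integral>x. f (A \<omega> *v x) \<partial>jump_tail k) \<partial>M)"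
    unfolding chain_functional.simps eq integral_jump_tail_0[OF Suc.prems] ..
  also have "(\<integral>\<omega>. (\<Sum>k<n. \<integral>x. f (A \<omega> *v x) \<partial>jump_tail k) \<partial>M) = (\<Sum>k<n. \<integral>\<omega>. (\<integral>x. f (A \<omega> *v x) \<partial>jump_tail k) \<partial>M)"
    by (rule Bochner_Integration.integral_sum) (rule integral_jump_tail_Suc(2)[OF Suc.prems])
  also have "\<dots> = (\<Sum>k<n. \<integral>x. f x \<partial>jump_tail (Suc k))" unfolding integral_jump_tail_Suc(1)[OF Suc.prems] ..
  also have "(\<integral>x. f x \<partial>jump_tail 0) + \<dots> = (\<Sum>k<Suc n. \<integral>x. f x \<partial>jump_tail k)" by (rule sum.lessThan_Suc_shift[symmetric])
  finally show ?case .
qed simp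

end

section \<open>Polar coordinates and spherical measures\<close>

text \<open>The radial part dr / r^(1+\<alpha>) of a homogeneous measure, placed on the whole line
  so that ordinary Borel measurability on the reals applies.\<close>

definition radial :: "real \<Rightarrow> real measure" where
  "radial \<alpha> = density lborel (\<lambda>r. ennreal (indicator {0<..} r * r powr - (1 + \<alpha>)))"

lemma sets_radial [measurable_cong]: "sets (radial \<alpha>) = sets borel" by (simp add: radial_def)

lemma sigma_finite_radial: "sigma_finite_measure (radial \<alpha>)"
proof -
  have m: "(\<lambda>r. ennreal (indicator {0<..} r * r powr - (1 + \<alpha>))) \<in> borel_measurable lborel" by measurable
  show ?thesis unfolding radial_def using sigma_finite_measure.sigma_finite_iff_density_finite[OF sigma_finite_lborel m] by simp
qed

lemma AE_radial_pos: "AE r in radial \<alpha>. r > 0"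
  unfolding radial_def by (subst AE_density) (auto simp: indicator_def)

lemma nn_integral_radial:
  assumes "F \<in> borel_measurable borel"
  shows "(\<integral>\<^sup>+r. F r \<partial>radial \<alpha>) = (\<integral>\<^sup>+r. ennreal (indicator {0<..} r * r powr - (1 + \<alpha>)) * F r \<partial>lborel)"
  unfolding radial_def using assms by (intro nn_integral_density) auto

lemma radial_tail:
  assumes "\<alpha> > 0" "u > 0"
  shows "(\<integral>\<^sup>+r. indicator {u..} r \<partial>radial \<alpha>) = ennreal (u powr - \<alpha> / \<alpha>)"
proof -
  have "((\<lambda>x. x powr - (1 + \<alpha>)) has_integral - (u powr (- (1 + \<alpha>) + 1)) / (- (1 + \<alpha>) + 1)) {u..}"
    using assms by (intro has_integral_powr_to_inf) auto
  from nn_integral_has_integral_lebesgue'[OF _ this]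
  have "(\<integral>\<^sup>+r. ennreal (r powr - (1 + \<alpha>)) * indicator {u..} r \<partial>lborel) = ennreal (u powr - \<alpha> / \<alpha>)" by simp
  moreover have "(\<integral>\<^sup>+r. indicator {u..} r \<partial>radial \<alpha>) = (\<integral>\<^sup>+r. ennreal (r powr - (1 + \<alpha>)) * indicator {u..} r \<partial>lborel)"
    by (subst nn_integral_radial, simp, rule nn_integral_cong) (use assms in \<open>auto simp: indicator_def\<close>)
  ultimately show ?thesis by simp
qed

text \<open>The weight leaves r^(\<alpha>-1) to be integrated over (0, u). In
  \<open>spherical_measure_exists\<close> the exponent 2 \<alpha> arises once from homogeneity and
  once from a normalised radius.\<close>

lemma radial_initial:
  assumes "\<alpha> > 0" "u > 0"
  shows "(\<integral>\<^sup>+r. ennreal (r powr (2 * \<alpha>)) * indicator {..u} r \<partial>radial \<alpha>) = ennreal (u powr \<alpha> / \<alpha>)"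
proof -
  have "((\<lambda>x. x powr (\<alpha> - 1)) has_integral (u powr (\<alpha> - 1 + 1) / (\<alpha> - 1 + 1))) {0..u}"
    using assms by (intro has_integral_powr_from_0) auto
  from nn_integral_has_integral_lebesgue'[OF _ this]
  have "(\<integral>\<^sup>+r. ennreal (r powr (\<alpha> - 1)) * indicator {0..u} r \<partial>lborel) = ennreal (u powr \<alpha> / \<alpha>)" by simp
  moreover have "(\<integral>\<^sup>+r. ennreal (r powr (2 * \<alpha>)) * indicator {..u} r \<partial>radial \<alpha>) = (\<integral>\<^sup>+r. ennreal (r powr (\<alpha> - 1)) * indicator {0..u} r \<partial>lborel)"
  proof (subst nn_integral_radial, measurable, rule nn_integral_cong)
    fix r :: real
    show "ennreal (indicator {0<..} r * r powr - (1 + \<alpha>)) * (ennreal (r powr (2 * \<alpha>)) * indicator {..u} r)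
        = ennreal (r powr (\<alpha> - 1)) * indicator {0..u} r"
    proof (cases "r > 0")
      case True
      have "r powr - (1 + \<alpha>) * r powr (2 * \<alpha>) = r powr (\<alpha> - 1)" by (simp add: powr_add[symmetric])
      then have "ennreal (r powr - (1 + \<alpha>)) * ennreal (r powr (2 * \<alpha>)) = ennreal (r powr (\<alpha> - 1))"
        by (simp add: ennreal_mult[symmetric])
      then show ?thesis using True by (auto simp: indicator_def)
    next
      case False
      then show ?thesis by (cases "r = 0") (auto simp: indicator_def)
    qed
  qed
  ultimately show ?thesis by simp
qed

text \<open>Substitution r to c r: a factor c comes from Lebesgue measure and c^-(1+\<alpha>) from
  the density.\<close>

lemma radial_scale:
  assumes "F \<in> borel_measurable borel" "c > 0"
  shows "(\<integral>\<^sup>+r. F (c * r) \<partial>radial \<alpha>) = ennreal (c powr \<alpha>) * (\<integral>\<^sup>+r. F r \<partial>radial \<alpha>)"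
proof -
  let ?G = "\<lambda>r. ennreal (indicator {0<..} r * r powr - (1 + \<alpha>)) * F r"
  have Gm: "?G \<in> borel_measurable borel" using assms(1) by measurable
  have Fm: "(\<lambda>r. F (c * r)) \<in> borel_measurable borel" by (rule measurable_compose[OF _ assms(1)]) measurable
  have pt: "ennreal (c powr \<alpha>) * (ennreal c * ?G (0 + c * r)) = ennreal (indicator {0<..} r * r powr - (1 + \<alpha>)) * F (c * r)" for r
  proof (cases "r > 0")
    case True
    have "c powr \<alpha> * c * c powr - (1 + \<alpha>) = c powr (\<alpha> + 1 + - (1 + \<alpha>))" using assms by (simp only: powr_add) simp
    then have 1: "c powr \<alpha> * c * c powr - (1 + \<alpha>) = 1" using assms by simp
    have "ennreal (c powr \<alpha>) * (ennreal c * ?G (0 + c * r)) = ennreal (c powr \<alpha> * c * c powr - (1 + \<alpha>) * r powr - (1 + \<alpha>)) * F (c * r)"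
      using True assms by (simp add: powr_mult ennreal_mult mult_ac)
    then show ?thesis unfolding 1 using True by simp
  next
    case False
    then have "\<not> 0 < c * r" using assms(2) by (simp add: zero_less_mult_iff)
    then show ?thesis using False by simp
  qed
  have "(\<integral>\<^sup>+r. F r \<partial>radial \<alpha>) = ennreal c * (\<integral>\<^sup>+r. ?G (0 + c * r) \<partial>lborel)"
    unfolding nn_integral_radial[OF assms(1)] using nn_integral_real_affine[OF Gm, of c 0] assms by simp
  also have "\<dots> = (\<integral>\<^sup>+r. ennreal c * ?G (0 + c * r) \<partial>lborel)"
    by (rule nn_integral_cmult[symmetric]) (rule measurable_compose[OF _ Gm], simp)
  finally have "ennreal (c powr \<alpha>) * (\<integral>\<^sup>+r. F r \<partial>radial \<alpha>) = ennreal (c powr \<alpha>) * (\<integral>\<^sup>+r. ennreal c * ?G (0 + c * r) \<partial>lborel)" by simp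
  also have "\<dots> = (\<integral>\<^sup>+r. ennreal (c powr \<alpha>) * (ennreal c * ?G (0 + c * r)) \<partial>lborel)"
  proof (rule nn_integral_cmult[symmetric])
    have "(\<lambda>r. ?G (0 + c * r)) \<in> borel_measurable lborel" by (rule measurable_compose[OF _ Gm]) simp
    from borel_measurable_times_ennreal[OF borel_measurable_const this, of "ennreal c"]
    show "(\<lambda>r. ennreal c * ?G (0 + c * r)) \<in> borel_measurable lborel" .
  qed
  also have "\<dots> = (\<integral>\<^sup>+r. F (c * r) \<partial>radial \<alpha>)" unfolding pt nn_integral_radial[OF Fm] ..
  finally show ?thesis ..
qed

text \<open>The homogeneous measure with spherical part \<sigma>. Having it as an image measure, and
  not only as an iterated integral over test functions, makes Tonelli and Borel sets
  available.\<close>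

definition polar :: "real \<Rightarrow> (real^'n) measure \<Rightarrow> (real^'n) measure" where
  "polar \<alpha> \<sigma> = punctured_image (\<sigma> \<Otimes>\<^sub>M radial \<alpha>) (\<lambda>p. snd p *\<^sub>R fst p)"

context
  fixes N :: "real^'n \<Rightarrow> real" and \<alpha> :: real
  assumes norm: "is_norm N" and alpha: "\<alpha> > 0"
begin

abbreviation sphere_space :: "(real^'n) measure" where "sphere_space \<equiv> restrict_space borel (unit_sphere N)"

lemma N_borel [measurable]: "N \<in> borel_measurable borel"
  by (rule is_norm_equiv[OF norm]) (rule borel_measurable_continuous_onI)

lemma N_scale: "N (c *\<^sub>R x) = \<bar>c\<bar> * N x" using norm unfolding is_norm_def by auto
lemma N_nonneg: "N x \<ge> 0" using norm unfolding is_norm_def by auto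
lemma N_0: "N x = 0 \<longleftrightarrow> x = 0" using norm unfolding is_norm_def by auto
lemma N_pos: "x \<noteq> 0 \<Longrightarrow> N x > 0" using N_nonneg[of x] N_0[of x] by linarith

lemma unit_sphere_borel: "unit_sphere N \<in> sets borel"
proof -
  have "{x \<in> space borel. N x = 1} \<in> sets borel" by measurable
  then show ?thesis by (simp add: unit_sphere_def)
qed

section \<open>Homogeneous measures built from a given spherical measure\<close>

context
  fixes \<sigma> :: "(real^'n) measure"
  assumes s: "sets \<sigma> = sets sphere_space" and fin: "finite_measure \<sigma>"
begin

interpretation sg: finite_measure \<sigma> by (rule fin)
interpretation rad: sigma_finite_measure "radial \<alpha>" by (rule sigma_finite_radial)
interpretation SR: pair_sigma_finite \<sigma> "radial \<alpha>" ..

lemma space_sigma: "space \<sigma> = unit_sphere N"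
  using sets_eq_imp_space_eq[OF s] by (simp add: space_restrict_space)

lemma id_sigma: "(\<lambda>x. x) \<in> measurable \<sigma> borel"
  by (simp add: measurable_cong_sets[OF s refl] measurable_restrict_space1)

lemma polar_measurable: "(\<lambda>p. snd p *\<^sub>R fst p) \<in> borel_measurable (\<sigma> \<Otimes>\<^sub>M radial \<alpha>)"
proof -
  have [measurable]: "fst \<in> measurable (\<sigma> \<Otimes>\<^sub>M radial \<alpha>) borel" using measurable_compose[OF measurable_fst id_sigma, of "radial \<alpha>"] by simp
  show ?thesis by measurable
qed

lemma nn_integral_polar:
  assumes f: "f \<in> borel_measurable borel" "f 0 = 0"
  shows "(\<integral>\<^sup>+x. f x \<partial>polar \<alpha> \<sigma>) = (\<integral>\<^sup>+w. (\<integral>\<^sup>+r. f (r *\<^sub>R w) \<partial>radial \<alpha>) \<partial>\<sigma>)"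
  unfolding polar_def nn_integral_punctured_image[OF polar_measurable f]
  using rad.nn_integral_fst[OF measurable_compose[OF polar_measurable f(1)]] by simp

lemma sets_polar: "sets (polar \<alpha> \<sigma>) = sets punct"
  unfolding polar_def by (rule sets_punctured_image)

text \<open>On the unit sphere of \<open>N\<close> the Euclidean norm is at most c, so |r w| \<ge> u
  forces r \<ge> u/c, a half-line of finite radial mass.\<close>

lemma finite_away_polar: "finite_away (polar \<alpha> \<sigma>)"
  unfolding finite_away_def
proof (intro conjI sets_polar allI impI)
  fix u :: real assume u: "u > 0"
  obtain c where c: "c > 0" "\<And>x. N x \<le> c * norm x" "\<And>x. norm x \<le> c * N x" by (rule is_norm_equiv[OF norm]) blast
  let ?S = "{x::real^'n. u \<le> norm x}"
  have S: "?S \<in> sets punct" using u by (auto simp: sets_restrict_space_iff)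
  have "emeasure (polar \<alpha> \<sigma>) ?S = (\<integral>\<^sup>+x. indicator ?S x \<partial>polar \<alpha> \<sigma>)" using S by (simp only: sets_polar nn_integral_indicator)
  also have "\<dots> = (\<integral>\<^sup>+w. (\<integral>\<^sup>+r. indicator ?S (r *\<^sub>R w) \<partial>radial \<alpha>) \<partial>\<sigma>)" using u by (intro nn_integral_polar) auto
  also have "\<dots> \<le> (\<integral>\<^sup>+w. (\<integral>\<^sup>+r. indicator {u / c..} r \<partial>radial \<alpha>) \<partial>\<sigma>)"
  proof (rule nn_integral_mono)
    fix w assume "w \<in> space \<sigma>"
    then have w: "norm w \<le> c" using c(3)[of w] by (simp add: space_sigma unit_sphere_def)
    show "(\<integral>\<^sup>+r. indicator ?S (r *\<^sub>R w) \<partial>radial \<alpha>) \<le> (\<integral>\<^sup>+r. indicator {u / c..} r \<partial>radial \<alpha>)"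
    proof (rule nn_integral_mono_AE)
      show "AE r in radial \<alpha>. indicator ?S (r *\<^sub>R w) \<le> (indicator {u / c..} r :: ennreal)"
        using AE_radial_pos
      proof eventually_elim
        case (elim r)
        have "norm (r *\<^sub>R w) \<le> r * c" using elim mult_left_mono[OF w, of r] by (simp only: norm_scaleR) simp
        then have "u \<le> norm (r *\<^sub>R w) \<Longrightarrow> u / c \<le> r"
          unfolding pos_divide_le_eq[OF c(1)] by (rule order_trans[rotated])
        then show ?case by (auto simp: indicator_def)
      qed
    qed
  qed
  also have "\<dots> = ennreal ((u / c) powr - \<alpha> / \<alpha>) * emeasure \<sigma> (space \<sigma>)"
    using radial_tail[OF alpha, of "u / c"] u c(1) by simp
  also have "\<dots> < \<infinity>" 
  proof -
    have "emeasure \<sigma> (space \<sigma>) < \<top>" unfolding less_top[symmetric] using sg.emeasure_finite[of "space \<sigma>"] by simp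
    then show ?thesis by (simp add: ennreal_mult_less_top)
  qed
  finally show "emeasure (polar \<alpha> \<sigma>) ?S < \<infinity>" .
qed

text \<open>Fubini in the order demanded by \<open>spherical_measure\<close>: angle inside, radius
  outside. Integrability over the product comes from finiteness away from the origin.\<close>

lemma integral_polar:
  assumes f: "f \<in> Cc_punctured"
  shows "(\<integral>x. f x \<partial>polar \<alpha> \<sigma>) = (LINT r:{0<..}|lborel. (\<integral>w. f (r *\<^sub>R w) \<partial>\<sigma>) / r powr (1 + \<alpha>))"
proof -
  have fb: "f \<in> Cb_away" using f Cc_subset_Cb_away by auto
  have f0: "f 0 = 0" using fb by (auto simp: Cb_away_def)
  note im = integral_punctured_image[OF polar_measurable borel_Cb_away[OF fb] f0]
  have i: "integrable (\<sigma> \<Otimes>\<^sub>M radial \<alpha>) (\<lambda>p. f (snd p *\<^sub>R fst p))"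
    using finite_away_integrable[OF finite_away_polar fb] im(2) unfolding polar_def by simp
  then have i': "integrable (\<sigma> \<Otimes>\<^sub>M radial \<alpha>) (\<lambda>(w, r). f (r *\<^sub>R w))" by (simp add: case_prod_unfold)
  have "(\<integral>x. f x \<partial>polar \<alpha> \<sigma>) = (\<integral>p. f (snd p *\<^sub>R fst p) \<partial>(\<sigma> \<Otimes>\<^sub>M radial \<alpha>))" unfolding polar_def by (rule im(1))
  also have "\<dots> = (\<integral>r. (\<integral>w. f (r *\<^sub>R w) \<partial>\<sigma>) \<partial>radial \<alpha>)" using SR.integral_snd[OF i'] by (simp add: case_prod_unfold)
  also have "\<dots> = (\<integral>r. (indicator {0<..} r * r powr - (1 + \<alpha>)) *\<^sub>R (\<integral>w. f (r *\<^sub>R w) \<partial>\<sigma>) \<partial>lborel)"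
    unfolding radial_def
  proof (rule integral_density)
    have "(\<lambda>r. \<integral>w. f (r *\<^sub>R w) \<partial>\<sigma>) \<in> borel_measurable (radial \<alpha>)"
      using SR.integrable_snd[OF i'] by (rule borel_measurable_integrable)
    then show "(\<lambda>r. \<integral>w. f (r *\<^sub>R w) \<partial>\<sigma>) \<in> borel_measurable lborel"
      by (simp add: measurable_cong_sets[OF sets_radial refl] measurable_cong_sets[OF sets_lborel refl])
  qed auto
  also have "\<dots> = (LINT r:{0<..}|lborel. (\<integral>w. f (r *\<^sub>R w) \<partial>\<sigma>) / r powr (1 + \<alpha>))"
    unfolding set_lebesgue_integral_def
    by (rule Bochner_Integration.integral_cong[OF refl]) (simp only: powr_minus_divide, simp)
  finally show ?thesis .
qed

text \<open>On the ray through \<open>v\<close>, the condition N (r v) \<ge> 1 cuts out r \<ge> 1 /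
  N v, whose radial mass is (N v)^\<alpha> / \<alpha>. This is the origin of the weight |A
  w|^\<alpha> in the transfer of spherical measures.\<close>

lemma radial_cone:
  assumes g: "g \<in> borel_measurable borel"
  shows "(\<integral>\<^sup>+r. (if 1 \<le> N (r *\<^sub>R v) then g ((r *\<^sub>R v) /\<^sub>R N (r *\<^sub>R v)) else 0) \<partial>radial \<alpha>)
       = (if v = 0 then 0 else g (v /\<^sub>R N v) * ennreal (N v powr \<alpha>)) * ennreal (1 / \<alpha>)"
proof (cases "v = 0")
  case True
  have "N 0 = 0" using N_0[of 0] by simp
  then show ?thesis using True by simp
next
  case False
  have p: "N v > 0" by (rule N_pos[OF False])
  have "(\<integral>\<^sup>+r. (if 1 \<le> N (r *\<^sub>R v) then g ((r *\<^sub>R v) /\<^sub>R N (r *\<^sub>R v)) else 0) \<partial>radial \<alpha>)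
      = (\<integral>\<^sup>+r. g (v /\<^sub>R N v) * indicator {1 / N v..} r \<partial>radial \<alpha>)"
  proof (rule nn_integral_cong_AE)
    show "AE r in radial \<alpha>. (if 1 \<le> N (r *\<^sub>R v) then g ((r *\<^sub>R v) /\<^sub>R N (r *\<^sub>R v)) else 0) = g (v /\<^sub>R N v) * indicator {1 / N v..} r"
      using AE_radial_pos
    proof eventually_elim
      case (elim r)
      have "1 \<le> N (r *\<^sub>R v) \<longleftrightarrow> r \<in> {1 / N v..}" using elim p by (simp add: N_scale field_simps)
      moreover have "(r *\<^sub>R v) /\<^sub>R N (r *\<^sub>R v) = v /\<^sub>R N v" using elim by (simp add: N_scale)
      ultimately have "(if 1 \<le> N (r *\<^sub>R v) then g ((r *\<^sub>R v) /\<^sub>R N (r *\<^sub>R v)) else 0) = (if r \<in> {1 / N v..} then g (v /\<^sub>R N v) else 0)"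
        by (simp only:)
      also have "\<dots> = g (v /\<^sub>R N v) * indicator {1 / N v..} r" by (simp add: indicator_def)
      finally show ?case .
    qed
  qed
  also have "\<dots> = g (v /\<^sub>R N v) * ennreal ((1 / N v) powr - \<alpha> / \<alpha>)"
    using radial_tail[OF alpha, of "1 / N v"] p by (subst nn_integral_cmult) auto
  also have "(1 / N v) powr - \<alpha> = N v powr \<alpha>" using powr_one_divide[OF p, of "- \<alpha>"] by simp
  finally show ?thesis using False alpha by (simp add: ennreal_mult[symmetric] mult.assoc)
qed

lemma cone_measurable:
  assumes [measurable]: "g \<in> borel_measurable borel"
  shows "(\<lambda>x. if 1 \<le> N x then g (x /\<^sub>R N x) else 0) \<in> borel_measurable borel"
  by measurable

text \<open>A function of the direction alone, cut off inside the unit ball, recovers \<sigma> up to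
  the radial mass 1/\<alpha>. Spherical measures of different tails are compared through this
  identity.\<close>

lemma nn_integral_polar_cone:
  assumes g: "g \<in> borel_measurable borel"
  shows "(\<integral>\<^sup>+x. (if 1 \<le> N x then g (x /\<^sub>R N x) else 0) \<partial>polar \<alpha> \<sigma>) = (\<integral>\<^sup>+w. g w \<partial>\<sigma>) * ennreal (1 / \<alpha>)"
proof -
  have "N 0 = 0" using N_0[of 0] by simp
  then have "(\<integral>\<^sup>+x. (if 1 \<le> N x then g (x /\<^sub>R N x) else 0) \<partial>polar \<alpha> \<sigma>)
    = (\<integral>\<^sup>+w. (if w = 0 then 0 else g (w /\<^sub>R N w) * ennreal (N w powr \<alpha>)) * ennreal (1 / \<alpha>) \<partial>\<sigma>)"
    unfolding radial_cone[OF g, symmetric] by (intro nn_integral_polar cone_measurable g) simp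
  also have "\<dots> = (\<integral>\<^sup>+w. g w * ennreal (1 / \<alpha>) \<partial>\<sigma>)"
  proof (rule nn_integral_cong)
    fix w assume "w \<in> space \<sigma>"
    then have "N w = 1" by (simp add: space_sigma unit_sphere_def)
    moreover have "w \<noteq> 0" using calculation N_0[of w] by auto
    ultimately show "(if w = 0 then 0 else g (w /\<^sub>R N w) * ennreal (N w powr \<alpha>)) * ennreal (1 / \<alpha>) = g w * ennreal (1 / \<alpha>)" by simp
  qed
  also have "\<dots> = (\<integral>\<^sup>+w. g w \<partial>\<sigma>) * ennreal (1 / \<alpha>)"
    by (rule nn_integral_multc) (rule measurable_compose[OF id_sigma g])
  finally show ?thesis .
qed

end

text \<open>Turns the identity for test functions into an equality of measures by uniqueness of
  Radon measures, so that discontinuous functions such as cones can be integrated.\<close>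

lemma spherical_measure_iff:
  assumes rad: "radon_punctured \<Lambda>"
  shows "spherical_measure N \<alpha> \<Lambda> \<sigma> \<longleftrightarrow> sets \<sigma> = sets sphere_space \<and> finite_measure \<sigma> \<and> \<Lambda> = polar \<alpha> \<sigma>"
proof
  assume sm: "spherical_measure N \<alpha> \<Lambda> \<sigma>"
  then have s: "sets \<sigma> = sets sphere_space" and fin: "finite_measure \<sigma>" unfolding spherical_measure_def by auto
  have "\<Lambda> = polar \<alpha> \<sigma>"
  proof (rule radon_punctured_eqI[OF rad finite_away_radon[OF finite_away_polar[OF s fin]]])
    fix f :: "real^'n \<Rightarrow> real" assume f: "f \<in> Cc_punctured"
    show "(\<integral>x. f x \<partial>\<Lambda>) = (\<integral>x. f x \<partial>polar \<alpha> \<sigma>)"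
      unfolding integral_polar[OF s fin f] using sm f unfolding spherical_measure_def by blast
  qed
  with s fin show "sets \<sigma> = sets sphere_space \<and> finite_measure \<sigma> \<and> \<Lambda> = polar \<alpha> \<sigma>" by blast
next
  assume "sets \<sigma> = sets sphere_space \<and> finite_measure \<sigma> \<and> \<Lambda> = polar \<alpha> \<sigma>"
  then have s: "sets \<sigma> = sets sphere_space" and fin: "finite_measure \<sigma>" and eq: "\<Lambda> = polar \<alpha> \<sigma>" by auto
  show "spherical_measure N \<alpha> \<Lambda> \<sigma>" unfolding spherical_measure_def
    by (intro conjI s fin ballI) (simp only: eq integral_polar[OF s fin])
qed

text \<open>Homogeneity is stated for test functions. Uniqueness of Radon measures identifies the
  dilated with the rescaled measure and so extends it to nonnegative Borel functions.\<close>

lemma nn_homogeneous: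
  fixes \<Lambda> :: "(real^'n) measure"
  assumes fa: "finite_away \<Lambda>" and hom: "homogeneous_measure \<alpha> \<Lambda>" and r: "r > 0"
    and f: "f \<in> borel_measurable borel" "f 0 = 0"
  shows "(\<integral>\<^sup>+x. f (r *\<^sub>R x) \<partial>\<Lambda>) = ennreal (r powr \<alpha>) * (\<integral>\<^sup>+x. f x \<partial>\<Lambda>)"
proof -
  have rad: "radon_punctured \<Lambda>" by (rule finite_away_radon[OF fa])
  have h: "(\<lambda>x. r *\<^sub>R x) \<in> borel_measurable \<Lambda>" by (rule measurable_radon[OF rad]) simp
  let ?P = "punctured_image \<Lambda> (\<lambda>x. r *\<^sub>R x)" and ?S = "scale_measure (ennreal (r powr \<alpha>)) \<Lambda>"
  have fin: "emeasure ?P {x. u \<le> norm x} < \<infinity>" if u: "u > 0" for u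
  proof -
    have "{x::real^'n. u \<le> norm x} \<in> sets punct" using u by (auto simp: sets_restrict_space_iff)
    then have "{x::real^'n. u \<le> norm x} \<in> sets ?P" by (simp only: sets_punctured_image)
    from nn_integral_indicator[OF this, symmetric]
    have "emeasure ?P {x. u \<le> norm x} = (\<integral>\<^sup>+x. indicator {x. u \<le> norm x} x \<partial>?P)" .
    also have "\<dots> = (\<integral>\<^sup>+x. indicator {x. u \<le> norm x} (r *\<^sub>R x) \<partial>\<Lambda>)" using u by (intro nn_integral_punctured_image[OF h]) auto
    also have "\<dots> = (\<integral>\<^sup>+x. indicator {x. u / r \<le> norm x} x \<partial>\<Lambda>)"
      using r by (intro nn_integral_cong) (auto simp: indicator_def field_simps)
    also have "\<dots> = emeasure \<Lambda> {x. u / r \<le> norm x}"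
      by (rule nn_integral_indicator, rule sets_radonI[OF rad]) (use u r in \<open>auto simp: not_le\<close>)
    also have "\<dots> < \<infinity>" using fa u r unfolding finite_away_def by simp
    finally show ?thesis .
  qed
  have faP: "finite_away ?P" unfolding finite_away_def using fin sets_punctured_image by blast
  have faS: "finite_away ?S" using fa unfolding finite_away_def by (auto simp: ennreal_mult_less_top)
  have "?P = ?S"
  proof (rule radon_punctured_eqI[OF finite_away_radon[OF faP] finite_away_radon[OF faS]])
    fix g :: "real^'n \<Rightarrow> real" assume g: "g \<in> Cc_punctured" "\<And>x. 0 \<le> g x"
    have gb: "g \<in> Cb_away" using g Cc_subset_Cb_away by auto
    have g0: "g 0 = 0" using gb by (auto simp: Cb_away_def)
    have "(\<integral>x. g x \<partial>?P) = (\<integral>x. g (r *\<^sub>R x) \<partial>\<Lambda>)" by (rule integral_punctured_image(1)[OF h borel_Cb_away[OF gb] g0])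
    also have "\<dots> = r powr \<alpha> * (\<integral>x. g x \<partial>\<Lambda>)" using hom r g(1) unfolding homogeneous_measure_def by blast
    also have "\<dots> = (\<integral>x. g x \<partial>?S)"
    proof -
      have "ennreal (\<integral>x. g x \<partial>?S) = (\<integral>\<^sup>+x. ennreal (g x) \<partial>?S)"
        using g(2) by (intro nn_integral_eq_integral[symmetric] finite_away_integrable[OF faS gb]) auto
      also have "\<dots> = ennreal (r powr \<alpha>) * (\<integral>\<^sup>+x. ennreal (g x) \<partial>\<Lambda>)"
        by (rule nn_integral_scale_measure) (use measurable_radon[OF rad borel_Cb_away[OF gb]] in measurable)
      also have "(\<integral>\<^sup>+x. ennreal (g x) \<partial>\<Lambda>) = ennreal (\<integral>x. g x \<partial>\<Lambda>)"
        using g(2) by (intro nn_integral_eq_integral finite_away_integrable[OF fa gb]) auto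
      finally have "ennreal (\<integral>x. g x \<partial>?S) = ennreal (r powr \<alpha> * (\<integral>x. g x \<partial>\<Lambda>))"
        by (simp add: ennreal_mult g(2) Bochner_Integration.integral_nonneg)
      then show ?thesis using g(2) by (simp add: Bochner_Integration.integral_nonneg)
    qed
    finally show "(\<integral>x. g x \<partial>?P) = (\<integral>x. g x \<partial>?S)" .
  qed
  then have "(\<integral>\<^sup>+x. f x \<partial>?P) = (\<integral>\<^sup>+x. f x \<partial>?S)" by simp
  then show ?thesis unfolding nn_integral_punctured_image[OF h f]
    by (subst (asm) nn_integral_scale_measure) (use measurable_radon[OF rad f(1)] in auto)
qed

text \<open>The part of \<open>\<Lambda>\<close> outside the unit ball of \<open>N\<close> is
  projected radially onto the sphere. To recover \<open>\<Lambda>\<close>, Tonelli is applied twice,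
  with homogeneity used at each fixed radius in between.\<close>

lemma spherical_measure_exists:
  assumes fa: "finite_away \<Lambda>" and hom: "homogeneous_measure \<alpha> \<Lambda>"
  shows "\<exists>\<sigma>. spherical_measure N \<alpha> \<Lambda> \<sigma>"
proof -
  have rd: "radon_punctured \<Lambda>" by (rule finite_away_radon[OF fa])
  interpret L: sigma_finite_measure \<Lambda> by (rule sigma_finite_radon[OF rd])
  interpret rad: sigma_finite_measure "radial \<alpha>" by (rule sigma_finite_radial)
  interpret LR: pair_sigma_finite \<Lambda> "radial \<alpha>" ..
  obtain c where c: "c > 0" "\<And>x. N x \<le> c * norm x" by (rule is_norm_equiv[OF norm]) blast
  define U where "U = {x::real^'n. 1 \<le> N x}"
  have Ub: "U \<in> sets borel" unfolding U_def by measurable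
  have N0: "N 0 = 0" using N_0[of 0] by simp
  have Us: "U \<in> sets \<Lambda>" using Ub by (intro sets_radonI[OF rd]) (auto simp: U_def N0)
  have sp: "space \<Lambda> = - {0}" by (rule space_radon[OF rd])
  define q where "q x = x /\<^sub>R N x" for x :: "real^'n"
  have qm: "q \<in> borel_measurable borel" unfolding q_def[abs_def] by measurable
  have qs: "q x \<in> unit_sphere N" if "x \<noteq> 0" for x using N_pos[OF that] by (simp add: q_def unit_sphere_def N_scale)
  have qm': "q \<in> measurable (restrict_space \<Lambda> U) sphere_space"
  proof (rule measurable_restrict_space2)
    show "q \<in> space (restrict_space \<Lambda> U) \<rightarrow> unit_sphere N" using qs by (auto simp: space_restrict_space sp)
    show "q \<in> measurable (restrict_space \<Lambda> U) borel" by (rule measurable_restrict_space1[OF measurable_radon[OF rd qm]])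
  qed
  \<comment> \<open>The factor \<alpha> compensates the radial mass 1/\<alpha> of the half-line from
    1.\<close>
  define \<sigma> where "\<sigma> = scale_measure (ennreal \<alpha>) (distr (restrict_space \<Lambda> U) sphere_space q)"
  have s: "sets \<sigma> = sets sphere_space" unfolding \<sigma>_def by simp
  have nns: "(\<integral>\<^sup>+w. h w \<partial>\<sigma>) = ennreal \<alpha> * (\<integral>\<^sup>+x. h (q x) * indicator U x \<partial>\<Lambda>)" if h: "h \<in> borel_measurable borel" for h
  proof -
    have hm: "h \<in> borel_measurable sphere_space" by (rule measurable_restrict_space1[OF h])
    have "(\<integral>\<^sup>+w. h w \<partial>\<sigma>) = ennreal \<alpha> * (\<integral>\<^sup>+w. h w \<partial>distr (restrict_space \<Lambda> U) sphere_space q)"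
      unfolding \<sigma>_def by (rule nn_integral_scale_measure) (simp add: hm)
    also have "(\<integral>\<^sup>+w. h w \<partial>distr (restrict_space \<Lambda> U) sphere_space q) = (\<integral>\<^sup>+x. h (q x) \<partial>restrict_space \<Lambda> U)"
      by (rule nn_integral_distr[OF qm']) (simp add: hm)
    also have "\<dots> = (\<integral>\<^sup>+x. h (q x) * indicator U x \<partial>\<Lambda>)"
      using Us by (intro nn_integral_restrict_space) (simp add: sets.Int_space_eq2)
    finally show ?thesis .
  qed
  have fin: "finite_measure \<sigma>"
  proof
    have "emeasure \<sigma> (space \<sigma>) = (\<integral>\<^sup>+w. 1 \<partial>\<sigma>)" by simp
    also have "\<dots> = ennreal \<alpha> * (\<integral>\<^sup>+x. 1 * indicator U x \<partial>\<Lambda>)" by (rule nns) simp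
    also have "\<dots> = ennreal \<alpha> * emeasure \<Lambda> U" using Us by simp
    also have "emeasure \<Lambda> U \<le> emeasure \<Lambda> {x. 1 / c \<le> norm x}"
    proof (rule emeasure_mono)
      show "U \<subseteq> {x. 1 / c \<le> norm x}" unfolding U_def using c by (auto simp: field_simps intro: order_trans)
      show "{x. 1 / c \<le> norm x} \<in> sets \<Lambda>" by (rule sets_radonI[OF rd]) (use c in \<open>auto simp: not_le\<close>)
    qed
    also have "ennreal \<alpha> * emeasure \<Lambda> {x. 1 / c \<le> norm x} < \<infinity>"
      using fa c(1) unfolding finite_away_def by (simp add: ennreal_mult_less_top)
    finally show "emeasure \<sigma> (space \<sigma>) \<noteq> \<infinity>" by (simp add: mult_left_mono)
  qed
  have "polar \<alpha> \<sigma> = \<Lambda>"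
  proof (rule punctured_measure_eqI[OF sets_polar[OF s fin] sets_radon[OF rd]])
    fix f :: "real^'n \<Rightarrow> ennreal" assume f: "f \<in> borel_measurable borel" "f 0 = 0"
    note [measurable] = f(1)
    have idL [measurable]: "fst \<in> measurable (\<Lambda> \<Otimes>\<^sub>M radial \<alpha>) borel"
      using measurable_compose[OF measurable_fst measurable_radon[OF rd measurable_ident], of "radial \<alpha>"] by simp
    have inner: "(\<lambda>w. \<integral>\<^sup>+r. f (r *\<^sub>R w) \<partial>radial \<alpha>) \<in> borel_measurable borel"
      by (rule rad.borel_measurable_nn_integral) measurable
    have "(\<integral>\<^sup>+x. f x \<partial>polar \<alpha> \<sigma>) = (\<integral>\<^sup>+w. (\<integral>\<^sup>+r. f (r *\<^sub>R w) \<partial>radial \<alpha>) \<partial>\<sigma>)" by (rule nn_integral_polar[OF s fin f])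
    also have "\<dots> = ennreal \<alpha> * (\<integral>\<^sup>+x. (\<integral>\<^sup>+r. f (r *\<^sub>R q x) \<partial>radial \<alpha>) * indicator U x \<partial>\<Lambda>)" by (rule nns[OF inner])
    \<comment> \<open>Rescaling the radius replaces the direction q x by x itself, at the cost of (N
      x)^-\<alpha>.\<close>
    also have "(\<integral>\<^sup>+x. (\<integral>\<^sup>+r. f (r *\<^sub>R q x) \<partial>radial \<alpha>) * indicator U x \<partial>\<Lambda>)
        = (\<integral>\<^sup>+x. (\<integral>\<^sup>+r. ennreal (N x powr - \<alpha>) * f (r *\<^sub>R x) * indicator U x \<partial>radial \<alpha>) \<partial>\<Lambda>)"
    proof (rule nn_integral_cong)
      fix x assume "x \<in> space \<Lambda>"
      then have x: "N x > 0" using N_pos sp by auto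
      have fx: "(\<lambda>r. f (r *\<^sub>R x)) \<in> borel_measurable borel" by measurable
      have "(\<integral>\<^sup>+r. f (r *\<^sub>R q x) \<partial>radial \<alpha>) = (\<integral>\<^sup>+r. f (((1 / N x) * r) *\<^sub>R x) \<partial>radial \<alpha>)"
        unfolding q_def by (simp add: divide_inverse mult.commute)
      also have "\<dots> = ennreal ((1 / N x) powr \<alpha>) * (\<integral>\<^sup>+r. f (r *\<^sub>R x) \<partial>radial \<alpha>)"
        using x by (intro radial_scale[OF fx]) simp
      also have "(1 / N x) powr \<alpha> = N x powr - \<alpha>" by (rule powr_one_divide[OF x])
      finally have "(\<integral>\<^sup>+r. f (r *\<^sub>R q x) \<partial>radial \<alpha>) * indicator U x = ennreal (N x powr - \<alpha>) * (\<integral>\<^sup>+r. f (r *\<^sub>R x) \<partial>radial \<alpha>) * indicator U x" by simp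
      also have "\<dots> = (\<integral>\<^sup>+r. ennreal (N x powr - \<alpha>) * f (r *\<^sub>R x) * indicator U x \<partial>radial \<alpha>)"
        by (subst nn_integral_cmult[symmetric], simp add: measurable_cong_sets[OF sets_radial refl] fx)
           (subst nn_integral_multc[symmetric], auto simp: measurable_cong_sets[OF sets_radial refl] fx)
      finally show "(\<integral>\<^sup>+r. f (r *\<^sub>R q x) \<partial>radial \<alpha>) * indicator U x = (\<integral>\<^sup>+r. ennreal (N x powr - \<alpha>) * f (r *\<^sub>R x) * indicator U x \<partial>radial \<alpha>)" .
    qed
    also have "\<dots> = (\<integral>\<^sup>+r. (\<integral>\<^sup>+x. ennreal (N x powr - \<alpha>) * f (r *\<^sub>R x) * indicator U x \<partial>\<Lambda>) \<partial>radial \<alpha>)"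
      by (rule LR.Fubini'[symmetric]) (use Ub in measurable)
    \<comment> \<open>For fixed r, the dilation x to r x turns N x \<ge> 1 into N x \<ge> r. One
      factor r^\<alpha> comes from homogeneity of \<open>\<Lambda>\<close>, the other from (N x /
      r)^-\<alpha>.\<close>
    also have "\<dots> = (\<integral>\<^sup>+r. (\<integral>\<^sup>+x. ennreal (N x powr - \<alpha>) * f x * (ennreal (r powr (2 * \<alpha>)) * indicator {..N x} r) \<partial>\<Lambda>) \<partial>radial \<alpha>)"
    proof (rule nn_integral_cong_AE)
      show "AE r in radial \<alpha>. (\<integral>\<^sup>+x. ennreal (N x powr - \<alpha>) * f (r *\<^sub>R x) * indicator U x \<partial>\<Lambda>)
          = (\<integral>\<^sup>+x. ennreal (N x powr - \<alpha>) * f x * (ennreal (r powr (2 * \<alpha>)) * indicator {..N x} r) \<partial>\<Lambda>)"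
        using AE_radial_pos
      proof eventually_elim
        case (elim r)
        define H where "H y = ennreal ((N y / r) powr - \<alpha>) * f y * indicator {..N y} r" for y
        have "(\<lambda>y. indicator {..N y} r :: ennreal) = (\<lambda>y. if r \<le> N y then 1 else 0)" by (auto simp: indicator_def)
        moreover have "(\<lambda>y. if r \<le> N y then 1 else 0 :: ennreal) \<in> borel_measurable borel" by measurable
        ultimately have [measurable]: "(\<lambda>y. indicator {..N y} r :: ennreal) \<in> borel_measurable borel" by simp
        have Hm: "H \<in> borel_measurable borel" unfolding H_def[abs_def] by measurable
        have "(\<integral>\<^sup>+x. ennreal (N x powr - \<alpha>) * f (r *\<^sub>R x) * indicator U x \<partial>\<Lambda>) = (\<integral>\<^sup>+x. H (r *\<^sub>R x) \<partial>\<Lambda>)"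
        proof (rule nn_integral_cong)
          fix x
          have "(x \<in> U) = (r \<in> {..N (r *\<^sub>R x)})" using elim unfolding U_def by (simp add: N_scale)
          moreover have "N (r *\<^sub>R x) / r = N x" using elim by (simp add: N_scale)
          ultimately show "ennreal (N x powr - \<alpha>) * f (r *\<^sub>R x) * indicator U x = H (r *\<^sub>R x)" unfolding H_def by (simp add: indicator_def)
        qed
        also have "\<dots> = ennreal (r powr \<alpha>) * (\<integral>\<^sup>+x. H x \<partial>\<Lambda>)"
          by (rule nn_homogeneous[OF fa hom elim Hm]) (simp add: H_def f(2))
        also have "\<dots> = (\<integral>\<^sup>+x. ennreal (r powr \<alpha>) * H x \<partial>\<Lambda>)" by (rule nn_integral_cmult[symmetric, OF measurable_radon[OF rd Hm]])
        also have "\<dots> = (\<integral>\<^sup>+x. ennreal (N x powr - \<alpha>) * f x * (ennreal (r powr (2 * \<alpha>)) * indicator {..N x} r) \<partial>\<Lambda>)"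
        proof (rule nn_integral_cong)
          fix x
          have "r powr \<alpha> * (N x / r) powr - \<alpha> = N x powr - \<alpha> * (r powr \<alpha> * r powr \<alpha>)"
            using elim by (simp only: powr_divide powr_minus_divide) (simp add: field_simps)
          also have "r powr \<alpha> * r powr \<alpha> = r powr (2 * \<alpha>)" by (simp add: powr_add[symmetric])
          finally have "ennreal (r powr \<alpha>) * ennreal ((N x / r) powr - \<alpha>) = ennreal (N x powr - \<alpha>) * ennreal (r powr (2 * \<alpha>))"
            by (simp add: ennreal_mult[symmetric])
          have "ennreal (r powr \<alpha>) * H x = (ennreal (r powr \<alpha>) * ennreal ((N x / r) powr - \<alpha>)) * f x * indicator {..N x} r"
            unfolding H_def by (simp only: mult.assoc)
          also note \<open>ennreal (r powr \<alpha>) * ennreal ((N x / r) powr - \<alpha>) = _\<close>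
          also have "ennreal (N x powr - \<alpha>) * ennreal (r powr (2 * \<alpha>)) * f x * indicator {..N x} r
              = ennreal (N x powr - \<alpha>) * f x * (ennreal (r powr (2 * \<alpha>)) * indicator {..N x} r)" by (simp only: mult_ac)
          finally show "ennreal (r powr \<alpha>) * H x = ennreal (N x powr - \<alpha>) * f x * (ennreal (r powr (2 * \<alpha>)) * indicator {..N x} r)" .
        qed
        finally show ?case .
      qed
    qed
    \<comment> \<open>After swapping back, the radial integral over r \<le> N x equals (N
      x)^\<alpha> / \<alpha> and cancels the weight (N x)^-\<alpha>.\<close>
    also have "\<dots> = (\<integral>\<^sup>+x. (\<integral>\<^sup>+r. ennreal (N x powr - \<alpha>) * f x * (ennreal (r powr (2 * \<alpha>)) * indicator {..N x} r) \<partial>radial \<alpha>) \<partial>\<Lambda>)"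
    proof (rule LR.Fubini')
      have "(\<lambda>p. indicator {..N (fst p)} (snd p) :: ennreal) \<in> borel_measurable (\<Lambda> \<Otimes>\<^sub>M radial \<alpha>)"
      proof -
        have "(\<lambda>p. indicator {..N (fst p)} (snd p) :: ennreal) = (\<lambda>p. if snd p \<le> N (fst p) then 1 else 0)" by (auto simp: indicator_def)
        moreover have "(\<lambda>p. if snd p \<le> N (fst p) then 1 else 0 :: ennreal) \<in> borel_measurable (\<Lambda> \<Otimes>\<^sub>M radial \<alpha>)" by measurable
        ultimately show ?thesis by simp
      qed
      then show "(\<lambda>(x, r). ennreal (N x powr - \<alpha>) * f x * (ennreal (r powr (2 * \<alpha>)) * indicator {..N x} r)) \<in> borel_measurable (\<Lambda> \<Otimes>\<^sub>M radial \<alpha>)"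
        unfolding case_prod_unfold by measurable
    qed
    also have "\<dots> = (\<integral>\<^sup>+x. f x * ennreal (1 / \<alpha>) \<partial>\<Lambda>)"
    proof (rule nn_integral_cong)
      fix x assume "x \<in> space \<Lambda>"
      then have x: "N x > 0" using N_pos sp by auto
      have "(\<integral>\<^sup>+r. ennreal (N x powr - \<alpha>) * f x * (ennreal (r powr (2 * \<alpha>)) * indicator {..N x} r) \<partial>radial \<alpha>)
          = ennreal (N x powr - \<alpha>) * f x * ennreal (N x powr \<alpha> / \<alpha>)"
        unfolding radial_initial[OF alpha x, symmetric] by (rule nn_integral_cmult) measurable
      also have "\<dots> = f x * (ennreal (N x powr - \<alpha>) * ennreal (N x powr \<alpha> / \<alpha>))" by (simp only: mult_ac)
      also have "ennreal (N x powr - \<alpha>) * ennreal (N x powr \<alpha> / \<alpha>) = ennreal (N x powr - \<alpha> * (N x powr \<alpha> / \<alpha>))"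
        using alpha by (intro ennreal_mult[symmetric]) auto
      also have "N x powr - \<alpha> * (N x powr \<alpha> / \<alpha>) = 1 / \<alpha>" using x by (simp add: powr_minus_divide)
      finally show "(\<integral>\<^sup>+r. ennreal (N x powr - \<alpha>) * f x * (ennreal (r powr (2 * \<alpha>)) * indicator {..N x} r) \<partial>radial \<alpha>) = f x * ennreal (1 / \<alpha>)" .
    qed
    also have "\<dots> = (\<integral>\<^sup>+x. f x \<partial>\<Lambda>) * ennreal (1 / \<alpha>)" by (rule nn_integral_multc[OF measurable_radon[OF rd f(1)]])
    also have "ennreal \<alpha> * ((\<integral>\<^sup>+x. f x \<partial>\<Lambda>) * ennreal (1 / \<alpha>)) = (\<integral>\<^sup>+x. f x \<partial>\<Lambda>) * ennreal (\<alpha> * (1 / \<alpha>))"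
      using alpha by (simp only: ennreal_mult less_imp_le zero_le_divide_1_iff) (simp only: mult_ac)
    also have "\<alpha> * (1 / \<alpha>) = 1" using alpha by simp
    finally show "(\<integral>\<^sup>+x. f x \<partial>polar \<alpha> \<sigma>) = (\<integral>\<^sup>+x. f x \<partial>\<Lambda>)" by simp
  qed
  then have "spherical_measure N \<alpha> \<Lambda> \<sigma>" unfolding spherical_measure_iff[OF rd] using s fin by simp
  then show ?thesis by blast
qed

end

section \<open>Sums of measures and the series of tails\<close>

lemma ennreal_suminf_swap: "(\<Sum>k. \<Sum>i. f i k) = (\<Sum>i. \<Sum>k. (f i k :: ennreal))"
proof -
  have "(\<Sum>k. \<Sum>i. f i k) = (\<integral>\<^sup>+k. (\<Sum>i. f i k) \<partial>count_space UNIV)" by (simp add: nn_integral_count_space_nat)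
  also have "\<dots> = (\<Sum>i. \<integral>\<^sup>+k. f i k \<partial>count_space UNIV)" by (rule nn_integral_suminf) simp
  finally show ?thesis by (simp add: nn_integral_count_space_nat)
qed

text \<open>Intended for measures that share the sigma-algebra of \<open>m 0\<close>; countable
  additivity is then the exchange of two series of nonnegative terms.\<close>

definition sum_measure :: "(nat \<Rightarrow> 'a measure) \<Rightarrow> 'a measure" where
  "sum_measure m = measure_of (space (m 0)) (sets (m 0)) (\<lambda>E. \<Sum>k. emeasure (m k) E)"

lemma sets_sum_measure: "sets (sum_measure m) = sets (m 0)"
  by (simp add: sum_measure_def sets.space_closed)

context
  fixes m :: "nat \<Rightarrow> 'a measure"
  assumes eq_sets: "\<And>k. sets (m k) = sets (m 0)"
begin

lemma emeasure_sum_measure: "E \<in> sets (m 0) \<Longrightarrow> emeasure (sum_measure m) E = (\<Sum>k. emeasure (m k) E)"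
  unfolding sum_measure_def
proof (rule emeasure_measure_of_sigma)
  show "sigma_algebra (space (m 0)) (sets (m 0))" by (rule sets.sigma_algebra_axioms)
  show "positive (sets (m 0)) (\<lambda>E. \<Sum>k. emeasure (m k) E)" by (simp add: positive_def)
  show "countably_additive (sets (m 0)) (\<lambda>E. \<Sum>k. emeasure (m k) E)"
  proof (rule countably_additiveI)
    fix A :: "nat \<Rightarrow> 'a set" assume A: "range A \<subseteq> sets (m 0)" "disjoint_family A"
    have "(\<Sum>i. \<Sum>k. emeasure (m k) (A i)) = (\<Sum>k. \<Sum>i. emeasure (m k) (A i))" by (rule ennreal_suminf_swap[symmetric])
    also have "\<dots> = (\<Sum>k. emeasure (m k) (\<Union> (range A)))"
      using A eq_sets by (intro suminf_cong suminf_emeasure) auto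
    finally show "(\<Sum>i. \<Sum>k. emeasure (m k) (A i)) = (\<Sum>k. emeasure (m k) (\<Union> (range A)))" .
  qed
qed

lemma nn_integral_sum_measure:
  assumes "f \<in> borel_measurable (m 0)"
  shows "(\<integral>\<^sup>+x. f x \<partial>sum_measure m) = (\<Sum>k. \<integral>\<^sup>+x. f x \<partial>m k)"
proof -
  have sp: "space (m k) = space (m 0)" for k by (rule sets_eq_imp_space_eq[OF eq_sets])
  have sp': "space (sum_measure m) = space (m 0)" by (rule sets_eq_imp_space_eq[OF sets_sum_measure])
  have bm: "u \<in> borel_measurable (m k)" "u \<in> borel_measurable (sum_measure m)" if "u \<in> borel_measurable (m 0)" for u :: "'a \<Rightarrow> ennreal" and k
    using that by (subst measurable_cong_sets[OF eq_sets[of k] refl] measurable_cong_sets[OF sets_sum_measure refl], assumption)+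
  show ?thesis using assms
  proof (induction rule: borel_measurable_induct)
    case (cong f g)
    have "(\<integral>\<^sup>+x. f x \<partial>sum_measure m) = (\<integral>\<^sup>+x. g x \<partial>sum_measure m)" by (rule nn_integral_cong) (use cong(3) sp' in auto)
    moreover have "(\<integral>\<^sup>+x. f x \<partial>m k) = (\<integral>\<^sup>+x. g x \<partial>m k)" for k by (rule nn_integral_cong) (use cong(3) sp[of k] in auto)
    ultimately show ?case using cong(4) by simp
  next
    case (set A)
    then have "A \<in> sets (m k)" "A \<in> sets (sum_measure m)" for k
      by (subst eq_sets[of k] sets_sum_measure, assumption)+
    then show ?case using emeasure_sum_measure[OF set] by simp
  next
    case (mult u c)
    have "(\<integral>\<^sup>+x. c * u x \<partial>sum_measure m) = c * (\<integral>\<^sup>+x. u x \<partial>sum_measure m)" by (rule nn_integral_cmult[OF bm(2)[OF mult(2)]])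
    also have "\<dots> = (\<Sum>k. c * (\<integral>\<^sup>+x. u x \<partial>m k))" unfolding mult(4) by (rule ennreal_suminf_cmult[symmetric])
    also have "\<dots> = (\<Sum>k. \<integral>\<^sup>+x. c * u x \<partial>m k)" by (rule suminf_cong) (rule nn_integral_cmult[symmetric, OF bm(1)[OF mult(2)]])
    finally show ?case .
  next
    case (add u v)
    have "(\<integral>\<^sup>+x. v x + u x \<partial>sum_measure m) = (\<integral>\<^sup>+x. v x \<partial>sum_measure m) + (\<integral>\<^sup>+x. u x \<partial>sum_measure m)"
      by (rule nn_integral_add[OF bm(2)[OF add(3)] bm(2)[OF add(1)]])
    also have "\<dots> = (\<Sum>k. (\<integral>\<^sup>+x. v x \<partial>m k) + (\<integral>\<^sup>+x. u x \<partial>m k))" unfolding add(6) add(7) by (rule suminf_add) auto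
    also have "\<dots> = (\<Sum>k. \<integral>\<^sup>+x. v x + u x \<partial>m k)" by (rule suminf_cong) (rule nn_integral_add[symmetric, OF bm(1)[OF add(3)] bm(1)[OF add(1)]])
    finally show ?case .
  next
    case (seq U)
    have 1: "(\<integral>\<^sup>+x. (SUP i. U i) x \<partial>M') = (SUP i. \<integral>\<^sup>+x. U i x \<partial>M')" if "\<And>i. U i \<in> borel_measurable M'" for M'
      using nn_integral_monotone_convergence_SUP[OF seq(3) that] by (simp add: image_comp)
    have "(\<integral>\<^sup>+x. (SUP i. U i) x \<partial>sum_measure m) = (SUP i. \<Sum>k. \<integral>\<^sup>+x. U i x \<partial>m k)"
      unfolding 1[OF bm(2)[OF seq(1)]] seq(5) ..
    also have "\<dots> = (\<Sum>k. SUP i. \<integral>\<^sup>+x. U i x \<partial>m k)"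
      by (rule ennreal_suminf_SUP_eq[symmetric]) (auto simp: incseq_def intro!: nn_integral_mono dest: incseqD[OF seq(3), THEN le_funD])
    also have "\<dots> = (\<Sum>k. \<integral>\<^sup>+x. (SUP i. U i) x \<partial>m k)" by (rule suminf_cong) (rule 1[symmetric, OF bm(1)[OF seq(1)]])
    finally show ?case .
  qed
qed

end

text \<open>Each entry is bounded through the image of a coordinate vector. This is the direction of
  comparison that carries the moment hypothesis from the operator norm to the Euclidean matrix
  norm.\<close>

lemma norm_matrix_le_op_norm:
  fixes N :: "real^'n \<Rightarrow> real"
  assumes "is_norm N"
  obtains c where "c > 0" "\<And>A. norm A \<le> c * op_norm N A" "\<And>A. 0 \<le> op_norm N A"
proof -
  obtain c where c: "c > 0" "\<And>x. N x \<le> c * norm x" "\<And>x. norm x \<le> c * N x" by (rule is_norm_equiv[OF assms]) blast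
  have Np: "N x \<ge> 0" and N0: "N x = 0 \<longleftrightarrow> x = 0" and Ns: "N (t *\<^sub>R x) = \<bar>t\<bar> * N x" for x t using assms unfolding is_norm_def by auto
  have bdd: "bdd_above ((\<lambda>x. N (A *v x)) ` unit_sphere N)" for A :: "real^'n^'n"
  proof (rule bdd_aboveI2)
    fix x assume "x \<in> unit_sphere N"
    then have x: "norm x \<le> c" using c(3)[of x] by (simp add: unit_sphere_def)
    have "N (A *v x) \<le> c * norm (A *v x)" by (rule c)
    also have "\<dots> \<le> c * (norm A * norm x)" using c(1) by (intro mult_left_mono norm_matrix_vector_mult_le) auto
    also have "\<dots> \<le> c * (norm A * c)" using c(1) x by (intro mult_left_mono) auto
    finally show "N (A *v x) \<le> c * (norm A * c)" .
  qed
  have op: "N (A *v x) \<le> op_norm N A * N x" if "x \<noteq> 0" for A :: "real^'n^'n" and x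
  proof -
    have p: "N x > 0" using Np[of x] N0[of x] that by linarith
    have "x /\<^sub>R N x \<in> unit_sphere N" using p by (simp add: unit_sphere_def Ns)
    then have "N (A *v (x /\<^sub>R N x)) \<le> op_norm N A" unfolding op_norm_def by (rule cSUP_upper[OF _ bdd])
    moreover have "N (A *v (x /\<^sub>R N x)) = N (A *v x) / N x" using p by (simp add: matrix_vector_mult_scaleR Ns divide_inverse mult.commute)
    ultimately have "N (A *v x) / N x \<le> op_norm N A" by (simp only:)
    then show ?thesis using p by (simp add: pos_divide_le_eq)
  qed
  have op0: "0 \<le> op_norm N A" for A
  proof -
    define x where "x = (axis undefined 1 :: real^'n)"
    have x: "x \<noteq> 0" unfolding x_def by simp
    have "0 \<le> op_norm N A * N x" using order_trans[OF Np op[OF x]] .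
    moreover have "N x > 0" using Np[of x] N0[of x] x by linarith
    ultimately show ?thesis by (simp add: zero_le_mult_iff)
  qed
  define D where "D = (\<Sum>(i::'n)\<in>UNIV. \<Sum>j\<in>UNIV. c * N (axis j 1 :: real^'n)) + 1"
  have D: "D > 0" unfolding D_def using c(1) Np by (intro add_nonneg_pos sum_nonneg) auto
  have "norm A \<le> D * op_norm N A" for A :: "real^'n^'n"
  proof -
    have ent: "\<bar>A $ i $ j\<bar> \<le> c * N (axis j 1) * op_norm N A" for i j
    proof -
      have "A $ i $ j = (A *v axis j 1) $ i" by (simp add: matrix_vector_mul_component inner_axis)
      then have "\<bar>A $ i $ j\<bar> \<le> norm (A *v axis j 1)" using component_le_norm_cart[of "A *v axis j 1" i] by simp
      also have "\<dots> \<le> c * N (A *v axis j 1)" by (rule c)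
      also have "\<dots> \<le> c * (op_norm N A * N (axis j 1))" using c(1) by (intro mult_left_mono op) auto
      finally show ?thesis by (simp add: mult_ac)
    qed
    have "norm A \<le> (\<Sum>i\<in>UNIV. norm (A $ i))" unfolding norm_vec_def[of A] by (intro L2_set_le_sum) auto
    also have "\<dots> \<le> (\<Sum>i\<in>UNIV. \<Sum>j\<in>UNIV. \<bar>A $ i $ j\<bar>)" by (intro sum_mono norm_le_l1_cart)
    also have "\<dots> \<le> (\<Sum>(i::'n)\<in>UNIV. \<Sum>j\<in>UNIV. c * N (axis j 1 :: real^'n) * op_norm N A)" by (intro sum_mono ent)
    also have "\<dots> = (D - 1) * op_norm N A" unfolding D_def by (simp add: sum_distrib_right)
    also have "\<dots> \<le> D * op_norm N A" using op0 by (intro mult_right_mono) auto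
    finally show ?thesis .
  qed
  with D op0 show ?thesis by (intro that[of D]) auto
qed

section \<open>Matrix products, the expected series and identification of the sequence of
  tails\<close>

context tail_chain
begin

text \<open>The product A_m ... A_(m+k-1), indexed by first factor and length: splitting off the
  left factor raises the first index and lowers the length, as the induction needs.\<close>

definition mat_product :: "nat \<Rightarrow> nat \<Rightarrow> 'w \<Rightarrow> real^'n^'n" where
  "mat_product m k \<omega> = foldr (\<lambda>i P. As i \<omega> ** P) [m..<m + k] (mat 1)"

lemma mat_prod_eq_mat_product: "mat_prod As 2 (Suc k) \<omega> = mat_product 2 k \<omega>"
  by (simp add: mat_prod_def mat_product_def)

lemma mat_product_0: "mat_product m 0 \<omega> = mat 1" by (simp add: mat_product_def)

lemma mat_product_Suc: "mat_product m (Suc k) \<omega> = As m \<omega> ** mat_product (Suc m) k \<omega>"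
proof -
  have "[m..<m + Suc k] = m # [Suc m..<Suc m + k]" by (subst upt_conv_Cons) auto
  then show ?thesis unfolding mat_product_def by simp
qed

lemma fst_input_measurable: "fst \<in> measurable (input_space :: ((real^'n^'n) \<times> (real^'n) \<times> (real^'n \<Rightarrow> real^'n) \<times> real) measure) borel"
  unfolding input_space_def by measurable

lemma inp_measurable: "n \<ge> 1 \<Longrightarrow> inp n \<in> measurable M input_space"
  using copies by (intro random_inputD(5)[of N \<delta>]) auto

lemma As_measurable: "n \<ge> 1 \<Longrightarrow> As n \<in> borel_measurable M"
  using measurable_compose[OF inp_measurable fst_input_measurable, of n] by simp

lemma As_law: assumes "n \<ge> 1" shows "distr M borel (As n) = \<mu>"
proof -
  have "distr M borel (As n) = distr (distr M input_space (inp n)) borel fst"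
    by (subst distr_distr[OF fst_input_measurable inp_measurable[OF assms]]) (simp add: comp_def)
  also have "\<dots> = distr (distr M input_space (\<lambda>\<omega>. (A \<omega>, B1 \<omega>, B2 \<omega>, B3 \<omega>))) borel fst" using same_law assms by simp
  also have "\<dots> = \<mu>" by (subst distr_distr[OF fst_input_measurable random_inputD(5)[OF input]]) (simp add: comp_def)
  finally show ?thesis .
qed

lemma measurable_input_prod:
  "{m..<m + k} \<subseteq> J \<Longrightarrow> (\<lambda>i. foldr (\<lambda>j P. fst (i j) ** P) [m..<m + k] (mat 1)) \<in> borel_measurable
     (Pi\<^sub>M J (\<lambda>_. input_space :: ((real^'n^'n) \<times> (real^'n) \<times> (real^'n \<Rightarrow> real^'n) \<times> real) measure))"
proof (induction k arbitrary: m)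
  case (Suc k)
  have m: "m \<in> J" and sub: "{Suc m..<Suc m + k} \<subseteq> J" using Suc.prems by auto
  have "[m..<m + Suc k] = m # [Suc m..<Suc m + k]" by (subst upt_conv_Cons) auto
  moreover have "(\<lambda>i. fst (i m) ** foldr (\<lambda>j P. fst (i j) ** P) [Suc m..<Suc m + k] (mat 1)) \<in> borel_measurable
     (Pi\<^sub>M J (\<lambda>_. input_space :: ((real^'n^'n) \<times> (real^'n) \<times> (real^'n \<Rightarrow> real^'n) \<times> real) measure))"
    by (rule borel_measurable_matrix_matrix_mult[OF measurable_compose[OF measurable_component_singleton[OF m] fst_input_measurable] Suc.IH[OF sub]])
  ultimately show ?case by simp
qed simp

lemma input_prod_eq_mat_product:
  assumes "{m..<m + k} \<subseteq> J"
  shows "foldr (\<lambda>j P. fst (restrict (\<lambda>i. inp i \<omega>) J j) ** P) [m..<m + k] (mat 1) = mat_product m k \<omega>"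
  unfolding mat_product_def by (rule foldr_cong) (use assms in auto)

lemma indep_As_mat_product:
  assumes "m \<ge> 1"
  shows "indep_var borel (As m) borel (mat_product (Suc m) k)"
proof -
  let ?J = "{Suc m..<Suc m + k}"
  have 1: "indep_var (Pi\<^sub>M {m} (\<lambda>_. input_space)) (\<lambda>\<omega>. restrict (\<lambda>i. inp i \<omega>) {m})
      (Pi\<^sub>M ?J (\<lambda>_. input_space)) (\<lambda>\<omega>. restrict (\<lambda>i. inp i \<omega>) ?J)"
    by (rule indep_var_restrict[OF indep]) (use assms in auto)
  have "m \<in> {m}" by simp
  from indep_var_compose[OF 1 measurable_compose[OF measurable_component_singleton[OF this] fst_input_measurable] measurable_input_prod[OF order_refl]]
  have "indep_var borel ((\<lambda>i. fst (i m)) \<circ> (\<lambda>\<omega>. restrict (\<lambda>i. inp i \<omega>) {m})) borel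
     ((\<lambda>i. foldr (\<lambda>j P. fst (i j) ** P) [Suc m..<Suc m + k] (mat 1)) \<circ> (\<lambda>\<omega>. restrict (\<lambda>i. inp i \<omega>) ?J))" .
  then show ?thesis unfolding comp_def input_prod_eq_mat_product[OF order_refl] by simp
qed

lemma mat_product_measurable: "m \<ge> 1 \<Longrightarrow> mat_product m k \<in> borel_measurable M"
proof (induction k arbitrary: m)
  case 0
  have "mat_product m 0 = (\<lambda>_. mat 1)" by (simp add: mat_product_0 fun_eq_iff)
  then show ?case by simp
next
  case (Suc k)
  have "(\<lambda>\<omega>. As m \<omega> ** mat_product (Suc m) k \<omega>) \<in> borel_measurable M"
    by (rule borel_measurable_matrix_matrix_mult[OF As_measurable Suc.IH]) (use Suc.prems in auto)
  then show ?case by (simp add: mat_product_Suc[abs_def])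
qed

lemma id_jump_tail: "(\<lambda>x. x) \<in> measurable (jump_tail k) borel"
  by (rule measurable_radon[OF rad_jump_tail]) simp

text \<open>The start index is generalised because the left factor A_m is split off. It is
  independent of the remaining product, has law \<mu>, and acts last, exactly like the new matrix in
  \<open>jump_tail (Suc k)\<close>.\<close>

lemma nn_integral_mat_product:
  assumes "m \<ge> 1" "f \<in> borel_measurable borel" "f 0 = 0"
  shows "(\<integral>\<^sup>+\<omega>. (\<integral>\<^sup>+x. f (mat_product m k \<omega> *v x) \<partial>jump_tail 0) \<partial>M) = (\<integral>\<^sup>+x. f x \<partial>jump_tail k)"
  using assms
proof (induction k arbitrary: m f)
  case 0
  then show ?case by (simp add: mat_product_0 emeasure_space_1)
next
  case (Suc k)
  note [measurable] = Suc.prems(2)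
  interpret g0: sigma_finite_measure "jump_tail 0" by (rule sigma_finite_jump_tail)
  let ?D = "distr M borel (mat_product (Suc m) k)"
  have mpm: "mat_product (Suc m) k \<in> borel_measurable M" by (rule mat_product_measurable) simp
  interpret mu: prob_space \<mu> by (rule prob_mu)
  interpret D: prob_space ?D by (rule prob_space_distr[OF mpm])
  define H where "H p = (\<integral>\<^sup>+x. f (fst p *v (snd p *v x)) \<partial>jump_tail 0)" for p :: "(real^'n^'n) \<times> (real^'n^'n)"
  have Hm: "H \<in> borel_measurable (borel \<Otimes>\<^sub>M borel)"
  proof -
    have [measurable]: "snd \<in> measurable ((borel \<Otimes>\<^sub>M borel) \<Otimes>\<^sub>M jump_tail 0) (borel :: (real^'n) measure)"
      by (rule measurable_compose[OF measurable_snd id_jump_tail[of 0]])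
    have "(\<lambda>q. f (fst (fst q) *v (snd (fst q) *v snd q))) \<in> borel_measurable ((borel \<Otimes>\<^sub>M borel) \<Otimes>\<^sub>M jump_tail 0)"
      by (rule measurable_compose[OF _ Suc.prems(2)]) measurable
    then have "(\<lambda>(p, x). f (fst p *v (snd p *v x))) \<in> borel_measurable ((borel \<Otimes>\<^sub>M borel) \<Otimes>\<^sub>M jump_tail 0)" by (simp add: case_prod_unfold)
    from g0.borel_measurable_nn_integral[OF this] show ?thesis unfolding H_def[abs_def] .
  qed
  have joint: "\<mu> \<Otimes>\<^sub>M ?D = distr M (borel \<Otimes>\<^sub>M borel) (\<lambda>\<omega>. (As m \<omega>, mat_product (Suc m) k \<omega>))"
    using indep_As_mat_product[OF Suc.prems(1), of k] unfolding indep_var_distribution_eq As_law[OF Suc.prems(1)] by auto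
  have "(\<integral>\<^sup>+\<omega>. (\<integral>\<^sup>+x. f (mat_product m (Suc k) \<omega> *v x) \<partial>jump_tail 0) \<partial>M) = (\<integral>\<^sup>+\<omega>. H (As m \<omega>, mat_product (Suc m) k \<omega>) \<partial>M)"
    by (simp add: H_def mat_product_Suc matrix_vector_mul_assoc)
  also have "\<dots> = (\<integral>\<^sup>+p. H p \<partial>distr M (borel \<Otimes>\<^sub>M borel) (\<lambda>\<omega>. (As m \<omega>, mat_product (Suc m) k \<omega>)))"
    by (rule nn_integral_distr[symmetric, OF measurable_Pair[OF As_measurable[OF Suc.prems(1)] mpm]]) (simp add: Hm)
  also have "\<dots> = (\<integral>\<^sup>+p. H p \<partial>(\<mu> \<Otimes>\<^sub>M ?D))" unfolding joint ..
  also have "\<dots> = (\<integral>\<^sup>+a. (\<integral>\<^sup>+q. H (a, q) \<partial>?D) \<partial>\<mu>)"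
  proof (rule D.nn_integral_fst[symmetric])
    have "sets (\<mu> \<Otimes>\<^sub>M ?D) = sets (borel \<Otimes>\<^sub>M borel)" by (rule sets_pair_measure_cong) simp_all
    then show "H \<in> borel_measurable (\<mu> \<Otimes>\<^sub>M ?D)" using Hm measurable_cong_sets[OF _ refl, of "\<mu> \<Otimes>\<^sub>M ?D" "borel \<Otimes>\<^sub>M borel" "borel :: ennreal measure"] by blast
  qed
  also have "\<dots> = (\<integral>\<^sup>+a. (\<integral>\<^sup>+x. f (a *v x) \<partial>jump_tail k) \<partial>\<mu>)"
  proof (rule nn_integral_cong)
    fix a :: "real^'n^'n"
    have "(\<integral>\<^sup>+q. H (a, q) \<partial>?D) = (\<integral>\<^sup>+\<omega>. H (a, mat_product (Suc m) k \<omega>) \<partial>M)"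
      by (rule nn_integral_distr[OF mpm]) (use measurable_compose[OF measurable_Pair1' Hm] in simp)
    also have "\<dots> = (\<integral>\<^sup>+\<omega>. (\<integral>\<^sup>+x. (\<lambda>y. f (a *v y)) (mat_product (Suc m) k \<omega> *v x) \<partial>jump_tail 0) \<partial>M)" by (simp add: H_def)
    also have "\<dots> = (\<integral>\<^sup>+x. f (a *v x) \<partial>jump_tail k)"
      by (rule Suc.IH) (use Suc.prems in \<open>auto intro!: measurable_compose[OF _ Suc.prems(2)]\<close>)
    finally show "(\<integral>\<^sup>+q. H (a, q) \<partial>?D) = (\<integral>\<^sup>+x. f (a *v x) \<partial>jump_tail k)" .
  qed
  also have "\<dots> = (\<integral>\<^sup>+x. f x \<partial>jump_tail (Suc k))"
    unfolding jump_tail.simps(2) by (rule nn_integral_matrix_image[symmetric, OF _ sigma_finite_jump_tail sets_jump_tail Suc.prems(2,3)]) simp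
  finally show ?case .
qed

lemma mat_product_pair_measurable: "(\<lambda>p. mat_product 2 k (fst p) *v snd p) \<in> borel_measurable (M \<Otimes>\<^sub>M jump_tail 0)"
proof (rule borel_measurable_matrix_vector_mult)
  show "(\<lambda>p. mat_product 2 k (fst p)) \<in> borel_measurable (M \<Otimes>\<^sub>M jump_tail 0)" by (rule measurable_compose[OF measurable_fst mat_product_measurable]) simp
  show "snd \<in> borel_measurable (M \<Otimes>\<^sub>M jump_tail 0)" by (rule measurable_compose[OF measurable_snd id_jump_tail])
qed

text \<open>With an equality of measures in place of one for nonnegative integrals, integrability of
  signed test functions on the product space can be read off from
  \<open>jump_tail k\<close>.\<close>

lemma jump_tail_eq_mat_product_image: "jump_tail k = punctured_image (M \<Otimes>\<^sub>M jump_tail 0) (\<lambda>p. mat_product 2 k (fst p) *v snd p)"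
proof (rule punctured_measure_eqI[OF sets_jump_tail sets_punctured_image])
  fix f :: "real^'n \<Rightarrow> ennreal" assume f: "f \<in> borel_measurable borel" "f 0 = 0"
  have "(\<integral>\<^sup>+x. f x \<partial>jump_tail k) = (\<integral>\<^sup>+\<omega>. (\<integral>\<^sup>+x. f (mat_product 2 k \<omega> *v x) \<partial>jump_tail 0) \<partial>M)" by (rule nn_integral_mat_product[symmetric, OF _ f]) simp
  also have "\<dots> = (\<integral>\<^sup>+p. f (mat_product 2 k (fst p) *v snd p) \<partial>(M \<Otimes>\<^sub>M jump_tail 0))"
    using sigma_finite_measure.nn_integral_fst[OF sigma_finite_jump_tail measurable_compose[OF mat_product_pair_measurable f(1)]] by simp
  also have "\<dots> = (\<integral>\<^sup>+x. f x \<partial>punctured_image (M \<Otimes>\<^sub>M jump_tail 0) (\<lambda>p. mat_product 2 k (fst p) *v snd p))"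
    by (rule nn_integral_punctured_image[symmetric, OF mat_product_pair_measurable f])
  finally show "(\<integral>\<^sup>+x. f x \<partial>jump_tail k) = (\<integral>\<^sup>+x. f x \<partial>punctured_image (M \<Otimes>\<^sub>M jump_tail 0) (\<lambda>p. mat_product 2 k (fst p) *v snd p))" .
qed

lemma integral_mat_product:
  assumes f: "f \<in> Cb_away"
  shows "integrable M (\<lambda>\<omega>. \<integral>x. f (mat_product 2 k \<omega> *v x) \<partial>jump_tail 0)"
    "(\<integral>\<omega>. (\<integral>x. f (mat_product 2 k \<omega> *v x) \<partial>jump_tail 0) \<partial>M) = (\<integral>x. f x \<partial>jump_tail k)"
proof -
  interpret g0: sigma_finite_measure "jump_tail 0" by (rule sigma_finite_jump_tail)
  interpret P: pair_sigma_finite M "jump_tail 0" ..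
  have f0: "f 0 = 0" using f by (auto simp: Cb_away_def)
  note im = integral_punctured_image[OF mat_product_pair_measurable borel_Cb_away[OF f] f0, of k, folded jump_tail_eq_mat_product_image]
  have i: "integrable (M \<Otimes>\<^sub>M jump_tail 0) (\<lambda>p. f (mat_product 2 k (fst p) *v snd p))" using integrable_jump_tail[OF f] im(2) by blast
  show "integrable M (\<lambda>\<omega>. \<integral>x. f (mat_product 2 k \<omega> *v x) \<partial>jump_tail 0)" using P.integrable_fst'[OF i] by simp
  show "(\<integral>\<omega>. (\<integral>x. f (mat_product 2 k \<omega> *v x) \<partial>jump_tail 0) \<partial>M) = (\<integral>x. f x \<partial>jump_tail k)" using P.integral_fst'[OF i] im(1) by simp
qed

text \<open>E |s_k| is at most the integral of |f| against \<open>jump_tail (Suc k)\<close>.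
  Absolute summability of these integrals gives both almost sure convergence of the series and its
  interchange with the expectation.\<close>

lemma series_exchange:
  assumes f: "f \<in> Cb_away" and sm: "summable (\<lambda>k. \<integral>x. \<bar>f x\<bar> \<partial>jump_tail (Suc k))"
  defines "s \<equiv> \<lambda>k \<omega>. \<integral>x. f (mat_product 2 (Suc k) \<omega> *v x) \<partial>jump_tail 0"
  shows "AE \<omega> in M. summable (\<lambda>k. s k \<omega>)" "integrable M (\<lambda>\<omega>. \<Sum>k. s k \<omega>)"
    "(\<integral>\<omega>. (\<Sum>k. s k \<omega>) \<partial>M) = (\<Sum>k. \<integral>x. f x \<partial>jump_tail (Suc k))"
proof -
  have fa: "(\<lambda>x. \<bar>f x\<bar>) \<in> Cb_away" by (rule Cb_away_abs[OF f])
  have si: "integrable M (s k)" for k unfolding s_def by (rule integral_mat_product(1)[OF f])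
  have sa: "(\<integral>\<omega>. \<bar>s k \<omega>\<bar> \<partial>M) \<le> (\<integral>x. \<bar>f x\<bar> \<partial>jump_tail (Suc k))" for k
  proof -
    have "(\<integral>\<omega>. \<bar>s k \<omega>\<bar> \<partial>M) \<le> (\<integral>\<omega>. (\<integral>x. \<bar>f (mat_product 2 (Suc k) \<omega> *v x)\<bar> \<partial>jump_tail 0) \<partial>M)"
      by (rule integral_mono[OF integrable_abs[OF si] integral_mat_product(1)[OF fa]]) (simp add: s_def integral_abs_bound)
    also have "\<dots> = (\<integral>x. \<bar>f x\<bar> \<partial>jump_tail (Suc k))" by (rule integral_mat_product(2)[OF fa])
    finally show ?thesis .
  qed
  have sm': "summable (\<lambda>k. \<integral>\<omega>. norm (s k \<omega>) \<partial>M)"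
    by (rule summable_comparison_test[OF _ sm]) (use sa in \<open>auto simp: Bochner_Integration.integral_nonneg\<close>)
  have "(\<integral>\<^sup>+\<omega>. (\<Sum>k. ennreal (norm (s k \<omega>))) \<partial>M) = (\<Sum>k. \<integral>\<^sup>+\<omega>. ennreal (norm (s k \<omega>)) \<partial>M)"
    by (rule nn_integral_suminf) (use borel_measurable_integrable[OF si] in measurable)
  also have "\<dots> = (\<Sum>k. ennreal (\<integral>\<omega>. norm (s k \<omega>) \<partial>M))"
    by (intro suminf_cong nn_integral_eq_integral integrable_norm si) simp
  also have "\<dots> = ennreal (\<Sum>k. \<integral>\<omega>. norm (s k \<omega>) \<partial>M)"
    by (rule suminf_ennreal2[OF _ sm']) (simp add: Bochner_Integration.integral_nonneg)
  finally have "(\<integral>\<^sup>+\<omega>. (\<Sum>k. ennreal (norm (s k \<omega>))) \<partial>M) \<noteq> \<infinity>" by simp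
  then have "AE \<omega> in M. (\<Sum>k. ennreal (norm (s k \<omega>))) \<noteq> \<infinity>"
    by (rule nn_integral_PInf_AE[rotated]) (use borel_measurable_integrable[OF si] in measurable)
  then have AEs: "AE \<omega> in M. summable (\<lambda>k. norm (s k \<omega>))"
    by eventually_elim (rule summable_suminf_not_top, auto)
  then show "AE \<omega> in M. summable (\<lambda>k. s k \<omega>)" by eventually_elim (rule summable_norm_cancel)
  show "integrable M (\<lambda>\<omega>. \<Sum>k. s k \<omega>)" by (rule integrable_suminf[OF si AEs sm'])
  have "(\<integral>\<omega>. (\<Sum>k. s k \<omega>) \<partial>M) = (\<Sum>k. \<integral>\<omega>. s k \<omega> \<partial>M)" by (rule integral_suminf[OF si AEs sm'])
  then show "(\<integral>\<omega>. (\<Sum>k. s k \<omega>) \<partial>M) = (\<Sum>k. \<integral>x. f x \<partial>jump_tail (Suc k))" unfolding s_def integral_mat_product(2)[OF f] .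
qed

lemma jump_tail_homogeneous_measure: "homogeneous_measure \<alpha> (jump_tail k)"
  unfolding homogeneous_measure_def using jump_tail_homogeneous Cc_subset_Cb_away by blast

text \<open>\<open>\<Phi> 0\<close> commutes with positive dilations, and
  \<open>f (\<Phi> 0 y)\<close> is an admissible test function for B1 because its tail limit is
  known on all of \<open>Cb_away\<close>.\<close>

lemma tail_measure_jump_tail_0:
  assumes L: "slowly_varying L" and Vd: "V = (\<lambda>t. t powr \<alpha> * L t)"
  shows "tail_measure \<alpha> L (distr M borel (\<lambda>\<omega>. \<Phi> 0 (B1 \<omega>))) (jump_tail 0)"
  unfolding tail_measure_def
proof (intro conjI L rad_jump_tail ballI)
  fix f :: "real^'n \<Rightarrow> real" assume "f \<in> Cc_punctured"
  then have f: "f \<in> Cb_away" using Cc_subset_Cb_away by auto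
  note g = Cb_away_Phi(1)[OF f]
  have m: "(\<lambda>\<omega>. \<Phi> 0 (B1 \<omega>)) \<in> borel_measurable M"
    by (rule measurable_compose[OF measurable_inputs(2) borel_measurable_continuous_onI[OF continuous_Phi(2)]])
  have "((\<lambda>t. V t * (\<integral>y. f (\<Phi> 0 (y /\<^sub>R t)) \<partial>distr M borel B1)) \<longlongrightarrow> (\<integral>y. f (\<Phi> 0 y) \<partial>\<Lambda>\<^sub>b)) at_top"
    by (rule bspec[OF B1_tail[unfolded tail_functional_def] g])
  moreover have "eventually (\<lambda>t. V t * (\<integral>y. f (\<Phi> 0 (y /\<^sub>R t)) \<partial>distr M borel B1)
      = t powr \<alpha> * L t * (\<integral>w. f (w /\<^sub>R t) \<partial>distr M borel (\<lambda>\<omega>. \<Phi> 0 (B1 \<omega>)))) at_top"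
    using eventually_gt_at_top[of 0]
  proof eventually_elim
    case (elim t)
    have "(\<integral>y. f (\<Phi> 0 (y /\<^sub>R t)) \<partial>distr M borel B1) = (\<integral>\<omega>. f (\<Phi> 0 (B1 \<omega> /\<^sub>R t)) \<partial>M)"
      by (rule integral_distr[OF measurable_inputs(2) measurable_scale[OF borel_Cb_away[OF g]]])
    also have "\<dots> = (\<integral>\<omega>. f (\<Phi> 0 (B1 \<omega>) /\<^sub>R t) \<partial>M)" using Phi_scale[OF elim, of 0] by simp
    also have "\<dots> = (\<integral>w. f (w /\<^sub>R t) \<partial>distr M borel (\<lambda>\<omega>. \<Phi> 0 (B1 \<omega>)))"
      by (rule integral_distr[symmetric, OF m measurable_scale[OF borel_Cb_away[OF f]]])
    finally show ?case unfolding Vd by simp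
  qed
  ultimately show "((\<lambda>t. t powr \<alpha> * L t * (\<integral>w. f (w /\<^sub>R t) \<partial>distr M borel (\<lambda>\<omega>. \<Phi> 0 (B1 \<omega>)))) \<longlongrightarrow> (\<integral>x. f x \<partial>jump_tail 0)) at_top"
    unfolding integral_jump_tail_0[OF f] by (rule Lim_transform_eventually)
qed

text \<open>Radon measures are determined by their test integrals, so the sequence exists and is
  unique from index 1 on; every later claim can be proved for the recursive construction, with the
  index shifted by one.\<close>

lemma Gamma_sequence_iff:
  assumes L: "slowly_varying L" and Vd: "V = (\<lambda>t. t powr \<alpha> * L t)"
  shows "Gamma_sequence M As \<alpha> L (distr M borel (\<lambda>\<omega>. \<Phi> 0 (B1 \<omega>))) \<Gamma> \<longleftrightarrow> (\<forall>n\<ge>1. \<Gamma> n = jump_tail (n - 1))"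
proof
  assume G: "Gamma_sequence M As \<alpha> L (distr M borel (\<lambda>\<omega>. \<Phi> 0 (B1 \<omega>))) \<Gamma>"
  have t1: "tail_measure \<alpha> L (distr M borel (\<lambda>\<omega>. \<Phi> 0 (B1 \<omega>))) (\<Gamma> 1)" using G unfolding Gamma_sequence_def by simp
  have G1: "\<Gamma> 1 = jump_tail 0"
  proof (rule radon_punctured_eqI[OF _ rad_jump_tail])
    show "radon_punctured (\<Gamma> 1)" using t1 unfolding tail_measure_def by simp
    fix f :: "real^'n \<Rightarrow> real" assume f: "f \<in> Cc_punctured"
    show "(\<integral>x. f x \<partial>\<Gamma> 1) = (\<integral>x. f x \<partial>jump_tail 0)"
      by (rule tendsto_unique[OF trivial_limit_at_top_linorder])
         (use t1 tail_measure_jump_tail_0[OF L Vd] f in \<open>unfold tail_measure_def, blast, blast\<close>)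
  qed
  show "\<forall>n\<ge>1. \<Gamma> n = jump_tail (n - 1)"
  proof (intro allI impI)
    fix n :: nat assume n: "n \<ge> 1"
    show "\<Gamma> n = jump_tail (n - 1)"
    proof (cases "n = 1")
      case False
      then obtain k where k: "n = Suc (Suc k)" using n by (metis One_nat_def Suc_le_D not0_implies_Suc)
      show ?thesis
      proof (rule radon_punctured_eqI[OF _ rad_jump_tail])
        show "radon_punctured (\<Gamma> n)" using G k unfolding Gamma_sequence_def by simp
        fix f :: "real^'n \<Rightarrow> real" assume f: "f \<in> Cc_punctured"
        then have fb: "f \<in> Cb_away" using Cc_subset_Cb_away by auto
        have "(\<integral>x. f x \<partial>\<Gamma> n) = (\<integral>\<omega>. (\<integral>x. f (mat_prod As 2 n \<omega> *v x) \<partial>\<Gamma> 1) \<partial>M)"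
          using G k f unfolding Gamma_sequence_def by simp
        also have "\<dots> = (\<integral>x. f x \<partial>jump_tail (n - 1))" unfolding k mat_prod_eq_mat_product G1 using integral_mat_product(2)[OF fb, of "Suc k"] by simp
        finally show "(\<integral>x. f x \<partial>\<Gamma> n) = (\<integral>x. f x \<partial>jump_tail (n - 1))" .
      qed
    qed (simp add: G1[unfolded One_nat_def])
  qed
next
  assume eq: "\<forall>n\<ge>1. \<Gamma> n = jump_tail (n - 1)"
  then have G1: "\<Gamma> 1 = jump_tail 0" by simp
  show "Gamma_sequence M As \<alpha> L (distr M borel (\<lambda>\<omega>. \<Phi> 0 (B1 \<omega>))) \<Gamma>"
    unfolding Gamma_sequence_def G1
  proof (intro conjI tail_measure_jump_tail_0[OF L Vd] allI impI ballI)
    fix n :: nat assume n: "n \<ge> 2"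
    then obtain k where k: "n = Suc k" by (metis Suc_le_D numeral_2_eq_2)
    have Gn: "\<Gamma> n = jump_tail k" using eq k by simp
    show "radon_punctured (\<Gamma> n)" unfolding Gn by (rule rad_jump_tail)
    fix f :: "real^'n \<Rightarrow> real" assume "f \<in> Cc_punctured"
    then have fb: "f \<in> Cb_away" using Cc_subset_Cb_away by auto
    show "integrable (jump_tail 0) (\<lambda>x. f (mat_prod As 2 n \<omega> *v x))" for \<omega>
      by (rule integrable_jump_tail[OF Cb_away_matrix[OF fb]])
    show "integrable M (\<lambda>\<omega>. \<integral>x. f (mat_prod As 2 n \<omega> *v x) \<partial>jump_tail 0)"
      unfolding k mat_prod_eq_mat_product by (rule integral_mat_product(1)[OF fb])
    show "(\<integral>x. f x \<partial>\<Gamma> n) = (\<integral>\<omega>. (\<integral>x. f (mat_prod As 2 n \<omega> *v x) \<partial>jump_tail 0) \<partial>M)"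
      unfolding Gn unfolding k mat_prod_eq_mat_product by (rule integral_mat_product(2)[OF fb, symmetric])
  qed
qed

end

section \<open>Transfer of spherical measures\<close>

lemma ennreal_divide_cancel:
  assumes "\<alpha> > 0" "x * ennreal (1 / \<alpha>) = y * ennreal (1 / \<alpha>)" shows "x = y"
proof -
  have "x * ennreal (1 / \<alpha>) * ennreal \<alpha> = y * ennreal (1 / \<alpha>) * ennreal \<alpha>" using assms(2) by (rule arg_cong)
  moreover have "ennreal (1 / \<alpha>) * ennreal \<alpha> = 1" using assms(1) by (simp add: ennreal_mult[symmetric])
  ultimately show ?thesis by (simp add: mult.assoc)
qed

context tail_chain
begin

definition spherical_kernel :: "(real^'n \<Rightarrow> real) \<Rightarrow> real^'n \<Rightarrow> real" where
  "spherical_kernel g v = (if v = 0 then 0 else g (v /\<^sub>R N v) * N v powr \<alpha>)"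

context
  fixes k :: nat and \<sigma> \<sigma>' :: "(real^'n) measure"
  assumes sm: "spherical_measure N \<alpha> (jump_tail k) \<sigma>" and sm': "spherical_measure N \<alpha> (jump_tail (Suc k)) \<sigma>'"
begin

lemma polar_sm: "sets \<sigma> = sets (sphere_space N)" "finite_measure \<sigma>" "jump_tail k = polar \<alpha> \<sigma>"
  using spherical_measure_iff[OF norm alpha rad_jump_tail, THEN iffD1, OF sm] by blast+

lemma polar_sm': "sets \<sigma>' = sets (sphere_space N)" "finite_measure \<sigma>'" "jump_tail (Suc k) = polar \<alpha> \<sigma>'"
  using spherical_measure_iff[OF norm alpha rad_jump_tail, THEN iffD1, OF sm'] by blast+

lemma sigma_finite_sm: "sigma_finite_measure \<sigma>"
  using polar_sm(2) by (simp add: finite_measure_def)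

lemma sphere_image_measurable: "a \<in> borel_measurable M' \<Longrightarrow> (\<lambda>p. a (fst p) *v snd p) \<in> borel_measurable (M' \<Otimes>\<^sub>M \<sigma>)"
  for a :: "'b \<Rightarrow> real^'n^'n"
  by (rule borel_measurable_matrix_vector_mult[OF measurable_compose[OF measurable_fst] measurable_compose[OF measurable_snd id_sigma[OF norm alpha polar_sm(1,2)]]])

text \<open>The same cone function is integrated against the later tail in two ways: in that
  measure's own polar coordinates, and through the image of the earlier tail under \<open>A\<close>,
  where \<open>radial_cone\<close> produces the kernel. The common factor 1/\<alpha>
  cancels.\<close>

lemma spherical_transfer:
  assumes h: "h \<in> borel_measurable borel"
  defines "H \<equiv> \<lambda>v. if v = 0 then 0 else h (v /\<^sub>R N v) * ennreal (N v powr \<alpha>)"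
  shows "(\<integral>\<^sup>+w. h w \<partial>\<sigma>') = (\<integral>\<^sup>+\<omega>. (\<integral>\<^sup>+w. H (A \<omega> *v w) \<partial>\<sigma>) \<partial>M)"
proof -
  note [measurable] = h N_borel[OF norm alpha]
  define cone where "cone x = (if 1 \<le> N x then h (x /\<^sub>R N x) else 0)" for x
  have cone_m: "cone \<in> borel_measurable borel" unfolding cone_def[abs_def] using h by measurable
  have cone0: "cone 0 = 0" using N_0[OF norm alpha, of 0] by (simp add: cone_def)
  have Hm: "H \<in> borel_measurable borel" unfolding H_def by measurable
  let ?c = "ennreal (1 / \<alpha>)"
  have Ham: "(\<lambda>w. H (a *v w)) \<in> borel_measurable \<sigma>" for a
  proof -
    have "(\<lambda>w. a *v w) \<in> borel_measurable \<sigma>"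
      by (rule borel_measurable_matrix_vector_mult[OF borel_measurable_const id_sigma[OF norm alpha polar_sm(1,2)]])
    from measurable_compose[OF this Hm] show ?thesis .
  qed
  have "(\<integral>\<^sup>+w. h w \<partial>\<sigma>') * ?c = (\<integral>\<^sup>+x. cone x \<partial>jump_tail (Suc k))"
    unfolding polar_sm'(3) cone_def by (rule nn_integral_polar_cone[symmetric, OF norm alpha polar_sm'(1,2) h])
  also have "\<dots> = (\<integral>\<^sup>+a. (\<integral>\<^sup>+x. cone (a *v x) \<partial>jump_tail k) \<partial>\<mu>)"
    unfolding jump_tail.simps(2) by (rule nn_integral_matrix_image[OF _ sigma_finite_jump_tail sets_jump_tail cone_m cone0]) simp
  also have "\<dots> = (\<integral>\<^sup>+a. (\<integral>\<^sup>+w. H (a *v w) \<partial>\<sigma>) * ?c \<partial>\<mu>)"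
  proof (rule nn_integral_cong)
    fix a :: "real^'n^'n"
    have am: "(\<lambda>x. a *v x) \<in> borel_measurable borel" by (rule borel_measurable_matrix_vector_mult) simp_all
    have "(\<integral>\<^sup>+x. cone (a *v x) \<partial>jump_tail k) = (\<integral>\<^sup>+w. (\<integral>\<^sup>+r. cone (a *v (r *\<^sub>R w)) \<partial>radial \<alpha>) \<partial>\<sigma>)"
      unfolding polar_sm(3)
      by (rule nn_integral_polar[OF norm alpha polar_sm(1,2) measurable_compose[OF am cone_m]]) (simp add: cone0)
    also have "\<dots> = (\<integral>\<^sup>+w. H (a *v w) * ?c \<partial>\<sigma>)"
      by (rule nn_integral_cong) (simp only: matrix_vector_mult_scaleR cone_def radial_cone[OF norm alpha polar_sm(1,2) h] H_def)
    also have "\<dots> = (\<integral>\<^sup>+w. H (a *v w) \<partial>\<sigma>) * ?c" by (rule nn_integral_multc[OF Ham])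
    finally show "(\<integral>\<^sup>+x. cone (a *v x) \<partial>jump_tail k) = (\<integral>\<^sup>+w. H (a *v w) \<partial>\<sigma>) * ?c" .
  qed
  also have "\<dots> = (\<integral>\<^sup>+\<omega>. (\<integral>\<^sup>+w. H (A \<omega> *v w) \<partial>\<sigma>) * ?c \<partial>M)"
  proof (rule nn_integral_distr[OF measurable_inputs(1)])
    have "(\<lambda>p. H ((\<lambda>x. x) (fst p) *v snd p)) \<in> borel_measurable (borel \<Otimes>\<^sub>M \<sigma>)"
      by (rule measurable_compose[OF sphere_image_measurable Hm]) simp
    then have "case_prod (\<lambda>a w. H (a *v w)) \<in> borel_measurable (borel \<Otimes>\<^sub>M \<sigma>)" by (simp add: case_prod_unfold)
    from sigma_finite_measure.borel_measurable_nn_integral[OF sigma_finite_sm this]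
    show "(\<lambda>a. (\<integral>\<^sup>+w. H (a *v w) \<partial>\<sigma>) * ?c) \<in> borel_measurable \<mu>" by simp
  qed
  also have "\<dots> = (\<integral>\<^sup>+\<omega>. (\<integral>\<^sup>+w. H (A \<omega> *v w) \<partial>\<sigma>) \<partial>M) * ?c"
  proof (rule nn_integral_multc)
    have "(\<lambda>p. H (A (fst p) *v snd p)) \<in> borel_measurable (M \<Otimes>\<^sub>M \<sigma>)"
      by (rule measurable_compose[OF sphere_image_measurable[OF measurable_inputs(1)] Hm])
    then have "case_prod (\<lambda>\<omega> w. H (A \<omega> *v w)) \<in> borel_measurable (M \<Otimes>\<^sub>M \<sigma>)" by (simp add: case_prod_unfold)
    from sigma_finite_measure.borel_measurable_nn_integral[OF sigma_finite_sm this]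
    show "(\<lambda>\<omega>. \<integral>\<^sup>+w. H (A \<omega> *v w) \<partial>\<sigma>) \<in> borel_measurable M" .
  qed
  finally show ?thesis by (rule ennreal_divide_cancel[OF alpha])
qed

text \<open>For nonnegative functions the identity of extended integrals yields integrability and
  the value at once.\<close>

lemma spherical_transfer_bounded_nonneg:
  assumes g: "g \<in> borel_measurable borel" "\<And>x. 0 \<le> g x" "\<And>x. g x \<le> C"
  shows "integrable (M \<Otimes>\<^sub>M \<sigma>) (\<lambda>p. spherical_kernel g (A (fst p) *v snd p))"
    "(\<integral>p. spherical_kernel g (A (fst p) *v snd p) \<partial>(M \<Otimes>\<^sub>M \<sigma>)) = (\<integral>w. g w \<partial>\<sigma>')"
proof -
  interpret S': finite_measure \<sigma>' by (rule polar_sm'(2))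
  note [measurable] = g(1) N_borel[OF norm alpha]
  have km: "spherical_kernel g \<in> borel_measurable borel" unfolding spherical_kernel_def[abs_def] by measurable
  have pm: "(\<lambda>p. spherical_kernel g (A (fst p) *v snd p)) \<in> borel_measurable (M \<Otimes>\<^sub>M \<sigma>)"
    by (rule measurable_compose[OF sphere_image_measurable[OF measurable_inputs(1)] km])
  have pos: "0 \<le> spherical_kernel g v" for v using g(2) by (simp add: spherical_kernel_def)
  have gi: "integrable \<sigma>' g"
    by (rule S'.integrable_const_bound[where B=C])
       (use g(2,3) measurable_compose[OF id_sigma[OF norm alpha polar_sm'(1,2)] g(1)] in auto)
  have "(\<integral>\<^sup>+p. ennreal (spherical_kernel g (A (fst p) *v snd p)) \<partial>(M \<Otimes>\<^sub>M \<sigma>))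
      = (\<integral>\<^sup>+\<omega>. (\<integral>\<^sup>+w. ennreal (spherical_kernel g (A \<omega> *v w)) \<partial>\<sigma>) \<partial>M)"
    using sigma_finite_measure.nn_integral_fst[OF sigma_finite_sm measurable_compose[OF pm measurable_ennreal]] by simp
  also have "\<dots> = (\<integral>\<^sup>+\<omega>. (\<integral>\<^sup>+w. (if A \<omega> *v w = 0 then 0 else ennreal (g ((A \<omega> *v w) /\<^sub>R N (A \<omega> *v w))) * ennreal (N (A \<omega> *v w) powr \<alpha>)) \<partial>\<sigma>) \<partial>M)"
    by (intro nn_integral_cong) (simp add: spherical_kernel_def ennreal_mult g(2))
  also have "\<dots> = (\<integral>\<^sup>+w. ennreal (g w) \<partial>\<sigma>')"
    by (rule spherical_transfer[symmetric, OF measurable_compose[OF g(1) measurable_ennreal]])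
  also have "\<dots> = ennreal (\<integral>w. g w \<partial>\<sigma>')" by (rule nn_integral_eq_integral[OF gi]) (simp add: g(2))
  finally have "has_bochner_integral (M \<Otimes>\<^sub>M \<sigma>) (\<lambda>p. spherical_kernel g (A (fst p) *v snd p)) (\<integral>w. g w \<partial>\<sigma>')"
    by (intro has_bochner_integral_nn_integral pm) (use pos g(2) in \<open>auto intro!: Bochner_Integration.integral_nonneg\<close>)
  then show "integrable (M \<Otimes>\<^sub>M \<sigma>) (\<lambda>p. spherical_kernel g (A (fst p) *v snd p))"
    "(\<integral>p. spherical_kernel g (A (fst p) *v snd p) \<partial>(M \<Otimes>\<^sub>M \<sigma>)) = (\<integral>w. g w \<partial>\<sigma>')"
    by (simp_all only: has_bochner_integral_iff)
qed

text \<open>On the compact sphere \<open>f\<close> is bounded. Extended by 0 and raised by a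
  constant it becomes a bounded nonnegative Borel function, and the constant is removed by
  linearity.\<close>

lemma spherical_transfer_continuous:
  assumes f: "continuous_on (unit_sphere N) f"
  shows "integrable M (\<lambda>\<omega>. \<integral>w. spherical_kernel f (A \<omega> *v w) \<partial>\<sigma>)"
    "(\<integral>\<omega>. (\<integral>w. spherical_kernel f (A \<omega> *v w) \<partial>\<sigma>) \<partial>M) = (\<integral>w. f w \<partial>\<sigma>')"
proof -
  interpret S: finite_measure \<sigma> by (rule polar_sm(2))
  interpret S': finite_measure \<sigma>' by (rule polar_sm'(2))
  interpret P: pair_sigma_finite M \<sigma> ..
  obtain c where c: "c > 0" "\<And>x. norm x \<le> c * N x" "continuous_on UNIV N" by (rule is_norm_equiv[OF norm]) blast
  have cl: "closed (unit_sphere N)"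
    unfolding unit_sphere_def by (intro closed_Collect_eq c(3) continuous_intros)
  have "bounded (unit_sphere N)" unfolding bounded_iff unit_sphere_def using c(2) by (intro exI[of _ c]) (metis mem_Collect_eq mult.right_neutral)
  with cl have "compact (unit_sphere N)" by (simp add: compact_eq_bounded_closed)
  then have "bounded (f ` unit_sphere N)" by (intro compact_imp_bounded compact_continuous_image f)
  then obtain C where C: "\<And>x. x \<in> unit_sphere N \<Longrightarrow> \<bar>f x\<bar> \<le> C" "C > 0" unfolding bounded_pos by auto
  define g where "g x = indicator (unit_sphere N) x *\<^sub>R f x" for x
  have gm: "g \<in> borel_measurable borel" unfolding g_def[abs_def]
    by (rule borel_measurable_continuous_on_indicator[OF unit_sphere_borel[OF norm alpha] f])
  have gb: "\<bar>g x\<bar> \<le> C" for x using C by (simp add: g_def indicator_def)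
  have gCm: "(\<lambda>x. g x + C) \<in> borel_measurable borel" using gm by simp
  have gC: "0 \<le> g x + C" "g x + C \<le> 2 * C" for x using gb[of x] by linarith+
  note t1 = spherical_transfer_bounded_nonneg[of "\<lambda>x. g x + C" "2 * C", OF gCm gC]
  note t2 = spherical_transfer_bounded_nonneg[of "\<lambda>x. C" C, OF borel_measurable_const less_imp_le[OF C(2)] order_refl]
  have fg: "spherical_kernel f v = spherical_kernel (\<lambda>x. g x + C) v - spherical_kernel (\<lambda>x. C) v" for v
  proof (cases "v = 0")
    case False
    then have "v /\<^sub>R N v \<in> unit_sphere N" using N_pos[OF norm alpha False] by (simp add: unit_sphere_def N_scale[OF norm alpha])
    then show ?thesis using False by (simp add: spherical_kernel_def g_def algebra_simps)
  qed (simp add: spherical_kernel_def)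
  have gi: "integrable \<sigma>' g"
    by (rule S'.integrable_const_bound[where B=C])
       (use gb measurable_compose[OF id_sigma[OF norm alpha polar_sm'(1,2)] gm] in auto)
  have I: "integrable (M \<Otimes>\<^sub>M \<sigma>) (\<lambda>p. spherical_kernel f (A (fst p) *v snd p))"
    unfolding fg by (rule Bochner_Integration.integrable_diff[OF t1(1) t2(1)])
  have "(\<integral>p. spherical_kernel f (A (fst p) *v snd p) \<partial>(M \<Otimes>\<^sub>M \<sigma>)) = (\<integral>w. g w + C \<partial>\<sigma>') - (\<integral>w. C \<partial>\<sigma>')"
    unfolding fg Bochner_Integration.integral_diff[OF t1(1) t2(1)] t1(2) t2(2) ..
  also have "\<dots> = (\<integral>w. g w \<partial>\<sigma>')" by (subst Bochner_Integration.integral_add[OF gi]) simp_all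
  also have "\<dots> = (\<integral>w. f w \<partial>\<sigma>')"
    by (rule Bochner_Integration.integral_cong) (simp_all add: g_def space_sigma[OF norm alpha polar_sm'(1,2)])
  finally have E: "(\<integral>p. spherical_kernel f (A (fst p) *v snd p) \<partial>(M \<Otimes>\<^sub>M \<sigma>)) = (\<integral>w. f w \<partial>\<sigma>')" .
  show "integrable M (\<lambda>\<omega>. \<integral>w. spherical_kernel f (A \<omega> *v w) \<partial>\<sigma>)" using P.integrable_fst'[OF I] by simp
  show "(\<integral>\<omega>. (\<integral>w. spherical_kernel f (A \<omega> *v w) \<partial>\<sigma>) \<partial>M) = (\<integral>w. f w \<partial>\<sigma>')"
    using P.integral_fst'[OF I] E by simp
qed

end

section \<open>The tail of the stationary law as a sum of measures, and its spherical
  measure\<close>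

context
  fixes \<Lambda>1 :: "(real^'n) measure"
  assumes rad: "radon_punctured \<Lambda>1"
    and jump_tail_sums: "\<And>f. f \<in> Cc_punctured \<Longrightarrow> (\<lambda>k. \<integral>x. f x \<partial>jump_tail k) sums (\<integral>x. f x \<partial>\<Lambda>1)"
begin

lemma jump_tail_eq_sets: "sets (jump_tail k) = sets (jump_tail 0)"
  by (simp only: sets_jump_tail)

lemma nn_integral_sum_jump_tail:
  assumes f: "f \<in> Cc_punctured" "\<And>x. 0 \<le> f x"
  shows "(\<integral>\<^sup>+x. ennreal (f x) \<partial>sum_measure jump_tail) = ennreal (\<integral>x. f x \<partial>\<Lambda>1)"
proof -
  have fb: "f \<in> Cb_away" using f(1) Cc_subset_Cb_away by auto
  have "(\<integral>\<^sup>+x. ennreal (f x) \<partial>sum_measure jump_tail) = (\<Sum>k. \<integral>\<^sup>+x. ennreal (f x) \<partial>jump_tail k)"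
    by (rule nn_integral_sum_measure[of jump_tail, OF jump_tail_eq_sets measurable_compose[OF borel_measurable_integrable[OF integrable_jump_tail[OF fb]] measurable_ennreal]])
  also have "\<dots> = (\<Sum>k. ennreal (\<integral>x. f x \<partial>jump_tail k))"
    by (rule suminf_cong, rule nn_integral_eq_integral[OF integrable_jump_tail[OF fb]]) (simp add: f(2))
  also have "\<dots> = ennreal (\<Sum>k. \<integral>x. f x \<partial>jump_tail k)"
    by (rule suminf_ennreal2[OF _ sums_summable[OF jump_tail_sums[OF f(1)]]]) (simp add: Bochner_Integration.integral_nonneg f(2))
  also have "\<dots> = ennreal (\<integral>x. f x \<partial>\<Lambda>1)" unfolding sums_unique[OF jump_tail_sums[OF f(1)], symmetric] ..
  finally show ?thesis .
qed

lemma sets_sum_jump_tail: "sets (sum_measure jump_tail) = sets punct"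
  by (simp only: sets_sum_measure sets_jump_tail)

text \<open>An infinite sum of Radon measures need not be locally finite. Here a bump function above
  the compact set has a convergent series of integrals.\<close>

lemma radon_sum_jump_tail: "radon_punctured (sum_measure jump_tail)"
  unfolding radon_punctured_def
proof (intro conjI allI impI sets_sum_jump_tail, elim conjE)
  fix K :: "(real^'n) set" assume K: "compact K" "0 \<notin> K"
  show "emeasure (sum_measure jump_tail) K < \<infinity>"
  proof (cases "K = {}")
    case False
    obtain g :: "nat \<Rightarrow> real^'n \<Rightarrow> real" where g: "\<And>m. g m \<in> Cc_punctured" "\<And>m x. 0 \<le> g m x" "\<And>m x. x \<in> K \<Longrightarrow> g m x = 1"
      by (rule compact_bump[OF K False]) blast
    have "K \<in> sets (sum_measure jump_tail)"
      unfolding sets_sum_jump_tail using K compact_imp_closed[OF K(1)] by (auto simp: sets_restrict_space_iff)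
    then have "emeasure (sum_measure jump_tail) K = (\<integral>\<^sup>+x. indicator K x \<partial>sum_measure jump_tail)" by simp
    also have "\<dots> \<le> (\<integral>\<^sup>+x. ennreal (g 0 x) \<partial>sum_measure jump_tail)"
      by (rule nn_integral_mono) (use g in \<open>simp add: indicator_def\<close>)
    also have "\<dots> = ennreal (\<integral>x. g 0 x \<partial>\<Lambda>1)" by (rule nn_integral_sum_jump_tail[OF g(1,2)])
    finally show ?thesis by (rule order.strict_trans1) simp
  qed simp
qed

lemma sum_jump_tail_eq: "\<Lambda>1 = sum_measure jump_tail"
proof (rule radon_punctured_eqI[OF rad radon_sum_jump_tail])
  fix f :: "real^'n \<Rightarrow> real" assume f: "f \<in> Cc_punctured" "\<And>x. 0 \<le> f x"
  have "ennreal (\<integral>x. f x \<partial>sum_measure jump_tail) = (\<integral>\<^sup>+x. ennreal (f x) \<partial>sum_measure jump_tail)"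
    by (rule nn_integral_eq_integral[symmetric, OF integrable_Cc[OF radon_sum_jump_tail f(1)]]) (simp add: f(2))
  also have "\<dots> = ennreal (\<integral>x. f x \<partial>\<Lambda>1)" by (rule nn_integral_sum_jump_tail[OF f])
  finally show "(\<integral>x. f x \<partial>\<Lambda>1) = (\<integral>x. f x \<partial>sum_measure jump_tail)"
    by (simp add: Bochner_Integration.integral_nonneg f(2))
qed

text \<open>The cone over \<open>S\<close> turns the spherical mass of \<open>S\<close> into an
  integral against the full measure, where the decomposition into a sum applies. The factor
  1/\<alpha> cancels.\<close>

lemma spherical_measure_sum:
  assumes \<sigma>: "\<And>k. spherical_measure N \<alpha> (jump_tail k) (\<sigma> k)" and \<tau>: "spherical_measure N \<alpha> \<Lambda>1 \<tau>" and S: "S \<in> sets \<tau>"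
  shows "emeasure \<tau> S = (\<Sum>k. emeasure (\<sigma> k) S)"
proof (rule ennreal_divide_cancel[OF alpha])
  have p: "sets (\<sigma> k) = sets (sphere_space N)" "finite_measure (\<sigma> k)" "jump_tail k = polar \<alpha> (\<sigma> k)" for k
    using spherical_measure_iff[OF norm alpha rad_jump_tail, THEN iffD1, OF \<sigma>] by blast+
  have q: "sets \<tau> = sets (sphere_space N)" "finite_measure \<tau>" "\<Lambda>1 = polar \<alpha> \<tau>"
    using spherical_measure_iff[OF norm alpha rad, THEN iffD1, OF \<tau>] by blast+
  have Sb: "S \<in> sets borel" using S unfolding q(1) by (simp add: sets_restrict_space_iff unit_sphere_borel[OF norm alpha])
  have S\<sigma>: "S \<in> sets (\<sigma> k)" for k using S unfolding q(1) p(1) .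
  have im: "indicator S \<in> borel_measurable borel" using Sb by simp
  define cone :: "real^'n \<Rightarrow> ennreal" where "cone x = (if 1 \<le> N x then indicator S (x /\<^sub>R N x) else 0)" for x
  have cm: "cone \<in> borel_measurable borel" unfolding cone_def[abs_def] using im N_borel[OF norm alpha] by measurable
  have e\<sigma>: "(\<integral>\<^sup>+x. cone x \<partial>jump_tail k) = emeasure (\<sigma> k) S * ennreal (1 / \<alpha>)" for k
    unfolding p(3) cone_def nn_integral_polar_cone[OF norm alpha p(1,2) im] using S\<sigma>[of k] by simp
  have "emeasure \<tau> S * ennreal (1 / \<alpha>) = (\<integral>\<^sup>+x. cone x \<partial>\<Lambda>1)"
    unfolding q(3) cone_def nn_integral_polar_cone[OF norm alpha q(1,2) im] using S by simp
  also have "\<dots> = (\<Sum>k. \<integral>\<^sup>+x. cone x \<partial>jump_tail k)"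
    unfolding sum_jump_tail_eq by (rule nn_integral_sum_measure[of jump_tail, OF jump_tail_eq_sets measurable_radon[OF rad_jump_tail cm]])
  also have "\<dots> = (\<Sum>k. emeasure (\<sigma> k) S) * ennreal (1 / \<alpha>)" unfolding e\<sigma> by simp
  finally show "emeasure \<tau> S * ennreal (1 / \<alpha>) = (\<Sum>k. emeasure (\<sigma> k) S) * ennreal (1 / \<alpha>)" .
qed

end

end

text \<open>The sequence of tails and the spherical measures are quantified universally, each
  together with an existence claim: everything that satisfies the definitions is covered, and no
  universal claim is vacuous.\<close>

theorem theorem1p10:
  fixes N :: "real^'n \<Rightarrow> real"
    and \<Phi> :: "real^'n \<Rightarrow> real^'n \<Rightarrow> real^'n"
    and M :: "'w measure"
    and A :: "'w \<Rightarrow> real^'n^'n" and B1 :: "'w \<Rightarrow> real^'n"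
    and B2 :: "'w \<Rightarrow> real^'n \<Rightarrow> real^'n" and B3 :: "'w \<Rightarrow> real"
    and As :: "nat \<Rightarrow> 'w \<Rightarrow> real^'n^'n" and B1s :: "nat \<Rightarrow> 'w \<Rightarrow> real^'n"
    and B2s :: "nat \<Rightarrow> 'w \<Rightarrow> real^'n \<Rightarrow> real^'n" and B3s :: "nat \<Rightarrow> 'w \<Rightarrow> real"
    and \<delta>\<^sub>0 \<alpha> :: real and L\<^sub>b :: "real \<Rightarrow> real"
    and \<Lambda>\<^sub>b \<nu> \<Lambda>1 :: "(real^'n) measure"
  assumes norm: "is_norm N"
    and Phi_cont: "continuous_on UNIV (\<lambda>(x, y). \<Phi> x y)"
    and Phi_hom: "\<forall>t>0. \<forall>x y. \<Phi> (t *\<^sub>R x) (t *\<^sub>R y) = t *\<^sub>R \<Phi> x y"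
    and prob: "prob_space M"
    and delta: "0 \<le> \<delta>\<^sub>0" "\<delta>\<^sub>0 < 1"
    and input: "random_input N \<delta>\<^sub>0 M A B1 B2 B3"
    and copies: "\<forall>n\<ge>1. random_input N \<delta>\<^sub>0 M (As n) (B1s n) (B2s n) (B3s n)"
    and same_law: "\<forall>n\<ge>1. distr M input_space (\<lambda>\<omega>. (As n \<omega>, B1s n \<omega>, B2s n \<omega>, B3s n \<omega>))
                        = distr M input_space (\<lambda>\<omega>. (A \<omega>, B1 \<omega>, B2 \<omega>, B3 \<omega>))"
    and indep: "prob_space.indep_vars M (\<lambda>_. input_space)
                  (\<lambda>n \<omega>. (As n \<omega>, B1s n \<omega>, B2s n \<omega>, B3s n \<omega>)) {1..}"
    and lipschitz: "\<forall>n\<ge>1. \<forall>\<omega>\<in>space M. lipschitz_wrt N (random_map \<Phi> (As n) (B1s n) (B2s n) \<omega>)"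
    and alpha: "\<alpha> > 0"
    \<comment> \<open>hypothesis (1)\<close>
    and B1_tail: "tail_measure \<alpha> L\<^sub>b (distr M borel B1) \<Lambda>\<^sub>b"
    and tail_nonzero: "emeasure \<Lambda>\<^sub>b (space \<Lambda>\<^sub>b) \<noteq> 0"
    and L_bounds: "\<forall>K. compact K \<and> K \<subseteq> {0..} \<longrightarrow> (\<exists>c C. 0 < c \<and> (\<forall>t\<in>K. c \<le> L\<^sub>b t \<and> L\<^sub>b t \<le> C))"
    \<comment> \<open>hypothesis (2)\<close>
    and geometric: "\<exists>\<gamma>>\<alpha>. geometric_chain N M (\<lambda>n. random_map \<Phi> (As n) (B1s n) (B2s n)) \<gamma>"
    \<comment> \<open>hypothesis (3)\<close>
    and A_moment: "\<exists>\<beta>>\<alpha>. integrable M (\<lambda>\<omega>. op_norm N (A \<omega>) powr \<beta>)"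
    \<comment> \<open>hypothesis (4)\<close>
    and B3_moment: "\<exists>\<epsilon>\<^sub>0>0.
          (0 < \<delta>\<^sub>0 \<longrightarrow> integrable M (\<lambda>\<omega>. B3 \<omega> powr (\<alpha> / \<delta>\<^sub>0 + \<epsilon>\<^sub>0))) \<and>
          (\<delta>\<^sub>0 = 0 \<longrightarrow> integrable M (\<lambda>\<omega>. B3 \<omega> powr (\<alpha> + \<epsilon>\<^sub>0)))"
    \<comment> \<open>hypothesis (5)\<close>
    and nontrivial: "measure M {\<omega> \<in> space M. \<Phi> 0 (B1 \<omega>) \<noteq> 0} > 0"
    and Phi_id: "\<forall>x \<in> closure {g *v \<Phi> 0 y | g y.
                    g \<in> generated_semigroup (msupport (distr M borel A)) \<and> y \<in> msupport \<Lambda>\<^sub>b}.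
                  \<Phi> x 0 = x"
    and contraction: "\<exists>l<1. (\<lambda>n. (\<integral>\<omega>. op_norm N (mat_prod As 1 n \<omega>) powr \<alpha> \<partial>M) powr (1 / real n))
                             \<longlonglongrightarrow> l"
    \<comment> \<open>the stationary measure and its tail measure\<close>
    and stationary: "stationary_measure M (random_map \<Phi> A B1 B2) \<nu>"
    and X_tail: "tail_measure \<alpha> L\<^sub>b \<nu> \<Lambda>1"
  shows
    "(\<exists>\<Gamma>. Gamma_sequence M As \<alpha> L\<^sub>b (distr M borel (\<lambda>\<omega>. \<Phi> 0 (B1 \<omega>))) \<Gamma>) \<and>
     (\<forall>\<Gamma>. Gamma_sequence M As \<alpha> L\<^sub>b (distr M borel (\<lambda>\<omega>. \<Phi> 0 (B1 \<omega>))) \<Gamma> \<longrightarrow>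
        (\<forall>f\<in>Cc_punctured.
           (\<lambda>k. \<integral>x. f x \<partial>\<Gamma> (Suc k)) sums (\<integral>x. f x \<partial>\<Lambda>1) \<and>
           (AE \<omega> in M. summable (\<lambda>k. \<integral>x. f (mat_prod As 2 (k + 2) \<omega> *v x) \<partial>\<Gamma> 1)) \<and>
           integrable M (\<lambda>\<omega>. \<Sum>k. \<integral>x. f (mat_prod As 2 (k + 2) \<omega> *v x) \<partial>\<Gamma> 1) \<and>
           (\<integral>x. f x \<partial>\<Lambda>1) =
             (\<integral>x. f x \<partial>\<Gamma> 1) +
             (\<integral>\<omega>. (\<Sum>k. \<integral>x. f (mat_prod As 2 (k + 2) \<omega> *v x) \<partial>\<Gamma> 1) \<partial>M)) \<and>
        (\<forall>n\<ge>1. homogeneous_measure \<alpha> (\<Gamma> n)) \<and>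
        (\<exists>\<sigma>. \<forall>n\<ge>1. spherical_measure N \<alpha> (\<Gamma> n) (\<sigma> n)) \<and>
        (\<exists>\<tau>. spherical_measure N \<alpha> \<Lambda>1 \<tau>) \<and>
        (\<forall>\<sigma>. (\<forall>n\<ge>1. spherical_measure N \<alpha> (\<Gamma> n) (\<sigma> n)) \<longrightarrow>
           (\<forall>n\<ge>1. \<forall>f. continuous_on (unit_sphere N) f \<longrightarrow>
              integrable M (\<lambda>\<omega>. \<integral>w. (if A \<omega> *v w = 0 then 0
                 else f ((A \<omega> *v w) /\<^sub>R N (A \<omega> *v w)) * N (A \<omega> *v w) powr \<alpha>) \<partial>\<sigma> n) \<and>
              (\<integral>\<omega>. (\<integral>w. (if A \<omega> *v w = 0 then 0
                 else f ((A \<omega> *v w) /\<^sub>R N (A \<omega> *v w)) * N (A \<omega> *v w) powr \<alpha>) \<partial>\<sigma> n) \<partial>M)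
              = (\<integral>w. f w \<partial>\<sigma> (Suc n))) \<and>
           (\<forall>\<tau>. spherical_measure N \<alpha> \<Lambda>1 \<tau> \<longrightarrow>
              (\<forall>S\<in>sets \<tau>. emeasure \<tau> S = (\<Sum>n. emeasure (\<sigma> (Suc n)) S)))))"
proof -
  define V where "V = (\<lambda>t. t powr \<alpha> * L\<^sub>b t)"
  interpret P: prob_space M by (rule prob)
  have L: "slowly_varying L\<^sub>b" using B1_tail unfolding tail_measure_def by blast
  have B1_law: "prob_space (distr M borel B1)" "sets (distr M borel B1) = sets borel"
    using P.prob_space_distr[OF random_inputD(2)[OF input]] by simp_all
  \<comment> \<open>Nonvanishing of the tail measure of B1 enters here. The same \<open>V\<close>
    then serves for \<open>\<nu>\<close>, whose tail measure is not assumed to be nonzero.\<close>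
  have pot: "potter V \<alpha>" unfolding V_def by (rule potter_tail_measure[OF alpha B1_tail B1_law tail_nonzero])
  note Tb = tail_functional_tail_measure[OF alpha B1_tail B1_law V_def pot]
  have nu: "prob_space \<nu>" "sets \<nu> = sets borel" using stationary unfolding stationary_measure_def by blast+
  note T1 = tail_functional_tail_measure[OF alpha X_tail nu V_def pot]
  have rad_b: "radon_punctured \<Lambda>\<^sub>b" using B1_tail unfolding tail_measure_def by blast
  have rad_1: "radon_punctured \<Lambda>1" using X_tail unfolding tail_measure_def by blast
  have fa_b: "finite_away \<Lambda>\<^sub>b" unfolding finite_away_def
    using sets_radon[OF rad_b] tail_measure_finite_outside[OF alpha B1_tail B1_law V_def pot] by blast
  have fa_1: "finite_away \<Lambda>1" unfolding finite_away_def
    using sets_radon[OF rad_1] tail_measure_finite_outside[OF alpha X_tail nu V_def pot] by blast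
  have norm_moment: "\<exists>\<beta>>\<alpha>. integrable M (\<lambda>\<omega>. norm (A \<omega>) powr \<beta>)"
  proof -
    obtain \<beta> where \<beta>: "\<beta> > \<alpha>" "integrable M (\<lambda>\<omega>. op_norm N (A \<omega>) powr \<beta>)" using A_moment by blast
    obtain c where c: "c > 0" "\<And>a. norm a \<le> c * op_norm N a" "\<And>a. 0 \<le> op_norm N a"
      by (rule norm_matrix_le_op_norm[OF norm]) blast
    have [measurable]: "A \<in> borel_measurable M" by (rule random_inputD(1)[OF input])
    have "integrable M (\<lambda>\<omega>. norm (A \<omega>) powr \<beta>)"
    proof (rule Bochner_Integration.integrable_bound)
      show "integrable M (\<lambda>\<omega>. c powr \<beta> * op_norm N (A \<omega>) powr \<beta>)" by (rule integrable_mult_right[OF \<beta>(2)])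
      show "(\<lambda>\<omega>. norm (A \<omega>) powr \<beta>) \<in> borel_measurable M" by measurable
      have "norm (A \<omega>) powr \<beta> \<le> c powr \<beta> * op_norm N (A \<omega>) powr \<beta>" for \<omega>
      proof -
        have "norm (A \<omega>) powr \<beta> \<le> (c * op_norm N (A \<omega>)) powr \<beta>"
          by (rule powr_mono2) (use c alpha \<beta> in auto)
        then show ?thesis using c by (simp add: powr_mult)
      qed
      then show "AE \<omega> in M. norm (norm (A \<omega>) powr \<beta>) \<le> norm (c powr \<beta> * op_norm N (A \<omega>) powr \<beta>)" by simp
    qed
    with \<beta>(1) show ?thesis by blast
  qed
  interpret tail_chain M N \<Phi> \<delta>\<^sub>0 A B1 B2 B3 As B1s B2s B3s V \<alpha> \<Lambda>\<^sub>b
    by (intro tail_chain.intro heavy_chain.intro random_chain.intro random_chain_axioms.intro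
        heavy_chain_axioms.intro tail_chain_axioms.intro) (fact prob Phi_cont input copies same_law indep
        norm Phi_hom delta alpha pot Tb norm_moment B3_moment fa_b Phi_id)+
  obtain \<gamma> where \<gamma>: "\<gamma> > \<alpha>" "geometric_chain N M (\<lambda>n. random_map \<Phi> (As n) (B1s n) (B2s n)) \<gamma>"
    using geometric by blast
  \<comment> \<open>Two descriptions of the chain from 0 meet: its tail functionals are the partial
    sums of the series, and they converge to the integral against \<open>\<Lambda>1\<close>.\<close>
  have sums: "(\<lambda>k. \<integral>x. f x \<partial>jump_tail k) sums (\<integral>x. f x \<partial>\<Lambda>1)" if f: "f \<in> Cc_punctured" for f
  proof -
    have "f \<in> Cb_away" using f Cc_subset_Cb_away by auto
    from chain_functional_eq_sum[OF this] chain_tail_converges[OF \<gamma>(2,1) stationary T1 f]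
    show ?thesis unfolding sums_def by simp
  qed
  have Gamma_ex: "\<exists>\<Gamma>. \<forall>n\<ge>1. \<Gamma> n = jump_tail (n - 1)" by (rule exI[of _ "\<lambda>n. jump_tail (n - 1)"]) simp
  have series: "\<forall>f\<in>Cc_punctured.
           (\<lambda>k. \<integral>x. f x \<partial>\<Gamma> (Suc k)) sums (\<integral>x. f x \<partial>\<Lambda>1) \<and>
           (AE \<omega> in M. summable (\<lambda>k. \<integral>x. f (mat_prod As 2 (k + 2) \<omega> *v x) \<partial>\<Gamma> 1)) \<and>
           integrable M (\<lambda>\<omega>. \<Sum>k. \<integral>x. f (mat_prod As 2 (k + 2) \<omega> *v x) \<partial>\<Gamma> 1) \<and>
           (\<integral>x. f x \<partial>\<Lambda>1) =
             (\<integral>x. f x \<partial>\<Gamma> 1) +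
             (\<integral>\<omega>. (\<Sum>k. \<integral>x. f (mat_prod As 2 (k + 2) \<omega> *v x) \<partial>\<Gamma> 1) \<partial>M)"
    if eq: "\<forall>n\<ge>1. \<Gamma> n = jump_tail (n - 1)" for \<Gamma>
  proof
    fix f :: "real^'n \<Rightarrow> real" assume f: "f \<in> Cc_punctured"
    then have fb: "f \<in> Cb_away" using Cc_subset_Cb_away by auto
    have G1: "\<Gamma> 1 = jump_tail 0" and GS: "\<Gamma> (Suc k) = jump_tail k" for k using eq by simp_all
    have prods: "mat_prod As 2 (k + 2) \<omega> = mat_product 2 (Suc k) \<omega>" for k \<omega> using mat_prod_eq_mat_product[of "Suc k" \<omega>] by simp
    \<comment> \<open>|f| is again a test function, so the convergence just proved, applied to it,
      is absolute convergence for \<open>f\<close>.\<close>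
    have abs_summable: "summable (\<lambda>k. \<integral>x. \<bar>f x\<bar> \<partial>jump_tail (Suc k))"
      using sums_summable[OF sums[OF Cc_abs[OF f]]] by (rule summable_Suc_iff[THEN iffD2])
    note ex = series_exchange[OF fb abs_summable]
    have "(\<integral>x. f x \<partial>\<Lambda>1) = (\<integral>x. f x \<partial>jump_tail 0) + (\<Sum>k. \<integral>x. f x \<partial>jump_tail (Suc k))"
      unfolding suminf_split_head[OF sums_summable[OF sums[OF f]]] sums_unique[OF sums[OF f], symmetric] by simp
    then show "(\<lambda>k. \<integral>x. f x \<partial>\<Gamma> (Suc k)) sums (\<integral>x. f x \<partial>\<Lambda>1) \<and>
           (AE \<omega> in M. summable (\<lambda>k. \<integral>x. f (mat_prod As 2 (k + 2) \<omega> *v x) \<partial>\<Gamma> 1)) \<and>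
           integrable M (\<lambda>\<omega>. \<Sum>k. \<integral>x. f (mat_prod As 2 (k + 2) \<omega> *v x) \<partial>\<Gamma> 1) \<and>
           (\<integral>x. f x \<partial>\<Lambda>1) =
             (\<integral>x. f x \<partial>\<Gamma> 1) +
             (\<integral>\<omega>. (\<Sum>k. \<integral>x. f (mat_prod As 2 (k + 2) \<omega> *v x) \<partial>\<Gamma> 1) \<partial>M)"
      unfolding G1 GS prods ex(3) by (intro conjI sums[OF f] ex(1,2))
  qed
  have hom: "\<forall>n\<ge>1. homogeneous_measure \<alpha> (\<Gamma> n)" if "\<forall>n\<ge>1. \<Gamma> n = jump_tail (n - 1)" for \<Gamma>
    using that jump_tail_homogeneous_measure by simp
  have spherical_ex: "\<exists>\<sigma>. \<forall>n\<ge>1. spherical_measure N \<alpha> (\<Gamma> n) (\<sigma> n)" if "\<forall>n\<ge>1. \<Gamma> n = jump_tail (n - 1)" for \<Gamma>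
  proof -
    have "\<forall>n. \<exists>\<sigma>. spherical_measure N \<alpha> (jump_tail n) \<sigma>"
      using spherical_measure_exists[OF norm alpha jump_tail_finite_away jump_tail_homogeneous_measure] by blast
    from choice[OF this] obtain \<sigma> where "\<forall>n. spherical_measure N \<alpha> (jump_tail n) (\<sigma> n)" ..
    then show ?thesis using that by (intro exI[of _ "\<lambda>n. \<sigma> (n - 1)"]) simp
  qed
  \<comment> \<open>Homogeneity of \<open>\<Lambda>1\<close> comes from its own tail limit under the
    same \<open>V\<close>, independently of the series.\<close>
  have limit_spherical_ex: "\<exists>\<tau>. spherical_measure N \<alpha> \<Lambda>1 \<tau>"
  proof (rule spherical_measure_exists[OF norm alpha fa_1])
    show "homogeneous_measure \<alpha> \<Lambda>1" unfolding homogeneous_measure_def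
      by (intro allI impI ballI tail_functional_homogeneous[OF T1 B1_regvar subsetD[OF Cc_subset_Cb_away]])
  qed
  have spherical: "\<forall>\<sigma>. (\<forall>n\<ge>1. spherical_measure N \<alpha> (\<Gamma> n) (\<sigma> n)) \<longrightarrow>
           (\<forall>n\<ge>1. \<forall>f. continuous_on (unit_sphere N) f \<longrightarrow>
              integrable M (\<lambda>\<omega>. \<integral>w. (if A \<omega> *v w = 0 then 0
                 else f ((A \<omega> *v w) /\<^sub>R N (A \<omega> *v w)) * N (A \<omega> *v w) powr \<alpha>) \<partial>\<sigma> n) \<and>
              (\<integral>\<omega>. (\<integral>w. (if A \<omega> *v w = 0 then 0
                 else f ((A \<omega> *v w) /\<^sub>R N (A \<omega> *v w)) * N (A \<omega> *v w) powr \<alpha>) \<partial>\<sigma> n) \<partial>M)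
              = (\<integral>w. f w \<partial>\<sigma> (Suc n))) \<and>
           (\<forall>\<tau>. spherical_measure N \<alpha> \<Lambda>1 \<tau> \<longrightarrow>
              (\<forall>S\<in>sets \<tau>. emeasure \<tau> S = (\<Sum>n. emeasure (\<sigma> (Suc n)) S)))"
    if eq: "\<forall>n\<ge>1. \<Gamma> n = jump_tail (n - 1)" for \<Gamma>
  proof (intro allI impI, rule conjI)
    fix \<sigma> assume "\<forall>n\<ge>1. spherical_measure N \<alpha> (\<Gamma> n) (\<sigma> n)"
    then have \<sigma>: "spherical_measure N \<alpha> (jump_tail k) (\<sigma> (Suc k))" for k using eq by auto
    show "\<forall>n\<ge>1. \<forall>f. continuous_on (unit_sphere N) f \<longrightarrow>
              integrable M (\<lambda>\<omega>. \<integral>w. (if A \<omega> *v w = 0 then 0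
                 else f ((A \<omega> *v w) /\<^sub>R N (A \<omega> *v w)) * N (A \<omega> *v w) powr \<alpha>) \<partial>\<sigma> n) \<and>
              (\<integral>\<omega>. (\<integral>w. (if A \<omega> *v w = 0 then 0
                 else f ((A \<omega> *v w) /\<^sub>R N (A \<omega> *v w)) * N (A \<omega> *v w) powr \<alpha>) \<partial>\<sigma> n) \<partial>M)
              = (\<integral>w. f w \<partial>\<sigma> (Suc n))"
    proof (intro allI impI)
      fix n :: nat and f :: "real^'n \<Rightarrow> real"
      assume n: "n \<ge> 1" and f: "continuous_on (unit_sphere N) f"
      then obtain k where k: "n = Suc k" by (cases n) auto
      show "integrable M (\<lambda>\<omega>. \<integral>w. (if A \<omega> *v w = 0 then 0
                 else f ((A \<omega> *v w) /\<^sub>R N (A \<omega> *v w)) * N (A \<omega> *v w) powr \<alpha>) \<partial>\<sigma> n) \<and>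
              (\<integral>\<omega>. (\<integral>w. (if A \<omega> *v w = 0 then 0
                 else f ((A \<omega> *v w) /\<^sub>R N (A \<omega> *v w)) * N (A \<omega> *v w) powr \<alpha>) \<partial>\<sigma> n) \<partial>M)
              = (\<integral>w. f w \<partial>\<sigma> (Suc n))"
        unfolding k by (rule conjI[OF spherical_transfer_continuous[OF \<sigma> \<sigma> f, unfolded spherical_kernel_def]])
    qed
    show "\<forall>\<tau>. spherical_measure N \<alpha> \<Lambda>1 \<tau> \<longrightarrow> (\<forall>S\<in>sets \<tau>. emeasure \<tau> S = (\<Sum>n. emeasure (\<sigma> (Suc n)) S))"
      using spherical_measure_sum[OF rad_1 sums \<sigma>] by blast
  qed
  show ?thesis unfolding Gamma_sequence_iff[OF L V_def]
    by (rule conjI[OF Gamma_ex], intro allI impI, intro conjI)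
       (rule series hom spherical_ex limit_spherical_ex spherical, assumption?)+
qed

end
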